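(* Let $A$ be an Artin algebra, let $M$ be a (finitely generated) Gorenstein projective left $A$-module, and let $B = \mathrm{End}_A(M)$. Suppose that $A$ is CM-finite, with $E$ a finitely generated left $A$-module such that $\mathcal{GP}(A) = \mathrm{add}\,({}_AE)$, and that $\mathrm{fin.dim}\, A \geq 2$. Then $$\mathrm{fin.dim}\, B \leq \mathrm{fin.dim}\, A + \mathrm{rfd}(M_B) + \mathrm{pd}_B\,\mathrm{Hom}_A(M,E).$$
   Context: For an Artin algebra $A$, $A$-mod denotes the category of finitely generated left $A$-modules; all modules over Artin algebras are finitely generated left modules unless stated otherwise. For $M \in A$-mod, $B=\mathrm{End}_A(M)$ is taken with the multiplication for which $M$ is an $A$-$B$-bimodule (endomorphisms act on the right of $M$, i.e. the product $fg$ means "first $f$, then $g$"). For $X\in A$-mod, $\mathrm{Hom}_A(M,X)$ is then a left $B$-module via $(b\cdot f)(m)=f(mb)$. $\mathrm{pd}$ denotes projective dimension, possibly $\infty$; the right-hand side of the inequality is allowed to be infinite. Finitistic dimension: $\mathrm{fin.dim}\,A$ is the supremum of the projective dimensions of all finitely generated left $A$-modules of finite projective dimension. Gorenstein projective modules: $G\in A$-mod is Gorenstein projective if there is an exact sequence $\cdots\to P_1\to P_0\to P^0\to P^1\to\cdots$ of projective modules in $A$-mod such that $G\cong \mathrm{Im}(P_0\to P^0)$ and the sequence remains exact after applying $\mathrm{Hom}_A(-,Q)$ for every projective $Q\in A$-mod. $\mathcal{GP}(A)$ is the full subcategory of $A$-mod of Gorenstein projective modules. For $E\in A$-mod, $\mathrm{add}\,({}_AE)$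 is the category of all direct summands of finite direct sums of copies of $E$. CM-finite: $A$ is CM-finite if $\mathcal{GP}(A)$ has only finitely many isomorphism classes of indecomposable objects; equivalently, $\mathcal{GP}(A)=\mathrm{add}\,({}_AE)$ for some $E\in A$-mod. Little restricted flat dimension: for a ring $R$ and a right $R$-module $T_R$, $\mathrm{rfd}(T_R)$ is at most $m$ if $\mathrm{Tor}^R_i(T,X)=0$ for all $i>m$ and all left $R$-modules $X$ of finite flat dimension which admit a projective resolution by finitely generated projective modules; $\mathrm{rfd}(T_R)$ is the least such $m \geq 0$, or $\infty$ if there is none. *)

theory Defs
  imports
    "HOL-Algebra.Free_Abelian_Groups"
    "HOL-Algebra.Ideal"
    "HOL-Algebra.Module"
    "HOL-Library.Extended_Nat"
begin

section \<open>Modules over noncommutative rings\<close>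

text \<open>
  The locale \<^locale>\<open>module\<close> is restricted to commutative rings.  As there, the \<open>mult\<close> and
  \<open>one\<close> fields of the record \<open>module\<close> carry no meaning for modules.
\<close>

locale left_module = R?: ring R + M?: abelian_group M for R :: "('a, 'x) ring_scheme" and M :: "('a, 'b, 'y) module_scheme" (structure) +
  assumes smult_closed [simp, intro]:
      "\<lbrakk>a \<in> carrier R; x \<in> carrier M\<rbrakk> \<Longrightarrow> a \<odot>\<^bsub>M\<^esub> x \<in> carrier M"
    and smult_l_distr:
      "\<lbrakk>a \<in> carrier R; b \<in> carrier R; x \<in> carrier M\<rbrakk> \<Longrightarrow>
        (a \<oplus>\<^bsub>R\<^esub> b) \<odot>\<^bsub>M\<^esub> x = a \<odot>\<^bsub>M\<^esub> x \<oplus>\<^bsub>M\<^esub> b \<odot>\<^bsub>M\<^esub> x"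
    and smult_r_distr:
      "\<lbrakk>a \<in> carrier R; x \<in> carrier M; y \<in> carrier M\<rbrakk> \<Longrightarrow>
        a \<odot>\<^bsub>M\<^esub> (x \<oplus>\<^bsub>M\<^esub> y) = a \<odot>\<^bsub>M\<^esub> x \<oplus>\<^bsub>M\<^esub> a \<odot>\<^bsub>M\<^esub> y"
    and smult_assoc:
      "\<lbrakk>a \<in> carrier R; b \<in> carrier R; x \<in> carrier M\<rbrakk> \<Longrightarrow>
        (a \<otimes>\<^bsub>R\<^esub> b) \<odot>\<^bsub>M\<^esub> x = a \<odot>\<^bsub>M\<^esub> (b \<odot>\<^bsub>M\<^esub> x)"
    and smult_one [simp]: "x \<in> carrier M \<Longrightarrow> \<one>\<^bsub>R\<^esub> \<odot>\<^bsub>M\<^esub> x = x"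

text \<open>For right modules, \<open>a \<odot>\<^bsub>M\<^esub> x\<close> stands for the product $xa$.\<close>

locale right_module = R?: ring R + M?: abelian_group M for R :: "('a, 'x) ring_scheme" and M :: "('a, 'b, 'y) module_scheme" (structure) +
  assumes smult_closed [simp, intro]:
      "\<lbrakk>a \<in> carrier R; x \<in> carrier M\<rbrakk> \<Longrightarrow> a \<odot>\<^bsub>M\<^esub> x \<in> carrier M"
    and smult_l_distr:
      "\<lbrakk>a \<in> carrier R; b \<in> carrier R; x \<in> carrier M\<rbrakk> \<Longrightarrow>
        (a \<oplus>\<^bsub>R\<^esub> b) \<odot>\<^bsub>M\<^esub> x = a \<odot>\<^bsub>M\<^esub> x \<oplus>\<^bsub>M\<^esub> b \<odot>\<^bsub>M\<^esub> x"
    and smult_r_distr: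
      "\<lbrakk>a \<in> carrier R; x \<in> carrier M; y \<in> carrier M\<rbrakk> \<Longrightarrow>
        a \<odot>\<^bsub>M\<^esub> (x \<oplus>\<^bsub>M\<^esub> y) = a \<odot>\<^bsub>M\<^esub> x \<oplus>\<^bsub>M\<^esub> a \<odot>\<^bsub>M\<^esub> y"
    and smult_assoc:
      "\<lbrakk>a \<in> carrier R; b \<in> carrier R; x \<in> carrier M\<rbrakk> \<Longrightarrow>
        (a \<otimes>\<^bsub>R\<^esub> b) \<odot>\<^bsub>M\<^esub> x = b \<odot>\<^bsub>M\<^esub> (a \<odot>\<^bsub>M\<^esub> x)"
    and smult_one [simp]: "x \<in> carrier M \<Longrightarrow> \<one>\<^bsub>R\<^esub> \<odot>\<^bsub>M\<^esub> x = x"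

text \<open>This and \<open>mod_iso\<close> serve for left and right modules alike.\<close>

definition mod_hom ::
  "('r, 'x) ring_scheme \<Rightarrow> ('r, 'm) module \<Rightarrow> ('r, 'n) module \<Rightarrow> ('m \<Rightarrow> 'n) set" where
  "mod_hom R M N = {f \<in> carrier M \<rightarrow> carrier N.
     (\<forall>x\<in>carrier M. \<forall>y\<in>carrier M. f (x \<oplus>\<^bsub>M\<^esub> y) = f x \<oplus>\<^bsub>N\<^esub> f y) \<and>
     (\<forall>r\<in>carrier R. \<forall>x\<in>carrier M. f (r \<odot>\<^bsub>M\<^esub> x) = r \<odot>\<^bsub>N\<^esub> f x)}"

definition mod_iso ::
  "('r, 'x) ring_scheme \<Rightarrow> ('r, 'm) module \<Rightarrow> ('r, 'n) module \<Rightarrow> bool" where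
  "mod_iso R M N \<longleftrightarrow> (\<exists>f\<in>mod_hom R M N. bij_betw f (carrier M) (carrier N))"

definition fin_gen :: "('r, 'x) ring_scheme \<Rightarrow> ('r, 'm) module \<Rightarrow> bool" where
  "fin_gen R M \<longleftrightarrow> (\<exists>S\<subseteq>carrier M. finite S \<and>
     (\<forall>x\<in>carrier M. \<exists>a\<in>S \<rightarrow> carrier R. x = (\<Oplus>\<^bsub>M\<^esub>s\<in>S. a s \<odot>\<^bsub>M\<^esub> s)))"

text \<open>
  HOL cannot quantify over modules of all carrier types at once.  Every finitely generated
  \<open>R\<close>-module is a quotient of some $R^n$, hence isomorphic to a module whose elements are sets
  of functions from the naturals to \<open>R\<close> (proved in \<open>fin_gen_iso_universe\<close> below).  This carrier
  type is the universe for all quantification over modules.  Only modules given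
  individually have arbitrary carrier types.
\<close>

type_synonym 'r univ = "(nat \<Rightarrow> 'r) set"
type_synonym 'r umodule = "('r, 'r univ) module"

definition transport_module ::
  "('m \<Rightarrow> 'n) \<Rightarrow> ('r, 'm) module \<Rightarrow> ('r, 'n) module" where
  "transport_module h M =
     (let k = inv_into (carrier M) h in
      \<lparr>carrier = h ` carrier M, monoid.mult = undefined, monoid.one = undefined,
       ring.zero = h \<zero>\<^bsub>M\<^esub>, ring.add = (\<lambda>x y. h (k x \<oplus>\<^bsub>M\<^esub> k y)),
       smult = (\<lambda>r x. h (r \<odot>\<^bsub>M\<^esub> k x))\<rparr>)"

lemma transport_module:
  assumes "left_module R M" "inj_on h (carrier M)"
  shows "left_module R (transport_module h M)" (is ?L)
    and "mod_iso R M (transport_module h M)" (is ?I)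
proof -
  interpret left_module R M by fact
  note inv = inv_into_f_f[OF assms(2)]
  let ?N = "transport_module h M"
  have N: "carrier ?N = h ` carrier M" "\<zero>\<^bsub>?N\<^esub> = h \<zero>\<^bsub>M\<^esub>"
    "\<And>x y. x \<in> carrier M \<Longrightarrow> y \<in> carrier M \<Longrightarrow> h x \<oplus>\<^bsub>?N\<^esub> h y = h (x \<oplus>\<^bsub>M\<^esub> y)"
    "\<And>r x. x \<in> carrier M \<Longrightarrow> r \<odot>\<^bsub>?N\<^esub> h x = h (r \<odot>\<^bsub>M\<^esub> x)"
    by (simp_all add: transport_module_def Let_def inv)
  have ab: "abelian_group ?N"
  proof (rule abelian_groupI)
    fix x assume "x \<in> carrier ?N"
    then obtain x' where x': "x' \<in> carrier M" "x = h x'" by (auto simp: N)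
    show "\<exists>y\<in>carrier ?N. y \<oplus>\<^bsub>?N\<^esub> x = \<zero>\<^bsub>?N\<^esub>"
      by (rule bexI[of _ "h (\<ominus>\<^bsub>M\<^esub> x')"]) (use x' in \<open>auto simp: N M.l_neg\<close>)
  qed (auto simp: N M.a_ac)
  show ?L
    by (intro left_module.intro left_module_axioms.intro R.ring_axioms ab)
       (auto simp: N smult_l_distr smult_r_distr smult_assoc)
  show ?I
    unfolding mod_iso_def
    by (rule bexI[of _ h]) (use assms(2) in \<open>auto simp: mod_hom_def N bij_betw_def\<close>)
qed

lemma fin_gen_iso:
  assumes "left_module R M" "left_module R N" "mod_iso R M N" "fin_gen R M"
  shows "fin_gen R N"
proof -
  interpret M: left_module R M by fact
  interpret N: left_module R N by fact
  from assms(3) obtain f where f: "f \<in> mod_hom R M N" and bij: "bij_betw f (carrier M) (carrier N)"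
    by (auto simp: mod_iso_def)
  from assms(4) obtain S where S: "S \<subseteq> carrier M" "finite S"
    and gen: "\<And>x. x \<in> carrier M \<Longrightarrow> \<exists>a\<in>S \<rightarrow> carrier R. x = (\<Oplus>\<^bsub>M\<^esub>s\<in>S. a s \<odot>\<^bsub>M\<^esub> s)"
    unfolding fin_gen_def by blast
  have fS: "f s \<in> carrier N" if "s \<in> carrier M" for s
    using f that by (auto simp: mod_hom_def)
  have "f (\<zero>\<^bsub>M\<^esub> \<oplus>\<^bsub>M\<^esub> \<zero>\<^bsub>M\<^esub>) = f \<zero>\<^bsub>M\<^esub> \<oplus>\<^bsub>N\<^esub> f \<zero>\<^bsub>M\<^esub>"
    using f by (auto simp: mod_hom_def simp del: M.l_zero M.r_zero M.M.l_zero M.M.r_zero)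
  then have f0: "f \<zero>\<^bsub>M\<^esub> = \<zero>\<^bsub>N\<^esub>"
    using fS[of "\<zero>\<^bsub>M\<^esub>"]  N.M.add.r_cancel_one' by (simp add: N.M.add.l_cancel_one')
  have sum: "f (\<Oplus>\<^bsub>M\<^esub>s\<in>T. a s \<odot>\<^bsub>M\<^esub> s) = (\<Oplus>\<^bsub>N\<^esub>s\<in>T. a s \<odot>\<^bsub>N\<^esub> f s)"
    if "T \<subseteq> S" "a \<in> S \<rightarrow> carrier R" for T a
    using finite_subset[OF that(1) S(2)] that(1)
  proof (induction T rule: finite_induct)
    case (insert t T)
    have a: "a s \<in> carrier R" "s \<in> carrier M" if "s \<in> insert t T" for s
      using that insert.prems \<open>a \<in> _\<close> S(1) by auto
    have "f (\<Oplus>\<^bsub>M\<^esub>s\<in>insert t T. a s \<odot>\<^bsub>M\<^esub> s) = f (a t \<odot>\<^bsub>M\<^esub> t \<oplus>\<^bsub>M\<^esub> (\<Oplus>\<^bsub>M\<^esub>s\<in>T. a s \<odot>\<^bsub>M\<^esub> s))"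
      using insert.hyps a by (subst M.M.finsum_insert) auto
    also have "\<dots> = f (a t \<odot>\<^bsub>M\<^esub> t) \<oplus>\<^bsub>N\<^esub> f (\<Oplus>\<^bsub>M\<^esub>s\<in>T. a s \<odot>\<^bsub>M\<^esub> s)"
      using f a by (auto simp: mod_hom_def intro!: M.M.finsum_closed)
    also have "\<dots> = a t \<odot>\<^bsub>N\<^esub> f t \<oplus>\<^bsub>N\<^esub> (\<Oplus>\<^bsub>N\<^esub>s\<in>T. a s \<odot>\<^bsub>N\<^esub> f s)"
      using f a insert by (auto simp: mod_hom_def)
    also have "\<dots> = (\<Oplus>\<^bsub>N\<^esub>s\<in>insert t T. a s \<odot>\<^bsub>N\<^esub> f s)"
      using insert.hyps a fS by (subst N.M.finsum_insert) auto
    finally show ?case .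
  qed (simp add: f0)
  have inj: "inj_on f S" using bij S(1) by (auto simp: bij_betw_def inj_on_def)
  show ?thesis unfolding fin_gen_def
  proof (intro exI[of _ "f ` S"] conjI ballI)
    fix y assume "y \<in> carrier N"
    then obtain x where x: "x \<in> carrier M" "y = f x" using bij by (auto simp: bij_betw_def)
    obtain a where a: "a \<in> S \<rightarrow> carrier R" "x = (\<Oplus>\<^bsub>M\<^esub>s\<in>S. a s \<odot>\<^bsub>M\<^esub> s)" using gen[OF x(1)] by blast
    let ?b = "a \<circ> inv_into S f"
    have b: "?b (f s) = a s" if "s \<in> S" for s using inj that by simp
    have bc: "?b \<in> f ` S \<rightarrow> carrier R" using a b by auto
    have "(\<Oplus>\<^bsub>N\<^esub>s\<in>f ` S. ?b s \<odot>\<^bsub>N\<^esub> s) = (\<Oplus>\<^bsub>N\<^esub>s\<in>S. ?b (f s) \<odot>\<^bsub>N\<^esub> f s)"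
      by (rule N.M.finsum_reindex) (use a bc S fS inj in \<open>auto simp: Pi_def\<close>)
    also have "\<dots> = (\<Oplus>\<^bsub>N\<^esub>s\<in>S. a s \<odot>\<^bsub>N\<^esub> f s)"
      by (rule N.M.finsum_cong') (use a S fS b in auto)
    also have "\<dots> = y" using sum[of S a] a x by simp
    finally show "\<exists>b\<in>f ` S \<rightarrow> carrier R. y = (\<Oplus>\<^bsub>N\<^esub>s\<in>f ` S. b s \<odot>\<^bsub>N\<^esub> s)"
      using bc by metis
  qed (use S fS in auto)
qed

theorem fin_gen_iso_universe:
  fixes R :: "('r, 'x) ring_scheme" and M :: "('r, 'm) module"
  assumes "left_module R M" "fin_gen R M"
  shows "\<exists>N :: 'r umodule. left_module R N \<and> fin_gen R N \<and> mod_iso R M N"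
proof -
  from assms(2) obtain S where S: "finite S"
    and gen: "\<And>x. x \<in> carrier M \<Longrightarrow> \<exists>a\<in>S \<rightarrow> carrier R. x = (\<Oplus>\<^bsub>M\<^esub>s\<in>S. a s \<odot>\<^bsub>M\<^esub> s)"
    and SM: "S \<subseteq> carrier M"
    unfolding fin_gen_def by blast
  interpret left_module R M by fact
  obtain t :: "'m \<Rightarrow> nat" where t: "inj_on t S" using finite_imp_inj_to_nat_seg[OF S] by blast
  define h :: "'m \<Rightarrow> 'r univ" where
    "h x = {a \<in> t ` S \<rightarrow> carrier R. (\<Oplus>\<^bsub>M\<^esub>s\<in>S. a (t s) \<odot>\<^bsub>M\<^esub> s) = x}" for x
  have "h x \<noteq> {}" if x: "x \<in> carrier M" for x
  proof -
    obtain a where a: "a \<in> S \<rightarrow> carrier R" "x = (\<Oplus>\<^bsub>M\<^esub>s\<in>S. a s \<odot>\<^bsub>M\<^esub> s)" using gen[OF x] by blast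
    have "(\<Oplus>\<^bsub>M\<^esub>s\<in>S. (a \<circ> inv_into S t) (t s) \<odot>\<^bsub>M\<^esub> s) = x"
      unfolding a(2) by (rule M.finsum_cong') (use a SM t in auto)
    then have "a \<circ> inv_into S t \<in> h x" using a t by (auto simp: h_def)
    then show ?thesis by blast
  qed
  moreover have "x = y" if "c \<in> h x" "c \<in> h y" for c x y using that by (auto simp: h_def)
  ultimately have "inj_on h (carrier M)" by (intro inj_onI) (metis ex_in_conv)
  with transport_module[OF assms(1)] fin_gen_iso[OF assms(1) _ _ assms(2)] show ?thesis by blast
qed

definition internal_direct_sum ::
  "('r, 'x) ring_scheme \<Rightarrow> ('r, 'm) module \<Rightarrow> 'm set \<Rightarrow> 'm set \<Rightarrow> bool" where
  "internal_direct_sum R M S C \<longleftrightarrow>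
     submodule S R M \<and> submodule C R M \<and> S \<inter> C = {\<zero>\<^bsub>M\<^esub>} \<and> S <+>\<^bsub>M\<^esub> C = carrier M"

definition indecomposable :: "('r, 'x) ring_scheme \<Rightarrow> ('r, 'm) module \<Rightarrow> bool" where
  "indecomposable R M \<longleftrightarrow> carrier M \<noteq> {\<zero>\<^bsub>M\<^esub>} \<and>
     (\<forall>S C. internal_direct_sum R M S C \<longrightarrow> S = {\<zero>\<^bsub>M\<^esub>} \<or> C = {\<zero>\<^bsub>M\<^esub>})"

definition mod_power :: "('r, 'm) module \<Rightarrow> nat \<Rightarrow> ('r, nat \<Rightarrow> 'm) module" where
  "mod_power M n =
     \<lparr>carrier = {..<n} \<rightarrow>\<^sub>E carrier M, monoid.mult = undefined, monoid.one = undefined,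
      ring.zero = (\<lambda>i\<in>{..<n}. \<zero>\<^bsub>M\<^esub>), ring.add = (\<lambda>x y. \<lambda>i\<in>{..<n}. x i \<oplus>\<^bsub>M\<^esub> y i),
      smult = (\<lambda>r x. \<lambda>i\<in>{..<n}. r \<odot>\<^bsub>M\<^esub> x i)\<rparr>"

definition add_class :: "('r, 'x) ring_scheme \<Rightarrow> ('r, 'm) module \<Rightarrow> 'r umodule set" where
  "add_class R E = {X. left_module R X \<and>
     (\<exists>n S C. internal_direct_sum R (mod_power E n) S C \<and>
              mod_iso R X ((mod_power E n)\<lparr>carrier := S\<rparr>))}"


section \<open>Projective dimension and finitistic dimension\<close>

definition projective :: "('r, 'x) ring_scheme \<Rightarrow> ('r, 'p) module \<Rightarrow> bool" where
  "projective R P \<longleftrightarrow> left_module R P \<and>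
     (\<forall>(L :: 'r umodule) (N :: 'r umodule). \<forall>g\<in>mod_hom R L N. \<forall>f\<in>mod_hom R P N.
        left_module R L \<and> left_module R N \<and> g ` carrier L = carrier N \<longrightarrow>
        (\<exists>h\<in>mod_hom R P L. \<forall>x\<in>carrier P. g (h x) = f x))"

text \<open>Exactness of $\cdots \to P_1 \to P_0 \to X \to 0$, where $d_i : P_{i+1} \to P_i$.\<close>

definition left_resolution ::
  "('r, 'x) ring_scheme \<Rightarrow> ('r, 'm) module \<Rightarrow> (nat \<Rightarrow> ('r, 'p) module) \<Rightarrow>
   (nat \<Rightarrow> 'p \<Rightarrow> 'p) \<Rightarrow> ('p \<Rightarrow> 'm) \<Rightarrow> bool" where
  "left_resolution R X P d e \<longleftrightarrow>
     (\<forall>i. left_module R (P i)) \<and>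
     (\<forall>i. d i \<in> mod_hom R (P (Suc i)) (P i)) \<and>
     e \<in> mod_hom R (P 0) X \<and>
     e ` carrier (P 0) = carrier X \<and>
     d 0 ` carrier (P 1) = a_kernel (P 0) X e \<and>
     (\<forall>i. d (Suc i) ` carrier (P (Suc (Suc i))) = a_kernel (P (Suc i)) (P i) (d i))"

definition fg_projective_resolution ::
  "('r, 'x) ring_scheme \<Rightarrow> ('r, 'm) module \<Rightarrow> (nat \<Rightarrow> 'r umodule) \<Rightarrow>
   (nat \<Rightarrow> 'r univ \<Rightarrow> 'r univ) \<Rightarrow> ('r univ \<Rightarrow> 'm) \<Rightarrow> bool" where
  "fg_projective_resolution R X P d e \<longleftrightarrow>
     left_resolution R X P d e \<and> (\<forall>i. projective R (P i) \<and> fin_gen R (P i))"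

text \<open>
  Projective dimension in the category of finitely generated modules.  Over a left noetherian
  ring, in particular over an Artin algebra, this is the usual projective dimension of a
  finitely generated module.
\<close>

definition proj_dim :: "('r, 'x) ring_scheme \<Rightarrow> ('r, 'm) module \<Rightarrow> enat" where
  "proj_dim R X = Inf {enat n | n. \<exists>P d e.
     fg_projective_resolution R X P d e \<and> (\<forall>i>n. carrier (P i) = {\<zero>\<^bsub>P i\<^esub>})}"

definition fin_dim :: "('r, 'x) ring_scheme \<Rightarrow> enat" where
  "fin_dim R = Sup {proj_dim R X | X :: 'r umodule.
     left_module R X \<and> fin_gen R X \<and> proj_dim R X < \<infinity>}"


section \<open>Artin algebras\<close>

definition artinian_cring :: "('k, 'x) ring_scheme \<Rightarrow> bool" where
  "artinian_cring K \<longleftrightarrow> cring K \<and>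
     (\<forall>I :: nat \<Rightarrow> 'k set. (\<forall>n. ideal (I n) K) \<and> (\<forall>n. I (Suc n) \<subseteq> I n) \<longrightarrow>
        (\<exists>N. \<forall>n\<ge>N. I n = I N))"

definition algebra_module ::
  "('k \<Rightarrow> 'a) \<Rightarrow> ('a, 'x) ring_scheme \<Rightarrow> ('k, 'a) module" where
  "algebra_module \<phi> A =
     \<lparr>carrier = carrier A, monoid.mult = monoid.mult A, monoid.one = monoid.one A,
      ring.zero = ring.zero A, ring.add = ring.add A,
      smult = (\<lambda>k a. \<phi> k \<otimes>\<^bsub>A\<^esub> a)\<rparr>"

definition artin_algebra ::
  "('k, 'x) ring_scheme \<Rightarrow> ('k \<Rightarrow> 'a) \<Rightarrow> ('a, 'y) ring_scheme \<Rightarrow> bool" where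
  "artin_algebra K \<phi> A \<longleftrightarrow>
     artinian_cring K \<and> ring A \<and> \<phi> \<in> ring_hom K A \<and>
     (\<forall>k\<in>carrier K. \<forall>a\<in>carrier A. \<phi> k \<otimes>\<^bsub>A\<^esub> a = a \<otimes>\<^bsub>A\<^esub> \<phi> k) \<and>
     fin_gen K (algebra_module \<phi> A)"


section \<open>Gorenstein projective modules\<close>

text \<open>
  The complex is indexed homologically by the integers, $d_i : P_i \to P_{i-1}$, so that $P^j$
  is \<open>P (-1 - j)\<close>.  The last conjunct is exactness of
  $\mathrm{Hom}(P_{i-1},Q) \to \mathrm{Hom}(P_i,Q) \to \mathrm{Hom}(P_{i+1},Q)$.
\<close>

definition totally_acyclic ::
  "('r, 'x) ring_scheme \<Rightarrow> (int \<Rightarrow> 'r umodule) \<Rightarrow> (int \<Rightarrow> 'r univ \<Rightarrow> 'r univ) \<Rightarrow> bool" where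
  "totally_acyclic R P d \<longleftrightarrow>
     (\<forall>i. projective R (P i) \<and> fin_gen R (P i)) \<and>
     (\<forall>i. d i \<in> mod_hom R (P i) (P (i - 1))) \<and>
     (\<forall>i. d (i + 1) ` carrier (P (i + 1)) = a_kernel (P i) (P (i - 1)) (d i)) \<and>
     (\<forall>(Q :: 'r umodule) i. projective R Q \<and> fin_gen R Q \<longrightarrow>
        (\<forall>f\<in>mod_hom R (P i) Q.
           (\<forall>x\<in>carrier (P (i + 1)). f (d (i + 1) x) = \<zero>\<^bsub>Q\<^esub>) \<longrightarrow>
           (\<exists>g\<in>mod_hom R (P (i - 1)) Q. \<forall>x\<in>carrier (P i). f x = g (d i x))))"

definition gorenstein_projective ::
  "('r, 'x) ring_scheme \<Rightarrow> ('r, 'm) module \<Rightarrow> bool" where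
  "gorenstein_projective R G \<longleftrightarrow> left_module R G \<and> fin_gen R G \<and>
     (\<exists>P d. totally_acyclic R P d \<and>
        mod_iso R G ((P (-1))\<lparr>carrier := d 0 ` carrier (P 0)\<rparr>))"

definition GP_class :: "('r, 'x) ring_scheme \<Rightarrow> 'r umodule set" where
  "GP_class R = {G. gorenstein_projective R G}"

definition CM_finite :: "('r, 'x) ring_scheme \<Rightarrow> bool" where
  "CM_finite R \<longleftrightarrow> (\<exists>S :: 'r umodule set. finite S \<and>
     (\<forall>X\<in>GP_class R. indecomposable R X \<longrightarrow> (\<exists>Y\<in>S. mod_iso R X Y)))"


section \<open>Tensor products, flatness and Tor\<close>

definition tensor_relations ::
  "('r, 'x) ring_scheme \<Rightarrow> ('r, 't) module \<Rightarrow> ('r, 'm) module \<Rightarrow> ('t \<times> 'm \<Rightarrow>\<^sub>0 int) set" where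
  "tensor_relations R T X =
     {frag_of (t \<oplus>\<^bsub>T\<^esub> t', x) - frag_of (t, x) - frag_of (t', x) | t t' x.
        t \<in> carrier T \<and> t' \<in> carrier T \<and> x \<in> carrier X} \<union>
     {frag_of (t, x \<oplus>\<^bsub>X\<^esub> x') - frag_of (t, x) - frag_of (t, x') | t x x'.
        t \<in> carrier T \<and> x \<in> carrier X \<and> x' \<in> carrier X} \<union>
     {frag_of (r \<odot>\<^bsub>T\<^esub> t, x) - frag_of (t, r \<odot>\<^bsub>X\<^esub> x) | r t x.
        r \<in> carrier R \<and> t \<in> carrier T \<and> x \<in> carrier X}"

definition tensor_kernel ::
  "('r, 'x) ring_scheme \<Rightarrow> ('r, 't) module \<Rightarrow> ('r, 'm) module \<Rightarrow> ('t \<times> 'm \<Rightarrow>\<^sub>0 int) set" where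
  "tensor_kernel R T X =
     generate (free_Abelian_group (carrier T \<times> carrier X)) (tensor_relations R T X)"

text \<open>The abelian group $T \otimes_R X$ for a right module $T$ and a left module $X$.\<close>

definition tensor ::
  "('r, 'x) ring_scheme \<Rightarrow> ('r, 't) module \<Rightarrow> ('r, 'm) module \<Rightarrow> ('t \<times> 'm \<Rightarrow>\<^sub>0 int) set monoid" where
  "tensor R T X =
     free_Abelian_group (carrier T \<times> carrier X) Mod tensor_kernel R T X"

text \<open>
  The map $f \otimes g$ into $T \otimes_R X$.  Over the representatives \<open>c\<close> of a coset \<open>C\<close> of the
  source, the cosets in the union all coincide when \<open>f\<close> and \<open>g\<close> are homomorphisms.
\<close>

definition tensor_map ::
  "('r, 'x) ring_scheme \<Rightarrow> ('r, 't) module \<Rightarrow> ('r, 'm) module \<Rightarrow> ('t' \<Rightarrow> 't) \<Rightarrow> ('m' \<Rightarrow> 'm) \<Rightarrow>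
   ('t' \<times> 'm' \<Rightarrow>\<^sub>0 int) set \<Rightarrow> ('t \<times> 'm \<Rightarrow>\<^sub>0 int) set" where
  "tensor_map R T X f g C =
     (\<Union>c\<in>C. tensor_kernel R T X #>\<^bsub>free_Abelian_group (carrier T \<times> carrier X)\<^esub>
               frag_extend (\<lambda>(t, x). frag_of (f t, g x)) c)"

text \<open>
  It suffices to test flatness on the inclusions of right ideals into \<open>R\<close>, so restricting
  the test modules to the universe is harmless.
\<close>

definition flat :: "('r, 'x) ring_scheme \<Rightarrow> ('r, 'm) module \<Rightarrow> bool" where
  "flat R F \<longleftrightarrow> left_module R F \<and>
     (\<forall>(K :: 'r umodule) (L :: 'r umodule). \<forall>f\<in>mod_hom R K L.
        right_module R K \<and> right_module R L \<and> inj_on f (carrier K) \<longrightarrow>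
        inj_on (tensor_map R L F f id) (carrier (tensor R K F)))"

text \<open>
  Flat dimension, computed with flat modules in the universe.  If \<open>X\<close> has a resolution by
  finitely generated projectives, which is the only case used below, then its flat dimension is
  at most \<open>n\<close> iff the \<open>n\<close>-th syzygy in that resolution is flat, so the restriction to the
  universe is harmless.
\<close>

definition flat_dim :: "('r, 'x) ring_scheme \<Rightarrow> ('r, 'm) module \<Rightarrow> enat" where
  "flat_dim R X = Inf {enat n | n. \<exists>(P :: nat \<Rightarrow> 'r umodule) d e.
     left_resolution R X P d e \<and> (\<forall>i. flat R (P i)) \<and> (\<forall>i>n. carrier (P i) = {\<zero>\<^bsub>P i\<^esub>})}"

text \<open>
  $\mathrm{Tor}^R_i(T,X)$ as the homology of $T \otimes_R P$ in degree \<open>i\<close>, for \<open>(P, d)\<close> a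
  projective resolution of \<open>X\<close>.
\<close>

definition Tor ::
  "('r, 'x) ring_scheme \<Rightarrow> ('r, 't) module \<Rightarrow> (nat \<Rightarrow> ('r, 'p) module) \<Rightarrow> (nat \<Rightarrow> 'p \<Rightarrow> 'p) \<Rightarrow>
   nat \<Rightarrow> ('t \<times> 'p \<Rightarrow>\<^sub>0 int) set set monoid" where
  "Tor R T P d i =
     (let C = (\<lambda>j. tensor R T (P j));
          D = (\<lambda>j. tensor_map R T (P j) id (d j));
          Z = (case i of 0 \<Rightarrow> carrier (C 0) | Suc j \<Rightarrow> kernel (C (Suc j)) (C j) (D j))
      in (C i)\<lparr>carrier := Z\<rparr> Mod (D i ` carrier (C (Suc i))))"

text \<open>
  Little restricted flat dimension of a right module \<open>T\<close>.  The test modules \<open>X\<close> are those of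
  finite flat dimension that possess a resolution \<open>(P, d, e)\<close> by finitely generated projectives;
  such an \<open>X\<close> is finitely generated.
\<close>

definition rfd :: "('r, 'x) ring_scheme \<Rightarrow> ('r, 't) module \<Rightarrow> enat" where
  "rfd R T = Inf {enat m | m. \<forall>(X :: 'r umodule) P d e.
     left_module R X \<and> flat_dim R X < \<infinity> \<and> fg_projective_resolution R X P d e \<longrightarrow>
     (\<forall>i>m. trivial_group (Tor R T P d i))}"


section \<open>Endomorphism rings\<close>

text \<open>Endomorphisms act on the right: the product \<open>fg\<close> is ``first \<open>f\<close>, then \<open>g\<close>''.\<close>

definition End_ring :: "('r, 'x) ring_scheme \<Rightarrow> ('r, 'm) module \<Rightarrow> ('m \<Rightarrow> 'm) ring" where
  "End_ring R M =
     \<lparr>carrier = mod_hom R M M \<inter> extensional (carrier M),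
      monoid.mult = (\<lambda>f g. \<lambda>x\<in>carrier M. g (f x)), monoid.one = (\<lambda>x\<in>carrier M. x),
      ring.zero = (\<lambda>x\<in>carrier M. \<zero>\<^bsub>M\<^esub>), ring.add = (\<lambda>f g. \<lambda>x\<in>carrier M. f x \<oplus>\<^bsub>M\<^esub> g x)\<rparr>"

text \<open>\<open>M\<close> as a right module over its endomorphism ring.\<close>

definition End_right_module :: "('r, 'm) module \<Rightarrow> ('m \<Rightarrow> 'm, 'm) module" where
  "End_right_module M =
     \<lparr>carrier = carrier M, monoid.mult = monoid.mult M, monoid.one = monoid.one M,
      ring.zero = ring.zero M, ring.add = ring.add M,
      smult = (\<lambda>b x. b x)\<rparr>"

text \<open>$\mathrm{Hom}_R(M,X)$ as a left module over the endomorphism ring of \<open>M\<close>.\<close>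

definition Hom_module ::
  "('r, 'x) ring_scheme \<Rightarrow> ('r, 'm) module \<Rightarrow> ('r, 'n) module \<Rightarrow> ('m \<Rightarrow> 'm, 'm \<Rightarrow> 'n) module" where
  "Hom_module R M X =
     \<lparr>carrier = mod_hom R M X \<inter> extensional (carrier M),
      monoid.mult = undefined, monoid.one = undefined,
      ring.zero = (\<lambda>x\<in>carrier M. \<zero>\<^bsub>X\<^esub>), ring.add = (\<lambda>f g. \<lambda>x\<in>carrier M. f x \<oplus>\<^bsub>X\<^esub> g x),
      smult = (\<lambda>b f. \<lambda>x\<in>carrier M. f (b x))\<rparr>"

lemma left_module_smult_zero_minus:
  assumes "left_module R M" "r \<in> carrier R"
  shows "r \<odot>\<^bsub>M\<^esub> \<zero>\<^bsub>M\<^esub> = \<zero>\<^bsub>M\<^esub>"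
    and "x \<in> carrier M \<Longrightarrow> r \<odot>\<^bsub>M\<^esub> (\<ominus>\<^bsub>M\<^esub> x) = \<ominus>\<^bsub>M\<^esub> (r \<odot>\<^bsub>M\<^esub> x)"
proof -
  interpret left_module R M by fact
  have "r \<odot>\<^bsub>M\<^esub> \<zero>\<^bsub>M\<^esub> \<oplus>\<^bsub>M\<^esub> r \<odot>\<^bsub>M\<^esub> \<zero>\<^bsub>M\<^esub> = r \<odot>\<^bsub>M\<^esub> \<zero>\<^bsub>M\<^esub>"
    using smult_r_distr[OF assms(2), of "\<zero>\<^bsub>M\<^esub>" "\<zero>\<^bsub>M\<^esub>"] by simp
  then show z: "r \<odot>\<^bsub>M\<^esub> \<zero>\<^bsub>M\<^esub> = \<zero>\<^bsub>M\<^esub>"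
    using assms(2) by (simp add: M.add.l_cancel_one')
  assume x: "x \<in> carrier M"
  have "r \<odot>\<^bsub>M\<^esub> (\<ominus>\<^bsub>M\<^esub> x) \<oplus>\<^bsub>M\<^esub> r \<odot>\<^bsub>M\<^esub> x = \<zero>\<^bsub>M\<^esub>"
    using x assms(2) z by (simp add: smult_r_distr[symmetric] M.l_neg)
  then show "r \<odot>\<^bsub>M\<^esub> (\<ominus>\<^bsub>M\<^esub> x) = \<ominus>\<^bsub>M\<^esub> (r \<odot>\<^bsub>M\<^esub> x)"
    using x assms(2) by (intro M.minus_equality[symmetric]) auto
qed

lemma abelian_group_hom_group:
  fixes R :: "('r, 'x) ring_scheme" and M :: "('r, 'm) module" and X :: "('r, 'n) module"
    and H :: "('m \<Rightarrow> 'n, 'y) ring_scheme"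
  assumes "left_module R M" "left_module R X"
    and "carrier H = mod_hom R M X \<inter> extensional (carrier M)"
    and "zero H = (\<lambda>x\<in>carrier M. \<zero>\<^bsub>X\<^esub>)"
    and "add H = (\<lambda>f g. \<lambda>x\<in>carrier M. f x \<oplus>\<^bsub>X\<^esub> g x)"
  shows "abelian_group H"
proof -
  interpret M: left_module R M by fact
  interpret X: left_module R X by fact
  note X.M.a_ac [simp] X.smult_r_distr [simp] left_module_smult_zero_minus[OF assms(2), simp]
  show ?thesis
  proof (rule abelian_groupI)
    fix f assume f: "f \<in> carrier H"
    show "\<exists>g\<in>carrier H. g \<oplus>\<^bsub>H\<^esub> f = \<zero>\<^bsub>H\<^esub>"
    proof (rule bexI)
      show "(\<lambda>x\<in>carrier M. \<ominus>\<^bsub>X\<^esub> f x) \<oplus>\<^bsub>H\<^esub> f = \<zero>\<^bsub>H\<^esub>"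
        using f by (auto simp: assms mod_hom_def fun_eq_iff X.M.r_neg Pi_def)
      show "(\<lambda>x\<in>carrier M. \<ominus>\<^bsub>X\<^esub> f x) \<in> carrier H"
        using f by (auto simp: assms mod_hom_def X.M.minus_add Pi_def)
    qed
  next
    fix f assume "f \<in> carrier H"
    then show "\<zero>\<^bsub>H\<^esub> \<oplus>\<^bsub>H\<^esub> f = f"
      by (auto simp: assms mod_hom_def extensional_def fun_eq_iff Pi_def)
  qed (auto simp: assms mod_hom_def fun_eq_iff Pi_def)
qed

lemma End_ring_is_ring:
  assumes "left_module R M"
  shows "ring (End_ring R M)"
proof -
  interpret M: left_module R M by fact
  show ?thesis
  proof (rule ringI)
    show "abelian_group (End_ring R M)"
      by (rule abelian_group_hom_group[OF assms assms]) (auto simp: End_ring_def)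
    show "monoid (End_ring R M)"
      by (rule monoidI)
         (auto simp: End_ring_def mod_hom_def extensional_def fun_eq_iff Pi_def restrict_def)
  qed (auto simp: End_ring_def mod_hom_def fun_eq_iff Pi_def)
qed

lemma End_right_module_is_module:
  assumes "left_module R M"
  shows "right_module (End_ring R M) (End_right_module M)"
proof -
  interpret M: left_module R M by fact
  have "abelian_group (End_right_module M)"
    by (rule abelian_groupI)
       (auto simp: End_right_module_def M.M.a_ac intro: M.M.l_neg M.M.a_inv_closed)
  then show ?thesis
    by (intro right_module.intro right_module_axioms.intro End_ring_is_ring[OF assms])
       (auto simp: End_right_module_def End_ring_def mod_hom_def)
qed

lemma Hom_module_is_module:
  assumes "left_module R M" "left_module R X"
  shows "left_module (End_ring R M) (Hom_module R M X)"
proof -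
  interpret M: left_module R M by fact
  interpret X: left_module R X by fact
  have "abelian_group (Hom_module R M X)"
    by (rule abelian_group_hom_group[OF assms]) (auto simp: Hom_module_def)
  then show ?thesis
    by (intro left_module.intro left_module_axioms.intro End_ring_is_ring[OF assms(1)])
       (auto simp: Hom_module_def End_ring_def mod_hom_def extensional_def fun_eq_iff Pi_def)
qed

end

theory Submission
  imports Defs
begin

text \<open>
  Write $n$, $r$ and $p$ for the three terms on the right, all finite without loss of generality,
  and let $Y$ be a $B$-module of finite projective dimension.  Tensoring a finite projective
  resolution $Q$ of $Y$ with $M$ yields a complex of modules in
  $\mathrm{add}\,M \subseteq \mathcal{GP}(A)$ which is exact above degree $r$.  The cokernel $X$ of
  its differential into degree $r$ thus has a finite resolution by Gorenstein projectives.  Hence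
  there is an exact sequence $0 \to L \to W \to X \to 0$ with $W$ Gorenstein projective and $L$ of
  finite projective dimension.  Embedding $W$ into a projective $P$ with Gorenstein projective
  cokernel shows that $L$ is a syzygy of $P/L$, so $\mathrm{pd}\,L \le n - 1$.  Hence the $n$-th
  syzygy $N$ of $X$ in the complex is Gorenstein projective, so $N \in \mathrm{add}\,E$.  As $n \ge 2$,
  $N$ is a kernel of a differential $M \otimes_B Q_{i+1} \to M \otimes_B Q_i$, where $i = r + n - 2$.  Since
  $M \otimes_B -$ is fully faithful from the finitely generated projectives to $\mathrm{add}\,M$,
  $\mathrm{Hom}_A(M, N)$ is the kernel of $Q_{i+1} \to Q_i$, a syzygy of $Y$ of order $r + n$.  It lies in
  $\mathrm{add}\,\mathrm{Hom}_A(M, E)$ and so has projective dimension at most $p$.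
\<close>

section \<open>Modules and homomorphisms\<close>

text \<open>Three devices carry the argument. Membership in an additive closure means that the
  identity is a finite sum of composites through the given modules (\<open>through\<close>); a
  property is proved for an arbitrary such sum, one composite at a time, and the identity is
  inserted at the end. This covers finitely generated projectives as add of the ring, the passage
  from add B to add M, bounds on projective dimension for summands, and independence of a chosen
  projective cover. Ext groups are not formed: their vanishing is the extendability of homomorphisms
  along a short exact sequence with projective middle term. The conditions in all degrees, and the
  endless coresolution of a Gorenstein projective, are coinductive predicates, so closure under
  extensions is a coinduction with one step of the horseshoe lemma. Finally, products, tensor
  products and Hom modules have carrier types outside the universe over which the definitions
  quantify; being finitely generated, each is exchanged for an isomorphic copy in the universe
  together with mutually inverse homomorphisms.\<close>

lemma (in left_module) add_minus_cancel:
  assumes "x \<in> carrier M" "y \<in> carrier M"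
  shows "x \<oplus>\<^bsub>M\<^esub> (\<ominus>\<^bsub>M\<^esub> x \<oplus>\<^bsub>M\<^esub> y) = y" "\<ominus>\<^bsub>M\<^esub> x \<oplus>\<^bsub>M\<^esub> (x \<oplus>\<^bsub>M\<^esub> y) = y"
    "x \<oplus>\<^bsub>M\<^esub> (y \<oplus>\<^bsub>M\<^esub> \<ominus>\<^bsub>M\<^esub> x) = y" "\<ominus>\<^bsub>M\<^esub> x \<oplus>\<^bsub>M\<^esub> (y \<oplus>\<^bsub>M\<^esub> x) = y"
proof -
  show *: "x \<oplus>\<^bsub>M\<^esub> (\<ominus>\<^bsub>M\<^esub> x \<oplus>\<^bsub>M\<^esub> y) = y" "\<ominus>\<^bsub>M\<^esub> x \<oplus>\<^bsub>M\<^esub> (x \<oplus>\<^bsub>M\<^esub> y) = y"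
    using assms by (simp_all add: M.a_assoc[symmetric] M.r_neg M.l_neg)
  show "x \<oplus>\<^bsub>M\<^esub> (y \<oplus>\<^bsub>M\<^esub> \<ominus>\<^bsub>M\<^esub> x) = y" "\<ominus>\<^bsub>M\<^esub> x \<oplus>\<^bsub>M\<^esub> (y \<oplus>\<^bsub>M\<^esub> x) = y"
    using assms * by (simp_all add: M.a_comm[of y])
qed

text \<open>A rewriting system for sums in a module: right association and commutation, together
  with four cancellation rules that catch an element and its negative when they are neighbours or
  have one term between them. Later proofs also cite single members by position, through
  \<open>mod_simps\<close>.\<close>

lemma (in left_module) module_arith:
  shows "\<zero>\<^bsub>M\<^esub> \<in> carrier M"
    "\<And>x y. x \<in> carrier M \<Longrightarrow> y \<in> carrier M \<Longrightarrow> x \<oplus>\<^bsub>M\<^esub> y \<in> carrier M"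
    "\<And>x. x \<in> carrier M \<Longrightarrow> \<ominus>\<^bsub>M\<^esub> x \<in> carrier M"
    "\<And>r x. r \<in> carrier R \<Longrightarrow> x \<in> carrier M \<Longrightarrow> r \<odot>\<^bsub>M\<^esub> x \<in> carrier M"
    "\<And>x. x \<in> carrier M \<Longrightarrow> \<zero>\<^bsub>M\<^esub> \<oplus>\<^bsub>M\<^esub> x = x"
    "\<And>x. x \<in> carrier M \<Longrightarrow> x \<oplus>\<^bsub>M\<^esub> \<zero>\<^bsub>M\<^esub> = x"
    "\<And>x. x \<in> carrier M \<Longrightarrow> \<ominus>\<^bsub>M\<^esub> x \<oplus>\<^bsub>M\<^esub> x = \<zero>\<^bsub>M\<^esub>"
    "\<And>x. x \<in> carrier M \<Longrightarrow> x \<oplus>\<^bsub>M\<^esub> \<ominus>\<^bsub>M\<^esub> x = \<zero>\<^bsub>M\<^esub>"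
    "\<And>x y. x \<in> carrier M \<Longrightarrow> y \<in> carrier M \<Longrightarrow> x \<oplus>\<^bsub>M\<^esub> (\<ominus>\<^bsub>M\<^esub> x \<oplus>\<^bsub>M\<^esub> y) = y"
    "\<And>x y. x \<in> carrier M \<Longrightarrow> y \<in> carrier M \<Longrightarrow> \<ominus>\<^bsub>M\<^esub> x \<oplus>\<^bsub>M\<^esub> (x \<oplus>\<^bsub>M\<^esub> y) = y"
    "\<And>x y. x \<in> carrier M \<Longrightarrow> y \<in> carrier M \<Longrightarrow> x \<oplus>\<^bsub>M\<^esub> (y \<oplus>\<^bsub>M\<^esub> \<ominus>\<^bsub>M\<^esub> x) = y"
    "\<And>x y. x \<in> carrier M \<Longrightarrow> y \<in> carrier M \<Longrightarrow> \<ominus>\<^bsub>M\<^esub> x \<oplus>\<^bsub>M\<^esub> (y \<oplus>\<^bsub>M\<^esub> x) = y"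
    "\<And>x y. x \<in> carrier M \<Longrightarrow> y \<in> carrier M \<Longrightarrow> \<ominus>\<^bsub>M\<^esub> (x \<oplus>\<^bsub>M\<^esub> y) = \<ominus>\<^bsub>M\<^esub> x \<oplus>\<^bsub>M\<^esub> \<ominus>\<^bsub>M\<^esub> y"
    "\<And>x. x \<in> carrier M \<Longrightarrow> \<ominus>\<^bsub>M\<^esub> (\<ominus>\<^bsub>M\<^esub> x) = x"
    "\<ominus>\<^bsub>M\<^esub> \<zero>\<^bsub>M\<^esub> = \<zero>\<^bsub>M\<^esub>"
    "\<And>x y z. x \<in> carrier M \<Longrightarrow> y \<in> carrier M \<Longrightarrow> z \<in> carrier M \<Longrightarrow>
        (x \<oplus>\<^bsub>M\<^esub> y) \<oplus>\<^bsub>M\<^esub> z = x \<oplus>\<^bsub>M\<^esub> (y \<oplus>\<^bsub>M\<^esub> z)"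
    "\<And>x y. x \<in> carrier M \<Longrightarrow> y \<in> carrier M \<Longrightarrow> x \<oplus>\<^bsub>M\<^esub> y = y \<oplus>\<^bsub>M\<^esub> x"
    "\<And>x y z. x \<in> carrier M \<Longrightarrow> y \<in> carrier M \<Longrightarrow> z \<in> carrier M \<Longrightarrow>
        x \<oplus>\<^bsub>M\<^esub> (y \<oplus>\<^bsub>M\<^esub> z) = y \<oplus>\<^bsub>M\<^esub> (x \<oplus>\<^bsub>M\<^esub> z)"
    "\<And>r x y. r \<in> carrier R \<Longrightarrow> x \<in> carrier M \<Longrightarrow> y \<in> carrier M \<Longrightarrow>
        r \<odot>\<^bsub>M\<^esub> (x \<oplus>\<^bsub>M\<^esub> y) = r \<odot>\<^bsub>M\<^esub> x \<oplus>\<^bsub>M\<^esub> r \<odot>\<^bsub>M\<^esub> y"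
    "\<And>r. r \<in> carrier R \<Longrightarrow> r \<odot>\<^bsub>M\<^esub> \<zero>\<^bsub>M\<^esub> = \<zero>\<^bsub>M\<^esub>"
    "\<And>r x. r \<in> carrier R \<Longrightarrow> x \<in> carrier M \<Longrightarrow> r \<odot>\<^bsub>M\<^esub> (\<ominus>\<^bsub>M\<^esub> x) = \<ominus>\<^bsub>M\<^esub> (r \<odot>\<^bsub>M\<^esub> x)"
  by (simp_all add: left_module_smult_zero_minus[OF left_module_axioms] smult_r_distr M.l_neg M.r_neg
      M.minus_add M.a_assoc M.a_comm M.a_lcomm add_minus_cancel)

lemmas mod_simps = left_module.module_arith

lemma neg_unique:
  assumes "left_module R M" "x \<in> carrier M" "y \<in> carrier M" "x \<oplus>\<^bsub>M\<^esub> y = \<zero>\<^bsub>M\<^esub>"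
  shows "y = \<ominus>\<^bsub>M\<^esub> x"
proof -
  interpret left_module R M by fact
  show ?thesis using assms by (metis M.minus_equality M.a_comm)
qed

lemma diff_zero_eq:
  assumes "left_module R M" "x \<in> carrier M" "y \<in> carrier M" "x \<oplus>\<^bsub>M\<^esub> \<ominus>\<^bsub>M\<^esub> y = \<zero>\<^bsub>M\<^esub>"
  shows "x = y"
proof -
  interpret left_module R M by fact
  show ?thesis using neg_unique[OF assms(1,2) _ assms(4)] assms by (metis M.minus_minus M.a_inv_closed)
qed

lemma smult_uminus_one:
  assumes "left_module R M" "x \<in> carrier M"
  shows "(\<ominus>\<^bsub>R\<^esub> \<one>\<^bsub>R\<^esub>) \<odot>\<^bsub>M\<^esub> x = \<ominus>\<^bsub>M\<^esub> x"
proof -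
  interpret left_module R M by fact
  have "\<zero>\<^bsub>R\<^esub> \<odot>\<^bsub>M\<^esub> x \<oplus>\<^bsub>M\<^esub> \<zero>\<^bsub>R\<^esub> \<odot>\<^bsub>M\<^esub> x = \<zero>\<^bsub>R\<^esub> \<odot>\<^bsub>M\<^esub> x"
    using assms(2) smult_l_distr[of "\<zero>\<^bsub>R\<^esub>" "\<zero>\<^bsub>R\<^esub>" x] by simp
  then have "\<zero>\<^bsub>R\<^esub> \<odot>\<^bsub>M\<^esub> x = \<zero>\<^bsub>M\<^esub>"
    using assms(2) by (simp add: M.add.l_cancel_one')
  then have "x \<oplus>\<^bsub>M\<^esub> (\<ominus>\<^bsub>R\<^esub> \<one>\<^bsub>R\<^esub>) \<odot>\<^bsub>M\<^esub> x = \<zero>\<^bsub>M\<^esub>"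
    using assms(2) smult_l_distr[of "\<one>\<^bsub>R\<^esub>" "\<ominus>\<^bsub>R\<^esub> \<one>\<^bsub>R\<^esub>" x] by (simp add: R.r_neg)
  then show ?thesis
    using neg_unique[OF assms(1)] assms(2) by simp
qed

lemma mod_homI:
  assumes "\<And>x. x \<in> carrier M \<Longrightarrow> f x \<in> carrier N"
    and "\<And>x y. x \<in> carrier M \<Longrightarrow> y \<in> carrier M \<Longrightarrow> f (x \<oplus>\<^bsub>M\<^esub> y) = f x \<oplus>\<^bsub>N\<^esub> f y"
    and "\<And>r x. r \<in> carrier R \<Longrightarrow> x \<in> carrier M \<Longrightarrow> f (r \<odot>\<^bsub>M\<^esub> x) = r \<odot>\<^bsub>N\<^esub> f x"
  shows "f \<in> mod_hom R M N"
  using assms by (auto simp: mod_hom_def)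

lemma hom_in: "f \<in> mod_hom R M N \<Longrightarrow> x \<in> carrier M \<Longrightarrow> f x \<in> carrier N"
  by (auto simp: mod_hom_def)

lemma hom_simps:
  assumes "left_module R M" "left_module R N" "f \<in> mod_hom R M N"
  shows "\<And>x. x \<in> carrier M \<Longrightarrow> f x \<in> carrier N"
    "\<And>x y. x \<in> carrier M \<Longrightarrow> y \<in> carrier M \<Longrightarrow> f (x \<oplus>\<^bsub>M\<^esub> y) = f x \<oplus>\<^bsub>N\<^esub> f y"
    "\<And>r x. r \<in> carrier R \<Longrightarrow> x \<in> carrier M \<Longrightarrow> f (r \<odot>\<^bsub>M\<^esub> x) = r \<odot>\<^bsub>N\<^esub> f x"
    "f \<zero>\<^bsub>M\<^esub> = \<zero>\<^bsub>N\<^esub>"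
    "\<And>x. x \<in> carrier M \<Longrightarrow> f (\<ominus>\<^bsub>M\<^esub> x) = \<ominus>\<^bsub>N\<^esub> f x"
proof -
  interpret M: left_module R M by fact
  interpret N: left_module R N by fact
  show cl: "\<And>x. x \<in> carrier M \<Longrightarrow> f x \<in> carrier N"
    and add: "\<And>x y. x \<in> carrier M \<Longrightarrow> y \<in> carrier M \<Longrightarrow> f (x \<oplus>\<^bsub>M\<^esub> y) = f x \<oplus>\<^bsub>N\<^esub> f y"
    and "\<And>r x. r \<in> carrier R \<Longrightarrow> x \<in> carrier M \<Longrightarrow> f (r \<odot>\<^bsub>M\<^esub> x) = r \<odot>\<^bsub>N\<^esub> f x"
    using assms(3) by (auto simp: mod_hom_def)
  have "f \<zero>\<^bsub>M\<^esub> \<oplus>\<^bsub>N\<^esub> f \<zero>\<^bsub>M\<^esub> = f \<zero>\<^bsub>M\<^esub>"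
    using add[of "\<zero>\<^bsub>M\<^esub>" "\<zero>\<^bsub>M\<^esub>"] by simp
  then show z: "f \<zero>\<^bsub>M\<^esub> = \<zero>\<^bsub>N\<^esub>"
    using cl by (simp add: N.M.add.l_cancel_one')
  show "f (\<ominus>\<^bsub>M\<^esub> x) = \<ominus>\<^bsub>N\<^esub> f x" if "x \<in> carrier M" for x
    using that cl z add[of x "\<ominus>\<^bsub>M\<^esub> x"] by (intro neg_unique[OF assms(2)]) (auto simp: M.M.r_neg)
qed

lemma hom_id: "(\<lambda>x. x) \<in> mod_hom R M M"
  by (auto simp: mod_hom_def)

lemma hom_zero: "left_module R N \<Longrightarrow> (\<lambda>x. \<zero>\<^bsub>N\<^esub>) \<in> mod_hom R M N"
  by (rule mod_homI) (simp_all add: mod_simps(1,5,20,21)[where M = N])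

lemma hom_comp: "f \<in> mod_hom R L M \<Longrightarrow> g \<in> mod_hom R M N \<Longrightarrow> (\<lambda>x. g (f x)) \<in> mod_hom R L N"
  by (auto simp: mod_hom_def Pi_def)

lemma hom_add:
  assumes "left_module R M" "left_module R N" "f \<in> mod_hom R M N" "g \<in> mod_hom R M N"
  shows "(\<lambda>x. f x \<oplus>\<^bsub>N\<^esub> g x) \<in> mod_hom R M N"
  by (rule mod_homI) (simp_all add: mod_simps[OF assms(2)] hom_simps[OF assms(1,2,3)] hom_simps[OF assms(1,2,4)])

lemma hom_uminus:
  assumes "left_module R M" "left_module R N" "f \<in> mod_hom R M N"
  shows "(\<lambda>x. \<ominus>\<^bsub>N\<^esub> f x) \<in> mod_hom R M N"
  by (rule mod_homI) (simp_all add: mod_simps[OF assms(2)] hom_simps[OF assms(1,2,3)])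

lemma hom_diff:
  assumes "left_module R M" "left_module R N" "f \<in> mod_hom R M N" "g \<in> mod_hom R M N"
  shows "(\<lambda>x. f x \<oplus>\<^bsub>N\<^esub> \<ominus>\<^bsub>N\<^esub> g x) \<in> mod_hom R M N"
  using hom_add[OF assms(1-3) hom_uminus[OF assms(1,2,4)]] .

lemma hom_cong:
  assumes "f \<in> mod_hom R M N" "left_module R M" "\<And>x. x \<in> carrier M \<Longrightarrow> f x = g x"
  shows "g \<in> mod_hom R M N"
proof (rule mod_homI)
  show "g x \<in> carrier N" if "x \<in> carrier M" for x
    using hom_in[OF assms(1) that] assms(3)[OF that] by simp
qed (use assms(1) in \<open>simp_all add: mod_hom_def assms(3)[symmetric] mod_simps(2,4)[OF assms(2)]\<close>)

lemma hom_inj: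
  assumes "left_module R M" "left_module R N" "f \<in> mod_hom R M N"
    and "\<And>x. x \<in> carrier M \<Longrightarrow> f x = \<zero>\<^bsub>N\<^esub> \<Longrightarrow> x = \<zero>\<^bsub>M\<^esub>"
  shows "inj_on f (carrier M)"
proof (rule inj_onI)
  fix x y assume xy: "x \<in> carrier M" "y \<in> carrier M" "f x = f y"
  then show "x = y"
    using assms(4)[of "x \<oplus>\<^bsub>M\<^esub> \<ominus>\<^bsub>M\<^esub> y"]
    by - (rule diff_zero_eq[OF assms(1)],
      simp_all add: mod_simps[OF assms(1)] mod_simps[OF assms(2)] hom_simps[OF assms(1-3)])
qed

lemma left_module_axiomsI:
  assumes "ring R" "abelian_group M"
    and "\<And>a x. a \<in> carrier R \<Longrightarrow> x \<in> carrier M \<Longrightarrow> a \<odot>\<^bsub>M\<^esub> x \<in> carrier M"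
    and "\<And>a b x. a \<in> carrier R \<Longrightarrow> b \<in> carrier R \<Longrightarrow> x \<in> carrier M \<Longrightarrow>
        (a \<oplus>\<^bsub>R\<^esub> b) \<odot>\<^bsub>M\<^esub> x = a \<odot>\<^bsub>M\<^esub> x \<oplus>\<^bsub>M\<^esub> b \<odot>\<^bsub>M\<^esub> x"
    and "\<And>a x y. a \<in> carrier R \<Longrightarrow> x \<in> carrier M \<Longrightarrow> y \<in> carrier M \<Longrightarrow>
        a \<odot>\<^bsub>M\<^esub> (x \<oplus>\<^bsub>M\<^esub> y) = a \<odot>\<^bsub>M\<^esub> x \<oplus>\<^bsub>M\<^esub> a \<odot>\<^bsub>M\<^esub> y"
    and "\<And>a b x. a \<in> carrier R \<Longrightarrow> b \<in> carrier R \<Longrightarrow> x \<in> carrier M \<Longrightarrow>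
        (a \<otimes>\<^bsub>R\<^esub> b) \<odot>\<^bsub>M\<^esub> x = a \<odot>\<^bsub>M\<^esub> (b \<odot>\<^bsub>M\<^esub> x)"
    and "\<And>x. x \<in> carrier M \<Longrightarrow> \<one>\<^bsub>R\<^esub> \<odot>\<^bsub>M\<^esub> x = x"
  shows "left_module R M"
  using assms by (intro left_module.intro left_module_axioms.intro) auto

text \<open>Here \<open>N\<close> is a bare record. Every axiom is inherited from \<open>M\<close>
  along a surjection that respects the operations, which spares checking them by hand for the
  quotient in \<open>ses_quotient\<close>.\<close>

lemma left_module_image:
  fixes M :: "('r, 'm) module" and N :: "('r, 'n) module"
  assumes M: "left_module R M" and surj: "f ` carrier M = carrier N"
    and z: "f \<zero>\<^bsub>M\<^esub> = \<zero>\<^bsub>N\<^esub>"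
    and add: "\<And>x y. x \<in> carrier M \<Longrightarrow> y \<in> carrier M \<Longrightarrow> f (x \<oplus>\<^bsub>M\<^esub> y) = f x \<oplus>\<^bsub>N\<^esub> f y"
    and sm: "\<And>r x. r \<in> carrier R \<Longrightarrow> x \<in> carrier M \<Longrightarrow> f (r \<odot>\<^bsub>M\<^esub> x) = r \<odot>\<^bsub>N\<^esub> f x"
  shows "left_module R N"
proof -
  interpret M: left_module R M by fact
  note add' = add[symmetric] and sm' = sm[symmetric]
  have "abelian_group N"
  proof (rule abelian_groupI)
    fix x assume "x \<in> carrier N"
    then obtain a where a: "a \<in> carrier M" "x = f a" using surj by auto
    show "\<exists>y\<in>carrier N. y \<oplus>\<^bsub>N\<^esub> x = \<zero>\<^bsub>N\<^esub>"
      by (rule bexI[of _ "f (\<ominus>\<^bsub>M\<^esub> a)"]) (use a surj in \<open>auto simp: add' z M.M.l_neg\<close>)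
  qed (unfold surj[symmetric], auto simp: add' z[symmetric] M.M.a_ac)
  then show ?thesis
    by (intro left_module_axiomsI M.R.ring_axioms, unfold surj[symmetric])
       (auto simp: add' sm' M.smult_l_distr M.smult_r_distr M.smult_assoc)
qed

section \<open>Submodules, kernels, images and factorisations\<close>

definition submod :: "('r, 'x) ring_scheme \<Rightarrow> ('r, 'm) module \<Rightarrow> 'm set \<Rightarrow> bool" where
  "submod R M S \<longleftrightarrow> S \<subseteq> carrier M \<and> \<zero>\<^bsub>M\<^esub> \<in> S \<and> (\<forall>x\<in>S. \<forall>y\<in>S. x \<oplus>\<^bsub>M\<^esub> y \<in> S) \<and>
     (\<forall>r\<in>carrier R. \<forall>x\<in>S. r \<odot>\<^bsub>M\<^esub> x \<in> S)"

text \<open>The negative is the multiple by minus one, so closure under scalars yields closure under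
  negation.\<close>

lemma submod_uminus:
  assumes "left_module R M" "submod R M S" "x \<in> S"
  shows "\<ominus>\<^bsub>M\<^esub> x \<in> S"
proof -
  interpret left_module R M by fact
  show ?thesis
    using assms smult_uminus_one[OF assms(1), of x] R.one_closed R.a_inv_closed
    unfolding submod_def by (metis subset_iff)
qed

lemma left_module_submod:
  assumes "left_module R M" "submod R M S"
  shows "left_module R (M\<lparr>carrier := S\<rparr>)"
proof -
  interpret left_module R M by fact
  note S = assms(2)[unfolded submod_def]
  have [simp]: "x \<in> S \<Longrightarrow> x \<in> carrier M" for x using S by auto
  have "abelian_group (M\<lparr>carrier := S\<rparr>)"
  proof (rule abelian_groupI)
    fix x assume "x \<in> carrier (M\<lparr>carrier := S\<rparr>)"
    then show "\<exists>y\<in>carrier (M\<lparr>carrier := S\<rparr>). y \<oplus>\<^bsub>M\<lparr>carrier := S\<rparr>\<^esub> x = \<zero>\<^bsub>M\<lparr>carrier := S\<rparr>\<^esub>"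
      by (intro bexI[of _ "\<ominus>\<^bsub>M\<^esub> x"]) (auto simp: submod_uminus[OF assms] M.l_neg)
  qed (use S in \<open>auto simp: M.a_ac\<close>)
  then show ?thesis
    by (intro left_module_axiomsI R.ring_axioms)
       (use S in \<open>auto simp: smult_l_distr smult_r_distr smult_assoc\<close>)
qed

lemma submod_kernel:
  assumes "left_module R M" "left_module R N" "f \<in> mod_hom R M N"
  shows "submod R M {x \<in> carrier M. f x = \<zero>\<^bsub>N\<^esub>}"
  by (auto simp: submod_def mod_simps[OF assms(1)] hom_simps[OF assms] mod_simps[OF assms(2)])

lemma submod_image:
  assumes "left_module R M" "left_module R N" "f \<in> mod_hom R M N"
  shows "submod R N (f ` carrier M)"
proof -
  note [simp] = mod_simps[OF assms(1)]
  have "f x \<oplus>\<^bsub>N\<^esub> f y \<in> f ` carrier M" if "x \<in> carrier M" "y \<in> carrier M" for x y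
    using that by (intro image_eqI[of _ _ "x \<oplus>\<^bsub>M\<^esub> y"]) (auto simp: hom_simps(2)[OF assms])
  moreover have "r \<odot>\<^bsub>N\<^esub> f x \<in> f ` carrier M" if "x \<in> carrier M" "r \<in> carrier R" for x r
    using that by (intro image_eqI[of _ _ "r \<odot>\<^bsub>M\<^esub> x"]) (auto simp: hom_simps(3)[OF assms])
  moreover have "\<zero>\<^bsub>N\<^esub> \<in> f ` carrier M"
    by (intro image_eqI[of _ _ "\<zero>\<^bsub>M\<^esub>"]) (auto simp: hom_simps(4)[OF assms])
  ultimately show ?thesis
    using hom_simps(1)[OF assms] by (auto simp: submod_def)
qed

lemma hom_sub_dom: "f \<in> mod_hom R M N \<Longrightarrow> S \<subseteq> carrier M \<Longrightarrow> f \<in> mod_hom R (M\<lparr>carrier := S\<rparr>) N"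
  by (auto simp: mod_hom_def subset_eq)

lemma hom_sub_cod:
  "f \<in> mod_hom R M N \<Longrightarrow> f ` carrier M \<subseteq> S \<Longrightarrow> f \<in> mod_hom R M (N\<lparr>carrier := S\<rparr>)"
  by (auto simp: mod_hom_def)

lemma hom_sub_incl: "f \<in> mod_hom R M (N\<lparr>carrier := S\<rparr>) \<Longrightarrow> S \<subseteq> carrier N \<Longrightarrow> f \<in> mod_hom R M N"
  by (auto simp: mod_hom_def)

lemma hom_inverse:
  assumes "left_module R M" "left_module R N" "f \<in> mod_hom R M N" "bij_betw f (carrier M) (carrier N)"
  obtains g where "g \<in> mod_hom R N M" "\<And>x. x \<in> carrier M \<Longrightarrow> g (f x) = x"
    "\<And>y. y \<in> carrier N \<Longrightarrow> f (g y) = y"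
proof
  let ?g = "inv_into (carrier M) f"
  note [simp] = mod_simps[OF assms(1)] hom_simps[OF assms(1-3)]
  have inj: "inj_on f (carrier M)" and im: "f ` carrier M = carrier N"
    using assms(4) by (auto simp: bij_betw_def)
  show 1: "?g (f x) = x" if "x \<in> carrier M" for x using inj that by simp
  show 2: "f (?g y) = y" if "y \<in> carrier N" for y using im that by (simp add: f_inv_into_f)
  show "?g \<in> mod_hom R N M"
  proof (rule mod_homI; unfold im[symmetric])
    fix x y assume "x \<in> f ` carrier M" "y \<in> f ` carrier M"
    then obtain a b where "x = f a" "y = f b" "a \<in> carrier M" "b \<in> carrier M" by auto
    then show "?g (x \<oplus>\<^bsub>N\<^esub> y) = ?g x \<oplus>\<^bsub>M\<^esub> ?g y"
      using 1[of "a \<oplus>\<^bsub>M\<^esub> b"] by (simp add: 1)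
  next
    fix r x assume "r \<in> carrier R" "x \<in> f ` carrier M"
    then obtain a where "x = f a" "a \<in> carrier M" "r \<in> carrier R" by auto
    then show "?g (r \<odot>\<^bsub>N\<^esub> x) = r \<odot>\<^bsub>M\<^esub> ?g x"
      using 1[of "r \<odot>\<^bsub>M\<^esub> a"] by (simp add: 1)
  qed (auto simp: inv_into_into)
qed

lemma mod_isoE:
  assumes "left_module R M" "left_module R N" "mod_iso R M N"
  obtains f g where "f \<in> mod_hom R M N" "g \<in> mod_hom R N M"
    "\<And>x. x \<in> carrier M \<Longrightarrow> g (f x) = x" "\<And>y. y \<in> carrier N \<Longrightarrow> f (g y) = y"
  using assms hom_inverse[OF assms(1,2)] unfolding mod_iso_def by metis

lemma mod_isoI:
  assumes "f \<in> mod_hom R M N" "g \<in> mod_hom R N M"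
    "\<And>x. x \<in> carrier M \<Longrightarrow> g (f x) = x" "\<And>y. y \<in> carrier N \<Longrightarrow> f (g y) = y"
  shows "mod_iso R M N"
  unfolding mod_iso_def using assms
  by (intro bexI[of _ f] bij_betw_byWitness[of _ g]) (auto dest: hom_in)

text \<open>Any preimage under \<open>p\<close> may be used to define the value, since two preimages
  differ by an element of the kernel of \<open>p\<close>, which \<open>f\<close> kills.\<close>

lemma factor_epi:
  assumes "left_module R Y" "left_module R Z" "left_module R W"
    and "p \<in> mod_hom R Y Z" "p ` carrier Y = carrier Z" "f \<in> mod_hom R Y W"
    and "\<And>y. y \<in> carrier Y \<Longrightarrow> p y = \<zero>\<^bsub>Z\<^esub> \<Longrightarrow> f y = \<zero>\<^bsub>W\<^esub>"
  obtains g where "g \<in> mod_hom R Z W" "\<And>y. y \<in> carrier Y \<Longrightarrow> g (p y) = f y"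
proof
  let ?g = "\<lambda>z. f (inv_into (carrier Y) p z)"
  note [simp] = mod_simps[OF assms(1)] mod_simps[OF assms(2)] mod_simps[OF assms(3)] hom_simps[OF assms(1,2,4)] hom_simps[OF assms(1,3,6)]
  show g: "?g (p y) = f y" if y: "y \<in> carrier Y" for y
  proof -
    let ?x = "inv_into (carrier Y) p (p y)"
    have x: "?x \<in> carrier Y" "p ?x = p y"
      using y by (auto intro: inv_into_into f_inv_into_f)
    then show ?thesis
      using assms(7)[of "?x \<oplus>\<^bsub>Y\<^esub> \<ominus>\<^bsub>Y\<^esub> y"] y by - (rule diff_zero_eq[OF assms(3)], simp_all)
  qed
  show "?g \<in> mod_hom R Z W"
  proof (rule mod_homI; unfold assms(5)[symmetric])
    fix x y assume "x \<in> p ` carrier Y" "y \<in> p ` carrier Y"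
    then obtain a b where "x = p a" "y = p b" "a \<in> carrier Y" "b \<in> carrier Y" by auto
    then show "?g (x \<oplus>\<^bsub>Z\<^esub> y) = ?g x \<oplus>\<^bsub>W\<^esub> ?g y"
      using g[of "a \<oplus>\<^bsub>Y\<^esub> b"] by (simp add: g)
  next
    fix r x assume "r \<in> carrier R" "x \<in> p ` carrier Y"
    then obtain a where "x = p a" "a \<in> carrier Y" "r \<in> carrier R" by auto
    then show "?g (r \<odot>\<^bsub>Z\<^esub> x) = r \<odot>\<^bsub>W\<^esub> ?g x"
      using g[of "r \<odot>\<^bsub>Y\<^esub> a"] by (simp add: g)
  qed (auto simp: g)
qed

lemma factor_mono:
  assumes "left_module R X" "left_module R Y" "left_module R W"
    and "i \<in> mod_hom R X Y" "inj_on i (carrier X)" "f \<in> mod_hom R W Y"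
    and "f ` carrier W \<subseteq> i ` carrier X"
  obtains g where "g \<in> mod_hom R W X" "\<And>w. w \<in> carrier W \<Longrightarrow> i (g w) = f w"
proof -
  let ?I = "Y\<lparr>carrier := i ` carrier X\<rparr>"
  have I: "left_module R ?I"
    by (rule left_module_submod[OF assms(2) submod_image[OF assms(1,2,4)]])
  have i: "i \<in> mod_hom R X ?I" using assms(4) by (rule hom_sub_cod) simp
  have b: "bij_betw i (carrier X) (carrier ?I)" using assms(5) by (simp add: bij_betw_def)
  obtain h where h: "h \<in> mod_hom R ?I X" "\<And>x. x \<in> carrier X \<Longrightarrow> h (i x) = x" "\<And>y. y \<in> carrier ?I \<Longrightarrow> i (h y) = y"
    using hom_inverse[OF assms(1) I i b] by blast
  show ?thesis
  proof (rule that)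
    show "(\<lambda>w. h (f w)) \<in> mod_hom R W X"
      using hom_comp[OF hom_sub_cod[OF assms(6,7)] h(1)] .
  qed (use h(3) assms(7) in auto)
qed

section \<open>Short exact sequences\<close>

definition ses ::
  "('r, 'x) ring_scheme \<Rightarrow> ('r, 'm) module \<Rightarrow> ('r, 'n) module \<Rightarrow> ('r, 'q) module \<Rightarrow> ('m \<Rightarrow> 'n) \<Rightarrow> ('n \<Rightarrow> 'q) \<Rightarrow> bool" where
  "ses R X Y Z i p \<longleftrightarrow> left_module R X \<and> left_module R Y \<and> left_module R Z \<and>
     i \<in> mod_hom R X Y \<and> p \<in> mod_hom R Y Z \<and> inj_on i (carrier X) \<and>
     i ` carrier X = {y \<in> carrier Y. p y = \<zero>\<^bsub>Z\<^esub>} \<and> p ` carrier Y = carrier Z"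

lemma sesD:
  assumes "ses R X Y Z i p"
  shows "left_module R X" "left_module R Y" "left_module R Z"
    "i \<in> mod_hom R X Y" "p \<in> mod_hom R Y Z" "inj_on i (carrier X)"
    "i ` carrier X = {y \<in> carrier Y. p y = \<zero>\<^bsub>Z\<^esub>}" "p ` carrier Y = carrier Z"
    "\<And>x. x \<in> carrier X \<Longrightarrow> p (i x) = \<zero>\<^bsub>Z\<^esub>"
  using assms by (auto simp: ses_def)

lemma ses_kernelE:
  assumes "ses R X Y Z i p" "y \<in> carrier Y" "p y = \<zero>\<^bsub>Z\<^esub>"
  obtains x where "x \<in> carrier X" "i x = y"
proof -
  have "y \<in> i ` carrier X" using assms(2,3) sesD(7)[OF assms(1)] by simp
  then show ?thesis by (auto intro: that)
qed

lemma ses_epiE: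
  assumes "ses R X Y Z i p" "z \<in> carrier Z"
  obtains y where "y \<in> carrier Y" "p y = z"
proof -
  have "z \<in> p ` carrier Y" using assms(2) sesD(8)[OF assms(1)] by simp
  then show ?thesis by (auto intro: that)
qed

lemma ses_inj:
  assumes "ses R X Y Z i p" "x \<in> carrier X" "i x = \<zero>\<^bsub>Y\<^esub>"
  shows "x = \<zero>\<^bsub>X\<^esub>"
proof -
  note D = sesD[OF assms(1)]
  have "i x = i \<zero>\<^bsub>X\<^esub>" using assms(3) hom_simps(4)[OF D(1,2,4)] by simp
  then show ?thesis using inj_onD[OF D(6)] assms(2) mod_simps(1)[OF D(1)] by blast
qed

text \<open>The universal property of a kernel; \<open>ses_desc\<close> below is the dual one of a
  cokernel.\<close>

lemma ses_lift:
  assumes "ses R X Y Z i p" "left_module R W" "f \<in> mod_hom R W Y"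
    "\<And>w. w \<in> carrier W \<Longrightarrow> p (f w) = \<zero>\<^bsub>Z\<^esub>"
  obtains g where "g \<in> mod_hom R W X" "\<And>w. w \<in> carrier W \<Longrightarrow> i (g w) = f w"
proof -
  note D = sesD[OF assms(1)]
  have "f ` carrier W \<subseteq> i ` carrier X" using hom_in[OF assms(3)] assms(4) D(7) by auto
  then show ?thesis using factor_mono[OF D(1,2) assms(2) D(4,6) assms(3)] that by blast
qed

lemma ses_desc:
  assumes "ses R X Y Z i p" "left_module R W" "f \<in> mod_hom R Y W"
    "\<And>x. x \<in> carrier X \<Longrightarrow> f (i x) = \<zero>\<^bsub>W\<^esub>"
  obtains g where "g \<in> mod_hom R Z W" "\<And>y. y \<in> carrier Y \<Longrightarrow> g (p y) = f y"
proof -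
  note D = sesD[OF assms(1)]
  have "f y = \<zero>\<^bsub>W\<^esub>" if "y \<in> carrier Y" "p y = \<zero>\<^bsub>Z\<^esub>" for y
    using ses_kernelE[OF assms(1) that] assms(4) by metis
  then show ?thesis using factor_epi[OF D(2,3) assms(2) D(5,8) assms(3)] that by blast
qed

lemma sesI:
  assumes "left_module R X" "left_module R Y" "left_module R Z"
    and "i \<in> mod_hom R X Y" "p \<in> mod_hom R Y Z"
    and "\<And>x. x \<in> carrier X \<Longrightarrow> i x = \<zero>\<^bsub>Y\<^esub> \<Longrightarrow> x = \<zero>\<^bsub>X\<^esub>"
    and "\<And>x. x \<in> carrier X \<Longrightarrow> p (i x) = \<zero>\<^bsub>Z\<^esub>"
    and "\<And>y. y \<in> carrier Y \<Longrightarrow> p y = \<zero>\<^bsub>Z\<^esub> \<Longrightarrow> \<exists>x\<in>carrier X. i x = y"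
    and "\<And>z. z \<in> carrier Z \<Longrightarrow> \<exists>y\<in>carrier Y. p y = z"
  shows "ses R X Y Z i p"
  unfolding ses_def using assms hom_inj[OF assms(1,2,4)] hom_in[OF assms(4)] hom_in[OF assms(5)]
  by (auto simp: image_iff) (metis+)?

lemma ses_kernel:
  assumes "left_module R Y" "left_module R Z" "p \<in> mod_hom R Y Z" "p ` carrier Y = carrier Z"
  shows "ses R (Y\<lparr>carrier := {y \<in> carrier Y. p y = \<zero>\<^bsub>Z\<^esub>}\<rparr>) Y Z (\<lambda>x. x) p"
  unfolding ses_def using assms left_module_submod[OF assms(1) submod_kernel[OF assms(1-3)]]
  by (auto simp: mod_hom_def)

text \<open>The quotient keeps the carrier type of \<open>Y\<close>: its elements are chosen
  representatives of the cosets instead of the cosets themselves. Hence quotients of modules in the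
  universe stay in the universe, on which the later constructions of cokernels rely.\<close>

lemma ses_quotient:
  fixes Y :: "('r, 'm) module"
  assumes "left_module R X" "left_module R Y" "i \<in> mod_hom R X Y" "inj_on i (carrier X)"
  obtains Z :: "('r, 'm) module" and p where "ses R X Y Z i p"
proof -
  interpret Y: left_module R Y by fact
  let ?S = "i ` carrier X"
  have S: "submod R Y ?S" by (rule submod_image[OF assms(1-3)])
  note SD = S[unfolded submod_def]
  have [simp]: "x \<in> ?S \<Longrightarrow> x \<in> carrier Y" for x using SD by auto
  note [simp] = mod_simps[OF assms(2)] submod_uminus[OF assms(2) S]
  define p where "p y = (SOME z. z \<in> carrier Y \<and> y \<oplus>\<^bsub>Y\<^esub> \<ominus>\<^bsub>Y\<^esub> z \<in> ?S)" for y
  have pp: "p y \<in> carrier Y \<and> y \<oplus>\<^bsub>Y\<^esub> \<ominus>\<^bsub>Y\<^esub> p y \<in> ?S" if "y \<in> carrier Y" for y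
    unfolding p_def by (rule someI[of _ y]) (use that SD in simp)
  then have p1: "p y \<in> carrier Y" and p2: "y \<oplus>\<^bsub>Y\<^esub> \<ominus>\<^bsub>Y\<^esub> p y \<in> ?S" if "y \<in> carrier Y" for y
    using that by auto
  \<comment> \<open>The predicate under the choice operator depends only on the coset, so congruent
    elements receive the same representative.\<close>
  have eqI: "p a = p b" if ab: "a \<in> carrier Y" "b \<in> carrier Y" "a \<oplus>\<^bsub>Y\<^esub> \<ominus>\<^bsub>Y\<^esub> b \<in> ?S" for a b
  proof -
    have "a \<oplus>\<^bsub>Y\<^esub> \<ominus>\<^bsub>Y\<^esub> z \<in> ?S \<longleftrightarrow> b \<oplus>\<^bsub>Y\<^esub> \<ominus>\<^bsub>Y\<^esub> z \<in> ?S" if z: "z \<in> carrier Y" for z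
    proof
      assume *: "a \<oplus>\<^bsub>Y\<^esub> \<ominus>\<^bsub>Y\<^esub> z \<in> ?S"
      have "\<ominus>\<^bsub>Y\<^esub> (a \<oplus>\<^bsub>Y\<^esub> \<ominus>\<^bsub>Y\<^esub> b) \<oplus>\<^bsub>Y\<^esub> (a \<oplus>\<^bsub>Y\<^esub> \<ominus>\<^bsub>Y\<^esub> z) \<in> ?S"
        using SD * submod_uminus[OF assms(2) S ab(3)] by blast
      also have "\<ominus>\<^bsub>Y\<^esub> (a \<oplus>\<^bsub>Y\<^esub> \<ominus>\<^bsub>Y\<^esub> b) \<oplus>\<^bsub>Y\<^esub> (a \<oplus>\<^bsub>Y\<^esub> \<ominus>\<^bsub>Y\<^esub> z) = b \<oplus>\<^bsub>Y\<^esub> \<ominus>\<^bsub>Y\<^esub> z"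
        using ab z by simp
      finally show "b \<oplus>\<^bsub>Y\<^esub> \<ominus>\<^bsub>Y\<^esub> z \<in> ?S" .
    next
      assume *: "b \<oplus>\<^bsub>Y\<^esub> \<ominus>\<^bsub>Y\<^esub> z \<in> ?S"
      have "(a \<oplus>\<^bsub>Y\<^esub> \<ominus>\<^bsub>Y\<^esub> b) \<oplus>\<^bsub>Y\<^esub> (b \<oplus>\<^bsub>Y\<^esub> \<ominus>\<^bsub>Y\<^esub> z) \<in> ?S"
        using SD * ab(3) by blast
      also have "(a \<oplus>\<^bsub>Y\<^esub> \<ominus>\<^bsub>Y\<^esub> b) \<oplus>\<^bsub>Y\<^esub> (b \<oplus>\<^bsub>Y\<^esub> \<ominus>\<^bsub>Y\<^esub> z) = a \<oplus>\<^bsub>Y\<^esub> \<ominus>\<^bsub>Y\<^esub> z"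
        using ab z by simp
      finally show "a \<oplus>\<^bsub>Y\<^esub> \<ominus>\<^bsub>Y\<^esub> z \<in> ?S" .
    qed
    then show ?thesis unfolding p_def by (intro arg_cong[where f = Eps] ext) auto
  qed
  have idem: "p (p y) = p y" if "y \<in> carrier Y" for y
    by (rule eqI[symmetric]) (use that p1 p2 in auto)
  define Z :: "('r, 'm) module" where
    "Z = \<lparr>carrier = p ` carrier Y, monoid.mult = undefined, monoid.one = undefined,
       ring.zero = p \<zero>\<^bsub>Y\<^esub>, ring.add = (\<lambda>x y. p (x \<oplus>\<^bsub>Y\<^esub> y)), smult = (\<lambda>r x. p (r \<odot>\<^bsub>Y\<^esub> x))\<rparr>"
  have add: "p (x \<oplus>\<^bsub>Y\<^esub> y) = p x \<oplus>\<^bsub>Z\<^esub> p y" if "x \<in> carrier Y" "y \<in> carrier Y" for x y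
  proof -
    have "(x \<oplus>\<^bsub>Y\<^esub> \<ominus>\<^bsub>Y\<^esub> p x) \<oplus>\<^bsub>Y\<^esub> (y \<oplus>\<^bsub>Y\<^esub> \<ominus>\<^bsub>Y\<^esub> p y) \<in> ?S"
      using SD p2[OF that(1)] p2[OF that(2)] by blast
    then show ?thesis unfolding Z_def using that p1 by (auto intro!: eqI)
  qed
  have sm: "p (r \<odot>\<^bsub>Y\<^esub> x) = r \<odot>\<^bsub>Z\<^esub> p x" if "x \<in> carrier Y" "r \<in> carrier R" for x r
  proof -
    have "r \<odot>\<^bsub>Y\<^esub> (x \<oplus>\<^bsub>Y\<^esub> \<ominus>\<^bsub>Y\<^esub> p x) \<in> ?S" using SD p2[OF that(1)] that(2) by blast
    then show ?thesis unfolding Z_def using that p1 by (auto intro!: eqI)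
  qed
  have Z: "left_module R Z"
    by (rule left_module_image[OF assms(2), of p]) (use add sm in \<open>auto simp: Z_def\<close>)
  have ph: "p \<in> mod_hom R Y Z" using add sm by (auto simp: mod_hom_def) (auto simp: Z_def)
  have "ses R X Y Z i p"
  proof -
    have "p y = \<zero>\<^bsub>Z\<^esub> \<longleftrightarrow> y \<in> ?S" if y: "y \<in> carrier Y" for y
    proof
      assume py: "p y = \<zero>\<^bsub>Z\<^esub>"
      then have py: "p y = p \<zero>\<^bsub>Y\<^esub>" by (simp add: Z_def)
      \<comment> \<open>If \<open>y\<close> and zero have the same representative, then both differ
        from it by elements of the image, and subtracting leaves \<open>y\<close>.\<close>
      then have "(y \<oplus>\<^bsub>Y\<^esub> \<ominus>\<^bsub>Y\<^esub> p \<zero>\<^bsub>Y\<^esub>) \<oplus>\<^bsub>Y\<^esub> \<ominus>\<^bsub>Y\<^esub> (\<zero>\<^bsub>Y\<^esub> \<oplus>\<^bsub>Y\<^esub> \<ominus>\<^bsub>Y\<^esub> p \<zero>\<^bsub>Y\<^esub>) \<in> ?S"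
        using SD p2[OF y] submod_uminus[OF assms(2) S p2[OF mod_simps(1)[OF assms(2)]]]
        unfolding py by blast
      then show "y \<in> ?S" using y p1[of "\<zero>\<^bsub>Y\<^esub>"] by simp
    next
      assume "y \<in> ?S"
      then have "p y = p \<zero>\<^bsub>Y\<^esub>" using y by (intro eqI) auto
      then show "p y = \<zero>\<^bsub>Z\<^esub>" by (simp add: Z_def)
    qed
    then show ?thesis unfolding ses_def using assms Z ph SD by (auto simp: Z_def)
  qed
  then show thesis by (rule that)
qed

subsection \<open>Finite generation\<close>

text \<open>Finite sums built one multiple at a time, with repetitions allowed. Inductions over this
  set replace manipulations of coefficient functions on a finite generating set.\<close>

inductive_set gen_span :: "('r, 'x) ring_scheme \<Rightarrow> ('r, 'm) module \<Rightarrow> 'm set \<Rightarrow> 'm set"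
  for R :: "('r, 'x) ring_scheme" and M :: "('r, 'm) module" and S :: "'m set" where
  zero: "\<zero>\<^bsub>M\<^esub> \<in> gen_span R M S"
| step: "x \<in> gen_span R M S \<Longrightarrow> r \<in> carrier R \<Longrightarrow> s \<in> S \<Longrightarrow> x \<oplus>\<^bsub>M\<^esub> r \<odot>\<^bsub>M\<^esub> s \<in> gen_span R M S"

lemma span_mono: "x \<in> gen_span R M S \<Longrightarrow> S \<subseteq> T \<Longrightarrow> x \<in> gen_span R M T"
  by (induction rule: gen_span.induct) (auto intro: gen_span.intros)

lemma span_in:
  assumes "left_module R M" "S \<subseteq> carrier M" "x \<in> gen_span R M S"
  shows "x \<in> carrier M"
  using assms(3) by induction (use assms(2) in \<open>auto simp: mod_simps[OF assms(1)]\<close>)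

lemma span_add:
  assumes "left_module R M" "S \<subseteq> carrier M" "x \<in> gen_span R M S" "y \<in> gen_span R M S"
  shows "x \<oplus>\<^bsub>M\<^esub> y \<in> gen_span R M S"
  using assms(4)
proof induction
  case zero
  then show ?case using assms span_in[OF assms(1-3)] by (simp add: mod_simps[OF assms(1)])
next
  case (step y r s)
  have "x \<oplus>\<^bsub>M\<^esub> (y \<oplus>\<^bsub>M\<^esub> r \<odot>\<^bsub>M\<^esub> s) = (x \<oplus>\<^bsub>M\<^esub> y) \<oplus>\<^bsub>M\<^esub> r \<odot>\<^bsub>M\<^esub> s"
    using step span_in[OF assms(1-3)] span_in[OF assms(1,2) step(1)] assms(2)
    by (subst mod_simps(16)[OF assms(1)]) (auto simp: mod_simps[OF assms(1)] subset_eq)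
  then show ?case using gen_span.step[OF step(4,2,3)] by simp
qed

lemma span_base:
  assumes "left_module R M" "S \<subseteq> carrier M" "s \<in> S"
  shows "s \<in> gen_span R M S"
proof -
  interpret left_module R M by fact
  have "\<zero>\<^bsub>M\<^esub> \<oplus>\<^bsub>M\<^esub> \<one>\<^bsub>R\<^esub> \<odot>\<^bsub>M\<^esub> s \<in> gen_span R M S"
    by (rule gen_span.step) (use assms in \<open>auto intro: gen_span.zero\<close>)
  then show ?thesis using assms(2,3) by (simp add: subset_eq)
qed

lemma fin_gen_iff_span:
  assumes "left_module R M"
  shows "fin_gen R M \<longleftrightarrow> (\<exists>S\<subseteq>carrier M. finite S \<and> carrier M \<subseteq> gen_span R M S)"
proof -
  interpret left_module R M by fact
  have 1: "(\<Oplus>\<^bsub>M\<^esub>s\<in>T. a s \<odot>\<^bsub>M\<^esub> s) \<in> gen_span R M S"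
    if "finite T" "T \<subseteq> S" "S \<subseteq> carrier M" "a \<in> S \<rightarrow> carrier R" for S T a
    using that
  proof induction
    case (insert t T)
    have "(\<Oplus>\<^bsub>M\<^esub>s\<in>insert t T. a s \<odot>\<^bsub>M\<^esub> s) = a t \<odot>\<^bsub>M\<^esub> t \<oplus>\<^bsub>M\<^esub> (\<Oplus>\<^bsub>M\<^esub>s\<in>T. a s \<odot>\<^bsub>M\<^esub> s)"
      using insert by (subst M.finsum_insert) auto
    moreover have "(\<Oplus>\<^bsub>M\<^esub>s\<in>T. a s \<odot>\<^bsub>M\<^esub> s) \<in> carrier M"
      using insert by (intro M.finsum_closed) auto
    ultimately have "(\<Oplus>\<^bsub>M\<^esub>s\<in>insert t T. a s \<odot>\<^bsub>M\<^esub> s) = (\<Oplus>\<^bsub>M\<^esub>s\<in>T. a s \<odot>\<^bsub>M\<^esub> s) \<oplus>\<^bsub>M\<^esub> a t \<odot>\<^bsub>M\<^esub> t"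
      using insert by (simp add: M.a_comm Pi_def subset_eq)
    then show ?case using insert by (auto intro!: gen_span.step)
  qed (simp add: gen_span.zero)
  have 2: "\<exists>a\<in>S \<rightarrow> carrier R. x = (\<Oplus>\<^bsub>M\<^esub>s\<in>S. a s \<odot>\<^bsub>M\<^esub> s)"
    if "x \<in> gen_span R M S" "S \<subseteq> carrier M" "finite S" for S x
    using that(1)
  proof induction
    case zero
    have "(\<Oplus>\<^bsub>M\<^esub>s\<in>S. \<zero>\<^bsub>R\<^esub> \<odot>\<^bsub>M\<^esub> s) = \<zero>\<^bsub>M\<^esub>"
    proof (rule M.add.finprod_one_eqI)
      fix s assume "s \<in> S"
      then have s: "s \<in> carrier M" using that by auto
      have "\<zero>\<^bsub>R\<^esub> \<odot>\<^bsub>M\<^esub> s \<oplus>\<^bsub>M\<^esub> \<zero>\<^bsub>R\<^esub> \<odot>\<^bsub>M\<^esub> s = \<zero>\<^bsub>R\<^esub> \<odot>\<^bsub>M\<^esub> s"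
        using s smult_l_distr[of "\<zero>\<^bsub>R\<^esub>" "\<zero>\<^bsub>R\<^esub>" s] by simp
      then show "\<zero>\<^bsub>R\<^esub> \<odot>\<^bsub>M\<^esub> s = \<zero>\<^bsub>M\<^esub>" using s by (simp add: M.add.l_cancel_one')
    qed
    then show ?case by (intro bexI[of _ "\<lambda>_. \<zero>\<^bsub>R\<^esub>"]) auto
  next
    case (step x r t)
    then obtain a where a: "a \<in> S \<rightarrow> carrier R" "x = (\<Oplus>\<^bsub>M\<^esub>s\<in>S. a s \<odot>\<^bsub>M\<^esub> s)" by blast
    \<comment> \<open>The generator already occurs in the sum, so the new multiple is absorbed into
      its coefficient.\<close>
    let ?b = "a(t := a t \<oplus>\<^bsub>R\<^esub> r)"
    have b: "?b \<in> S \<rightarrow> carrier R" using a(1) step(2) by (auto simp: Pi_def)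
    have S: "S = insert t (S - {t})" "finite (S - {t})" "t \<notin> S - {t}" using step that by auto
    have sc: "s \<in> carrier M" "a s \<in> carrier R" "?b s \<in> carrier R" if "s \<in> S" for s
      using that a(1) funcset_mem[OF b that] \<open>S \<subseteq> _\<close> by (auto simp: Pi_def)
    let ?T = "\<Oplus>\<^bsub>M\<^esub>s\<in>S-{t}. a s \<odot>\<^bsub>M\<^esub> s"
    have T: "?T \<in> carrier M" using sc by (intro M.finsum_closed) auto
    have "x = a t \<odot>\<^bsub>M\<^esub> t \<oplus>\<^bsub>M\<^esub> ?T"
      unfolding a(2) by (subst S(1), subst M.finsum_insert) (use S sc step in auto)
    moreover have "(\<Oplus>\<^bsub>M\<^esub>s\<in>S. ?b s \<odot>\<^bsub>M\<^esub> s) = ?b t \<odot>\<^bsub>M\<^esub> t \<oplus>\<^bsub>M\<^esub> (\<Oplus>\<^bsub>M\<^esub>s\<in>S-{t}. ?b s \<odot>\<^bsub>M\<^esub> s)"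
      by (subst S(1), subst M.finsum_insert) (use S sc step in auto)
    moreover have "(\<Oplus>\<^bsub>M\<^esub>s\<in>S-{t}. ?b s \<odot>\<^bsub>M\<^esub> s) = ?T"
      by (rule M.finsum_cong') (use sc in auto)
    ultimately have "x \<oplus>\<^bsub>M\<^esub> r \<odot>\<^bsub>M\<^esub> t = (\<Oplus>\<^bsub>M\<^esub>s\<in>S. ?b s \<odot>\<^bsub>M\<^esub> s)"
      using T sc step by (simp add: smult_l_distr M.a_ac)
    then show ?case using b by blast
  qed
  show ?thesis
  proof
    assume "fin_gen R M"
    then obtain S where S: "S \<subseteq> carrier M" "finite S"
      "\<And>x. x \<in> carrier M \<Longrightarrow> \<exists>a\<in>S \<rightarrow> carrier R. x = (\<Oplus>\<^bsub>M\<^esub>s\<in>S. a s \<odot>\<^bsub>M\<^esub> s)"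
      unfolding fin_gen_def by blast
    have "carrier M \<subseteq> gen_span R M S" using S(3) 1[OF S(2) order_refl S(1)] by fastforce
    then show "\<exists>S\<subseteq>carrier M. finite S \<and> carrier M \<subseteq> gen_span R M S" using S(1,2) by blast
  next
    assume "\<exists>S\<subseteq>carrier M. finite S \<and> carrier M \<subseteq> gen_span R M S"
    then obtain S where S: "S \<subseteq> carrier M" "finite S" "carrier M \<subseteq> gen_span R M S" by blast
    then show "fin_gen R M" unfolding fin_gen_def using 2[OF _ S(1,2)] by (intro exI[of _ S]) auto
  qed
qed

lemma span_hom:
  assumes "left_module R M" "left_module R N" "f \<in> mod_hom R M N" "S \<subseteq> carrier M" "x \<in> gen_span R M S"
  shows "f x \<in> gen_span R N (f ` S)"
  using assms(5)
proof induction
  case (step x r s)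
  then show ?case using span_in[OF assms(1,4) step(1)] assms(4) mod_simps(4)[OF assms(1)]
    by (auto simp: hom_simps(2,3)[OF assms(1-3)] subset_eq intro!: gen_span.step)
qed (simp add: hom_simps[OF assms(1-3)] gen_span.zero)

lemma fin_gen_image:
  assumes "left_module R M" "left_module R N" "f \<in> mod_hom R M N" "f ` carrier M = carrier N" "fin_gen R M"
  shows "fin_gen R N"
proof -
  obtain S where S: "S \<subseteq> carrier M" "finite S" "carrier M \<subseteq> gen_span R M S"
    using assms(5) unfolding fin_gen_iff_span[OF assms(1)] by blast
  have "carrier N \<subseteq> gen_span R N (f ` S)"
    unfolding assms(4)[symmetric] using span_hom[OF assms(1-3) S(1)] S(3) by blast
  moreover have "f ` S \<subseteq> carrier N" using S(1) assms(4) by blast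
  ultimately show ?thesis
    unfolding fin_gen_iff_span[OF assms(2)] using S(2) by blast
qed

text \<open>Take the images of generators of the kernel together with lifts of generators of the
  quotient: after subtracting a combination of the lifts, the remainder of an element of
  \<open>Y\<close> lies in the kernel.\<close>

lemma fin_gen_extension:
  assumes "ses R X Y Z i p" "fin_gen R X" "fin_gen R Z"
  shows "fin_gen R Y"
proof -
  note D = sesD[OF assms(1)]
  obtain S where S: "S \<subseteq> carrier X" "finite S" "carrier X \<subseteq> gen_span R X S"
    using assms(2) unfolding fin_gen_iff_span[OF D(1)] by blast
  obtain T where T: "T \<subseteq> carrier Z" "finite T" "carrier Z \<subseteq> gen_span R Z T"
    using assms(3) unfolding fin_gen_iff_span[OF D(3)] by blast
  define l where "l z = (SOME y. y \<in> carrier Y \<and> p y = z)" for z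
  have l: "l z \<in> carrier Y \<and> p (l z) = z" if "z \<in> carrier Z" for z
    unfolding l_def by (rule someI_ex) (use ses_epiE[OF assms(1) that] in blast)
  let ?U = "i ` S \<union> l ` T"
  have U: "?U \<subseteq> carrier Y" using S(1) T(1) l hom_in[OF D(4)] by blast
  note [simp] = mod_simps[OF D(1)] mod_simps[OF D(2)] hom_simps[OF D(2,3,5)] mod_simps[OF D(3)]
  have lift: "\<exists>y\<in>gen_span R Y ?U. p y = z" if "z \<in> gen_span R Z T" for z
    using that
  proof induction
    case zero
    then show ?case using gen_span.zero[of Y R ?U] hom_simps(4)[OF D(2,3,5)] by blast
  next
    case (step z r t)
    then obtain y where y: "y \<in> gen_span R Y ?U" "p y = z" by blast
    then have "y \<in> carrier Y" using span_in[OF D(2) U] by blast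
    moreover have "l t \<in> carrier Y" "p (l t) = t" using l T(1) step(3) by blast+
    ultimately have "p (y \<oplus>\<^bsub>Y\<^esub> r \<odot>\<^bsub>Y\<^esub> l t) = z \<oplus>\<^bsub>Z\<^esub> r \<odot>\<^bsub>Z\<^esub> t"
      using y step(2) by (simp only: hom_simps[OF D(2,3,5)] mod_simps(4)[OF D(2)])
    moreover have "y \<oplus>\<^bsub>Y\<^esub> r \<odot>\<^bsub>Y\<^esub> l t \<in> gen_span R Y ?U"
      using y(1) step by (intro gen_span.step) auto
    ultimately show ?case by blast
  qed
  have "y \<in> gen_span R Y ?U" if y: "y \<in> carrier Y" for y
  proof -
    obtain y' where y': "y' \<in> gen_span R Y ?U" "p y' = p y" using lift[of "p y"] T(3) hom_in[OF D(5) y] by blast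
    then have y'c: "y' \<in> carrier Y" using span_in[OF D(2) U] by blast
    have py: "p (y \<oplus>\<^bsub>Y\<^esub> \<ominus>\<^bsub>Y\<^esub> y') = \<zero>\<^bsub>Z\<^esub>" using y y'c y'(2) by simp
    then obtain x where x: "x \<in> carrier X" "i x = y \<oplus>\<^bsub>Y\<^esub> \<ominus>\<^bsub>Y\<^esub> y'"
      using ses_kernelE[OF assms(1) _ py] y y'c by auto
    have "i x \<in> gen_span R Y ?U"
      using span_mono[OF span_hom[OF D(1,2,4) S(1)] Un_upper1] S(3) x(1) by blast
    then have "i x \<oplus>\<^bsub>Y\<^esub> y' \<in> gen_span R Y ?U" using span_add[OF D(2) U] y' by blast
    moreover have "i x \<oplus>\<^bsub>Y\<^esub> y' = y" unfolding x(2) using y y'c by simp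
    ultimately show ?thesis by simp
  qed
  then show ?thesis unfolding fin_gen_iff_span[OF D(2)] using U S(2) T(2) by (intro exI[of _ ?U]) auto
qed

lemma fin_gen_zero:
  assumes "left_module R M" "carrier M = {\<zero>\<^bsub>M\<^esub>}"
  shows "fin_gen R M"
  unfolding fin_gen_iff_span[OF assms(1)] by (intro exI[of _ "{}"]) (auto simp: assms(2) intro: gen_span.zero)

subsection \<open>Products\<close>

definition prod_module :: "('r, 'm) module \<Rightarrow> ('r, 'n) module \<Rightarrow> ('r, 'm \<times> 'n) module" where
  "prod_module X Y =
     \<lparr>carrier = carrier X \<times> carrier Y, monoid.mult = undefined, monoid.one = undefined,
      ring.zero = (\<zero>\<^bsub>X\<^esub>, \<zero>\<^bsub>Y\<^esub>), ring.add = (\<lambda>a b. (fst a \<oplus>\<^bsub>X\<^esub> fst b, snd a \<oplus>\<^bsub>Y\<^esub> snd b)),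
      smult = (\<lambda>r a. (r \<odot>\<^bsub>X\<^esub> fst a, r \<odot>\<^bsub>Y\<^esub> snd a))\<rparr>"

lemma prod_module_sel [simp]:
  "carrier (prod_module X Y) = carrier X \<times> carrier Y"
  "\<zero>\<^bsub>prod_module X Y\<^esub> = (\<zero>\<^bsub>X\<^esub>, \<zero>\<^bsub>Y\<^esub>)"
  "a \<oplus>\<^bsub>prod_module X Y\<^esub> b = (fst a \<oplus>\<^bsub>X\<^esub> fst b, snd a \<oplus>\<^bsub>Y\<^esub> snd b)"
  "r \<odot>\<^bsub>prod_module X Y\<^esub> a = (r \<odot>\<^bsub>X\<^esub> fst a, r \<odot>\<^bsub>Y\<^esub> snd a)"
  by (simp_all add: prod_module_def)

lemma left_module_prod:
  assumes "left_module R X" "left_module R Y"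
  shows "left_module R (prod_module X Y)"
proof -
  interpret X: left_module R X by fact
  interpret Y: left_module R Y by fact
  have "abelian_group (prod_module X Y)"
  proof (rule abelian_groupI)
    fix x assume "x \<in> carrier (prod_module X Y)"
    then show "\<exists>y\<in>carrier (prod_module X Y). y \<oplus>\<^bsub>prod_module X Y\<^esub> x = \<zero>\<^bsub>prod_module X Y\<^esub>"
      by (intro bexI[of _ "(\<ominus>\<^bsub>X\<^esub> fst x, \<ominus>\<^bsub>Y\<^esub> snd x)"]) (auto simp: X.M.l_neg Y.M.l_neg)
  qed (auto simp: X.M.a_ac Y.M.a_ac)
  then show ?thesis
    by (intro left_module_axiomsI X.R.ring_axioms)
       (auto simp: X.smult_l_distr X.smult_r_distr X.smult_assoc Y.smult_l_distr Y.smult_r_distr Y.smult_assoc)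
qed

lemma ses_prod:
  assumes "left_module R X" "left_module R Y"
  shows "ses R X (prod_module X Y) Y (\<lambda>x. (x, \<zero>\<^bsub>Y\<^esub>)) snd"
proof (rule sesI)
  show "\<exists>y\<in>carrier (prod_module X Y). snd y = z" if "z \<in> carrier Y" for z
    using that mod_simps(1)[OF assms(1)] by (intro bexI[of _ "(\<zero>\<^bsub>X\<^esub>, z)"]) auto
qed (auto simp: assms left_module_prod mod_simps[OF assms(1)] mod_simps[OF assms(2)] intro!: mod_homI)

text \<open>Described by its four structure maps instead of by pairs, so that an isomorphic copy of
  the product in the universe is a biproduct as well.\<close>

definition biprod ::
  "('r, 'x) ring_scheme \<Rightarrow> ('r, 'm) module \<Rightarrow> ('r, 'n) module \<Rightarrow> ('r, 'd) module \<Rightarrow>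
   ('m \<Rightarrow> 'd) \<Rightarrow> ('n \<Rightarrow> 'd) \<Rightarrow> ('d \<Rightarrow> 'm) \<Rightarrow> ('d \<Rightarrow> 'n) \<Rightarrow> bool" where
  "biprod R X Y D i j p q \<longleftrightarrow>
     left_module R X \<and> left_module R Y \<and> left_module R D \<and>
     i \<in> mod_hom R X D \<and> j \<in> mod_hom R Y D \<and> p \<in> mod_hom R D X \<and> q \<in> mod_hom R D Y \<and>
     (\<forall>x\<in>carrier X. p (i x) = x \<and> q (i x) = \<zero>\<^bsub>Y\<^esub>) \<and>
     (\<forall>y\<in>carrier Y. p (j y) = \<zero>\<^bsub>X\<^esub> \<and> q (j y) = y) \<and>
     (\<forall>d\<in>carrier D. i (p d) \<oplus>\<^bsub>D\<^esub> j (q d) = d)"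

lemma biprodD:
  assumes "biprod R X Y D i j p q"
  shows "left_module R X" "left_module R Y" "left_module R D"
    "i \<in> mod_hom R X D" "j \<in> mod_hom R Y D" "p \<in> mod_hom R D X" "q \<in> mod_hom R D Y"
    "\<And>x. x \<in> carrier X \<Longrightarrow> p (i x) = x" "\<And>x. x \<in> carrier X \<Longrightarrow> q (i x) = \<zero>\<^bsub>Y\<^esub>"
    "\<And>y. y \<in> carrier Y \<Longrightarrow> p (j y) = \<zero>\<^bsub>X\<^esub>" "\<And>y. y \<in> carrier Y \<Longrightarrow> q (j y) = y"
    "\<And>d. d \<in> carrier D \<Longrightarrow> i (p d) \<oplus>\<^bsub>D\<^esub> j (q d) = d"
  using assms by (auto simp: biprod_def)

lemma biprod_pair:
  assumes "biprod R X Y D i j p q" "left_module R W" "f \<in> mod_hom R W X" "g \<in> mod_hom R W Y"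
  obtains h where "h \<in> mod_hom R W D" "\<And>w. w \<in> carrier W \<Longrightarrow> p (h w) = f w" "\<And>w. w \<in> carrier W \<Longrightarrow> q (h w) = g w"
proof
  note D = biprodD[OF assms(1)]
  show "(\<lambda>w. i (f w) \<oplus>\<^bsub>D\<^esub> j (g w)) \<in> mod_hom R W D"
    by (rule hom_add[OF assms(2) D(3) hom_comp[OF assms(3) D(4)] hom_comp[OF assms(4) D(5)]])
  fix w assume "w \<in> carrier W"
  then have w: "f w \<in> carrier X" "g w \<in> carrier Y" using hom_in[OF assms(3)] hom_in[OF assms(4)] by auto
  then show "p (i (f w) \<oplus>\<^bsub>D\<^esub> j (g w)) = f w" "q (i (f w) \<oplus>\<^bsub>D\<^esub> j (g w)) = g w"
    by (simp_all add: D(8-11) hom_simps[OF D(3,1,6)] hom_simps[OF D(3,2,7)] hom_simps(1)[OF D(1,3,4)]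
        hom_simps(1)[OF D(2,3,5)] mod_simps(5,6)[OF D(1)] mod_simps(5,6)[OF D(2)])
qed

lemma biprod_elem:
  assumes "biprod R X Y D i j p q" "x \<in> carrier X" "y \<in> carrier Y"
  obtains d where "d \<in> carrier D" "p d = x" "q d = y"
proof
  note D = biprodD[OF assms(1)]
  show "i x \<oplus>\<^bsub>D\<^esub> j y \<in> carrier D" "p (i x \<oplus>\<^bsub>D\<^esub> j y) = x" "q (i x \<oplus>\<^bsub>D\<^esub> j y) = y"
    using assms(2,3)
    by (simp_all add: D(8-11) hom_simps[OF D(3,1,6)] hom_simps[OF D(3,2,7)] hom_simps(1)[OF D(1,3,4)]
        hom_simps(1)[OF D(2,3,5)] mod_simps(5,6)[OF D(1)] mod_simps(5,6)[OF D(2)] mod_simps(2)[OF D(3)])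
qed

lemma biprod_copair:
  assumes "biprod R X Y D i j p q" "left_module R W" "f \<in> mod_hom R X W" "g \<in> mod_hom R Y W"
  shows "(\<lambda>d. f (p d) \<oplus>\<^bsub>W\<^esub> g (q d)) \<in> mod_hom R D W"
proof -
  note D = biprodD[OF assms(1)]
  show ?thesis by (rule hom_add[OF D(3) assms(2) hom_comp[OF D(6) assms(3)] hom_comp[OF D(7) assms(4)]])
qed

lemma biprod_ses:
  assumes "biprod R X Y D i j p q"
  shows "ses R X D Y i q"
proof -
  note D = biprodD[OF assms]
  show ?thesis
  proof (rule sesI[OF D(1,3,2,4,7)])
    show "x = \<zero>\<^bsub>X\<^esub>" if "x \<in> carrier X" "i x = \<zero>\<^bsub>D\<^esub>" for x
      using D(8)[OF that(1)] that(2) hom_simps(4)[OF D(3,1,6)] by simp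
    show "\<exists>x\<in>carrier X. i x = d" if "d \<in> carrier D" "q d = \<zero>\<^bsub>Y\<^esub>" for d
      using D(12)[OF that(1)] that hom_simps(4)[OF D(2,3,5)] hom_in[OF D(6)] hom_in[OF D(4)] mod_simps(6)[OF D(3)]
      by (intro bexI[of _ "p d"]) auto
    show "\<exists>d\<in>carrier D. q d = y" if "y \<in> carrier Y" for y
      using D(11)[OF that] hom_in[OF D(5) that] by blast
  qed (rule D(9))
qed

text \<open>The product of pairs leaves the universe; it is finitely generated, hence has a copy
  there, and the structure maps are transported along the isomorphism.\<close>

lemma biprod_exists:
  fixes X Y :: "'r umodule"
  assumes "left_module R X" "left_module R Y" "fin_gen R X" "fin_gen R Y"
  obtains D :: "'r umodule" and i j p q where "biprod R X Y D i j p q" "fin_gen R D"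
proof -
  let ?P = "prod_module X Y"
  have P: "left_module R ?P" by (rule left_module_prod[OF assms(1,2)])
  have "fin_gen R ?P" by (rule fin_gen_extension[OF ses_prod[OF assms(1,2)] assms(3,4)])
  then obtain D :: "'r umodule" where D: "left_module R D" "fin_gen R D" "mod_iso R ?P D"
    using fin_gen_iso_universe[OF P] by blast
  obtain f g where f: "f \<in> mod_hom R ?P D" and g: "g \<in> mod_hom R D ?P"
    and gf: "\<And>x. x \<in> carrier ?P \<Longrightarrow> g (f x) = x" and fg: "\<And>y. y \<in> carrier D \<Longrightarrow> f (g y) = y"
    using mod_isoE[OF P D(1,3)] by blast
  have h: "(\<lambda>x. (x, \<zero>\<^bsub>Y\<^esub>)) \<in> mod_hom R X ?P" "(\<lambda>y. (\<zero>\<^bsub>X\<^esub>, y)) \<in> mod_hom R Y ?P"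
    "fst \<in> mod_hom R ?P X" "snd \<in> mod_hom R ?P Y"
    by (auto intro!: mod_homI simp: mod_simps(1,5,20)[OF assms(1)] mod_simps(1,5,20)[OF assms(2)])
  have "biprod R X Y D (\<lambda>x. f (x, \<zero>\<^bsub>Y\<^esub>)) (\<lambda>y. f (\<zero>\<^bsub>X\<^esub>, y)) (\<lambda>d. fst (g d)) (\<lambda>d. snd (g d))"
    unfolding biprod_def
  proof (intro conjI ballI)
    show "f (fst (g d), \<zero>\<^bsub>Y\<^esub>) \<oplus>\<^bsub>D\<^esub> f (\<zero>\<^bsub>X\<^esub>, snd (g d)) = d" if "d \<in> carrier D" for d
    proof -
      have gd: "fst (g d) \<in> carrier X" "snd (g d) \<in> carrier Y" using hom_in[OF g that] by auto
      have "f (fst (g d), \<zero>\<^bsub>Y\<^esub>) \<oplus>\<^bsub>D\<^esub> f (\<zero>\<^bsub>X\<^esub>, snd (g d)) = f ((fst (g d), \<zero>\<^bsub>Y\<^esub>) \<oplus>\<^bsub>?P\<^esub> (\<zero>\<^bsub>X\<^esub>, snd (g d)))"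
        using gd mod_simps(1)[OF assms(1)] mod_simps(1)[OF assms(2)]
        by (intro hom_simps(2)[OF P D(1) f, symmetric]) simp_all
      also have "\<dots> = f (g d)"
        using gd by (simp add: mod_simps(5,6)[OF assms(1)] mod_simps(5,6)[OF assms(2)])
      finally show ?thesis using fg[OF that] by simp
    qed
  qed (use assms(1,2) D(1) gf mod_simps(1)[OF assms(1)] mod_simps(1)[OF assms(2)] in
      \<open>simp_all add: hom_comp[OF h(1) f] hom_comp[OF h(2) f] hom_comp[OF g h(3)] hom_comp[OF g h(4)]\<close>)
  then show ?thesis using D(2) that by blast
qed

subsection \<open>Homomorphisms that are sums of composites through given modules\<close>

text \<open>With \<open>X\<close> = \<open>Y\<close> and \<open>h\<close> the identity this says
  that \<open>X\<close> is a direct summand of a finite direct sum of members of \<open>Zs\<close>;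
  the partial sums are what inductions run over. Equations are demanded on the carrier only, because
  functions are total in HOL.\<close>

inductive through ::
  "('r, 'x) ring_scheme \<Rightarrow> ('r, 'z) module set \<Rightarrow> ('r, 'm) module \<Rightarrow> ('r, 'n) module \<Rightarrow> ('m \<Rightarrow> 'n) \<Rightarrow> bool"
  for R :: "('r, 'x) ring_scheme" and Zs :: "('r, 'z) module set" and X :: "('r, 'm) module" and Y :: "('r, 'n) module"
  where
  zero: "(\<And>x. x \<in> carrier X \<Longrightarrow> h x = \<zero>\<^bsub>Y\<^esub>) \<Longrightarrow> through R Zs X Y h"
| step: "through R Zs X Y h \<Longrightarrow> Z \<in> Zs \<Longrightarrow> f \<in> mod_hom R X Z \<Longrightarrow> g \<in> mod_hom R Z Y \<Longrightarrow>
    (\<And>x. x \<in> carrier X \<Longrightarrow> h' x = h x \<oplus>\<^bsub>Y\<^esub> g (f x)) \<Longrightarrow> through R Zs X Y h'"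

lemma through_cong: "through R Zs X Y h \<Longrightarrow> (\<And>x. x \<in> carrier X \<Longrightarrow> h x = h' x) \<Longrightarrow> through R Zs X Y h'"
  by (induction arbitrary: h' rule: through.induct) (auto intro: through.zero through.step)

lemma through_in:
  assumes "through R Zs X Y h" "left_module R Y" "x \<in> carrier X"
  shows "h x \<in> carrier Y"
  using assms(1)
proof induction
  case (step h Z f g h')
  then show ?case using assms(3) hom_in[OF step(4) hom_in[OF step(3)]] by (simp add: mod_simps(2)[OF assms(2)])
qed (simp add: assms(3) mod_simps(1)[OF assms(2)])

lemma through_hom:
  assumes "through R Zs X Y h" "left_module R X" "left_module R Y"
  shows "h \<in> mod_hom R X Y"
  using assms(1)
proof induction
  case (zero h)
  then show ?case using hom_cong[OF hom_zero[OF assms(3)] assms(2)] by metis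
next
  case (step h Z f g h')
  then show ?case using hom_cong[OF hom_add[OF assms(2,3) step.IH hom_comp[OF step(3,4)]] assms(2)] by metis
qed

lemma through_add:
  assumes "through R Zs X Y h" "through R Zs X Y k" "left_module R Y"
  shows "through R Zs X Y (\<lambda>x. h x \<oplus>\<^bsub>Y\<^esub> k x)"
  using assms(2)
proof induction
  case (zero k)
  then show ?case
    by (intro through_cong[OF assms(1)]) (auto simp: mod_simps(6)[OF assms(3)] through_in[OF assms(1,3)])
next
  case (step k Z f g k')
  show ?case
  proof (rule through.step[OF step(6,2,3,4)])
    fix x assume "x \<in> carrier X"
    then show "h x \<oplus>\<^bsub>Y\<^esub> k' x = h x \<oplus>\<^bsub>Y\<^esub> k x \<oplus>\<^bsub>Y\<^esub> g (f x)"
      using step(5) through_in[OF assms(1,3)] through_in[OF step(1) assms(3)] hom_in[OF step(4) hom_in[OF step(3)]]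
      by (simp add: mod_simps(16)[OF assms(3)])
  qed
qed

lemma through_comp:
  assumes "through R Zs X Y h" "left_module R Y" "left_module R V" "k \<in> mod_hom R W X" "l \<in> mod_hom R Y V"
  shows "through R Zs W V (\<lambda>w. l (h (k w)))"
  using assms(1)
proof induction
  case (zero h)
  then show ?case using hom_in[OF assms(4)] by (auto intro!: through.zero simp: hom_simps(4)[OF assms(2,3,5)])
next
  case (step h Z f g h')
  show ?case
    by (rule through.step[OF step(6,2) hom_comp[OF assms(4) step(3)] hom_comp[OF step(4) assms(5)]])
      (use step hom_in[OF assms(4)] in \<open>simp add: hom_simps(2)[OF assms(2,3,5)] through_in[OF step(1) assms(2)] hom_in[OF step(4) hom_in[OF step(3)]]\<close>)
qed

lemma through_single:
  assumes "Z \<in> Zs" "f \<in> mod_hom R X Z" "g \<in> mod_hom R Z Y" "left_module R Y"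
  shows "through R Zs X Y (\<lambda>x. g (f x))"
  by (rule through.step[OF through.zero[of X "\<lambda>_. \<zero>\<^bsub>Y\<^esub>"] assms(1-3)])
     (simp_all add: mod_simps(5)[OF assms(4)] hom_in[OF assms(3) hom_in[OF assms(2)]])

text \<open>Each composite through a member \<open>Z\<close> is refined by inserting the
  decomposition of the identity of \<open>Z\<close> between its two factors.\<close>

lemma through_trans:
  assumes "through R Zs X Y h" "left_module R Y"
    and "\<And>Z. Z \<in> Zs \<Longrightarrow> left_module R Z \<and> through R Ws Z Z (\<lambda>z. z)"
  shows "through R Ws X Y h"
  using assms(1)
proof induction
  case (step h Z f g h')
  have "through R Ws X Y (\<lambda>x. g (f x))"
    using through_comp[OF _ _ assms(2) step(3,4)] assms(3)[OF step(2)] by blast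
  then show ?case using through_cong[OF through_add[OF step(6) _ assms(2)]] step(5) by metis
qed (rule through.zero)

text \<open>A composite through \<open>Z\<close> maps into the span of the images of finitely many
  generators of \<open>Z\<close>. The induction is over arbitrary sums, as the partial sums of an
  identity are not identities.\<close>

lemma through_fin_gen:
  assumes "through R Zs X X (\<lambda>x. x)" "left_module R X" "\<And>Z. Z \<in> Zs \<Longrightarrow> left_module R Z \<and> fin_gen R Z"
  shows "fin_gen R X"
proof -
  have "\<exists>S\<subseteq>carrier X. finite S \<and> h ` carrier X \<subseteq> gen_span R X S" if "through R Zs X X h" for h
    using that
  proof induction
    case (zero h)
    then have "h ` carrier X \<subseteq> gen_span R X {}" using gen_span.zero[of X R "{}"] by auto
    then show ?case by blast
  next
    case (step h Z f g h')
    have Z: "left_module R Z" "fin_gen R Z" using assms(3)[OF step(2)] by auto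
    obtain T where T: "T \<subseteq> carrier Z" "finite T" "carrier Z \<subseteq> gen_span R Z T"
      using Z(2) unfolding fin_gen_iff_span[OF Z(1)] by blast
    obtain S where S: "S \<subseteq> carrier X" "finite S" "h ` carrier X \<subseteq> gen_span R X S" using step(6) by blast
    have U: "S \<union> g ` T \<subseteq> carrier X" using S(1) T(1) hom_in[OF step(4)] by blast
    have "h' x \<in> gen_span R X (S \<union> g ` T)" if x: "x \<in> carrier X" for x
      unfolding step(5)[OF x]
    proof (rule span_add[OF assms(2) U])
      show "h x \<in> gen_span R X (S \<union> g ` T)" by (rule span_mono[OF _ Un_upper1]) (use S(3) x in auto)
      show "g (f x) \<in> gen_span R X (S \<union> g ` T)"
        by (rule span_mono[OF span_hom[OF Z(1) assms(2) step(4) T(1)] Un_upper2])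
          (use T(3) hom_in[OF step(3) x] in auto)
    qed
    then have "h' ` carrier X \<subseteq> gen_span R X (S \<union> g ` T)" by blast
    moreover have "finite (S \<union> g ` T)" using S(2) T(2) by simp
    ultimately show ?case using U by blast
  qed
  from this[OF assms(1)] show ?thesis unfolding fin_gen_iff_span[OF assms(2)] by simp
qed

section \<open>Projective modules\<close>

lemma projective_module: "projective R P \<Longrightarrow> left_module R P"
  by (simp add: projective_def)

lemma projective_lift:
  fixes L N :: "'r umodule" and P :: "('r, 'm) module"
  assumes "projective R P" "left_module R L" "left_module R N" "g \<in> mod_hom R L N" "g ` carrier L = carrier N"
    "f \<in> mod_hom R P N"
  obtains h where "h \<in> mod_hom R P L" "\<And>x. x \<in> carrier P \<Longrightarrow> g (h x) = f x"
proof -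
  have "\<exists>h\<in>mod_hom R P L. \<forall>x\<in>carrier P. g (h x) = f x"
    using assms unfolding projective_def by blast
  then show ?thesis using that by blast
qed

lemma projective_lift_ses:
  fixes K L N :: "'r umodule" and P :: "('r, 'm) module"
  assumes "projective R P" "ses R K L N i g" "f \<in> mod_hom R P N"
  obtains h where "h \<in> mod_hom R P L" "\<And>x. x \<in> carrier P \<Longrightarrow> g (h x) = f x"
  using projective_lift[OF assms(1) sesD(2,3,5,8)[OF assms(2)] assms(3)] by blast

lemma projective_retract:
  fixes P :: "('r, 'm) module" and Q :: "('r, 'n) module"
  assumes "projective R P" "left_module R Q" "s \<in> mod_hom R Q P" "r \<in> mod_hom R P Q"
    "\<And>x. x \<in> carrier Q \<Longrightarrow> r (s x) = x"
  shows "projective R Q"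
  unfolding projective_def
proof (intro conjI allI ballI impI)
  fix L N :: "'r umodule" and g f
  assume g: "g \<in> mod_hom R L N" and f: "f \<in> mod_hom R Q N"
    and LN: "left_module R L \<and> left_module R N \<and> g ` carrier L = carrier N"
  obtain h where h: "h \<in> mod_hom R P L" "\<And>x. x \<in> carrier P \<Longrightarrow> g (h x) = f (r x)"
    using projective_lift[OF assms(1) _ _ g _ hom_comp[OF assms(4) f]] LN by blast
  have "g (h (s x)) = f x" if "x \<in> carrier Q" for x
    using h(2)[OF hom_in[OF assms(3) that]] assms(5)[OF that] by simp
  then show "\<exists>h\<in>mod_hom R Q L. \<forall>x\<in>carrier Q. g (h x) = f x"
    by (intro bexI[OF _ hom_comp[OF assms(3) h(1)]] ballI)
qed (rule assms(2))

lemma projective_biprod: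
  fixes P :: "('r, 'm) module" and Q :: "('r, 'n) module"
  assumes "biprod R P Q D i j p q" "projective R P" "projective R Q"
  shows "projective R D"
  unfolding projective_def
proof (intro conjI allI ballI impI)
  note D = biprodD[OF assms(1)]
  show "left_module R D" by fact
  fix L N :: "'r umodule" and g f
  assume g: "g \<in> mod_hom R L N" and f: "f \<in> mod_hom R D N"
    and "left_module R L \<and> left_module R N \<and> g ` carrier L = carrier N"
  then have L: "left_module R L" and N: "left_module R N" and im: "g ` carrier L = carrier N" by auto
  obtain h where h: "h \<in> mod_hom R P L" "\<And>x. x \<in> carrier P \<Longrightarrow> g (h x) = f (i x)"
    using projective_lift[OF assms(2) L N g im hom_comp[OF D(4) f]] by blast
  obtain k where k: "k \<in> mod_hom R Q L" "\<And>x. x \<in> carrier Q \<Longrightarrow> g (k x) = f (j x)"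
    using projective_lift[OF assms(3) L N g im hom_comp[OF D(5) f]] by blast
  have "g (h (p d) \<oplus>\<^bsub>L\<^esub> k (q d)) = f d" if d: "d \<in> carrier D" for d
  proof -
    have c: "p d \<in> carrier P" "q d \<in> carrier Q" using d hom_in[OF D(6)] hom_in[OF D(7)] by auto
    have "g (h (p d) \<oplus>\<^bsub>L\<^esub> k (q d)) = f (i (p d)) \<oplus>\<^bsub>N\<^esub> f (j (q d))"
      using c hom_in[OF h(1)] hom_in[OF k(1)] h(2) k(2) by (simp add: hom_simps(2)[OF L N g])
    also have "\<dots> = f (i (p d) \<oplus>\<^bsub>D\<^esub> j (q d))"
      using c hom_in[OF D(4)] hom_in[OF D(5)] by (simp add: hom_simps(2)[OF D(3) N f])
    finally show ?thesis using D(12)[OF d] by simp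
  qed
  then show "\<exists>h\<in>mod_hom R D L. \<forall>x\<in>carrier D. g (h x) = f x"
    by (intro bexI[OF _ biprod_copair[OF assms(1) L h(1) k(1)]] ballI)
qed

lemma projective_zero:
  fixes P :: "('r, 'm) module"
  assumes "left_module R P" "carrier P = {\<zero>\<^bsub>P\<^esub>}"
  shows "projective R P"
  unfolding projective_def
proof (intro conjI allI ballI impI)
  fix L N :: "'r umodule" and g f
  assume g: "g \<in> mod_hom R L N" and f: "f \<in> mod_hom R P N"
    and LN: "left_module R L \<and> left_module R N \<and> g ` carrier L = carrier N"
  then have "g \<zero>\<^bsub>L\<^esub> = f x" if "x \<in> carrier P" for x
    using that hom_simps(4)[OF assms(1) _ f] hom_simps(4)[OF _ _ g] assms(2) by auto
  then show "\<exists>h\<in>mod_hom R P L. \<forall>x\<in>carrier P. g (h x) = f x"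
    using LN by (intro bexI[OF _ hom_zero] ballI) auto
qed (rule assms(1))

section \<open>The regular module and covers by free modules\<close>

definition regular_module :: "('r, 'x) ring_scheme \<Rightarrow> ('r, 'r) module" where
  "regular_module R =
     \<lparr>carrier = carrier R, monoid.mult = undefined, monoid.one = undefined,
      ring.zero = \<zero>\<^bsub>R\<^esub>, ring.add = ring.add R, smult = monoid.mult R\<rparr>"

lemma regular_module_sel [simp]:
  "carrier (regular_module R) = carrier R" "\<zero>\<^bsub>regular_module R\<^esub> = \<zero>\<^bsub>R\<^esub>"
  "a \<oplus>\<^bsub>regular_module R\<^esub> b = a \<oplus>\<^bsub>R\<^esub> b" "r \<odot>\<^bsub>regular_module R\<^esub> a = r \<otimes>\<^bsub>R\<^esub> a"
  by (simp_all add: regular_module_def)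

lemma left_module_regular:
  assumes "ring R"
  shows "left_module R (regular_module R)"
proof -
  interpret ring R by fact
  have "abelian_group (regular_module R)"
    by (rule abelian_groupI) (auto simp: a_ac intro: l_neg a_inv_closed)
  then show ?thesis
    by (intro left_module_axiomsI ring_axioms) (auto simp: l_distr r_distr m_assoc)
qed

lemma fin_gen_regular:
  assumes "ring R"
  shows "fin_gen R (regular_module R)"
proof -
  interpret ring R by fact
  have "a \<in> gen_span R (regular_module R) {\<one>\<^bsub>R\<^esub>}" if "a \<in> carrier R" for a
    using gen_span.step[OF gen_span.zero that, of "\<one>\<^bsub>R\<^esub>" "{\<one>\<^bsub>R\<^esub>}" "regular_module R"] that by simp
  then show ?thesis
    unfolding fin_gen_iff_span[OF left_module_regular[OF assms]] by (intro exI[of _ "{\<one>\<^bsub>R\<^esub>}"]) auto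
qed

lemma hom_regular:
  assumes "left_module R X" "x \<in> carrier X"
  shows "(\<lambda>r. r \<odot>\<^bsub>X\<^esub> x) \<in> mod_hom R (regular_module R) X"
proof -
  interpret left_module R X by fact
  show ?thesis by (rule mod_homI) (use assms(2) in \<open>auto simp: smult_l_distr smult_assoc\<close>)
qed

lemma hom_regular_eq:
  assumes "ring R" "left_module R X" "f \<in> mod_hom R (regular_module R) X" "r \<in> carrier R"
  shows "f r = r \<odot>\<^bsub>X\<^esub> f \<one>\<^bsub>R\<^esub>"
proof -
  interpret ring R by fact
  show ?thesis using hom_simps(3)[OF left_module_regular[OF assms(1)] assms(2,3,4), of "\<one>\<^bsub>R\<^esub>"] assms(4) by simp
qed

lemma projective_regular:
  fixes R :: "('r, 'x) ring_scheme"
  assumes "ring R"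
  shows "projective R (regular_module R)"
  unfolding projective_def
proof (intro conjI allI ballI impI)
  interpret ring R by fact
  fix L N :: "'r umodule" and g f
  assume g: "g \<in> mod_hom R L N" and f: "f \<in> mod_hom R (regular_module R) N"
    and LN: "left_module R L \<and> left_module R N \<and> g ` carrier L = carrier N"
  have "f \<one>\<^bsub>R\<^esub> \<in> g ` carrier L" using LN hom_in[OF f, of "\<one>\<^bsub>R\<^esub>"] by simp
  then obtain l where l: "l \<in> carrier L" "g l = f \<one>\<^bsub>R\<^esub>" by auto
  have "g (r \<odot>\<^bsub>L\<^esub> l) = f r" if "r \<in> carrier R" for r
    using hom_simps(3)[OF _ _ g that l(1)] hom_regular_eq[OF assms _ f that] l(2) LN by simp
  then show "\<exists>h\<in>mod_hom R (regular_module R) L. \<forall>x\<in>carrier (regular_module R). g (h x) = f x"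
    using LN by (intro bexI[OF _ hom_regular[OF _ l(1)]]) auto
qed (rule left_module_regular[OF assms])

lemma zero_module_exists:
  fixes X :: "('r, 'm) module"
  assumes "left_module R X"
  shows "left_module R (X\<lparr>carrier := {\<zero>\<^bsub>X\<^esub>}\<rparr>)"
  by (rule left_module_submod[OF assms]) (simp add: submod_def mod_simps[OF assms])

text \<open>One copy of the ring is added per generator. That the cover lies in the additive closure
  of the regular module is recorded along the way, for it is the form in which freeness is
  used.\<close>

lemma free_cover_aux:
  fixes X :: "('r, 'm) module"
  assumes X: "left_module R X" and "finite S" "S \<subseteq> carrier X"
  shows "\<exists>(P :: 'r umodule) p. projective R P \<and> fin_gen R P \<and> through R {regular_module R} P P (\<lambda>x. x) \<and>
    p \<in> mod_hom R P X \<and> gen_span R X S \<subseteq> p ` carrier P"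
  using assms(2,3)
proof induction
  have R: "ring R" using X by (simp add: left_module_def)
  note reg = left_module_regular[OF R]
  \<comment> \<open>A copy of the regular module in the universe, to be the summand added at each
    step.\<close>
  obtain U :: "'r umodule" where U: "left_module R U" "fin_gen R U" "mod_iso R (regular_module R) U"
    using fin_gen_iso_universe[OF reg fin_gen_regular[OF R]] by blast
  obtain f g where f: "f \<in> mod_hom R (regular_module R) U" and g: "g \<in> mod_hom R U (regular_module R)"
    and gf: "\<And>x. x \<in> carrier R \<Longrightarrow> g (f x) = x" and fg: "\<And>y. y \<in> carrier U \<Longrightarrow> f (g y) = y"
    using mod_isoE[OF reg U(1,3)] by (metis regular_module_sel(1))
  have Up: "projective R U" by (rule projective_retract[OF projective_regular[OF R] U(1) g f fg])
  have Ut: "through R {regular_module R} U U (\<lambda>x. x)"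
    by (rule through_cong[OF through_single[OF _ g f U(1)]]) (auto simp: fg)
  {
    case empty
    let ?Z = "U\<lparr>carrier := {\<zero>\<^bsub>U\<^esub>}\<rparr>"
    have Z: "left_module R ?Z" by (rule zero_module_exists[OF U(1)])
    have "gen_span R X {} \<subseteq> {\<zero>\<^bsub>X\<^esub>}" by (auto elim: gen_span.induct)
    then show ?case using projective_zero[OF Z] fin_gen_zero[OF Z] hom_zero[OF X, of ?Z]
      by (intro exI[of _ ?Z] exI[of _ "\<lambda>_. \<zero>\<^bsub>X\<^esub>"]) (auto intro: through.zero)
  next
    case (insert s S)
    then obtain P :: "'r umodule" and p where P: "projective R P" "fin_gen R P" "through R {regular_module R} P P (\<lambda>x. x)"
      and p: "p \<in> mod_hom R P X" "gen_span R X S \<subseteq> p ` carrier P" by blast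
    have s: "s \<in> carrier X" "S \<subseteq> carrier X" using insert by auto
    obtain D :: "'r umodule" and i j k l where D: "biprod R P U D i j k l" "fin_gen R D"
      using biprod_exists[OF projective_module[OF P(1)] U(1) P(2) U(2)] by blast
    note DD = biprodD[OF D(1)]
    have h: "(\<lambda>u. g u \<odot>\<^bsub>X\<^esub> s) \<in> mod_hom R U X" using hom_comp[OF g hom_regular[OF X s(1)]] by simp
    have t1: "through R {regular_module R} D D (\<lambda>d. i (k d))"
      by (rule through_comp[OF P(3) DD(1,3,6,4)])
    have t2: "through R {regular_module R} D D (\<lambda>d. j (l d))"
      by (rule through_comp[OF Ut DD(2,3,7,5)])
    have t: "through R {regular_module R} D D (\<lambda>d. d)"
      by (rule through_cong[OF through_add[OF t1 t2 DD(3)]]) (rule DD(12))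
    let ?p = "\<lambda>d. p (k d) \<oplus>\<^bsub>X\<^esub> g (l d) \<odot>\<^bsub>X\<^esub> s"
    have ph: "?p \<in> mod_hom R D X" by (rule biprod_copair[OF D(1) X p(1) h])
    have sub: "submod R X (?p ` carrier D)" by (rule submod_image[OF DD(3) X ph])
    have im: "p a \<oplus>\<^bsub>X\<^esub> r \<odot>\<^bsub>X\<^esub> s \<in> ?p ` carrier D" if ar: "a \<in> carrier P" "r \<in> carrier R" for a r
    proof -
      obtain d where d: "d \<in> carrier D" "k d = a" "l d = f r"
        using biprod_elem[OF D(1) ar(1), of "f r"] hom_in[OF f, of r] ar(2) by auto
      show ?thesis by (rule image_eqI[OF _ d(1)]) (simp add: d gf ar)
    qed
    interpret X: left_module R X by fact
    have "x \<in> ?p ` carrier D" if "x \<in> gen_span R X (insert s S)" for x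
      using that
    proof induction
      case zero
      then show ?case using sub by (simp add: submod_def)
    next
      case (step x r t)
      \<comment> \<open>The new summand of the cover reaches the multiples of \<open>s\<close>; any
        other generator is reached with coefficient zero there.\<close>
      have "r \<odot>\<^bsub>X\<^esub> t \<in> ?p ` carrier D"
      proof (cases "t = s")
        case True
        then show ?thesis
          using im[of "\<zero>\<^bsub>P\<^esub>" r] step(2) s(1) mod_simps(1)[OF DD(1)] hom_simps(4)[OF DD(1) X p(1)] by simp
      next
        case False
        then have "t \<in> gen_span R X S" using step(3) span_base[OF X s(2)] by blast
        then have "t \<in> p ` carrier P" using p(2) by blast
        then obtain a where a: "a \<in> carrier P" "t = p a" by blast
        have "p a \<oplus>\<^bsub>X\<^esub> \<zero>\<^bsub>R\<^esub> \<odot>\<^bsub>X\<^esub> s = p a"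
        proof -
          have "\<zero>\<^bsub>R\<^esub> \<odot>\<^bsub>X\<^esub> s \<oplus>\<^bsub>X\<^esub> \<zero>\<^bsub>R\<^esub> \<odot>\<^bsub>X\<^esub> s = \<zero>\<^bsub>R\<^esub> \<odot>\<^bsub>X\<^esub> s"
            using s(1) X.smult_l_distr[of "\<zero>\<^bsub>R\<^esub>" "\<zero>\<^bsub>R\<^esub>" s] by simp
          then have "\<zero>\<^bsub>R\<^esub> \<odot>\<^bsub>X\<^esub> s = \<zero>\<^bsub>X\<^esub>" using s(1) by (simp add: X.M.add.l_cancel_one')
          then show ?thesis using hom_in[OF p(1) a(1)] by simp
        qed
        then have "t \<in> ?p ` carrier D" using im[OF a(1), of "\<zero>\<^bsub>R\<^esub>"] a(2) by simp
        then show ?thesis using sub step(2) unfolding submod_def by blast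
      qed
      then show ?case using sub step(4) unfolding submod_def by blast
    qed
    then show ?case using projective_biprod[OF D(1) P(1) Up] D(2) t ph
      by (intro exI[of _ D] exI[of _ ?p]) blast
  }
qed

lemma free_cover:
  fixes X :: "('r, 'm) module"
  assumes "left_module R X" "fin_gen R X"
  obtains P :: "'r umodule" and p where "projective R P" "fin_gen R P" "through R {regular_module R} P P (\<lambda>x. x)"
    "p \<in> mod_hom R P X" "p ` carrier P = carrier X"
proof -
  obtain S where S: "S \<subseteq> carrier X" "finite S" "carrier X \<subseteq> gen_span R X S"
    using assms(2) unfolding fin_gen_iff_span[OF assms(1)] by blast
  obtain P :: "'r umodule" and p where P: "projective R P" "fin_gen R P" "through R {regular_module R} P P (\<lambda>x. x)"
    and p: "p \<in> mod_hom R P X" "gen_span R X S \<subseteq> p ` carrier P"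
    using free_cover_aux[OF assms(1) S(2,1)] by blast
  have "p ` carrier P = carrier X" using p S(3) hom_in[OF p(1)] by blast
  then show ?thesis using that P p(1) by blast
qed

text \<open>A projective module is a retract of its free cover, and the decomposition of the
  identity passes to retracts.\<close>

lemma projective_through_regular:
  fixes P :: "'r umodule"
  assumes "projective R P" "fin_gen R P"
  shows "through R {regular_module R} P P (\<lambda>x. x)"
proof -
  note P = projective_module[OF assms(1)]
  obtain F :: "'r umodule" and p where F: "projective R F" "fin_gen R F" "through R {regular_module R} F F (\<lambda>x. x)"
    "p \<in> mod_hom R F P" "p ` carrier F = carrier P"
    using free_cover[OF P assms(2)] by blast
  obtain s where s: "s \<in> mod_hom R P F" "\<And>x. x \<in> carrier P \<Longrightarrow> p (s x) = x"
    using projective_lift[OF assms(1) projective_module[OF F(1)] P F(4,5) hom_id] by blast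
  show ?thesis
    by (rule through_cong[OF through_comp[OF F(3) projective_module[OF F(1)] P s(1) F(4)]]) (rule s(2))
qed

subsection \<open>Syzygies of modules generated by others\<close>

text \<open>Lifting each composite X -> Z -> X to projective covers gives an endomorphism
  \<open>e'\<close> of \<open>P\<close> over \<open>e\<close>; on kernels each lifted composite
  passes through a syzygy \<open>Z'\<close>. The last clause carries along that maps into members of
  \<open>Qs\<close> extend, which holds for each composite because it holds for
  \<open>Z'\<close>.\<close>

lemma through_syzygy_aux:
  fixes X K P :: "'r umodule" and Zs Zs' Qs :: "'r umodule set"
  assumes S: "ses R K P X i p" and P: "projective R P"
    and Zs: "\<And>Z. Z \<in> Zs \<Longrightarrow> \<exists>Z'\<in>Zs'. \<exists>(P' :: 'r umodule) i' p'. ses R Z' P' Z i' p' \<and> projective R P' \<and>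
      (\<forall>Q\<in>Qs. \<forall>f\<in>mod_hom R Z' Q. \<exists>g\<in>mod_hom R P' Q. \<forall>x\<in>carrier Z'. g (i' x) = f x)"
    and Qs: "\<And>Q. Q \<in> Qs \<Longrightarrow> left_module R Q"
    and e: "through R Zs X X e"
  shows "\<exists>e' k. e' \<in> mod_hom R P P \<and> (\<forall>x\<in>carrier P. p (e' x) = e (p x)) \<and> through R Zs' K K k \<and>
    (\<forall>x\<in>carrier K. i (k x) = e' (i x)) \<and>
    (\<forall>Q\<in>Qs. \<forall>f\<in>mod_hom R K Q. \<exists>g\<in>mod_hom R P Q. \<forall>x\<in>carrier K. g (i x) = f (k x))"
  using e
proof induction
  note D = sesD[OF S]
  {
    case (zero h)
    have "h (p x) = \<zero>\<^bsub>X\<^esub>" if "x \<in> carrier P" for x using zero hom_in[OF D(5) that] by simp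
    moreover have "\<exists>g\<in>mod_hom R P Q. \<forall>x\<in>carrier K. g (i x) = f \<zero>\<^bsub>K\<^esub>"
      if "Q \<in> Qs" "f \<in> mod_hom R K Q" for Q f
      using hom_simps(4)[OF D(1) Qs[OF that(1)] that(2)] by (intro bexI[OF _ hom_zero[OF Qs[OF that(1)]]]) simp
    ultimately show ?case
      using hom_zero[OF D(2), of P] hom_simps(4)[OF D(1,2,4)] hom_simps(4)[OF D(2,3,5)]
      by (intro exI[of _ "\<lambda>_. \<zero>\<^bsub>P\<^esub>"] exI[of _ "\<lambda>_. \<zero>\<^bsub>K\<^esub>"] conjI through.zero) simp_all
  next
    case (step h Z f g h')
    then obtain e' k where e': "e' \<in> mod_hom R P P" "\<And>x. x \<in> carrier P \<Longrightarrow> p (e' x) = h (p x)"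
      and k: "through R Zs' K K k" "\<And>x. x \<in> carrier K \<Longrightarrow> i (k x) = e' (i x)"
      and ext: "\<And>Q f. Q \<in> Qs \<Longrightarrow> f \<in> mod_hom R K Q \<Longrightarrow> \<exists>g\<in>mod_hom R P Q. \<forall>x\<in>carrier K. g (i x) = f (k x)"
      by auto
    obtain Z' and P' :: "'r umodule" and i' p' where Z': "Z' \<in> Zs'" "projective R P'" and S': "ses R Z' P' Z i' p'"
      and ext0: "\<forall>Q\<in>Qs. \<forall>f\<in>mod_hom R Z' Q. \<exists>g\<in>mod_hom R P' Q. \<forall>x\<in>carrier Z'. g (i' x) = f x"
      using Zs[OF step(2)] by (elim bexE exE conjE) (rule that)
    note ext' = ext0[rule_format]
    note D' = sesD[OF S']
    obtain f' where f': "f' \<in> mod_hom R P P'" "\<And>x. x \<in> carrier P \<Longrightarrow> p' (f' x) = f (p x)"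
      by (rule projective_lift_ses[OF P S' hom_comp[OF D(5) step(3)]]) (rule that)
    obtain g' where g': "g' \<in> mod_hom R P' P" "\<And>x. x \<in> carrier P' \<Longrightarrow> p (g' x) = g (p' x)"
      by (rule projective_lift_ses[OF Z'(2) S hom_comp[OF D'(5) step(4)]]) (rule that)
    have "p' (f' (i x)) = \<zero>\<^bsub>Z\<^esub>" if "x \<in> carrier K" for x
      using f'(2)[OF hom_in[OF D(4) that]] D(9)[OF that] hom_simps(4)[OF D(3) D'(3) step(3)] by simp
    then obtain u where u: "u \<in> mod_hom R K Z'" "\<And>x. x \<in> carrier K \<Longrightarrow> i' (u x) = f' (i x)"
      using ses_lift[OF S' D(1) hom_comp[OF D(4) f'(1)]] by blast
    have "p (g' (i' x)) = \<zero>\<^bsub>X\<^esub>" if "x \<in> carrier Z'" for x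
      using g'(2)[OF hom_in[OF D'(4) that]] D'(9)[OF that] hom_simps(4)[OF D'(3) D(3) step(4)] by simp
    then obtain v where v: "v \<in> mod_hom R Z' K" "\<And>x. x \<in> carrier Z' \<Longrightarrow> i (v x) = g' (i' x)"
      using ses_lift[OF S D'(1) hom_comp[OF D'(4) g'(1)]] by blast
    let ?e = "\<lambda>x. e' x \<oplus>\<^bsub>P\<^esub> g' (f' x)" and ?k = "\<lambda>x. k x \<oplus>\<^bsub>K\<^esub> v (u x)"
    have kin: "k x \<in> carrier K" if "x \<in> carrier K" for x by (rule through_in[OF k(1) D(1) that])
    have 1: "?e \<in> mod_hom R P P" by (rule hom_add[OF D(2,2) e'(1) hom_comp[OF f'(1) g'(1)]])
    have 2: "p (?e x) = h' (p x)" if "x \<in> carrier P" for x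
      using that hom_in[OF e'(1)] hom_in[OF g'(1)] hom_in[OF f'(1)] hom_in[OF D(5)]
      by (simp add: hom_simps(2)[OF D(2,3,5)] e'(2) f'(2) g'(2) step(5))
    have 3: "through R Zs' K K ?k" by (rule through.step[OF k(1) Z'(1) u(1) v(1)]) simp
    have 4: "i (?k x) = ?e (i x)" if "x \<in> carrier K" for x
      using that hom_in[OF u(1)] hom_in[OF v(1)] kin by (simp add: hom_simps(2)[OF D(1,2,4)] k(2) u(2) v(2))
    have 5: "\<exists>g\<in>mod_hom R P Q. \<forall>x\<in>carrier K. g (i x) = f0 (?k x)" if Q: "Q \<in> Qs" "f0 \<in> mod_hom R K Q" for Q f0
    proof -
      obtain g1 where g1: "g1 \<in> mod_hom R P Q" "\<And>x. x \<in> carrier K \<Longrightarrow> g1 (i x) = f0 (k x)"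
        using ext[OF Q] by auto
      obtain g2 where g2: "g2 \<in> mod_hom R P' Q" "\<And>x. x \<in> carrier Z' \<Longrightarrow> g2 (i' x) = f0 (v x)"
        using ext'[OF Q(1) hom_comp[OF v(1) Q(2)]] by auto
      have "g1 (i x) \<oplus>\<^bsub>Q\<^esub> g2 (f' (i x)) = f0 (?k x)" if x: "x \<in> carrier K" for x
        using x kin hom_in[OF u(1)] hom_in[OF v(1)]
        by (simp add: hom_simps(2)[OF D(1) Qs[OF Q(1)] Q(2)] g1(2) u(2)[symmetric] g2(2))
      then show ?thesis
        by (intro bexI[OF _ hom_add[OF D(2) Qs[OF Q(1)] g1(1) hom_comp[OF f'(1) g2(1)]]] ballI)
    qed
    show ?case
      by (intro exI[of _ ?e] exI[of _ ?k] conjI ballI 1 2 3 4 5)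
  }
qed

text \<open>Schanuel's lemma in additive form. For the identity of \<open>X\<close> the lift
  \<open>e'\<close> differs from the identity of \<open>P\<close> by a map into the kernel, so the
  identity of \<open>K\<close> is \<open>k\<close> plus a map factoring through \<open>P\<close>;
  this explains the additional member \<open>P\<close>.\<close>

lemma through_syzygy:
  fixes X K P :: "'r umodule" and Zs Zs' Qs :: "'r umodule set"
  assumes S: "ses R K P X i p" and P: "projective R P"
    and Zs: "\<And>Z. Z \<in> Zs \<Longrightarrow> \<exists>Z'\<in>Zs'. \<exists>(P' :: 'r umodule) i' p'. ses R Z' P' Z i' p' \<and> projective R P' \<and>
      (\<forall>Q\<in>Qs. \<forall>f\<in>mod_hom R Z' Q. \<exists>g\<in>mod_hom R P' Q. \<forall>x\<in>carrier Z'. g (i' x) = f x)"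
    and Qs: "\<And>Q. Q \<in> Qs \<Longrightarrow> left_module R Q"
    and e: "through R Zs X X (\<lambda>x. x)"
  shows "through R (insert P Zs') K K (\<lambda>x. x)"
    and "\<And>Q f. Q \<in> Qs \<Longrightarrow> f \<in> mod_hom R K Q \<Longrightarrow> \<exists>g\<in>mod_hom R P Q. \<forall>x\<in>carrier K. g (i x) = f x"
proof -
  note D = sesD[OF S]
  obtain e' k where e': "e' \<in> mod_hom R P P" "\<And>x. x \<in> carrier P \<Longrightarrow> p (e' x) = p x"
    and k: "through R Zs' K K k" "\<And>x. x \<in> carrier K \<Longrightarrow> i (k x) = e' (i x)"
    and ext: "\<And>Q f. Q \<in> Qs \<Longrightarrow> f \<in> mod_hom R K Q \<Longrightarrow> \<exists>g\<in>mod_hom R P Q. \<forall>x\<in>carrier K. g (i x) = f (k x)"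
    using through_syzygy_aux[OF assms] by auto
  have d: "(\<lambda>x. x \<oplus>\<^bsub>P\<^esub> \<ominus>\<^bsub>P\<^esub> e' x) \<in> mod_hom R P P" by (rule hom_diff[OF D(2,2) hom_id e'(1)])
  have "p (x \<oplus>\<^bsub>P\<^esub> \<ominus>\<^bsub>P\<^esub> e' x) = \<zero>\<^bsub>X\<^esub>" if "x \<in> carrier P" for x
    using that hom_in[OF e'(1)] hom_in[OF D(5)]
    by (simp add: hom_simps(2,5)[OF D(2,3,5)] e'(2) mod_simps(3)[OF D(2)] mod_simps(8)[OF D(3)])
  then obtain c where c: "c \<in> mod_hom R P K" "\<And>x. x \<in> carrier P \<Longrightarrow> i (c x) = x \<oplus>\<^bsub>P\<^esub> \<ominus>\<^bsub>P\<^esub> e' x"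
    using ses_lift[OF S D(2) d] by blast
  have kin: "k x \<in> carrier K" if "x \<in> carrier K" for x by (rule through_in[OF k(1) D(1) that])
  have sum: "k x \<oplus>\<^bsub>K\<^esub> c (i x) = x" if x: "x \<in> carrier K" for x
  proof (rule inj_onD[OF D(6)])
    have "i (k x \<oplus>\<^bsub>K\<^esub> c (i x)) = e' (i x) \<oplus>\<^bsub>P\<^esub> (i x \<oplus>\<^bsub>P\<^esub> \<ominus>\<^bsub>P\<^esub> e' (i x))"
      using x kin hom_in[OF c(1)] hom_in[OF D(4)] by (simp add: hom_simps(2)[OF D(1,2,4)] c(2) k(2))
    then show "i (k x \<oplus>\<^bsub>K\<^esub> c (i x)) = i x"
      using x hom_in[OF e'(1)] hom_in[OF D(4)] by (simp add: mod_simps(11)[OF D(2)])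
  qed (use x kin hom_in[OF c(1)] hom_in[OF D(4)] mod_simps(2)[OF D(1)] in auto)
  have "through R (insert P Zs') K K k" using k(1)
    by induction (auto intro: through.zero through.step)
  from through.step[OF this _ D(4) c(1)] show "through R (insert P Zs') K K (\<lambda>x. x)"
    using sum by simp
  show "\<exists>g\<in>mod_hom R P Q. \<forall>x\<in>carrier K. g (i x) = f x" if Q: "Q \<in> Qs" "f \<in> mod_hom R K Q" for Q f
  proof -
    obtain g where g: "g \<in> mod_hom R P Q" "\<And>x. x \<in> carrier K \<Longrightarrow> g (i x) = f (k x)"
      using ext[OF Q] by auto
    \<comment> \<open>The map \<open>f\<close> splits as \<open>f\<close> after \<open>k\<close>,
      which extends by the preceding lemma, plus \<open>f\<close> after \<open>c\<close>, which is
      already defined on \<open>P\<close>.\<close>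
    have "g (i x) \<oplus>\<^bsub>Q\<^esub> f (c (i x)) = f x" if x: "x \<in> carrier K" for x
      using hom_simps(2)[OF D(1) Qs[OF Q(1)] Q(2) kin[OF x] hom_in[OF c(1) hom_in[OF D(4) x]]] sum[OF x] g(2)[OF x]
      by simp
    then show ?thesis
      by (intro bexI[OF _ hom_add[OF D(2) Qs[OF Q(1)] g(1) hom_comp[OF c(1) Q(2)]]] ballI)
  qed
qed

lemma projective_through:
  fixes X :: "('r, 'm) module" and Zs :: "('r, 'z) module set"
  assumes "through R Zs X X (\<lambda>x. x)" "left_module R X" "\<And>Z. Z \<in> Zs \<Longrightarrow> projective R Z"
  shows "projective R X"
  unfolding projective_def
proof (intro conjI allI ballI impI)
  fix L N :: "'r umodule" and g f
  assume g: "g \<in> mod_hom R L N" and f: "f \<in> mod_hom R X N"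
    and LN: "left_module R L \<and> left_module R N \<and> g ` carrier L = carrier N"
  then have L: "left_module R L" and N: "left_module R N" and im: "g ` carrier L = carrier N" by auto
  have "\<exists>h\<in>mod_hom R X L. \<forall>x\<in>carrier X. g (h x) = f (e x)" if "through R Zs X X e" for e
    using that
  proof induction
    case (zero e)
    then show ?case using hom_simps(4)[OF L N g] hom_simps(4)[OF assms(2) N f]
      by (intro bexI[OF _ hom_zero[OF L]]) simp
  next
    case (step e Z a b e')
    obtain h where h: "h \<in> mod_hom R X L" "\<And>x. x \<in> carrier X \<Longrightarrow> g (h x) = f (e x)" using step(6) by auto
    obtain k where k: "k \<in> mod_hom R Z L" "\<And>z. z \<in> carrier Z \<Longrightarrow> g (k z) = f (b z)"
      by (rule projective_lift[OF assms(3)[OF step(2)] L N g im hom_comp[OF step(4) f]]) (rule that)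
    have "g (h x \<oplus>\<^bsub>L\<^esub> k (a x)) = f (e' x)" if "x \<in> carrier X" for x
      using that through_in[OF step(1) assms(2)] hom_in[OF step(3)] hom_in[OF step(4)] hom_in[OF h(1)] hom_in[OF k(1)]
      by (simp add: hom_simps(2)[OF L N g] hom_simps(2)[OF assms(2) N f] h(2) k(2) step(5))
    then show ?case
      by (intro bexI[OF _ hom_add[OF assms(2) L h(1) hom_comp[OF step(3) k(1)]]] ballI)
  qed
  from this[OF assms(1)] show "\<exists>h\<in>mod_hom R X L. \<forall>x\<in>carrier X. g (h x) = f x" .
qed (rule assms(2))

subsection \<open>Modules with a projective resolution of given length\<close>

text \<open>\<open>pdl R k X\<close> says that \<open>X\<close> has a resolution with \<open>k\<close> terms, that is, projective dimension at most \<open>k - 1\<close>.\<close>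

inductive pdl :: "('r, 'x) ring_scheme \<Rightarrow> nat \<Rightarrow> 'r umodule \<Rightarrow> bool" for R :: "('r, 'x) ring_scheme" where
  zero: "left_module R X \<Longrightarrow> carrier X = {\<zero>\<^bsub>X\<^esub>} \<Longrightarrow> pdl R 0 X"
| suc: "ses R K (P :: 'r umodule) X i p \<Longrightarrow> projective R P \<Longrightarrow> fin_gen R P \<Longrightarrow> pdl R k K \<Longrightarrow> pdl R (Suc k) X"

lemma pdl_module: "pdl R k X \<Longrightarrow> left_module R X"
  by (induction rule: pdl.induct) (auto dest: sesD)

lemma pdl_fin_gen: "pdl R k X \<Longrightarrow> fin_gen R X"
  by (induction rule: pdl.induct) (auto intro: fin_gen_zero dest: fin_gen_image[OF sesD(2,3,5,8)])

lemma ses_zero_id: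
  assumes "left_module R X"
  shows "ses R (X\<lparr>carrier := {\<zero>\<^bsub>X\<^esub>}\<rparr>) X X (\<lambda>x. x) (\<lambda>x. x)"
  unfolding ses_def using assms zero_module_exists[OF assms] mod_simps(1)[OF assms] hom_id[of R X]
  by (auto intro: hom_sub_dom)

text \<open>The zero module serves as its own cover, so a resolution of it can be padded to any
  length.\<close>

lemma pdl_zero:
  assumes "left_module R X" "carrier X = {\<zero>\<^bsub>X\<^esub>}"
  shows "pdl R k X"
proof (induction k)
  case (Suc k)
  have "X\<lparr>carrier := {\<zero>\<^bsub>X\<^esub>}\<rparr> = X" using assms(2) by (cases X) simp
  then show ?case
    using pdl.suc[OF ses_zero_id[OF assms(1)] projective_zero[OF assms] fin_gen_zero[OF assms]] Suc by simp
qed (rule pdl.zero[OF assms])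

lemma pdl_projective:
  assumes "projective R X" "fin_gen R X"
  shows "pdl R (Suc k) X"
  by (rule pdl.suc[OF ses_zero_id[OF projective_module[OF assms(1)]] assms pdl_zero])
     (use zero_module_exists[OF projective_module[OF assms(1)]] in simp_all)

lemma pdl_mono_Suc: "pdl R k X \<Longrightarrow> pdl R (Suc k) X"
  by (induction rule: pdl.induct) (auto intro: pdl_zero pdl.suc)

lemma ses_iso_dom:
  assumes "ses R X Y Z i p" "left_module R W" "f \<in> mod_hom R W X" "g \<in> mod_hom R X W"
    "\<And>w. w \<in> carrier W \<Longrightarrow> g (f w) = w" "\<And>x. x \<in> carrier X \<Longrightarrow> f (g x) = x"
  shows "ses R W Y Z (\<lambda>w. i (f w)) p"
proof -
  note D = sesD[OF assms(1)]
  show ?thesis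
  proof (rule sesI[OF assms(2) D(2,3) hom_comp[OF assms(3) D(4)] D(5)])
    show "w = \<zero>\<^bsub>W\<^esub>" if "w \<in> carrier W" "i (f w) = \<zero>\<^bsub>Y\<^esub>" for w
      using ses_inj[OF assms(1) hom_in[OF assms(3) that(1)] that(2)] assms(5)[OF that(1)]
        hom_simps(4)[OF D(1) assms(2,4)] by simp
    show "p (i (f w)) = \<zero>\<^bsub>Z\<^esub>" if "w \<in> carrier W" for w by (rule D(9)[OF hom_in[OF assms(3) that]])
    show "\<exists>w\<in>carrier W. i (f w) = y" if y: "y \<in> carrier Y" "p y = \<zero>\<^bsub>Z\<^esub>" for y
    proof -
      obtain x where "x \<in> carrier X" "i x = y" by (rule ses_kernelE[OF assms(1) y])
      then show ?thesis using assms(6) hom_in[OF assms(4)] by (intro bexI[of _ "g x"]) auto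
    qed
    show "\<exists>y\<in>carrier Y. p y = z" if "z \<in> carrier Z" for z
      using ses_epiE[OF assms(1) that] by metis
  qed
qed

text \<open>One term means that the kernel of the cover is zero, so the cover is an
  isomorphism.\<close>

lemma pdl_one_projective:
  assumes "pdl R (Suc 0) X"
  shows "projective R X"
  using assms
proof cases
  case (suc K P i p)
  note D = sesD[OF suc(1)]
  have K: "carrier K = {\<zero>\<^bsub>K\<^esub>}" using suc(4) by cases auto
  have "bij_betw p (carrier P) (carrier X)"
    unfolding bij_betw_def
  proof
    show "inj_on p (carrier P)"
    proof (rule hom_inj[OF D(2,3,5)])
      fix y assume "y \<in> carrier P" "p y = \<zero>\<^bsub>X\<^esub>"
      then obtain x where "x \<in> carrier K" "i x = y" by (rule ses_kernelE[OF suc(1)])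
      then show "y = \<zero>\<^bsub>P\<^esub>" using K hom_simps(4)[OF D(1,2,4)] by simp
    qed
  qed (rule D(8))
  then obtain g where g: "g \<in> mod_hom R X P" "\<And>y. y \<in> carrier X \<Longrightarrow> p (g y) = y"
    by (rule hom_inverse[OF D(2,3,5)]) (rule that)
  show ?thesis by (rule projective_retract[OF suc(2) D(3) g(1) D(5) g(2)])
qed

text \<open>Induction on the length: the syzygy of \<open>X\<close> is a summand of syzygies of the
  \<open>Zs\<close> and of the cover \<open>P\<close>. Because \<open>P\<close> occurs, the
  induction starts with one term and not with zero terms.\<close>

lemma pdl_through:
  fixes R :: "('r, 'x) ring_scheme"
  assumes "through R Zs X X (\<lambda>x. x)" "left_module R X" "\<And>Z. Z \<in> Zs \<Longrightarrow> pdl R (Suc k) Z"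
  shows "pdl R (Suc k) X"
  using assms
proof (induction k arbitrary: X Zs)
  have fg: "fin_gen R X" if "through R Zs X X (\<lambda>x. x)" "left_module R X" "\<And>Z. Z \<in> Zs \<Longrightarrow> pdl R k Z" for X Zs k
    by (rule through_fin_gen[OF that(1,2)]) (auto dest: that(3) pdl_module pdl_fin_gen)
  {
    case 0
    have "projective R X" by (rule projective_through[OF 0(1,2)]) (rule pdl_one_projective[OF 0(3)])
    moreover have "fin_gen R X" by (rule fg[OF 0(1,2)]) (rule 0(3))
    ultimately show ?case by (rule pdl_projective)
  next
    case (Suc k)
    have X: "fin_gen R X" by (rule fg[OF Suc(2,3)]) (rule Suc(4))
    obtain P :: "'r umodule" and p where P: "projective R P" "fin_gen R P"
      and p: "p \<in> mod_hom R P X" "p ` carrier P = carrier X"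
      by (rule free_cover[OF Suc(3) X]) (rule that)
    have S: "ses R (P\<lparr>carrier := {y \<in> carrier P. p y = \<zero>\<^bsub>X\<^esub>}\<rparr>) P X (\<lambda>x. x) p" (is "ses R ?K _ _ _ _")
      by (rule ses_kernel[OF projective_module[OF P(1)] Suc(3) p])
    let ?Zs = "{Z. pdl R (Suc k) Z}"
    have "through R (insert P ?Zs) ?K ?K (\<lambda>x. x)"
    proof (rule through_syzygy(1)[OF S P(1) _ _ Suc(2)])
      fix Z assume "Z \<in> Zs"
      then have "pdl R (Suc (Suc k)) Z" by (rule Suc(4))
      then show "\<exists>Z'\<in>?Zs. \<exists>(P' :: 'r umodule) i' p'. ses R Z' P' Z i' p' \<and> projective R P' \<and>
          (\<forall>Q\<in>{}. \<forall>f\<in>mod_hom R Z' Q. \<exists>g\<in>mod_hom R P' Q. \<forall>x\<in>carrier Z'. g (i' x) = f x)"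
        by cases blast
    qed simp
    then have "pdl R (Suc k) ?K"
      by (rule Suc(1)) (use sesD(1)[OF S] pdl_projective[OF P] in auto)
    then show ?case by (rule pdl.suc[OF S P])
  }
qed

section \<open>Gorenstein projective modules\<close>

text \<open>Exactness together with the extension property says Ext^1(G, Q) = 0 for every finitely
  generated projective \<open>Q\<close>, without forming Ext.\<close>

definition pses ::
  "('r, 'x) ring_scheme \<Rightarrow> 'r umodule \<Rightarrow> 'r umodule \<Rightarrow> 'r umodule \<Rightarrow>
   ('r univ \<Rightarrow> 'r univ) \<Rightarrow> ('r univ \<Rightarrow> 'r univ) \<Rightarrow> bool" where
  "pses R K P G i p \<longleftrightarrow> ses R K P G i p \<and> projective R P \<and> fin_gen R P \<and>
     (\<forall>(Q :: 'r umodule) f. projective R Q \<and> fin_gen R Q \<and> f \<in> mod_hom R K Q \<longrightarrow>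
        (\<exists>g\<in>mod_hom R P Q. \<forall>x\<in>carrier K. g (i x) = f x))"

lemma psesD:
  assumes "pses R K P G i p"
  shows "ses R K P G i p" "projective R P" "fin_gen R P"
  using assms by (simp_all add: pses_def)

lemma pses_extend:
  fixes Q :: "'r umodule"
  assumes "pses R K P G i p" "projective R Q" "fin_gen R Q" "f \<in> mod_hom R K Q"
  obtains g where "g \<in> mod_hom R P Q" "\<And>x. x \<in> carrier K \<Longrightarrow> g (i x) = f x"
proof -
  have "\<exists>g\<in>mod_hom R P Q. \<forall>x\<in>carrier K. g (i x) = f x"
    using assms unfolding pses_def by simp
  then show ?thesis by (elim bexE) (rule that, auto)
qed

lemma psesI:
  fixes R :: "('r, 'x) ring_scheme"
  assumes "ses R K P G i p" "projective R P" "fin_gen R P"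
    and "\<And>(Q :: 'r umodule) f. projective R Q \<Longrightarrow> fin_gen R Q \<Longrightarrow> f \<in> mod_hom R K Q \<Longrightarrow>
        \<exists>g\<in>mod_hom R P Q. \<forall>x\<in>carrier K. g (i x) = f x"
  shows "pses R K P G i p"
  using assms by (simp add: pses_def)

text \<open>\<open>perp R G\<close> says that $\mathrm{Ext}^i(G, Q) = 0$ for all $i > 0$ and all finitely generated projective \<open>Q\<close>.\<close>

coinductive perp :: "('r, 'x) ring_scheme \<Rightarrow> 'r umodule \<Rightarrow> bool" for R :: "('r, 'x) ring_scheme" where
  step: "pses R K P G i p \<Longrightarrow> perp R K \<Longrightarrow> perp R G"

lemma perpE:
  assumes "perp R G"
  obtains K P i p where "pses R K P G i p" "perp R K"
  using assms by cases (rule that)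

lemma perp_module: "perp R G \<Longrightarrow> left_module R G"
  by (erule perpE) (auto dest: psesD(1) sesD(3))

lemma perp_fin_gen:
  assumes "perp R G"
  shows "fin_gen R G"
proof -
  obtain K P i p where S: "pses R K P G i p" using perpE[OF assms] .
  show ?thesis using fin_gen_image[OF sesD(2,3,5,8)[OF psesD(1)[OF S]] psesD(3)[OF S]] .
qed

text \<open>The cover is the identity; its kernel is the zero module, again finitely generated
  projective, so the coinduction closes.\<close>

lemma perp_projective:
  assumes "projective R Q" "fin_gen R Q"
  shows "perp R Q"
proof -
  have "projective R Q \<and> fin_gen R Q" using assms by simp
  then show ?thesis
  proof (coinduction arbitrary: Q rule: perp.coinduct)
    case (perp Q)
    note Q = projective_module[of R Q]
    let ?Z = "Q\<lparr>carrier := {\<zero>\<^bsub>Q\<^esub>}\<rparr>"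
    have Z: "left_module R ?Z" using zero_module_exists Q perp by auto
    have "pses R ?Z Q Q (\<lambda>x. x) (\<lambda>x. x)"
    proof (rule psesI)
      fix L :: "'a umodule" and f
      assume "projective R L" and f: "f \<in> mod_hom R ?Z L"
      then have L: "left_module R L" by (simp add: projective_module)
      show "\<exists>g\<in>mod_hom R Q L. \<forall>x\<in>carrier ?Z. g x = f x"
        using hom_simps(4)[OF Z L f] by (intro bexI[OF _ hom_zero[OF L]]) simp
    qed (use perp Q ses_zero_id in auto)
    moreover have "projective R ?Z" "fin_gen R ?Z"
      using projective_zero[OF Z] fin_gen_zero[OF Z] by auto
    ultimately show ?case by blast
  qed
qed

text \<open>One unfolding of \<open>perp\<close>, brought into the form of the hypothesis of
  \<open>through_syzygy\<close>: the syzygies are again in \<open>perp\<close>, and the targets are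
  all finitely generated projectives.\<close>

lemma perp_syzygy_data:
  fixes Z :: "'r umodule"
  assumes "perp R Z"
  shows "\<exists>Z'\<in>{Z'. perp R Z'}. \<exists>(P' :: 'r umodule) i' p'. ses R Z' P' Z i' p' \<and> projective R P' \<and>
      (\<forall>Q\<in>{Q :: 'r umodule. projective R Q \<and> fin_gen R Q}. \<forall>f\<in>mod_hom R Z' Q. \<exists>g\<in>mod_hom R P' Q. \<forall>x\<in>carrier Z'. g (i' x) = f x)"
proof -
  obtain K P i p where S: "pses R K P Z i p" "perp R K" by (rule perpE[OF assms]) (rule that)
  show ?thesis
    by (rule bexI[of _ K], rule exI[of _ P], rule exI[of _ i], rule exI[of _ p]) (use S in \<open>auto simp: pses_def\<close>)
qed

text \<open>The coinduction invariant is to be a summand of a finite sum of modules in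
  \<open>perp\<close>. It passes to syzygies by \<open>through_syzygy\<close>, where the cover
  \<open>P\<close> joins the family, being in \<open>perp\<close> itself.\<close>

lemma perp_through:
  fixes R :: "('r, 'x) ring_scheme"
  assumes "through R Zs X X (\<lambda>x. x)" "left_module R X" "\<And>Z. Z \<in> Zs \<Longrightarrow> perp R Z"
  shows "perp R X"
proof -
  have "left_module R X \<and> (\<exists>Zs. (\<forall>Z\<in>Zs. perp R Z) \<and> through R Zs X X (\<lambda>x. x))" using assms by blast
  then show ?thesis
  proof (coinduction arbitrary: X rule: perp.coinduct)
    case (perp X)
    then obtain Zs where X: "left_module R X" and Zs: "\<And>Z. Z \<in> Zs \<Longrightarrow> perp R Z" and t: "through R Zs X X (\<lambda>x. x)"
      by blast
    have fg: "fin_gen R X"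
      by (rule through_fin_gen[OF t X]) (use Zs perp_module perp_fin_gen in blast)
    obtain P :: "'r umodule" and p where P: "projective R P" "fin_gen R P"
      and p: "p \<in> mod_hom R P X" "p ` carrier P = carrier X"
      by (rule free_cover[OF X fg]) (rule that)
    have S: "ses R (P\<lparr>carrier := {y \<in> carrier P. p y = \<zero>\<^bsub>X\<^esub>}\<rparr>) P X (\<lambda>x. x) p" (is "ses R ?K _ _ _ _")
      by (rule ses_kernel[OF projective_module[OF P(1)] X p])
    note T = through_syzygy[OF S P(1) perp_syzygy_data[OF Zs] projective_module t, simplified]
    have "pses R ?K P X (\<lambda>x. x) p" by (rule psesI[OF S P]) (use T(2) in auto)
    moreover have "left_module R ?K" by (rule sesD(1)[OF S])
    moreover have "\<forall>Z\<in>insert P {Z'. perp R Z'}. perp R Z" using perp_projective[OF P] by simp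
    ultimately show ?case using T(1) by blast
  qed
qed

text \<open>Unfolding \<open>perp\<close> yields some projective cover; the case of a single module
  in \<open>through_syzygy\<close> shows that any other cover does as well.\<close>

lemma perp_cover:
  assumes "perp R G" "ses R K P G i p" "projective R P" "fin_gen R P"
  shows "pses R K P G i p" "perp R K"
proof -
  have t: "through R {G} G G (\<lambda>x. x)"
    using through_single[of G "{G}", OF _ hom_id hom_id perp_module[OF assms(1)]] by simp
  have Zs: "perp R Z" if "Z \<in> {G}" for Z using that assms(1) by simp
  note T = through_syzygy[OF assms(2,3) perp_syzygy_data[OF Zs] projective_module t, simplified]
  show "pses R K P G i p" by (rule psesI[OF assms(2-4)]) (use T(2) in auto)
  show "perp R K"
    by (rule perp_through[OF T(1) sesD(1)[OF assms(2)]]) (use perp_projective[OF assms(3,4)] in auto)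
qed

text \<open>The hypothesis on \<open>L\<close> is $\mathrm{Ext}^1(G, L) = 0$.\<close>

lemma lift_of_extension:
  fixes L W X :: "'r umodule"
  assumes S: "ses R K P G i p" and P: "projective R P"
    and ext: "\<And>f. f \<in> mod_hom R K L \<Longrightarrow> \<exists>g\<in>mod_hom R P L. \<forall>x\<in>carrier K. g (i x) = f x"
    and T: "ses R L W X l w" and g: "g \<in> mod_hom R G X"
  obtains u where "u \<in> mod_hom R G W" "\<And>x. x \<in> carrier G \<Longrightarrow> w (u x) = g x"
proof -
  note D = sesD[OF S] and E = sesD[OF T]
  obtain a where a: "a \<in> mod_hom R P W" "\<And>x. x \<in> carrier P \<Longrightarrow> w (a x) = g (p x)"
    by (rule projective_lift_ses[OF P T hom_comp[OF D(5) g]]) (rule that)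
  have "w (a (i x)) = \<zero>\<^bsub>X\<^esub>" if "x \<in> carrier K" for x
    using a(2)[OF hom_in[OF D(4) that]] D(9)[OF that] hom_simps(4)[OF D(3) E(3) g] by simp
  then obtain b where b: "b \<in> mod_hom R K L" "\<And>x. x \<in> carrier K \<Longrightarrow> l (b x) = a (i x)"
    by (rule ses_lift[OF T D(1) hom_comp[OF D(4) a(1)]]) (assumption, rule that)
  obtain c where c: "c \<in> mod_hom R P L" "\<And>x. x \<in> carrier K \<Longrightarrow> c (i x) = b x" using ext[OF b(1)] by auto
  \<comment> \<open>The lift \<open>a\<close> may fail to vanish on the kernel. Its restriction
    there lands in \<open>L\<close> as \<open>b\<close>, and subtracting an extension
    \<open>c\<close> of \<open>b\<close> makes the map descend to \<open>G\<close> without changing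
    its image in \<open>X\<close>.\<close>
  let ?h = "\<lambda>x. a x \<oplus>\<^bsub>W\<^esub> \<ominus>\<^bsub>W\<^esub> l (c x)"
  have h: "?h \<in> mod_hom R P W" by (rule hom_diff[OF D(2) E(2) a(1) hom_comp[OF c(1) E(4)]])
  have "?h (i x) = \<zero>\<^bsub>W\<^esub>" if "x \<in> carrier K" for x
    using c(2)[OF that] b(2)[OF that] hom_in[OF a(1) hom_in[OF D(4) that]] by (simp add: mod_simps(8)[OF E(2)])
  then obtain u where u: "u \<in> mod_hom R G W" "\<And>x. x \<in> carrier P \<Longrightarrow> u (p x) = ?h x"
    by (rule ses_desc[OF S E(2) h]) (assumption, rule that)
  have "w (u x) = g x" if x: "x \<in> carrier G" for x
  proof -
    obtain y where y: "y \<in> carrier P" "p y = x" by (rule ses_epiE[OF S x]) (rule that)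
    have "w (u (p y)) = w (a y) \<oplus>\<^bsub>X\<^esub> \<ominus>\<^bsub>X\<^esub> w (l (c y))"
      using y(1) hom_in[OF a(1) y(1)] hom_in[OF E(4) hom_in[OF c(1) y(1)]]
      by (simp add: u(2) hom_simps(2,5)[OF E(2,3,5)] mod_simps(3)[OF E(2)])
    also have "\<dots> = g x"
      using y a(2)[OF y(1)] E(9)[OF hom_in[OF c(1) y(1)]] hom_in[OF g x] by (simp add: mod_simps(6,15)[OF E(3)])
    finally show ?thesis using y(2) by simp
  qed
  then show ?thesis by (rule that[OF u(1)])
qed

text \<open>Dimension shifting along a resolution of \<open>L\<close>. A map from \<open>K\<close>
  to \<open>L\<close> lifts to the cover \<open>P0\<close> of \<open>L\<close>, since the syzygy of
  \<open>L\<close> has one term less and \<open>K\<close> is in \<open>perp\<close> too; the lift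
  extends to \<open>P\<close> because \<open>P0\<close> is projective.\<close>

lemma perp_extend_pdl:
  fixes L :: "'r umodule"
  assumes "pdl R k L" "perp R G" "pses R K P G i p" "f \<in> mod_hom R K L"
  shows "\<exists>g\<in>mod_hom R P L. \<forall>x\<in>carrier K. g (i x) = f x"
  using assms
proof (induction arbitrary: G K P i p f rule: pdl.induct)
  case (zero L)
  have "f x = \<zero>\<^bsub>L\<^esub>" if "x \<in> carrier K" for x using hom_in[OF zero(5) that] zero(2) by simp
  then show ?case by (intro bexI[OF _ hom_zero[OF zero(1)]]) simp
next
  case (suc L1 P0 L i0 p0 k)
  have K: "perp R K" using perp_cover(2)[OF suc(6) psesD[OF suc(7)]] .
  obtain K1 P1 i1 p1 where S1: "pses R K1 P1 K i1 p1" "perp R K1" by (rule perpE[OF K]) (rule that)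
  obtain f' where f': "f' \<in> mod_hom R K P0" "\<And>x. x \<in> carrier K \<Longrightarrow> p0 (f' x) = f x"
    by (rule lift_of_extension[OF psesD(1,2)[OF S1(1)] suc(5)[OF K S1(1)] suc(1) suc(8)]) (assumption, rule that)
  obtain g where g: "g \<in> mod_hom R P P0" "\<And>x. x \<in> carrier K \<Longrightarrow> g (i x) = f' x"
    by (rule pses_extend[OF suc(7,2,3) f'(1)]) (rule that)
  show ?case
    by (rule bexI[OF _ hom_comp[OF g(1) sesD(5)[OF suc(1)]]]) (simp add: f' g)
qed

text \<open>Thus an epimorphism whose kernel has finite projective dimension behaves as a precover
  with respect to all modules in \<open>perp\<close>.\<close>

lemma perp_lift_pdl:
  fixes L W X :: "'r umodule"
  assumes "perp R G" "pdl R k L" "ses R L W X l w" "g \<in> mod_hom R G X"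
  obtains u where "u \<in> mod_hom R G W" "\<And>x. x \<in> carrier G \<Longrightarrow> w (u x) = g x"
proof -
  obtain K P i p where S: "pses R K P G i p" "perp R K" by (rule perpE[OF assms(1)]) (rule that)
  show ?thesis
    by (rule lift_of_extension[OF psesD(1,2)[OF S(1)] perp_extend_pdl[OF assms(2,1) S(1)] assms(3,4)])
      (assumption, rule that)
qed

text \<open>The definition of \<open>pses\<close> gives extension along one sequence only. Writing
  \<open>Y\<close> as a quotient of \<open>P\<close> plus \<open>X\<close>, with \<open>P\<close> a
  cover of \<open>Z\<close>, transfers it to any sequence ending in \<open>Z\<close>.\<close>

lemma perp_extend:
  fixes X Y Z Q :: "'r umodule"
  assumes "perp R Z" "ses R X Y Z i p" "projective R Q" "fin_gen R Q" "f \<in> mod_hom R X Q"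
  obtains g where "g \<in> mod_hom R Y Q" "\<And>x. x \<in> carrier X \<Longrightarrow> g (i x) = f x"
proof -
  note D = sesD[OF assms(2)] and Q = projective_module[OF assms(3)]
  obtain K P k q where S: "pses R K P Z k q" by (rule perpE[OF assms(1)]) (rule that)
  note E = sesD[OF psesD(1)[OF S]]
  obtain l where l: "l \<in> mod_hom R P Y" "\<And>x. x \<in> carrier P \<Longrightarrow> p (l x) = q x"
    by (rule projective_lift_ses[OF psesD(2)[OF S] assms(2) E(5)]) (rule that)
  have "p (l (k x)) = \<zero>\<^bsub>Z\<^esub>" if "x \<in> carrier K" for x
    using l(2)[OF hom_in[OF E(4) that]] E(9)[OF that] by simp
  then obtain m where m: "m \<in> mod_hom R K X" "\<And>x. x \<in> carrier K \<Longrightarrow> i (m x) = l (k x)"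
    by (rule ses_lift[OF assms(2) E(1) hom_comp[OF E(4) l(1)]]) (assumption, rule that)
  obtain g where g: "g \<in> mod_hom R P Q" "\<And>x. x \<in> carrier K \<Longrightarrow> g (k x) = f (m x)"
    by (rule pses_extend[OF S assms(3,4) hom_comp[OF m(1) assms(5)]]) (rule that)
  let ?D = "prod_module P X"
  have PX: "left_module R ?D" by (rule left_module_prod[OF E(2) D(1)])
  let ?s = "\<lambda>a. l (fst a) \<oplus>\<^bsub>Y\<^esub> i (snd a)" and ?t = "\<lambda>a. g (fst a) \<oplus>\<^bsub>Q\<^esub> f (snd a)"
  have fs: "fst \<in> mod_hom R ?D P" "snd \<in> mod_hom R ?D X" by (auto intro!: mod_homI)
  have s: "?s \<in> mod_hom R ?D Y" by (rule hom_add[OF PX D(2) hom_comp[OF fs(1) l(1)] hom_comp[OF fs(2) D(4)]])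
  have t: "?t \<in> mod_hom R ?D Q" by (rule hom_add[OF PX Q hom_comp[OF fs(1) g(1)] hom_comp[OF fs(2) assms(5)]])
  have surj: "?s ` carrier ?D = carrier Y"
  proof
    show "carrier Y \<subseteq> ?s ` carrier ?D"
    proof
      fix y assume y: "y \<in> carrier Y"
      obtain a where a: "a \<in> carrier P" "q a = p y" by (rule ses_epiE[OF psesD(1)[OF S] hom_in[OF D(5) y]]) (rule that)
      have la: "l a \<in> carrier Y" by (rule hom_in[OF l(1) a(1)])
      have "p (y \<oplus>\<^bsub>Y\<^esub> \<ominus>\<^bsub>Y\<^esub> l a) = \<zero>\<^bsub>Z\<^esub>"
        using y la a l(2)[OF a(1)] hom_in[OF D(5) y]
        by (simp add: hom_simps(2,5)[OF D(2,3,5)] mod_simps(3)[OF D(2)] mod_simps(8)[OF D(3)])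
      then obtain x where x: "x \<in> carrier X" "i x = y \<oplus>\<^bsub>Y\<^esub> \<ominus>\<^bsub>Y\<^esub> l a"
        using ses_kernelE[OF assms(2) mod_simps(2)[OF D(2) y mod_simps(3)[OF D(2) la]]] by metis
      have "y = ?s (a, x)" using x la y by (simp add: mod_simps(11)[OF D(2)])
      then show "y \<in> ?s ` carrier ?D" using a(1) x(1) by (intro image_eqI) auto
    qed
  qed (use hom_in[OF s] in blast)
  \<comment> \<open>An element of the kernel of \<open>?s\<close> has its first entry in the syzygy
    \<open>K\<close>, and \<open>m\<close> turns the relation in \<open>Y\<close> into one in
    \<open>X\<close>; both summands of \<open>?t\<close> are then values of \<open>f\<close> whose
    arguments cancel.\<close>
  have ker: "?t a = \<zero>\<^bsub>Q\<^esub>" if a: "a \<in> carrier ?D" "?s a = \<zero>\<^bsub>Y\<^esub>" for a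
  proof -
    have ac: "fst a \<in> carrier P" "snd a \<in> carrier X" using a(1) by auto
    have ly: "l (fst a) \<in> carrier Y" "i (snd a) \<in> carrier Y" using ac hom_in[OF l(1)] hom_in[OF D(4)] by auto
    have "p (?s a) = q (fst a)"
      using ac ly hom_in[OF E(5) ac(1)] by (simp add: hom_simps(2)[OF D(2,3,5)] l(2) D(9) mod_simps(6)[OF D(3)])
    then have "q (fst a) = \<zero>\<^bsub>Z\<^esub>" using a(2) hom_simps(4)[OF D(2,3,5)] by simp
    then obtain x where x: "x \<in> carrier K" "k x = fst a" by (rule ses_kernelE[OF psesD(1)[OF S] ac(1)]) (rule that)
    have mx: "m x \<in> carrier X" by (rule hom_in[OF m(1) x(1)])
    have "i (m x \<oplus>\<^bsub>X\<^esub> snd a) = \<zero>\<^bsub>Y\<^esub>" using a(2) x mx ac by (simp add: hom_simps(2)[OF D(1,2,4)] m(2))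
    then have "m x \<oplus>\<^bsub>X\<^esub> snd a = \<zero>\<^bsub>X\<^esub>" by (rule ses_inj[OF assms(2) mod_simps(2)[OF D(1) mx ac(2)]])
    moreover have "?t a = f (m x \<oplus>\<^bsub>X\<^esub> snd a)"
      using mx ac g(2)[OF x(1)] x(2) by (simp add: hom_simps(2)[OF D(1) Q assms(5)])
    ultimately show ?thesis using hom_simps(4)[OF D(1) Q assms(5)] by simp
  qed
  obtain h where h: "h \<in> mod_hom R Y Q" "\<And>a. a \<in> carrier ?D \<Longrightarrow> h (?s a) = ?t a"
    by (rule factor_epi[OF PX D(2) Q s surj t ker]) (assumption, assumption, rule that)
  have "h (i x) = f x" if x: "x \<in> carrier X" for x
    using h(2)[of "(\<zero>\<^bsub>P\<^esub>, x)"] x hom_in[OF D(4) x] hom_in[OF assms(5) x] hom_simps(4)[OF E(2) D(2) l(1)]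
      hom_simps(4)[OF E(2) Q g(1)] by (simp add: mod_simps(1)[OF E(2)] mod_simps(5)[OF D(2)] mod_simps(5)[OF Q])
  then show ?thesis by (rule that[OF h(1)])
qed

text \<open>The horseshoe lemma, one step at a time: the sum of covers of the two ends covers the
  middle term, and the kernels again form a short exact sequence of the same kind, which closes the
  coinduction.\<close>

lemma perp_extension:
  fixes R :: "('r, 'x) ring_scheme" and X Y Z :: "'r umodule"
  assumes "ses R X Y Z i p" "perp R X" "perp R Z"
  shows "perp R Y"
proof -
  have "\<exists>X Z i p. ses R X Y Z i p \<and> perp R X \<and> perp R Z" using assms by blast
  then show ?thesis
  proof (coinduction arbitrary: Y rule: perp.coinduct)
    case (perp Y)
    then obtain X Z :: "'r umodule" and i p where S: "ses R X Y Z i p" and X: "perp R X" and Z: "perp R Z" by blast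
    note D = sesD[OF S]
    obtain Kx Px ix px where Sx: "pses R Kx Px X ix px" "perp R Kx" by (rule perpE[OF X]) (rule that)
    obtain Kz Pz iz pz where Sz: "pses R Kz Pz Z iz pz" "perp R Kz" by (rule perpE[OF Z]) (rule that)
    note Dx = sesD[OF psesD(1)[OF Sx(1)]] and Dz = sesD[OF psesD(1)[OF Sz(1)]]
    obtain P :: "'r umodule" and a b c d where P: "biprod R Px Pz P a b c d" "fin_gen R P"
      by (rule biprod_exists[OF Dx(2) Dz(2) psesD(3)[OF Sx(1)] psesD(3)[OF Sz(1)]]) (rule that)
    note B = biprodD[OF P(1)]
    have Pp: "projective R P" by (rule projective_biprod[OF P(1) psesD(2)[OF Sx(1)] psesD(2)[OF Sz(1)]])
    obtain l where l: "l \<in> mod_hom R Pz Y" "\<And>x. x \<in> carrier Pz \<Longrightarrow> p (l x) = pz x"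
      by (rule projective_lift_ses[OF psesD(2)[OF Sz(1)] S Dz(5)]) (rule that)
    let ?q = "\<lambda>w. i (px (c w)) \<oplus>\<^bsub>Y\<^esub> l (d w)"
    have q: "?q \<in> mod_hom R P Y" by (rule biprod_copair[OF P(1) D(2) hom_comp[OF Dx(5) D(4)] l(1)])
    have pq: "p (?q w) = pz (d w)" if w: "w \<in> carrier P" for w
    proof -
      have x: "px (c w) \<in> carrier X" using hom_in[OF Dx(5) hom_in[OF B(6) w]] .
      have "p (?q w) = p (i (px (c w))) \<oplus>\<^bsub>Z\<^esub> p (l (d w))"
        using hom_in[OF D(4) x] hom_in[OF l(1) hom_in[OF B(7) w]] by (rule hom_simps(2)[OF D(2,3,5)])
      then show ?thesis
        using D(9)[OF x] l(2)[OF hom_in[OF B(7) w]] hom_in[OF Dz(5) hom_in[OF B(7) w]] by (simp add: mod_simps(5)[OF D(3)])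
    qed
    have surj: "\<exists>w\<in>carrier P. ?q w = y" if y: "y \<in> carrier Y" for y
    proof -
      obtain u where u: "u \<in> carrier Pz" "pz u = p y" by (rule ses_epiE[OF psesD(1)[OF Sz(1)] hom_in[OF D(5) y]]) (rule that)
      have lu: "l u \<in> carrier Y" by (rule hom_in[OF l(1) u(1)])
      have yl: "y \<oplus>\<^bsub>Y\<^esub> \<ominus>\<^bsub>Y\<^esub> l u \<in> carrier Y" using y lu by (simp add: mod_simps(2,3)[OF D(2)])
      have "p (y \<oplus>\<^bsub>Y\<^esub> \<ominus>\<^bsub>Y\<^esub> l u) = \<zero>\<^bsub>Z\<^esub>"
        using y lu l(2)[OF u(1)] u(2) hom_in[OF D(5) y]
        by (simp add: hom_simps(2,5)[OF D(2,3,5)] mod_simps(3)[OF D(2)] mod_simps(8)[OF D(3)])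
      then obtain x where x: "x \<in> carrier X" "i x = y \<oplus>\<^bsub>Y\<^esub> \<ominus>\<^bsub>Y\<^esub> l u" by (rule ses_kernelE[OF S yl]) (rule that)
      obtain v where v: "v \<in> carrier Px" "px v = x" by (rule ses_epiE[OF psesD(1)[OF Sx(1)] x(1)]) (rule that)
      obtain w where w: "w \<in> carrier P" "c w = v" "d w = u" by (rule biprod_elem[OF P(1) v(1) u(1)]) (rule that)
      have "?q w = y" using w v x(2) y lu by (simp add: mod_simps(3,6,7,16)[OF D(2)])
      then show ?thesis using w(1) by blast
    qed
    have "?q ` carrier P = carrier Y" using surj hom_in[OF q] by (auto simp: image_iff)
    then have S': "ses R (P\<lparr>carrier := {y \<in> carrier P. ?q y = \<zero>\<^bsub>Y\<^esub>}\<rparr>) P Y (\<lambda>x. x) ?q" (is "ses R ?K _ _ _ _")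
      by (rule ses_kernel[OF B(3) D(2) q])
    note D' = sesD[OF S']
    have Kin: "w \<in> carrier P" "?q w = \<zero>\<^bsub>Y\<^esub>" if "w \<in> carrier ?K" for w using that by auto
    have "pz (d w) = \<zero>\<^bsub>Z\<^esub>" if "w \<in> carrier ?K" for w
      using pq[OF Kin(1)[OF that]] Kin(2)[OF that] hom_simps(4)[OF D(2,3,5)] by simp
    then obtain \<beta> where \<beta>: "\<beta> \<in> mod_hom R ?K Kz" "\<And>w. w \<in> carrier ?K \<Longrightarrow> iz (\<beta> w) = d w"
      by (rule ses_lift[OF psesD(1)[OF Sz(1)] D'(1) hom_comp[OF D'(4) B(7)]]) (assumption, rule that)
    let ?\<alpha> = "\<lambda>k. a (ix k)"
    have qa: "?q (a v) = i (px v)" if v: "v \<in> carrier Px" for v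
      using v hom_in[OF D(4) hom_in[OF Dx(5) v]] by (simp add: B(8,9) hom_simps(4)[OF Dz(2) D(2) l(1)] mod_simps(6)[OF D(2)])
    have "?q (?\<alpha> k) = \<zero>\<^bsub>Y\<^esub>" if "k \<in> carrier Kx" for k
      using qa[OF hom_in[OF Dx(4) that]] Dx(9)[OF that] hom_simps(4)[OF D(1,2,4)] by simp
    then have \<alpha>: "?\<alpha> \<in> mod_hom R Kx ?K"
      using hom_in[OF hom_comp[OF Dx(4) B(4)]] by (intro hom_sub_cod[OF hom_comp[OF Dx(4) B(4)]]) auto
    have SK: "ses R Kx ?K Kz ?\<alpha> \<beta>"
    proof (rule sesI[OF Dx(1) D'(1) Dz(1) \<alpha> \<beta>(1)])
      show "k = \<zero>\<^bsub>Kx\<^esub>" if "k \<in> carrier Kx" "?\<alpha> k = \<zero>\<^bsub>?K\<^esub>" for k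
      proof -
        have "ix k = \<zero>\<^bsub>Px\<^esub>" using B(8)[OF hom_in[OF Dx(4) that(1)]] that(2) hom_simps(4)[OF B(3,1,6)] by simp
        then show ?thesis by (rule ses_inj[OF psesD(1)[OF Sx(1)] that(1)])
      qed
      show "\<beta> (?\<alpha> k) = \<zero>\<^bsub>Kz\<^esub>" if k: "k \<in> carrier Kx" for k
      proof -
        have "iz (\<beta> (?\<alpha> k)) = \<zero>\<^bsub>Pz\<^esub>" using \<beta>(2)[OF hom_in[OF \<alpha> k]] B(9)[OF hom_in[OF Dx(4) k]] by simp
        then show ?thesis by (rule ses_inj[OF psesD(1)[OF Sz(1)] hom_in[OF \<beta>(1) hom_in[OF \<alpha> k]]])
      qed
      show "\<exists>k\<in>carrier Kx. ?\<alpha> k = w" if w: "w \<in> carrier ?K" "\<beta> w = \<zero>\<^bsub>Kz\<^esub>" for w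
      proof -
        have cw: "c w \<in> carrier Px" "px (c w) \<in> carrier X" using hom_in[OF B(6) Kin(1)[OF w(1)]] hom_in[OF Dx(5)] by auto
        have dw: "d w = \<zero>\<^bsub>Pz\<^esub>" using \<beta>(2)[OF w(1)] w(2) hom_simps(4)[OF Dz(1,2,4)] by simp
        have "i (px (c w)) = \<zero>\<^bsub>Y\<^esub>"
          using Kin(2)[OF w(1)] dw hom_in[OF D(4) cw(2)] by (simp add: hom_simps(4)[OF Dz(2) D(2) l(1)] mod_simps(6)[OF D(2)])
        then have "px (c w) = \<zero>\<^bsub>X\<^esub>" by (rule ses_inj[OF S cw(2)])
        then obtain k where k: "k \<in> carrier Kx" "ix k = c w" by (rule ses_kernelE[OF psesD(1)[OF Sx(1)] cw(1)]) (rule that)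
        have "a (ix k) = w"
          using B(12)[OF Kin(1)[OF w(1)]] dw k hom_in[OF B(4) cw(1)] by (simp add: hom_simps(4)[OF B(2,3,5)] mod_simps(6)[OF B(3)])
        then show ?thesis using k(1) by blast
      qed
      show "\<exists>w\<in>carrier ?K. \<beta> w = z" if z: "z \<in> carrier Kz" for z
      proof -
        have u: "iz z \<in> carrier Pz" by (rule hom_in[OF Dz(4) z])
        have lu: "l (iz z) \<in> carrier Y" by (rule hom_in[OF l(1) u])
        have "p (l (iz z)) = \<zero>\<^bsub>Z\<^esub>" using l(2)[OF u] Dz(9)[OF z] by simp
        then obtain x where x: "x \<in> carrier X" "i x = l (iz z)" by (rule ses_kernelE[OF S lu]) (rule that)
        obtain v where v: "v \<in> carrier Px" "px v = x" by (rule ses_epiE[OF psesD(1)[OF Sx(1)] x(1)]) (rule that)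
        \<comment> \<open>The entry from \<open>Px\<close> must cancel the image in \<open>Y\<close>
          of the entry from \<open>Pz\<close>, hence the sign.\<close>
        obtain w where w: "w \<in> carrier P" "c w = \<ominus>\<^bsub>Px\<^esub> v" "d w = iz z"
          by (rule biprod_elem[OF P(1) mod_simps(3)[OF Dx(2) v(1)] u]) (rule that)
        have "?q w = \<zero>\<^bsub>Y\<^esub>" using w v x lu
          by (simp add: hom_simps(5)[OF Dx(2) D(1) Dx(5)] hom_simps(5)[OF D(1,2,4)] mod_simps(7)[OF D(2)])
        then have wK: "w \<in> carrier ?K" using w(1) by simp
        have "\<beta> w = z" using \<beta>(2)[OF wK] w(3) inj_onD[OF Dz(6) _ hom_in[OF \<beta>(1) wK] z] by simp
        then show ?thesis using wK by blast
      qed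
    qed
    have "pses R ?K P Y (\<lambda>x. x) ?q"
    proof (rule psesI[OF S' Pp P(2)])
      fix Q :: "'r umodule" and f
      assume Q: "projective R Q" "fin_gen R Q" and f: "f \<in> mod_hom R ?K Q"
      note Qm = projective_module[OF Q(1)]
      obtain g1 where g1: "g1 \<in> mod_hom R Px Q" "\<And>x. x \<in> carrier Kx \<Longrightarrow> g1 (ix x) = f (?\<alpha> x)"
        by (rule pses_extend[OF Sx(1) Q hom_comp[OF \<alpha> f]]) (rule that)
      have g1c: "(\<lambda>w. g1 (c w)) \<in> mod_hom R ?K Q" by (rule hom_comp[OF hom_comp[OF D'(4) B(6)] g1(1)])
      \<comment> \<open>Extending the part on \<open>Kx\<close> first leaves a difference that
        vanishes there and descends to \<open>Kz\<close>, where it is extended separately.\<close>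
      let ?h = "\<lambda>w. f w \<oplus>\<^bsub>Q\<^esub> \<ominus>\<^bsub>Q\<^esub> g1 (c w)"
      have h: "?h \<in> mod_hom R ?K Q" by (rule hom_diff[OF D'(1) Qm f g1c])
      have "?h (?\<alpha> x) = \<zero>\<^bsub>Q\<^esub>" if "x \<in> carrier Kx" for x
        using g1(2)[OF that] B(8)[OF hom_in[OF Dx(4) that]] hom_in[OF f hom_in[OF \<alpha> that]] by (simp add: mod_simps(8)[OF Qm])
      then obtain t where t: "t \<in> mod_hom R Kz Q" "\<And>w. w \<in> carrier ?K \<Longrightarrow> t (\<beta> w) = ?h w"
        by (rule ses_desc[OF SK Qm h]) (assumption, rule that)
      obtain g2 where g2: "g2 \<in> mod_hom R Pz Q" "\<And>x. x \<in> carrier Kz \<Longrightarrow> g2 (iz x) = t x"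
        by (rule pses_extend[OF Sz(1) Q t(1)]) (rule that)
      have "g1 (c w) \<oplus>\<^bsub>Q\<^esub> g2 (d w) = f w" if w: "w \<in> carrier ?K" for w
      proof -
        have "g2 (d w) = ?h w" using g2(2)[OF hom_in[OF \<beta>(1) w]] \<beta>(2)[OF w] t(2)[OF w] by simp
        then show ?thesis using hom_in[OF g1c w] hom_in[OF f w] by (simp add: mod_simps(11)[OF Qm])
      qed
      then show "\<exists>g\<in>mod_hom R P Q. \<forall>w\<in>carrier ?K. g w = f w"
        by (intro bexI[OF _ biprod_copair[OF P(1) Qm g1(1) g2(1)]] ballI)
    qed
    then show ?case using SK Sx(2) Sz(2) by blast
  qed
qed

text \<open>
  Gorenstein projective modules of the universe, with the totally acyclic complex broken up into
  short exact sequences: \<open>perp\<close> provides the left half, the rule unfolds the right half.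
\<close>

coinductive gp :: "('r, 'x) ring_scheme \<Rightarrow> 'r umodule \<Rightarrow> bool" for R :: "('r, 'x) ring_scheme" where
  step: "perp R G \<Longrightarrow> pses R G P G' i p \<Longrightarrow> gp R G' \<Longrightarrow> gp R G"

lemma gpE:
  assumes "gp R G"
  obtains P G' i p where "pses R G P G' i p" "gp R G'"
  using assms by cases (rule that)

lemma gp_perp: "gp R G \<Longrightarrow> perp R G"
  by (erule gp.cases) simp

lemma gp_module: "gp R G \<Longrightarrow> left_module R G"
  using gp_perp perp_module by blast

lemma gp_fin_gen: "gp R G \<Longrightarrow> fin_gen R G"
  using gp_perp perp_fin_gen by blast

text \<open>The dual horseshoe lemma. The middle term is embedded into the sum of the two
  projectives, and the cokernels of the three embeddings form a short exact sequence of the same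
  kind.\<close>

lemma gp_extension:
  fixes R :: "('r, 'x) ring_scheme" and X Y Z :: "'r umodule"
  assumes "ses R X Y Z i p" "gp R X" "gp R Z"
  shows "gp R Y"
proof -
  have "\<exists>X Z i p. ses R X Y Z i p \<and> gp R X \<and> gp R Z" using assms by blast
  then show ?thesis
  proof (coinduction arbitrary: Y rule: gp.coinduct)
    case (gp Y)
    then obtain X Z :: "'r umodule" and i p where S: "ses R X Y Z i p" and X: "gp R X" and Z: "gp R Z" by blast
    note D = sesD[OF S]
    have Y: "perp R Y" by (rule perp_extension[OF S gp_perp[OF X] gp_perp[OF Z]])
    obtain Px X' ix px where Sx: "pses R X Px X' ix px" "gp R X'" by (rule gpE[OF X]) (rule that)
    obtain Pz Z' iz pz where Sz: "pses R Z Pz Z' iz pz" "gp R Z'" by (rule gpE[OF Z]) (rule that)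
    note Dx = sesD[OF psesD(1)[OF Sx(1)]] and Dz = sesD[OF psesD(1)[OF Sz(1)]]
    obtain P :: "'r umodule" and a b c d where P: "biprod R Px Pz P a b c d" "fin_gen R P"
      by (rule biprod_exists[OF Dx(2) Dz(2) psesD(3)[OF Sx(1)] psesD(3)[OF Sz(1)]]) (rule that)
    note B = biprodD[OF P(1)]
    have Pp: "projective R P" by (rule projective_biprod[OF P(1) psesD(2)[OF Sx(1)] psesD(2)[OF Sz(1)]])
    \<comment> \<open>Extending the embedding of \<open>X\<close> over \<open>Y\<close> is where
      Ext^1(Z, Px) = 0 enters.\<close>
    obtain \<alpha> where \<alpha>: "\<alpha> \<in> mod_hom R Y Px" "\<And>x. x \<in> carrier X \<Longrightarrow> \<alpha> (i x) = ix x"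
      by (rule perp_extend[OF gp_perp[OF Z] S psesD(2,3)[OF Sx(1)] Dx(4)]) (rule that)
    obtain j where j: "j \<in> mod_hom R Y P" "\<And>y. y \<in> carrier Y \<Longrightarrow> c (j y) = \<alpha> y" "\<And>y. y \<in> carrier Y \<Longrightarrow> d (j y) = iz (p y)"
      by (rule biprod_pair[OF P(1) D(2) \<alpha>(1) hom_comp[OF D(5) Dz(4)]]) (rule that)
    have kerd: "\<exists>x\<in>carrier X. i x = y" if y: "y \<in> carrier Y" "d (j y) = \<zero>\<^bsub>Pz\<^esub>" for y
    proof -
      have "p y = \<zero>\<^bsub>Z\<^esub>" using j(3)[OF y(1)] y(2) ses_inj[OF psesD(1)[OF Sz(1)] hom_in[OF D(5) y(1)]] by simp
      then show ?thesis using ses_kernelE[OF S y(1)] by metis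
    qed
    have "inj_on j (carrier Y)"
    proof (rule hom_inj[OF D(2) B(3) j(1)])
      fix y assume y: "y \<in> carrier Y" "j y = \<zero>\<^bsub>P\<^esub>"
      then have "d (j y) = \<zero>\<^bsub>Pz\<^esub>" using hom_simps(4)[OF B(3,2,7)] by simp
      then obtain x where x: "x \<in> carrier X" "i x = y" using kerd[OF y(1)] by auto
      have "ix x = \<zero>\<^bsub>Px\<^esub>" using \<alpha>(2)[OF x(1)] x(2) j(2)[OF y(1)] y(2) hom_simps(4)[OF B(3,1,6)] by simp
      then have "x = \<zero>\<^bsub>X\<^esub>" by (rule ses_inj[OF psesD(1)[OF Sx(1)] x(1)])
      then show "y = \<zero>\<^bsub>Y\<^esub>" using x(2) hom_simps(4)[OF D(1,2,4)] by simp
    qed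
    then obtain Y' :: "'r umodule" and q where S': "ses R Y P Y' j q"
      by (rule ses_quotient[OF D(2) B(3) j(1)]) (rule that)
    note D' = sesD[OF S']
    have aj: "a (ix x) = j (i x)" if x: "x \<in> carrier X" for x
    proof -
      have y: "i x \<in> carrier Y" by (rule hom_in[OF D(4) x])
      have "d (j (i x)) = \<zero>\<^bsub>Pz\<^esub>" using j(3)[OF y] D(9)[OF x] hom_simps(4)[OF Dz(1,2,4)] by simp
      then show ?thesis
        using B(12)[OF hom_in[OF j(1) y]] j(2)[OF y] \<alpha>(2)[OF x] hom_in[OF B(4) hom_in[OF Dx(4) x]]
        by (simp add: hom_simps(4)[OF B(2,3,5)] mod_simps(6)[OF B(3)])
    qed
    have "q (a (ix x)) = \<zero>\<^bsub>Y'\<^esub>" if "x \<in> carrier X" for x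
      using aj[OF that] D'(9)[OF hom_in[OF D(4) that]] by simp
    then obtain \<mu> where \<mu>: "\<mu> \<in> mod_hom R X' Y'" "\<And>u. u \<in> carrier Px \<Longrightarrow> \<mu> (px u) = q (a u)"
      by (rule ses_desc[OF psesD(1)[OF Sx(1)] D'(3) hom_comp[OF B(4) D'(5)]]) (assumption, rule that)
    have "pz (d (j y)) = \<zero>\<^bsub>Z'\<^esub>" if "y \<in> carrier Y" for y using j(3)[OF that] Dz(9)[OF hom_in[OF D(5) that]] by simp
    then obtain \<nu> where \<nu>: "\<nu> \<in> mod_hom R Y' Z'" "\<And>w. w \<in> carrier P \<Longrightarrow> \<nu> (q w) = pz (d w)"
      by (rule ses_desc[OF S' Dz(3) hom_comp[OF B(7) Dz(5)]]) (assumption, rule that)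
    have SY: "ses R X' Y' Z' \<mu> \<nu>"
    proof (rule sesI[OF Dx(3) D'(3) Dz(3) \<mu>(1) \<nu>(1)])
      show "x = \<zero>\<^bsub>X'\<^esub>" if x: "x \<in> carrier X'" "\<mu> x = \<zero>\<^bsub>Y'\<^esub>" for x
      proof -
        obtain u where u: "u \<in> carrier Px" "px u = x" by (rule ses_epiE[OF psesD(1)[OF Sx(1)] x(1)]) (rule that)
        have "q (a u) = \<zero>\<^bsub>Y'\<^esub>" using \<mu>(2)[OF u(1)] u(2) x(2) by simp
        then obtain y where y: "y \<in> carrier Y" "j y = a u" by (rule ses_kernelE[OF S' hom_in[OF B(4) u(1)]]) (rule that)
        obtain x' where x': "x' \<in> carrier X" "i x' = y" using kerd[OF y(1)] y(2) B(9)[OF u(1)] by auto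
        have "u = ix x'" using j(2)[OF y(1)] y(2) B(8)[OF u(1)] \<alpha>(2)[OF x'(1)] x'(2) by simp
        then show ?thesis using Dx(9)[OF x'(1)] u(2) by simp
      qed
      show "\<nu> (\<mu> x) = \<zero>\<^bsub>Z'\<^esub>" if x: "x \<in> carrier X'" for x
      proof -
        obtain u where u: "u \<in> carrier Px" "px u = x" by (rule ses_epiE[OF psesD(1)[OF Sx(1)] x]) (rule that)
        show ?thesis
          using \<mu>(2)[OF u(1)] u(2) \<nu>(2)[OF hom_in[OF B(4) u(1)]] B(9)[OF u(1)] hom_simps(4)[OF Dz(2,3,5)] by simp
      qed
      show "\<exists>x\<in>carrier X'. \<mu> x = y'" if y': "y' \<in> carrier Y'" "\<nu> y' = \<zero>\<^bsub>Z'\<^esub>" for y'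
      proof -
        obtain w where w: "w \<in> carrier P" "q w = y'" by (rule ses_epiE[OF S' y'(1)]) (rule that)
        have dw: "d w \<in> carrier Pz" by (rule hom_in[OF B(7) w(1)])
        have "pz (d w) = \<zero>\<^bsub>Z'\<^esub>" using \<nu>(2)[OF w(1)] w(2) y'(2) by simp
        then obtain z where z: "z \<in> carrier Z" "iz z = d w" by (rule ses_kernelE[OF psesD(1)[OF Sz(1)] dw]) (rule that)
        obtain y where y: "y \<in> carrier Y" "p y = z" by (rule ses_epiE[OF S z(1)]) (rule that)
        have jy: "j y \<in> carrier P" by (rule hom_in[OF j(1) y(1)])
        let ?v = "w \<oplus>\<^bsub>P\<^esub> \<ominus>\<^bsub>P\<^esub> j y"
        have v: "?v \<in> carrier P" using w(1) jy by (simp add: mod_simps(2,3)[OF B(3)])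
        have "d ?v = \<zero>\<^bsub>Pz\<^esub>" using w(1) jy j(3)[OF y(1)] y(2) z(2) dw
          by (simp add: hom_simps(2,5)[OF B(3,2,7)] mod_simps(3)[OF B(3)] mod_simps(8)[OF B(2)])
        then have "a (c ?v) = ?v"
          using B(12)[OF v] hom_in[OF B(4) hom_in[OF B(6) v]] by (simp add: hom_simps(4)[OF B(2,3,5)] mod_simps(6)[OF B(3)])
        then have "\<mu> (px (c ?v)) = q ?v" using \<mu>(2)[OF hom_in[OF B(6) v]] by simp
        also have "\<dots> = y'"
          using w jy D'(9)[OF y(1)] y'(1) by (simp add: hom_simps(2,5)[OF D'(2,3,5)] mod_simps(3)[OF B(3)] mod_simps(6,15)[OF D'(3)])
        finally show ?thesis using hom_in[OF Dx(5) hom_in[OF B(6) v]] by blast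
      qed
      show "\<exists>y\<in>carrier Y'. \<nu> y = z" if z: "z \<in> carrier Z'" for z
      proof -
        obtain u where u: "u \<in> carrier Pz" "pz u = z" by (rule ses_epiE[OF psesD(1)[OF Sz(1)] z]) (rule that)
        have "\<nu> (q (b u)) = z" using \<nu>(2)[OF hom_in[OF B(5) u(1)]] B(11)[OF u(1)] u(2) by simp
        then show ?thesis using hom_in[OF D'(5) hom_in[OF B(5) u(1)]] by blast
      qed
    qed
    have "pses R Y P Y' j q"
    proof (rule psesI[OF S' Pp P(2)])
      fix Q :: "'r umodule" and f
      assume Q: "projective R Q" "fin_gen R Q" and f: "f \<in> mod_hom R Y Q"
      note Qm = projective_module[OF Q(1)]
      obtain g1 where g1: "g1 \<in> mod_hom R Px Q" "\<And>x. x \<in> carrier X \<Longrightarrow> g1 (ix x) = f (i x)"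
        by (rule pses_extend[OF Sx(1) Q hom_comp[OF D(4) f]]) (rule that)
      have g1c: "(\<lambda>y. g1 (\<alpha> y)) \<in> mod_hom R Y Q" by (rule hom_comp[OF \<alpha>(1) g1(1)])
      let ?h = "\<lambda>y. f y \<oplus>\<^bsub>Q\<^esub> \<ominus>\<^bsub>Q\<^esub> g1 (\<alpha> y)"
      have h: "?h \<in> mod_hom R Y Q" by (rule hom_diff[OF D(2) Qm f g1c])
      have "?h (i x) = \<zero>\<^bsub>Q\<^esub>" if "x \<in> carrier X" for x
        using g1(2)[OF that] \<alpha>(2)[OF that] hom_in[OF f hom_in[OF D(4) that]] by (simp add: mod_simps(8)[OF Qm])
      then obtain t where t: "t \<in> mod_hom R Z Q" "\<And>y. y \<in> carrier Y \<Longrightarrow> t (p y) = ?h y"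
        by (rule ses_desc[OF S Qm h]) (assumption, rule that)
      obtain g2 where g2: "g2 \<in> mod_hom R Pz Q" "\<And>x. x \<in> carrier Z \<Longrightarrow> g2 (iz x) = t x"
        by (rule pses_extend[OF Sz(1) Q t(1)]) (rule that)
      have "g1 (c (j y)) \<oplus>\<^bsub>Q\<^esub> g2 (d (j y)) = f y" if y: "y \<in> carrier Y" for y
      proof -
        have "g2 (d (j y)) = ?h y" using g2(2)[OF hom_in[OF D(5) y]] j(3)[OF y] t(2)[OF y] by simp
        then show ?thesis using hom_in[OF g1c y] hom_in[OF f y] j(2)[OF y] by (simp add: mod_simps(11)[OF Qm])
      qed
      then show "\<exists>g\<in>mod_hom R P Q. \<forall>y\<in>carrier Y. g (j y) = f y"
        by (intro bexI[OF _ biprod_copair[OF P(1) Qm g1(1) g2(1)]] ballI)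
    qed
    then show ?case using Y SY Sx(2) Sz(2) by blast
  qed
qed

text \<open>The identity embeds \<open>Q\<close> into a projective with zero cokernel, which is
  finitely generated projective again.\<close>

lemma gp_projective:
  fixes R :: "('r, 'x) ring_scheme" and Q :: "'r umodule"
  assumes "projective R Q" "fin_gen R Q"
  shows "gp R Q"
proof -
  have "projective R Q \<and> fin_gen R Q" using assms by simp
  then show ?thesis
  proof (coinduction arbitrary: Q rule: gp.coinduct)
    case (gp Q)
    then have Q: "projective R Q" "fin_gen R Q" and m: "left_module R Q" by (auto intro: projective_module)
    let ?Z = "Q\<lparr>carrier := {\<zero>\<^bsub>Q\<^esub>}\<rparr>"
    have Z: "left_module R ?Z" by (rule zero_module_exists[OF m])
    have "ses R Q Q ?Z (\<lambda>x. x) (\<lambda>_. \<zero>\<^bsub>Q\<^esub>)"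
      by (rule sesI[OF m m Z hom_id]) (use hom_zero[OF Z, of Q] mod_simps(1)[OF m] in auto)
    then have "pses R Q Q ?Z (\<lambda>x. x) (\<lambda>_. \<zero>\<^bsub>Q\<^esub>)" by (rule psesI[OF _ Q]) blast
    moreover have "projective R ?Z" "fin_gen R ?Z" using projective_zero[OF Z] fin_gen_zero[OF Z] by auto
    ultimately show ?case using perp_projective[OF Q] by blast
  qed
qed

lemma ses_iso_mid:
  assumes "ses R X Y Z i p" "left_module R W" "f \<in> mod_hom R Y W" "g \<in> mod_hom R W Y"
    "\<And>y. y \<in> carrier Y \<Longrightarrow> g (f y) = y" "\<And>w. w \<in> carrier W \<Longrightarrow> f (g w) = w"
  shows "ses R X W Z (\<lambda>x. f (i x)) (\<lambda>w. p (g w))"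
proof -
  note D = sesD[OF assms(1)]
  show ?thesis
  proof (rule sesI[OF D(1) assms(2) D(3) hom_comp[OF D(4) assms(3)] hom_comp[OF assms(4) D(5)]])
    show "x = \<zero>\<^bsub>X\<^esub>" if "x \<in> carrier X" "f (i x) = \<zero>\<^bsub>W\<^esub>" for x
      using ses_inj[OF assms(1) that(1)] assms(5)[OF hom_in[OF D(4) that(1)]] that(2) hom_simps(4)[OF assms(2) D(2) assms(4)]
      by simp
    show "p (g (f (i x))) = \<zero>\<^bsub>Z\<^esub>" if "x \<in> carrier X" for x
      using D(9)[OF that] assms(5)[OF hom_in[OF D(4) that]] by simp
    show "\<exists>x\<in>carrier X. f (i x) = w" if w: "w \<in> carrier W" "p (g w) = \<zero>\<^bsub>Z\<^esub>" for w
    proof -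
      obtain x where "x \<in> carrier X" "i x = g w" by (rule ses_kernelE[OF assms(1) hom_in[OF assms(4) w(1)] w(2)]) (rule that)
      then show ?thesis using assms(6)[OF w(1)] by (intro bexI[of _ x]) auto
    qed
    show "\<exists>w\<in>carrier W. p (g w) = z" if z: "z \<in> carrier Z" for z
    proof -
      obtain y where "y \<in> carrier Y" "p y = z" by (rule ses_epiE[OF assms(1) z]) (rule that)
      then show ?thesis using assms(5) hom_in[OF assms(3)] by (intro bexI[of _ "f y"]) auto
    qed
  qed
qed

text \<open>
  That summands of Gorenstein projectives are Gorenstein projective is true in general, but here it
  also follows from $\mathcal{GP}(R) = \mathrm{add}\,E$, so it is carried along as a hypothesis.
\<close>

definition gp_retract_closed :: "('r, 'x) ring_scheme \<Rightarrow> bool" where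
  "gp_retract_closed R \<longleftrightarrow> (\<forall>X Z f g. gp R Z \<and> left_module R X \<and> f \<in> mod_hom R X Z \<and> g \<in> mod_hom R Z X \<and>
     (\<forall>x\<in>carrier X. g (f x) = x) \<longrightarrow> gp R X)"

lemma gp_retract:
  assumes "gp_retract_closed R" "gp R Z" "left_module R X" "f \<in> mod_hom R X Z" "g \<in> mod_hom R Z X"
    "\<And>x. x \<in> carrier X \<Longrightarrow> g (f x) = x"
  shows "gp R X"
  using assms(1)[unfolded gp_retract_closed_def, rule_format, of Z X f g] assms(2-) by simp

text \<open>A cover \<open>P\<close> of \<open>H\<close> turns the kernel \<open>K\<close> into a retract of an extension of \<open>G\<close> by a syzygy of \<open>H\<close>.\<close>

lemma gp_kernel:
  fixes R :: "('r, 'x) ring_scheme" and K G H :: "'r umodule"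
  assumes ret: "gp_retract_closed R" and S: "ses R K G H i p" and G: "gp R G" and H: "gp R H"
  shows "gp R K"
proof -
  note D = sesD[OF S]
  obtain H1 P h q where T: "pses R H1 P H h q" "perp R H1" by (rule perpE[OF gp_perp[OF H]]) (rule that)
  \<comment> \<open>The right half of a complex for the syzygy is the cover \<open>P\<close>
    followed by the right half for \<open>H\<close>.\<close>
  have H1: "gp R H1" by (rule gp.step[OF T(2,1) H])
  note E = sesD[OF psesD(1)[OF T(1)]]
  obtain l where l: "l \<in> mod_hom R P G" "\<And>x. x \<in> carrier P \<Longrightarrow> p (l x) = q x"
    by (rule projective_lift_ses[OF psesD(2)[OF T(1)] S E(5)]) (rule that)
  have "p (l (h x)) = \<zero>\<^bsub>H\<^esub>" if "x \<in> carrier H1" for x using l(2)[OF hom_in[OF E(4) that]] E(9)[OF that] by simp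
  then obtain m where m: "m \<in> mod_hom R H1 K" "\<And>x. x \<in> carrier H1 \<Longrightarrow> i (m x) = l (h x)"
    by (rule ses_lift[OF S E(1) hom_comp[OF E(4) l(1)]]) (assumption, rule that)
  let ?D = "prod_module K P"
  have PX: "left_module R ?D" by (rule left_module_prod[OF D(1) E(2)])
  have fs: "fst \<in> mod_hom R ?D K" "snd \<in> mod_hom R ?D P" by (auto intro!: mod_homI)
  \<comment> \<open>The sum of \<open>K\<close> and \<open>P\<close> is the pullback of
    \<open>G\<close> and \<open>P\<close> over \<open>H\<close>, because the cover lifts through
    \<open>G\<close> as \<open>l\<close>. The sign makes the two images of \<open>H1\<close> in
    \<open>G\<close> cancel.\<close>
  let ?a = "\<lambda>x. (\<ominus>\<^bsub>K\<^esub> m x, h x)" and ?b = "\<lambda>y. i (fst y) \<oplus>\<^bsub>G\<^esub> l (snd y)"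
  have mm: "(\<lambda>x. \<ominus>\<^bsub>K\<^esub> m x) \<in> mod_hom R H1 K" by (rule hom_uminus[OF E(1) D(1) m(1)])
  have a: "?a \<in> mod_hom R H1 ?D"
    by (rule mod_homI) (simp_all add: hom_simps(1-3)[OF E(1) D(1) mm] hom_simps(1-3)[OF E(1,2,4)])
  have b: "?b \<in> mod_hom R ?D G" by (rule hom_add[OF PX D(2) hom_comp[OF fs(1) D(4)] hom_comp[OF fs(2) l(1)]])
  have SD: "ses R H1 ?D G ?a ?b"
  proof (rule sesI[OF E(1) PX D(2) a b])
    show "x = \<zero>\<^bsub>H1\<^esub>" if "x \<in> carrier H1" "?a x = \<zero>\<^bsub>?D\<^esub>" for x
      by (rule ses_inj[OF psesD(1)[OF T(1)] that(1)]) (use that(2) in simp)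
    show "?b (?a x) = \<zero>\<^bsub>G\<^esub>" if "x \<in> carrier H1" for x
      using m(2)[OF that] hom_in[OF m(1) that] hom_in[OF l(1) hom_in[OF E(4) that]]
      by (simp add: hom_simps(5)[OF D(1,2,4)] mod_simps(7)[OF D(2)])
    show "\<exists>x\<in>carrier H1. ?a x = y" if y: "y \<in> carrier ?D" "?b y = \<zero>\<^bsub>G\<^esub>" for y
    proof -
      have yc: "fst y \<in> carrier K" "snd y \<in> carrier P" using y(1) by auto
      have "q (snd y) = p (?b y)"
        using yc hom_in[OF D(4) yc(1)] hom_in[OF l(1) yc(2)] hom_in[OF E(5) yc(2)]
        by (simp add: hom_simps(2)[OF D(2,3,5)] D(9) l(2) mod_simps(5)[OF D(3)])
      then have "q (snd y) = \<zero>\<^bsub>H\<^esub>" using y(2) hom_simps(4)[OF D(2,3,5)] by simp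
      then obtain x where x: "x \<in> carrier H1" "h x = snd y" by (rule ses_kernelE[OF psesD(1)[OF T(1)] yc(2)]) (rule that)
      have mx: "m x \<in> carrier K" by (rule hom_in[OF m(1) x(1)])
      have "i (m x \<oplus>\<^bsub>K\<^esub> fst y) = ?b y"
        using mx yc m(2)[OF x(1)] x(2) hom_in[OF D(4) yc(1)] hom_in[OF l(1) yc(2)]
        by (simp add: hom_simps(2)[OF D(1,2,4)] mod_simps(17)[OF D(2)])
      then have "m x \<oplus>\<^bsub>K\<^esub> fst y = \<zero>\<^bsub>K\<^esub>"
        using ses_inj[OF S mod_simps(2)[OF D(1) mx yc(1)]] y(2) by simp
      then have "fst y = \<ominus>\<^bsub>K\<^esub> m x" by (rule neg_unique[OF D(1) mx yc(1)])
      then have "?a x = y" using x(2) by (simp add: prod_eq_iff)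
      then show ?thesis using x(1) by blast
    qed
    show "\<exists>y\<in>carrier ?D. ?b y = z" if z: "z \<in> carrier G" for z
    proof -
      obtain u where u: "u \<in> carrier P" "q u = p z" by (rule ses_epiE[OF psesD(1)[OF T(1)] hom_in[OF D(5) z]]) (rule that)
      have lu: "l u \<in> carrier G" by (rule hom_in[OF l(1) u(1)])
      have zl: "z \<oplus>\<^bsub>G\<^esub> \<ominus>\<^bsub>G\<^esub> l u \<in> carrier G" using z lu by (simp add: mod_simps(2,3)[OF D(2)])
      have "p (z \<oplus>\<^bsub>G\<^esub> \<ominus>\<^bsub>G\<^esub> l u) = \<zero>\<^bsub>H\<^esub>"
        using z lu l(2)[OF u(1)] u(2) hom_in[OF D(5) z]
        by (simp add: hom_simps(2,5)[OF D(2,3,5)] mod_simps(3)[OF D(2)] mod_simps(8)[OF D(3)])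
      then obtain k where k: "k \<in> carrier K" "i k = z \<oplus>\<^bsub>G\<^esub> \<ominus>\<^bsub>G\<^esub> l u" by (rule ses_kernelE[OF S zl]) (rule that)
      have "?b (k, u) = z" using k(2) z lu by (simp add: mod_simps(3,6,7,16)[OF D(2)])
      then show ?thesis using k(1) u(1) by (intro bexI[of _ "(k, u)"]) auto
    qed
  qed
  \<comment> \<open>Pairs leave the universe, so closure under extensions is applied to a copy of
    the sum, of which \<open>K\<close> is then a retract.\<close>
  have "fin_gen R ?D" by (rule fin_gen_extension[OF SD gp_fin_gen[OF H1] gp_fin_gen[OF G]])
  then obtain U :: "'r umodule" where U: "left_module R U" "mod_iso R ?D U"
    using fin_gen_iso_universe[OF PX] by blast
  obtain f g where f: "f \<in> mod_hom R ?D U" and g: "g \<in> mod_hom R U ?D"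
    and gf: "\<And>x. x \<in> carrier ?D \<Longrightarrow> g (f x) = x" and fg: "\<And>y. y \<in> carrier U \<Longrightarrow> f (g y) = y"
    by (rule mod_isoE[OF PX U]) (rule that)
  have "gp R U" by (rule gp_extension[OF ses_iso_mid[OF SD U(1) f g gf fg] H1 G])
  moreover have i1: "(\<lambda>x. (x, \<zero>\<^bsub>P\<^esub>)) \<in> mod_hom R K ?D" by (rule sesD(4)[OF ses_prod[OF D(1) E(2)]])
  ultimately show ?thesis
    by (rule gp_retract[OF ret _ D(1) hom_comp[OF _ f] hom_comp[OF g fs(1)]])
      (use hom_in[OF i1] gf in auto)
qed

text \<open>Gorenstein projective dimension at most \<open>k\<close>, read off a Gorenstein projective precover.\<close>

definition gp_approx :: "('r, 'x) ring_scheme \<Rightarrow> nat \<Rightarrow> 'r umodule \<Rightarrow> bool" where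
  "gp_approx R k X \<longleftrightarrow> (\<exists>L W l w. ses R L W X l w \<and> pdl R k L \<and> gp R W)"

text \<open>Embed \<open>W\<close> into a projective \<open>P\<close> with Gorenstein projective
  cokernel, and let \<open>V\<close> be the pushout of W -> P and W -> K -> G. It has
  \<open>G\<close> as a submodule and that cokernel as quotient, so it is Gorenstein projective; the
  kernel of V -> X is \<open>P\<close> modulo \<open>L\<close>, resolved by \<open>P\<close> and a
  resolution of \<open>L\<close>.\<close>

lemma gp_approx_cokernel:
  fixes R :: "('r, 'x) ring_scheme" and K G X :: "'r umodule"
  assumes S: "ses R K G X \<kappa> \<gamma>" and G: "gp R G" and K: "gp_approx R k K"
  shows "gp_approx R (Suc k) X"
proof -
  obtain L W :: "'r umodule" and l w where T: "ses R L W K l w" and L: "pdl R k L" and W: "gp R W"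
    using K unfolding gp_approx_def by blast
  obtain P W' j \<pi> where J: "pses R W P W' j \<pi>" "gp R W'" by (rule gpE[OF W]) (rule that)
  note DS = sesD[OF S] and DT = sesD[OF T] and DJ = sesD[OF psesD(1)[OF J(1)]]
  obtain D :: "'r umodule" and a b c d where D: "biprod R P G D a b c d"
    by (rule biprod_exists[OF DJ(2) DS(2) psesD(3)[OF J(1)] gp_fin_gen[OF G]]) (rule that)
  note B = biprodD[OF D]
  have \<kappa>w: "(\<lambda>y. \<kappa> (w y)) \<in> mod_hom R W G" by (rule hom_comp[OF DT(5) DS(4)])
  \<comment> \<open>The pushout is the quotient of \<open>P\<close> plus \<open>G\<close> by this
    antidiagonal image of \<open>W\<close>.\<close>
  obtain e where e: "e \<in> mod_hom R W D" "\<And>y. y \<in> carrier W \<Longrightarrow> c (e y) = \<ominus>\<^bsub>P\<^esub> j y" "\<And>y. y \<in> carrier W \<Longrightarrow> d (e y) = \<kappa> (w y)"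
    by (rule biprod_pair[OF D DJ(1) hom_uminus[OF DJ(1,2,4)] \<kappa>w]) (rule that)
  have e0: "y = \<zero>\<^bsub>W\<^esub>" if y: "y \<in> carrier W" "c (e y) = \<zero>\<^bsub>P\<^esub>" for y
  proof (rule ses_inj[OF psesD(1)[OF J(1)] y(1)])
    have "j y = \<ominus>\<^bsub>P\<^esub> (\<ominus>\<^bsub>P\<^esub> j y)" using hom_in[OF DJ(4) y(1)] by (simp add: mod_simps(14)[OF DJ(2)])
    moreover have "\<ominus>\<^bsub>P\<^esub> j y = \<zero>\<^bsub>P\<^esub>" using e(2)[OF y(1)] y(2) by simp
    ultimately show "j y = \<zero>\<^bsub>P\<^esub>" using mod_simps(15)[OF DJ(2)] by simp
  qed
  have "inj_on e (carrier W)"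
    by (rule hom_inj[OF DJ(1) B(3) e(1)]) (use e0 hom_simps(4)[OF B(3,1,6)] in auto)
  then obtain V :: "'r umodule" and q where Q: "ses R W D V e q"
    by (rule ses_quotient[OF DJ(1) B(3) e(1)]) (rule that)
  note DQ = sesD[OF Q]
  have "\<pi> (c (e y)) = \<zero>\<^bsub>W'\<^esub>" if "y \<in> carrier W" for y
    using e(2)[OF that] DJ(9)[OF that] hom_in[OF DJ(4) that] by (simp add: hom_simps(5)[OF DJ(2,3,5)] mod_simps(15)[OF DJ(3)])
  then obtain \<nu> where \<nu>: "\<nu> \<in> mod_hom R V W'" "\<And>x. x \<in> carrier D \<Longrightarrow> \<nu> (q x) = \<pi> (c x)"
    by (rule ses_desc[OF Q DJ(3) hom_comp[OF B(6) DJ(5)]]) (assumption, rule that)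
  have "\<gamma> (d (e y)) = \<zero>\<^bsub>X\<^esub>" if "y \<in> carrier W" for y
    using e(3)[OF that] DS(9)[OF hom_in[OF DT(5) that]] by simp
  then obtain \<tau> where \<tau>: "\<tau> \<in> mod_hom R V X" "\<And>x. x \<in> carrier D \<Longrightarrow> \<tau> (q x) = \<gamma> (d x)"
    by (rule ses_desc[OF Q DS(3) hom_comp[OF B(7) DS(5)]]) (assumption, rule that)
  have qe: "q (x \<oplus>\<^bsub>D\<^esub> e y) = q x" if "x \<in> carrier D" "y \<in> carrier W" for x y
    using that hom_in[OF e(1)] hom_in[OF DQ(5)] by (simp add: hom_simps(2)[OF DQ(2,3,5)] DQ(9) mod_simps(6)[OF DQ(3)])
  have SV: "ses R G V W' (\<lambda>x. q (b x)) \<nu>"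
  proof (rule sesI[OF DS(2) DQ(3) DJ(3) hom_comp[OF B(5) DQ(5)] \<nu>(1)])
    show "x = \<zero>\<^bsub>G\<^esub>" if x: "x \<in> carrier G" "q (b x) = \<zero>\<^bsub>V\<^esub>" for x
    proof -
      obtain y where y: "y \<in> carrier W" "e y = b x" by (rule ses_kernelE[OF Q hom_in[OF B(5) x(1)] x(2)]) (rule that)
      have "y = \<zero>\<^bsub>W\<^esub>" by (rule e0[OF y(1)]) (simp add: y(2) B(10)[OF x(1)])
      then have "b x = \<zero>\<^bsub>D\<^esub>" using y(2) hom_simps(4)[OF DJ(1) B(3) e(1)] by simp
      then show ?thesis using B(11)[OF x(1)] hom_simps(4)[OF B(3,2,7)] by simp
    qed
    show "\<nu> (q (b x)) = \<zero>\<^bsub>W'\<^esub>" if "x \<in> carrier G" for x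
      using \<nu>(2)[OF hom_in[OF B(5) that]] B(10)[OF that] hom_simps(4)[OF DJ(2,3,5)] by simp
    show "\<exists>x\<in>carrier G. q (b x) = v" if v: "v \<in> carrier V" "\<nu> v = \<zero>\<^bsub>W'\<^esub>" for v
    proof -
      obtain x where x: "x \<in> carrier D" "q x = v" by (rule ses_epiE[OF Q v(1)]) (rule that)
      have "\<pi> (c x) = \<zero>\<^bsub>W'\<^esub>" using \<nu>(2)[OF x(1)] x(2) v(2) by simp
      then obtain y where y: "y \<in> carrier W" "j y = c x"
        by (rule ses_kernelE[OF psesD(1)[OF J(1)] hom_in[OF B(6) x(1)]]) (rule that)
      have ey: "e y \<in> carrier D" by (rule hom_in[OF e(1) y(1)])
      let ?x = "x \<oplus>\<^bsub>D\<^esub> e y"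
      have xc: "?x \<in> carrier D" using x(1) ey by (simp add: mod_simps(2)[OF B(3)])
      have "c ?x = \<zero>\<^bsub>P\<^esub>" using x(1) ey e(2)[OF y(1)] y(2) hom_in[OF B(6) x(1)]
        by (simp add: hom_simps(2)[OF B(3,1,6)] mod_simps(8)[OF B(1)])
      then have "b (d ?x) = ?x" using B(12)[OF xc] hom_in[OF B(5) hom_in[OF B(7) xc]]
        by (simp add: hom_simps(4)[OF B(1,3,4)] mod_simps(5)[OF B(3)])
      then have "q (b (d ?x)) = v" using qe[OF x(1) y(1)] x(2) by simp
      then show ?thesis using hom_in[OF B(7) xc] by blast
    qed
    show "\<exists>v\<in>carrier V. \<nu> v = z" if z: "z \<in> carrier W'" for z
    proof -
      obtain u where u: "u \<in> carrier P" "\<pi> u = z" by (rule ses_epiE[OF psesD(1)[OF J(1)] z]) (rule that)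
      have "\<nu> (q (a u)) = z" using \<nu>(2)[OF hom_in[OF B(4) u(1)]] B(8)[OF u(1)] u(2) by simp
      then show ?thesis using hom_in[OF DQ(5) hom_in[OF B(4) u(1)]] by blast
    qed
  qed
  have V: "gp R V" by (rule gp_extension[OF SV G J(2)])
  have surj: "\<tau> ` carrier V = carrier X"
  proof
    show "carrier X \<subseteq> \<tau> ` carrier V"
    proof
      fix x assume "x \<in> carrier X"
      then obtain g where g: "g \<in> carrier G" "\<gamma> g = x" by (rule ses_epiE[OF S]) (rule that)
      have "\<tau> (q (b g)) = x" using \<tau>(2)[OF hom_in[OF B(5) g(1)]] B(11)[OF g(1)] g(2) by simp
      then show "x \<in> \<tau> ` carrier V" using hom_in[OF DQ(5) hom_in[OF B(5) g(1)]] by blast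
    qed
  qed (use hom_in[OF \<tau>(1)] in blast)
  have SX: "ses R (V\<lparr>carrier := {v \<in> carrier V. \<tau> v = \<zero>\<^bsub>X\<^esub>}\<rparr>) V X (\<lambda>x. x) \<tau>" (is "ses R ?L _ _ _ _")
    by (rule ses_kernel[OF DQ(3) DS(3) \<tau>(1) surj])
  note DX = sesD[OF SX]
  have \<phi>: "(\<lambda>u. q (a u)) \<in> mod_hom R P ?L"
  proof (rule hom_sub_cod[OF hom_comp[OF B(4) DQ(5)]])
    have "\<tau> (q (a u)) = \<zero>\<^bsub>X\<^esub>" if "u \<in> carrier P" for u
      using \<tau>(2)[OF hom_in[OF B(4) that]] B(9)[OF that] hom_simps(4)[OF DS(2,3,5)] by simp
    then show "(\<lambda>u. q (a u)) ` carrier P \<subseteq> {v \<in> carrier V. \<tau> v = \<zero>\<^bsub>X\<^esub>}"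
      using hom_in[OF hom_comp[OF B(4) DQ(5)]] by auto
  qed
  have "ses R L P ?L (\<lambda>x. j (l x)) (\<lambda>u. q (a u))"
  proof (rule sesI[OF DT(1) DJ(2) DX(1) hom_comp[OF DT(4) DJ(4)] \<phi>])
    show "x = \<zero>\<^bsub>L\<^esub>" if "x \<in> carrier L" "j (l x) = \<zero>\<^bsub>P\<^esub>" for x
      by (rule ses_inj[OF T that(1) ses_inj[OF psesD(1)[OF J(1)] hom_in[OF DT(4) that(1)] that(2)]])
    show "q (a (j (l x))) = \<zero>\<^bsub>?L\<^esub>" if x: "x \<in> carrier L" for x
    proof -
      have lx: "l x \<in> carrier W" and ml: "\<ominus>\<^bsub>W\<^esub> l x \<in> carrier W" and jl: "j (l x) \<in> carrier P"
        using hom_in[OF DT(4) x] hom_in[OF DJ(4)] by (auto simp: mod_simps(3)[OF DJ(1)])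
      have "c (e (\<ominus>\<^bsub>W\<^esub> l x)) = j (l x)"
        using e(2)[OF ml] lx jl by (simp add: hom_simps(5)[OF DJ(1,2,4)] mod_simps(14)[OF DJ(2)])
      moreover have "d (e (\<ominus>\<^bsub>W\<^esub> l x)) = \<zero>\<^bsub>G\<^esub>"
        using e(3)[OF ml] DT(9)[OF x] hom_simps(5)[OF DJ(1) DT(3,5) lx] hom_simps(4)[OF DS(1,2,4)]
        by (simp add: mod_simps(15)[OF DT(3)])
      ultimately have "a (j (l x)) = e (\<ominus>\<^bsub>W\<^esub> l x)"
        using B(12)[OF hom_in[OF e(1) ml]] hom_in[OF B(4) jl] by (simp add: hom_simps(4)[OF B(2,3,5)] mod_simps(6)[OF B(3)])
      then show ?thesis using DQ(9)[OF ml] by simp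
    qed
    show "\<exists>x\<in>carrier L. j (l x) = u" if u: "u \<in> carrier P" "q (a u) = \<zero>\<^bsub>?L\<^esub>" for u
    proof -
      have "q (a u) = \<zero>\<^bsub>V\<^esub>" using u(2) by simp
      then obtain y where y: "y \<in> carrier W" "e y = a u" by (rule ses_kernelE[OF Q hom_in[OF B(4) u(1)]]) (rule that)
      have wy: "w y \<in> carrier K" by (rule hom_in[OF DT(5) y(1)])
      have "\<kappa> (w y) = \<zero>\<^bsub>G\<^esub>" using e(3)[OF y(1)] y(2) B(9)[OF u(1)] by simp
      then have "w y = \<zero>\<^bsub>K\<^esub>" by (rule ses_inj[OF S wy])
      then obtain z where z: "z \<in> carrier L" "l z = y" by (rule ses_kernelE[OF T y(1)]) (rule that)
      have mz: "\<ominus>\<^bsub>L\<^esub> z \<in> carrier L" using z(1) by (simp add: mod_simps(3)[OF DT(1)])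
      have "j (l (\<ominus>\<^bsub>L\<^esub> z)) = \<ominus>\<^bsub>P\<^esub> j y"
        using z y(1) by (simp add: hom_simps(5)[OF DT(1,2,4)] hom_simps(5)[OF DJ(1,2,4)])
      also have "\<dots> = u" using e(2)[OF y(1)] y(2) B(8)[OF u(1)] by simp
      finally show ?thesis using mz by blast
    qed
    show "\<exists>u\<in>carrier P. q (a u) = v" if v: "v \<in> carrier ?L" for v
    proof -
      have vV: "v \<in> carrier V" "\<tau> v = \<zero>\<^bsub>X\<^esub>" using v by auto
      obtain x where x: "x \<in> carrier D" "q x = v" by (rule ses_epiE[OF Q vV(1)]) (rule that)
      have "\<gamma> (d x) = \<zero>\<^bsub>X\<^esub>" using \<tau>(2)[OF x(1)] x(2) vV(2) by simp
      then obtain y' where y': "y' \<in> carrier K" "\<kappa> y' = d x" by (rule ses_kernelE[OF S hom_in[OF B(7) x(1)]]) (rule that)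
      obtain y where y: "y \<in> carrier W" "w y = y'" by (rule ses_epiE[OF T y'(1)]) (rule that)
      have my: "\<ominus>\<^bsub>W\<^esub> y \<in> carrier W" using y(1) by (simp add: mod_simps(3)[OF DJ(1)])
      let ?x = "x \<oplus>\<^bsub>D\<^esub> e (\<ominus>\<^bsub>W\<^esub> y)"
      have xc: "?x \<in> carrier D" using x(1) hom_in[OF e(1) my] by (simp add: mod_simps(2)[OF B(3)])
      have "d ?x = \<zero>\<^bsub>G\<^esub>"
        using x(1) hom_in[OF e(1) my] e(3)[OF my] y y'
        by (simp add: hom_simps(2)[OF B(3,2,7)] hom_simps(5)[OF DT(2,3,5)] hom_simps(5)[OF DS(1,2,4)] mod_simps(8)[OF B(2)] hom_in[OF B(7) x(1)])
      then have "a (c ?x) = ?x" using B(12)[OF xc] hom_in[OF B(4) hom_in[OF B(6) xc]]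
        by (simp add: hom_simps(4)[OF B(2,3,5)] mod_simps(6)[OF B(3)])
      then have "q (a (c ?x)) = v" using qe[OF x(1) my] x(2) by simp
      then show ?thesis using hom_in[OF B(6) xc] by blast
    qed
  qed
  then have "pdl R (Suc k) ?L" by (rule pdl.suc[OF _ psesD(2,3)[OF J(1)] L])
  then show ?thesis unfolding gp_approx_def using SX V by blast
qed

text \<open>With \<open>W\<close> embedded in a projective \<open>P\<close>, the module X = W/L
  embeds in C = P/L, whose projective dimension is finite and hence at most \<open>n\<close>.
  Replacing \<open>P\<close> by a cover \<open>P0\<close> of \<open>C\<close> whose kernel
  \<open>C1\<close> has \<open>n\<close> terms, and taking the preimage of \<open>X\<close>, gives
  the shorter approximation. Using \<open>C1\<close> in place of \<open>L\<close> avoids a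
  comparison of two syzygies of \<open>C\<close>.\<close>

lemma gp_approx_shorten:
  fixes R :: "('r, 'x) ring_scheme" and X :: "'r umodule"
  assumes ret: "gp_retract_closed R" and X: "gp_approx R k X"
    and fin: "\<And>(C :: 'r umodule) k. pdl R k C \<Longrightarrow> pdl R (Suc n) C"
  shows "gp_approx R n X"
proof -
  obtain L W :: "'r umodule" and l w where T: "ses R L W X l w" and L: "pdl R k L" and W: "gp R W"
    using X unfolding gp_approx_def by blast
  obtain P W' j \<pi> where J: "pses R W P W' j \<pi>" "gp R W'" by (rule gpE[OF W]) (rule that)
  note DT = sesD[OF T] and DJ = sesD[OF psesD(1)[OF J(1)]]
  have jl: "(\<lambda>x. j (l x)) \<in> mod_hom R L P" by (rule hom_comp[OF DT(4) DJ(4)])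
  have "inj_on (\<lambda>x. j (l x)) (carrier L)"
  proof (rule inj_onI)
    fix x y assume x: "x \<in> carrier L" and y: "y \<in> carrier L" and e: "j (l x) = j (l y)"
    show "x = y" by (rule inj_onD[OF DT(6) inj_onD[OF DJ(6) e hom_in[OF DT(4) x] hom_in[OF DT(4) y]] x y])
  qed
  then obtain C :: "'r umodule" and q where Q: "ses R L P C (\<lambda>x. j (l x)) q"
    by (rule ses_quotient[OF DT(1) DJ(2) jl]) (rule that)
  note DQ = sesD[OF Q]
  have "pdl R (Suc n) C" by (rule fin[OF pdl.suc[OF Q psesD(2,3)[OF J(1)] L]])
  then obtain C1 P0 i0 p0 where C: "ses R C1 (P0 :: 'r umodule) C i0 p0" "projective R P0" "fin_gen R P0" "pdl R n C1"
    by cases auto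
  note DC = sesD[OF C(1)]
  obtain \<sigma> where \<sigma>: "\<sigma> \<in> mod_hom R X C" "\<And>y. y \<in> carrier W \<Longrightarrow> \<sigma> (w y) = q (j y)"
    by (rule ses_desc[OF T DQ(3) hom_comp[OF DJ(4) DQ(5)] DQ(9)]) (assumption, rule that)
  have "\<pi> (j (l x)) = \<zero>\<^bsub>W'\<^esub>" if "x \<in> carrier L" for x by (rule DJ(9)[OF hom_in[OF DT(4) that]])
  then obtain \<theta> where \<theta>: "\<theta> \<in> mod_hom R C W'" "\<And>u. u \<in> carrier P \<Longrightarrow> \<theta> (q u) = \<pi> u"
    by (rule ses_desc[OF Q DJ(3,5)]) (assumption, rule that)
  \<comment> \<open>This is the exact sequence of W/L, P/L and P/W.\<close>
  have S: "ses R X C W' \<sigma> \<theta>"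
  proof (rule sesI[OF DT(3) DQ(3) DJ(3) \<sigma>(1) \<theta>(1)])
    show "x = \<zero>\<^bsub>X\<^esub>" if x: "x \<in> carrier X" "\<sigma> x = \<zero>\<^bsub>C\<^esub>" for x
    proof -
      obtain y where y: "y \<in> carrier W" "w y = x" by (rule ses_epiE[OF T x(1)]) (rule that)
      have jy: "j y \<in> carrier P" by (rule hom_in[OF DJ(4) y(1)])
      have "q (j y) = \<zero>\<^bsub>C\<^esub>" using \<sigma>(2)[OF y(1)] y(2) x(2) by simp
      then obtain z where z: "z \<in> carrier L" "j (l z) = j y" by (rule ses_kernelE[OF Q jy]) (rule that)
      have "l z = y" by (rule inj_onD[OF DJ(6) z(2) hom_in[OF DT(4) z(1)] y(1)])
      then show ?thesis using DT(9)[OF z(1)] y(2) by simp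
    qed
    show "\<theta> (\<sigma> x) = \<zero>\<^bsub>W'\<^esub>" if x: "x \<in> carrier X" for x
    proof -
      obtain y where y: "y \<in> carrier W" "w y = x" by (rule ses_epiE[OF T x]) (rule that)
      show ?thesis using \<sigma>(2)[OF y(1)] y(2) \<theta>(2)[OF hom_in[OF DJ(4) y(1)]] DJ(9)[OF y(1)] by simp
    qed
    show "\<exists>x\<in>carrier X. \<sigma> x = c" if c: "c \<in> carrier C" "\<theta> c = \<zero>\<^bsub>W'\<^esub>" for c
    proof -
      obtain u where u: "u \<in> carrier P" "q u = c" by (rule ses_epiE[OF Q c(1)]) (rule that)
      have "\<pi> u = \<zero>\<^bsub>W'\<^esub>" using \<theta>(2)[OF u(1)] u(2) c(2) by simp
      then obtain y where y: "y \<in> carrier W" "j y = u" by (rule ses_kernelE[OF psesD(1)[OF J(1)] u(1)]) (rule that)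
      have "\<sigma> (w y) = c" using \<sigma>(2)[OF y(1)] y(2) u(2) by simp
      then show ?thesis using hom_in[OF DT(5) y(1)] by blast
    qed
    show "\<exists>c\<in>carrier C. \<theta> c = z" if z: "z \<in> carrier W'" for z
    proof -
      obtain u where u: "u \<in> carrier P" "\<pi> u = z" by (rule ses_epiE[OF psesD(1)[OF J(1)] z]) (rule that)
      show ?thesis using \<theta>(2)[OF u(1)] u(2) hom_in[OF DQ(5) u(1)] by auto
    qed
  qed
  note DS = sesD[OF S]
  have tp: "(\<lambda>x. \<theta> (p0 x)) \<in> mod_hom R P0 W'" by (rule hom_comp[OF DC(5) \<theta>(1)])
  have "(\<lambda>x. \<theta> (p0 x)) ` carrier P0 = carrier W'"
    unfolding image_image[of \<theta> p0, symmetric] DC(8) DS(8) ..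
  \<comment> \<open>The preimage of \<open>X\<close> in \<open>P0\<close>, described as the kernel
    of an epimorphism between Gorenstein projectives so that \<open>gp_kernel\<close>
    applies.\<close>
  then have SW: "ses R (P0\<lparr>carrier := {x \<in> carrier P0. \<theta> (p0 x) = \<zero>\<^bsub>W'\<^esub>}\<rparr>) P0 W' (\<lambda>x. x) (\<lambda>x. \<theta> (p0 x))"
    (is "ses R ?W _ _ _ _") by (rule ses_kernel[OF DC(2) DJ(3) tp])
  note DW = sesD[OF SW]
  have W2: "gp R ?W" by (rule gp_kernel[OF ret SW gp_projective[OF C(2,3)] J(2)])
  have pW: "p0 \<in> mod_hom R ?W C" by (rule hom_comp[OF DW(4) DC(5), simplified])
  have "\<theta> (p0 x) = \<zero>\<^bsub>W'\<^esub>" if "x \<in> carrier ?W" for x using that by simp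
  then obtain \<eta> where \<eta>: "\<eta> \<in> mod_hom R ?W X" "\<And>x. x \<in> carrier ?W \<Longrightarrow> \<sigma> (\<eta> x) = p0 x"
    by (rule ses_lift[OF S DW(1) pW]) (assumption, rule that)
  have i0: "i0 \<in> mod_hom R C1 ?W"
  proof (rule hom_sub_cod[OF DC(4)])
    show "i0 ` carrier C1 \<subseteq> {x \<in> carrier P0. \<theta> (p0 x) = \<zero>\<^bsub>W'\<^esub>}"
      using hom_in[OF DC(4)] DC(9) hom_simps(4)[OF DQ(3) DJ(3) \<theta>(1)] by auto
  qed
  have "ses R C1 ?W X i0 \<eta>"
  proof (rule sesI[OF DC(1) DW(1) DT(3) i0 \<eta>(1)])
    show "x = \<zero>\<^bsub>C1\<^esub>" if "x \<in> carrier C1" "i0 x = \<zero>\<^bsub>?W\<^esub>" for x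
      by (rule ses_inj[OF C(1) that(1)]) (use that(2) in simp)
    show "\<eta> (i0 x) = \<zero>\<^bsub>X\<^esub>" if x: "x \<in> carrier C1" for x
      by (rule ses_inj[OF S hom_in[OF \<eta>(1) hom_in[OF i0 x]]]) (use \<eta>(2)[OF hom_in[OF i0 x]] DC(9)[OF x] in simp)
    show "\<exists>x\<in>carrier C1. i0 x = y" if y: "y \<in> carrier ?W" "\<eta> y = \<zero>\<^bsub>X\<^esub>" for y
    proof -
      have "p0 y = \<zero>\<^bsub>C\<^esub>" using \<eta>(2)[OF y(1)] y(2) hom_simps(4)[OF DT(3) DQ(3) \<sigma>(1)] by simp
      then obtain x where "x \<in> carrier C1" "i0 x = y" using ses_kernelE[OF C(1) hom_in[OF DW(4) y(1)]] by metis
      then show ?thesis by blast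
    qed
    show "\<exists>y\<in>carrier ?W. \<eta> y = x" if x: "x \<in> carrier X" for x
    proof -
      obtain y where y: "y \<in> carrier P0" "p0 y = \<sigma> x" by (rule ses_epiE[OF C(1) hom_in[OF \<sigma>(1) x]]) (rule that)
      have yW: "y \<in> carrier ?W" using y DS(9)[OF x] by simp
      have "\<eta> y = x" by (rule inj_onD[OF DS(6) _ hom_in[OF \<eta>(1) yW] x]) (use \<eta>(2)[OF yW] y(2) in simp)
      then show ?thesis using yW by blast
    qed
  qed
  then show ?thesis unfolding gp_approx_def using C(4) W2 by blast
qed

text \<open>Because \<open>L\<close> has finite projective dimension, G -> X lifts to
  \<open>W\<close>. With a cover \<open>P\<close> of \<open>L\<close>, the sum of \<open>P\<close>
  and \<open>G\<close> maps onto \<open>W\<close>; the kernel of this map is Gorenstein projective,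
  and it projects onto \<open>K\<close> with kernel the syzygy \<open>L1\<close>, one term shorter
  than \<open>L\<close>.\<close>

lemma gp_approx_syzygy:
  fixes R :: "('r, 'x) ring_scheme" and K G X :: "'r umodule"
  assumes ret: "gp_retract_closed R" and S: "ses R K G X \<kappa> \<gamma>" and G: "gp R G" and X: "gp_approx R (Suc k) X"
  shows "gp_approx R k K"
proof -
  obtain L W :: "'r umodule" and l w where T: "ses R L W X l w" and L: "pdl R (Suc k) L" and W: "gp R W"
    using X unfolding gp_approx_def by blast
  from L obtain L1 P i \<pi> where C: "ses R L1 (P :: 'r umodule) L i \<pi>" "projective R P" "fin_gen R P" "pdl R k L1"
    by cases auto
  note DS = sesD[OF S] and DT = sesD[OF T] and DC = sesD[OF C(1)]
  obtain u where u: "u \<in> mod_hom R G W" "\<And>x. x \<in> carrier G \<Longrightarrow> w (u x) = \<gamma> x"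
    by (rule perp_lift_pdl[OF gp_perp[OF G] L T DS(5)]) (rule that)
  obtain D :: "'r umodule" and a b c d where D: "biprod R P G D a b c d"
    by (rule biprod_exists[OF DC(2) DS(2) C(3) gp_fin_gen[OF G]]) (rule that)
  note B = biprodD[OF D]
  let ?q = "\<lambda>x. l (\<pi> (c x)) \<oplus>\<^bsub>W\<^esub> u (d x)"
  have q: "?q \<in> mod_hom R D W" by (rule biprod_copair[OF D DT(2) hom_comp[OF DC(5) DT(4)] u(1)])
  have lc: "\<pi> (c x) \<in> carrier L" "l (\<pi> (c x)) \<in> carrier W" "u (d x) \<in> carrier W" if "x \<in> carrier D" for x
    using hom_in[OF DC(5) hom_in[OF B(6) that]] hom_in[OF DT(4)] hom_in[OF u(1) hom_in[OF B(7) that]] by auto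
  have wq: "w (?q x) = \<gamma> (d x)" if x: "x \<in> carrier D" for x
    using lc[OF x] u(2)[OF hom_in[OF B(7) x]] hom_in[OF DS(5) hom_in[OF B(7) x]]
    by (simp add: hom_simps(2)[OF DT(2,3,5)] DT(9) mod_simps(5)[OF DT(3)])
  \<comment> \<open>Surjectivity onto \<open>W\<close> with the entry in \<open>G\<close>
    prescribed; its case of zero in \<open>W\<close> is what makes the projection onto
    \<open>K\<close> surjective.\<close>
  have lift: "\<exists>x\<in>carrier D. ?q x = y \<and> d x = g"
    if y: "y \<in> carrier W" "g \<in> carrier G" "\<gamma> g = w y" for y g
  proof -
    have ug: "u g \<in> carrier W" by (rule hom_in[OF u(1) y(2)])
    have yu: "y \<oplus>\<^bsub>W\<^esub> \<ominus>\<^bsub>W\<^esub> u g \<in> carrier W" using y(1) ug by (simp add: mod_simps(2,3)[OF DT(2)])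
    have "w (y \<oplus>\<^bsub>W\<^esub> \<ominus>\<^bsub>W\<^esub> u g) = \<zero>\<^bsub>X\<^esub>"
      using y ug u(2)[OF y(2)] hom_in[OF DT(5) y(1)]
      by (simp add: hom_simps(2,5)[OF DT(2,3,5)] mod_simps(3)[OF DT(2)] mod_simps(8)[OF DT(3)])
    then obtain z where z: "z \<in> carrier L" "l z = y \<oplus>\<^bsub>W\<^esub> \<ominus>\<^bsub>W\<^esub> u g" by (rule ses_kernelE[OF T yu]) (rule that)
    obtain p where p: "p \<in> carrier P" "\<pi> p = z" by (rule ses_epiE[OF C(1) z(1)]) (rule that)
    obtain x where x: "x \<in> carrier D" "c x = p" "d x = g" by (rule biprod_elem[OF D p(1) y(2)]) (rule that)
    have "?q x = y" using x p z y(1) ug by (simp add: mod_simps(3,6,7,16)[OF DT(2)])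
    then show ?thesis using x by blast
  qed
  have "?q ` carrier D = carrier W"
  proof
    show "carrier W \<subseteq> ?q ` carrier D"
    proof
      fix y assume y: "y \<in> carrier W"
      obtain g where g: "g \<in> carrier G" "\<gamma> g = w y" by (rule ses_epiE[OF S hom_in[OF DT(5) y]]) (rule that)
      show "y \<in> ?q ` carrier D" using lift[OF y g] by blast
    qed
  qed (use hom_in[OF q] in blast)
  then have SK: "ses R (D\<lparr>carrier := {x \<in> carrier D. ?q x = \<zero>\<^bsub>W\<^esub>}\<rparr>) D W (\<lambda>x. x) ?q" (is "ses R ?K _ _ _ _")
    by (rule ses_kernel[OF B(3) DT(2) q])
  note DK = sesD[OF SK]
  have "gp R D" by (rule gp_extension[OF biprod_ses[OF D] gp_projective[OF C(2,3)] G])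
  then have Kt: "gp R ?K" by (rule gp_kernel[OF ret SK _ W])
  have Kin: "x \<in> carrier D" "?q x = \<zero>\<^bsub>W\<^esub>" if "x \<in> carrier ?K" for x using that by auto
  have "\<gamma> (d x) = \<zero>\<^bsub>X\<^esub>" if "x \<in> carrier ?K" for x
    using wq[OF Kin(1)[OF that]] Kin(2)[OF that] hom_simps(4)[OF DT(2,3,5)] by simp
  then obtain \<eta> where \<eta>: "\<eta> \<in> mod_hom R ?K K" "\<And>x. x \<in> carrier ?K \<Longrightarrow> \<kappa> (\<eta> x) = d x"
    by (rule ses_lift[OF S DK(1) hom_comp[OF DK(4) B(7)]]) (assumption, rule that)
  have ai: "(\<lambda>t. a (i t)) \<in> mod_hom R L1 D" by (rule hom_comp[OF DC(4) B(4)])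
  have "?q (a (i t)) = \<zero>\<^bsub>W\<^esub>" if t: "t \<in> carrier L1" for t
    using B(8,9)[OF hom_in[OF DC(4) t]] DC(9)[OF t] hom_simps(4)[OF DT(1,2,4)] hom_simps(4)[OF DS(2) DT(2) u(1)]
    by (simp add: mod_simps(1,5)[OF DT(2)])
  then have aiK: "(\<lambda>t. a (i t)) \<in> mod_hom R L1 ?K"
    using hom_in[OF ai] by (intro hom_sub_cod[OF ai]) auto
  have "ses R L1 ?K K (\<lambda>t. a (i t)) \<eta>"
  proof (rule sesI[OF DC(1) DK(1) DS(1) aiK \<eta>(1)])
    show "t = \<zero>\<^bsub>L1\<^esub>" if t: "t \<in> carrier L1" "a (i t) = \<zero>\<^bsub>?K\<^esub>" for t
      by (rule ses_inj[OF C(1) t(1)]) (use B(8)[OF hom_in[OF DC(4) t(1)]] t(2) hom_simps(4)[OF B(3,1,6)] in simp)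
    show "\<eta> (a (i t)) = \<zero>\<^bsub>K\<^esub>" if t: "t \<in> carrier L1" for t
      by (rule ses_inj[OF S hom_in[OF \<eta>(1) hom_in[OF aiK t]]])
        (use \<eta>(2)[OF hom_in[OF aiK t]] B(9)[OF hom_in[OF DC(4) t]] in simp)
    show "\<exists>t\<in>carrier L1. a (i t) = x" if x: "x \<in> carrier ?K" "\<eta> x = \<zero>\<^bsub>K\<^esub>" for x
    proof -
      have dx: "d x = \<zero>\<^bsub>G\<^esub>" using \<eta>(2)[OF x(1)] x(2) hom_simps(4)[OF DS(1,2,4)] by simp
      have cx: "c x \<in> carrier P" by (rule hom_in[OF B(6) Kin(1)[OF x(1)]])
      have "l (\<pi> (c x)) = \<zero>\<^bsub>W\<^esub>"
        using Kin(2)[OF x(1)] dx lc(2)[OF Kin(1)[OF x(1)]] by (simp add: hom_simps(4)[OF DS(2) DT(2) u(1)] mod_simps(6)[OF DT(2)])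
      then have "\<pi> (c x) = \<zero>\<^bsub>L\<^esub>" by (rule ses_inj[OF T lc(1)[OF Kin(1)[OF x(1)]]])
      then obtain t where t: "t \<in> carrier L1" "i t = c x" by (rule ses_kernelE[OF C(1) cx]) (rule that)
      have "a (i t) = x" using B(12)[OF Kin(1)[OF x(1)]] dx t(2) hom_in[OF B(4) cx]
        by (simp add: hom_simps(4)[OF B(2,3,5)] mod_simps(6)[OF B(3)])
      then show ?thesis using t(1) by blast
    qed
    show "\<exists>x\<in>carrier ?K. \<eta> x = y" if y: "y \<in> carrier K" for y
    proof -
      have \<kappa>y: "\<kappa> y \<in> carrier G" by (rule hom_in[OF DS(4) y])
      have "\<gamma> (\<kappa> y) = w \<zero>\<^bsub>W\<^esub>" using DS(9)[OF y] hom_simps(4)[OF DT(2,3,5)] by simp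
      then obtain x where x: "x \<in> carrier D" "?q x = \<zero>\<^bsub>W\<^esub>" "d x = \<kappa> y"
        using lift[OF mod_simps(1)[OF DT(2)] \<kappa>y] by blast
      have xK: "x \<in> carrier ?K" using x by simp
      have "\<eta> x = y" by (rule inj_onD[OF DS(6) _ hom_in[OF \<eta>(1) xK] y]) (use \<eta>(2)[OF xK] x(3) in simp)
      then show ?thesis using xK by blast
    qed
  qed
  then show ?thesis unfolding gp_approx_def using C(4) Kt by blast
qed

text \<open>Zero terms mean that \<open>L\<close> vanishes, so W -> X is an isomorphism.\<close>

lemma gp_approx_zero:
  fixes R :: "('r, 'x) ring_scheme" and X :: "'r umodule"
  assumes ret: "gp_retract_closed R" and X: "gp_approx R 0 X"
  shows "gp R X"
proof -
  obtain L W :: "'r umodule" and l w where T: "ses R L W X l w" and L: "pdl R 0 L" and W: "gp R W"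
    using X unfolding gp_approx_def by blast
  note DT = sesD[OF T]
  have L0: "carrier L = {\<zero>\<^bsub>L\<^esub>}" using L by cases auto
  have "inj_on w (carrier W)"
  proof (rule hom_inj[OF DT(2,3,5)])
    fix y assume "y \<in> carrier W" "w y = \<zero>\<^bsub>X\<^esub>"
    then obtain x where "x \<in> carrier L" "l x = y" by (rule ses_kernelE[OF T]) (rule that)
    then show "y = \<zero>\<^bsub>W\<^esub>" using L0 hom_simps(4)[OF DT(1,2,4)] by simp
  qed
  then have "bij_betw w (carrier W) (carrier X)" using DT(8) by (simp add: bij_betw_def)
  then obtain g where g: "g \<in> mod_hom R X W" "\<And>y. y \<in> carrier W \<Longrightarrow> g (w y) = y" "\<And>x. x \<in> carrier X \<Longrightarrow> w (g x) = x"
    by (rule hom_inverse[OF DT(2,3,5)]) (rule that)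
  show ?thesis by (rule gp_retract[OF ret W DT(3) g(1) DT(5) g(3)])
qed

text \<open>An approximation is built from the zero module \<open>K s\<close>, one term longer at
  each cokernel, until \<open>K 0\<close> is reached; there the uniform bound on projective
  dimensions cuts its length to \<open>n\<close>, and \<open>n\<close> syzygies use it up.\<close>

theorem gp_syzygy:
  fixes R :: "('r, 'x) ring_scheme" and G K :: "nat \<Rightarrow> 'r umodule"
  assumes ret: "gp_retract_closed R"
    and fin: "\<And>(C :: 'r umodule) k. pdl R k C \<Longrightarrow> pdl R (Suc n) C"
    and S: "\<And>j. ses R (K (Suc j)) (G j) (K j) (i j) (p j)" and G: "\<And>j. gp R (G j)"
    and zero: "carrier (K s) = {\<zero>\<^bsub>K s\<^esub>}"
  shows "gp R (K n)"
proof -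
  have Ks: "left_module R (K s)" by (rule sesD(3)[OF S])
  have eq: "(K s)\<lparr>carrier := {\<zero>\<^bsub>K s\<^esub>}\<rparr> = K s" using zero by (cases "K s") simp
  have "gp R (K s)" by (rule gp_projective[OF projective_zero[OF Ks zero] fin_gen_zero[OF Ks zero]])
  then have "gp_approx R 0 (K s)"
    unfolding gp_approx_def using ses_zero_id[OF Ks] pdl.zero[OF Ks zero] unfolding eq by blast
  then have "gp_approx R m (K (s - m))" if "m \<le> s" for m
    using that
  proof (induction m)
    case (Suc m)
    then have "Suc (s - Suc m) = s - m" by simp
    then show ?case using gp_approx_cokernel[OF S[of "s - Suc m"] G] Suc by simp
  qed simp
  from this[of s] have "gp_approx R s (K 0)" by simp
  then have "gp_approx R n (K 0)" by (rule gp_approx_shorten[OF ret]) (rule fin)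
  then have "gp_approx R (n - m) (K m)" if "m \<le> n" for m
    using that
  proof (induction m)
    case (Suc m)
    then have "Suc (n - Suc m) = n - m" by simp
    then show ?case using gp_approx_syzygy[OF ret S[of m] G, of "n - Suc m"] Suc by simp
  qed simp
  from this[of n] show ?thesis using gp_approx_zero[OF ret] by simp
qed

lemma perp_iso:
  fixes R :: "('r, 'x) ring_scheme" and G G' :: "'r umodule"
  assumes "perp R G" "left_module R G'" "f \<in> mod_hom R G' G" "g \<in> mod_hom R G G'"
    "\<And>x. x \<in> carrier G' \<Longrightarrow> g (f x) = x"
  shows "perp R G'"
proof (rule perp_through[where Zs = "{G}"])
  show "through R {G} G' G' (\<lambda>x. x)"
    by (rule through_cong[OF through_single[OF _ assms(3,4,2)]]) (simp_all add: assms(5))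
qed (use assms(1,2) in simp_all)

lemma gp_iso:
  fixes R :: "('r, 'x) ring_scheme" and G G' :: "'r umodule"
  assumes G: "gp R G" and G': "left_module R G'" and "mod_iso R G G'"
  shows "gp R G'"
proof -
  obtain f g where f: "f \<in> mod_hom R G G'" and g: "g \<in> mod_hom R G' G"
    and gf: "\<And>x. x \<in> carrier G \<Longrightarrow> g (f x) = x" and fg: "\<And>y. y \<in> carrier G' \<Longrightarrow> f (g y) = y"
    by (rule mod_isoE[OF gp_module[OF G] assms(2,3)]) (rule that)
  obtain P C i p where S: "pses R G P C i p" "gp R C" by (rule gpE[OF G]) (rule that)
  have "pses R G' P C (\<lambda>x. i (g x)) p"
  proof (rule psesI[OF ses_iso_dom[OF psesD(1)[OF S(1)] G' g f fg gf] psesD(2,3)[OF S(1)]])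
    fix Q :: "'r umodule" and h
    assume Q: "projective R Q" "fin_gen R Q" and h: "h \<in> mod_hom R G' Q"
    obtain k where k: "k \<in> mod_hom R P Q" "\<And>x. x \<in> carrier G \<Longrightarrow> k (i x) = h (f x)"
      by (rule pses_extend[OF S(1) Q hom_comp[OF f h]]) (rule that)
    show "\<exists>k\<in>mod_hom R P Q. \<forall>x\<in>carrier G'. k (i (g x)) = h x"
      by (rule bexI[OF _ k(1)]) (simp add: k(2) hom_in[OF g] fg)
  qed
  moreover have "perp R G'" by (rule perp_iso[OF gp_perp[OF G] G' g f fg])
  ultimately show ?thesis using S(2) gp.step by blast
qed

section \<open>Totally acyclic complexes versus the coinductive description\<close>

definition boundaries ::
  "(int \<Rightarrow> ('r, 'm) module) \<Rightarrow> (int \<Rightarrow> 'm \<Rightarrow> 'm) \<Rightarrow> int \<Rightarrow> ('r, 'm) module" where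
  "boundaries P d i = (P (i - 1))\<lparr>carrier := d i ` carrier (P i)\<rparr>"

text \<open>Each differential is split into an epimorphism onto its image and the inclusion of that
  image. The extension property is the exactness after Hom(-, Q): a map on an image, composed with
  the differential onto it, vanishes on the preceding image and therefore factors through that
  differential.\<close>

lemma totally_acyclic_pses:
  fixes R :: "('r, 'x) ring_scheme"
  assumes T: "totally_acyclic R P d"
  shows "pses R (boundaries P d (i + 1)) (P i) (boundaries P d i) (\<lambda>x. x) (d i)"
proof -
  have P: "projective R (P i)" "fin_gen R (P i)" for i using T by (auto simp: totally_acyclic_def)
  note Pm = projective_module[OF P(1)]
  have d: "d i \<in> mod_hom R (P i) (P (i - 1))" for i using T by (auto simp: totally_acyclic_def)
  have ex: "d (i + 1) ` carrier (P (i + 1)) = {x \<in> carrier (P i). d i x = \<zero>\<^bsub>P (i - 1)\<^esub>}" for i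
    using T by (auto simp: totally_acyclic_def a_kernel_def')
  have ext: "\<exists>g\<in>mod_hom R (P (i - 1)) Q. \<forall>x\<in>carrier (P i). f x = g (d i x)"
    if "projective R Q" "fin_gen R Q" "f \<in> mod_hom R (P i) Q"
      "\<And>x. x \<in> carrier (P (i + 1)) \<Longrightarrow> f (d (i + 1) x) = \<zero>\<^bsub>Q\<^esub>" for f i and Q :: "'r umodule"
    using T[unfolded totally_acyclic_def, THEN conjunct2, THEN conjunct2, THEN conjunct2, rule_format, of Q f i] that by simp
  have I: "left_module R (boundaries P d i)" for i
    unfolding boundaries_def by (rule left_module_submod[OF Pm submod_image[OF Pm Pm d]])
  have sub: "d (i + 1) ` carrier (P (i + 1)) \<subseteq> carrier (P i)" for i using ex[of i] by auto
  have h1: "(\<lambda>x. x) \<in> mod_hom R (boundaries P d (i + 1)) (P i)"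
    unfolding boundaries_def using hom_sub_dom[OF hom_id sub[of i]] by simp
  have h2: "d i \<in> mod_hom R (P i) (boundaries P d i)"
    unfolding boundaries_def by (rule hom_sub_cod[OF d]) simp
  show ?thesis
  proof (rule psesI[OF _ P])
    show "ses R (boundaries P d (i + 1)) (P i) (boundaries P d i) (\<lambda>x. x) (d i)"
      unfolding ses_def using I[of "i + 1"] I[of i] Pm h1 h2 ex[of i] by (auto simp: boundaries_def)
    fix Q :: "'r umodule" and f
    assume Q: "projective R Q" "fin_gen R Q" and f: "f \<in> mod_hom R (boundaries P d (i + 1)) Q"
    have "(\<lambda>x. f (d (i + 1) x)) \<in> mod_hom R (P (i + 1)) Q"
      by (rule hom_comp[OF _ f], unfold boundaries_def, rule hom_sub_cod[OF d]) simp
    moreover have "f (d (i + 1) (d (i + 1 + 1) x)) = \<zero>\<^bsub>Q\<^esub>" if x: "x \<in> carrier (P (i + 1 + 1))" for x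
    proof -
      have "d (i + 1 + 1) x \<in> {x \<in> carrier (P (i + 1)). d (i + 1) x = \<zero>\<^bsub>P (i + 1 - 1)\<^esub>}"
        unfolding ex[of "i + 1", symmetric] using x by blast
      then have "d (i + 1) (d (i + 1 + 1) x) = \<zero>\<^bsub>boundaries P d (i + 1)\<^esub>" by (simp add: boundaries_def)
      then show ?thesis using hom_simps(4)[OF I projective_module[OF Q(1)] f] by simp
    qed
    ultimately obtain g where g: "g \<in> mod_hom R (P i) Q" "\<forall>x\<in>carrier (P (i + 1)). f (d (i + 1) x) = g (d (i + 1) x)"
      using ext[OF Q, of "\<lambda>x. f (d (i + 1) x)" "i + 1"] by auto
    then show "\<exists>g\<in>mod_hom R (P i) Q. \<forall>x\<in>carrier (boundaries P d (i + 1)). g x = f x"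
      by (intro bexI[OF _ g(1)]) (auto simp: boundaries_def)
  qed
qed

text \<open>The invariant is to be one of the images: \<open>perp\<close> moves to higher indices
  and \<open>gp\<close> to lower ones.\<close>

lemma totally_acyclic_gp:
  fixes R :: "('r, 'x) ring_scheme"
  assumes T: "totally_acyclic R P d"
  shows "gp R (boundaries P d i)"
proof -
  have perp: "perp R (boundaries P d i)" for i
  proof -
    have "\<exists>i. boundaries P d i = boundaries P d i" by simp
    then show ?thesis
    proof (coinduction arbitrary: i rule: perp.coinduct)
      case (perp i)
      show ?case using totally_acyclic_pses[OF T, of i] by blast
    qed
  qed
  show ?thesis
  proof (coinduction arbitrary: i rule: gp.coinduct)
    case (gp i)
    show ?case using totally_acyclic_pses[OF T, of "i - 1"] perp[of i] by fastforce
  qed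
qed

lemma gorenstein_projective_iso_gp:
  fixes R :: "('r, 'x) ring_scheme" and G :: "('r, 'm) module"
  assumes "gorenstein_projective R G"
  obtains G' :: "'r umodule" where "gp R G'" "mod_iso R G G'"
proof -
  obtain P d where "totally_acyclic R P d" "mod_iso R G ((P (-1))\<lparr>carrier := d 0 ` carrier (P 0)\<rparr>)"
    using assms unfolding gorenstein_projective_def by blast
  then show ?thesis using that[of "boundaries P d 0"] totally_acyclic_gp[of R P d 0] by (simp add: boundaries_def)
qed

lemma mod_iso_sym:
  assumes "left_module R M" "left_module R N" "mod_iso R M N"
  shows "mod_iso R N M"
  by (rule mod_isoE[OF assms]) (rule mod_isoI)

text \<open>Dependent choice unrolls \<open>perp\<close> into syzygies and \<open>gp\<close> into
  cosyzygies; joined at \<open>G\<close> they give a doubly infinite family of short exact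
  sequences, whose splicing is the complex.\<close>

lemma gp_gorenstein_projective:
  fixes R :: "('r, 'x) ring_scheme" and G :: "'r umodule"
  assumes G: "gp R G"
  shows "gorenstein_projective R G"
proof -
  define nxt where "nxt X Y \<longleftrightarrow> (\<exists>P i p. pses R X P Y i p)" for X Y :: "'r umodule"
  have "\<exists>f. \<forall>n. ((n = 0 \<longrightarrow> f n = G) \<and> gp R (f n)) \<and> nxt (f n) (f (Suc n))"
  proof (rule dependent_nat_choice)
    show "\<exists>x. ((0 :: nat) = 0 \<longrightarrow> x = G) \<and> gp R x" using G by blast
    show "\<exists>y. ((Suc n = 0 \<longrightarrow> y = G) \<and> gp R y) \<and> nxt x y" if "(n = 0 \<longrightarrow> x = G) \<and> gp R x" for x n
      using that gpE[of R x] unfolding nxt_def by (metis nat.distinct(1))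
  qed
  then obtain r where r: "r 0 = G" "\<And>n. nxt (r n) (r (Suc n))" by blast
  have "\<exists>f. \<forall>n. ((n = 0 \<longrightarrow> f n = G) \<and> perp R (f n)) \<and> nxt (f (Suc n)) (f n)"
  proof (rule dependent_nat_choice)
    show "\<exists>x. ((0 :: nat) = 0 \<longrightarrow> x = G) \<and> perp R x" using gp_perp[OF G] by blast
    show "\<exists>y. ((Suc n = 0 \<longrightarrow> y = G) \<and> perp R y) \<and> nxt y x" if "(n = 0 \<longrightarrow> x = G) \<and> perp R x" for x n
      using that perpE[of R x] unfolding nxt_def by (metis nat.distinct(1))
  qed
  then obtain l where l: "l 0 = G" "\<And>n. nxt (l (Suc n)) (l n)" by blast
  \<comment> \<open>Syzygies of \<open>G\<close> sit at positive indices and cosyzygies at negative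
    ones, so that every sequence starts at index \<open>i + 1\<close> and ends at index
    \<open>i\<close>.\<close>
  define H where "H i = (if i \<ge> 0 then l (nat i) else r (nat (- i)))" for i :: int
  have "nxt (H (i + 1)) (H i)" for i
  proof (cases "i \<ge> 0")
    case True
    then show ?thesis using l(2)[of "nat i"] by (simp add: H_def Suc_nat_eq_nat_zadd1 add.commute)
  next
    case False
    then have "Suc (nat (- (i + 1))) = nat (- i)" by simp
    then have "nxt (r (nat (- (i + 1)))) (r (nat (- i)))" using r(2)[of "nat (- (i + 1))"] by simp
    then show ?thesis using False l(1) r(1) by (cases "i = -1") (auto simp: H_def)
  qed
  then obtain P \<iota> \<pi> where S: "\<And>i. pses R (H (i + 1)) (P i) (H i) (\<iota> i) (\<pi> i)"
    unfolding nxt_def by metis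
  note D = sesD[OF psesD(1)[OF S]]
  define d where "d i x = \<iota> (i - 1) (\<pi> i x)" for i x
  have \<iota>: "\<iota> (i - 1) \<in> mod_hom R (H i) (P (i - 1))" for i using D(4)[of "i - 1"] by simp
  have \<iota>0: "\<iota> (i - 1) x = \<zero>\<^bsub>P (i - 1)\<^esub> \<longleftrightarrow> x = \<zero>\<^bsub>H i\<^esub>" if "x \<in> carrier (H i)" for i x
    using ses_inj[OF psesD(1)[OF S[of "i - 1"]], of x] that hom_simps(4)[OF D(3) D(2) \<iota>] by auto
  have d: "d i \<in> mod_hom R (P i) (P (i - 1))" for i
    unfolding d_def by (rule hom_comp[OF D(5) \<iota>])
  have im: "d (i + 1) ` carrier (P (i + 1)) = \<iota> i ` carrier (H (i + 1))" for i
    unfolding d_def using D(8)[of "i + 1"] by (simp flip: image_image)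
  have ex: "d (i + 1) ` carrier (P (i + 1)) = {x \<in> carrier (P i). d i x = \<zero>\<^bsub>P (i - 1)\<^esub>}" for i
    unfolding im D(7) using \<iota>0[OF hom_in[OF D(5)]] by (auto simp: d_def)
  have T: "totally_acyclic R P d"
    unfolding totally_acyclic_def
  proof (intro conjI allI impI ballI)
    fix Q :: "'r umodule" and i f
    assume Q: "projective R Q \<and> fin_gen R Q" and f: "f \<in> mod_hom R (P i) Q"
      and z: "\<forall>x\<in>carrier (P (i + 1)). f (d (i + 1) x) = \<zero>\<^bsub>Q\<^esub>"
    have "f (\<iota> i x) = \<zero>\<^bsub>Q\<^esub>" if "x \<in> carrier (H (i + 1))" for x
    proof -
      have "\<iota> i x \<in> d (i + 1) ` carrier (P (i + 1))" unfolding im using that by blast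
      then show ?thesis using z by auto
    qed
    then obtain t where t: "t \<in> mod_hom R (H i) Q" "\<And>x. x \<in> carrier (P i) \<Longrightarrow> t (\<pi> i x) = f x"
      by (rule ses_desc[OF psesD(1)[OF S] projective_module[OF conjunct1[OF Q]] f]) (assumption, rule that)
    have t': "t \<in> mod_hom R (H (i - 1 + 1)) Q" using t(1) by simp
    obtain g where g: "g \<in> mod_hom R (P (i - 1)) Q" "\<And>x. x \<in> carrier (H (i - 1 + 1)) \<Longrightarrow> g (\<iota> (i - 1) x) = t x"
      by (rule pses_extend[OF S conjunct1[OF Q] conjunct2[OF Q] t']) (rule that)
    show "\<exists>g\<in>mod_hom R (P (i - 1)) Q. \<forall>x\<in>carrier (P i). f x = g (d i x)"
      by (rule bexI[OF _ g(1)]) (use g(2) t(2) hom_in[OF D(5)] in \<open>simp add: d_def\<close>)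
  qed (use psesD(2,3)[OF S] d ex in \<open>simp_all add: a_kernel_def'\<close>)
  let ?I = "(P (-1))\<lparr>carrier := d 0 ` carrier (P 0)\<rparr>"
  have H0: "H 0 = G" by (simp add: H_def l(1))
  have i0: "\<iota> (-1) \<in> mod_hom R G (P (-1))" using \<iota>[of 0] H0 by simp
  have im0: "d 0 ` carrier (P 0) = \<iota> (-1) ` carrier G" using im[of "-1"] H0 by simp
  have "mod_iso R G ?I"
    unfolding mod_iso_def
  proof (rule bexI[of _ "\<iota> (-1)"])
    show "\<iota> (-1) \<in> mod_hom R G ?I" by (rule hom_sub_cod[OF i0]) (simp add: im0)
    show "bij_betw (\<iota> (-1)) (carrier G) (carrier ?I)"
      using D(6)[of "-1"] H0 by (simp add: bij_betw_def im0)
  qed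
  then show ?thesis unfolding gorenstein_projective_def using T gp_module[OF G] gp_fin_gen[OF G] by blast
qed

lemma gorenstein_projective_iff_gp:
  fixes R :: "('r, 'x) ring_scheme" and G :: "'r umodule"
  shows "gorenstein_projective R G \<longleftrightarrow> gp R G"
proof
  assume G: "gorenstein_projective R G"
  then have m: "left_module R G" by (simp add: gorenstein_projective_def)
  obtain G' :: "'r umodule" where G': "gp R G'" "mod_iso R G G'" by (rule gorenstein_projective_iso_gp[OF G]) (rule that)
  show "gp R G" by (rule gp_iso[OF G'(1) m mod_iso_sym[OF m gp_module[OF G'(1)] G'(2)]])
qed (rule gp_gorenstein_projective)

section \<open>Summands of powers\<close>

lemma submodule_iff_submod:
  assumes "left_module R M"
  shows "submodule S R M \<longleftrightarrow> submod R M S"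
proof
  interpret left_module R M by fact
  assume "submodule S R M"
  then interpret S: submodule S R M .
  show "submod R M S" unfolding submod_def
    using S.subset S.m_closed S.one_closed S.smult_closed by auto
next
  interpret left_module R M by fact
  assume S: "submod R M S"
  show "submodule S R M"
  proof (intro submodule.intro subgroup.intro submodule_axioms.intro)
    show "inv\<^bsub>add_monoid M\<^esub> x \<in> S" if "x \<in> S" for x
      using submod_uminus[OF assms S that] by (simp add: a_inv_def)
  qed (use S in \<open>auto simp: submod_def\<close>)
qed

lemma mod_power_sel [simp]:
  "carrier (mod_power M n) = {..<n} \<rightarrow>\<^sub>E carrier M" "\<zero>\<^bsub>mod_power M n\<^esub> = (\<lambda>i\<in>{..<n}. \<zero>\<^bsub>M\<^esub>)"
  "x \<oplus>\<^bsub>mod_power M n\<^esub> y = (\<lambda>i\<in>{..<n}. x i \<oplus>\<^bsub>M\<^esub> y i)" "r \<odot>\<^bsub>mod_power M n\<^esub> x = (\<lambda>i\<in>{..<n}. r \<odot>\<^bsub>M\<^esub> x i)"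
  by (simp_all add: mod_power_def)

lemma left_module_power:
  assumes "left_module R M"
  shows "left_module R (mod_power M n)"
proof -
  interpret M: left_module R M by fact
  have "abelian_group (mod_power M n)"
  proof (rule abelian_groupI)
    fix x assume "x \<in> carrier (mod_power M n)"
    then show "\<exists>y\<in>carrier (mod_power M n). y \<oplus>\<^bsub>mod_power M n\<^esub> x = \<zero>\<^bsub>mod_power M n\<^esub>"
      by (intro bexI[of _ "\<lambda>i\<in>{..<n}. \<ominus>\<^bsub>M\<^esub> x i"]) (auto simp: fun_eq_iff M.M.l_neg PiE_iff)
  qed (auto simp: fun_eq_iff M.M.a_ac PiE_iff extensional_def)
  then show ?thesis
    by (intro left_module_axiomsI M.R.ring_axioms)
       (auto simp: fun_eq_iff M.smult_l_distr M.smult_r_distr M.smult_assoc PiE_iff extensional_def)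
qed

text \<open>The composite is the sum of its parts through the single coordinates of the
  power.\<close>

lemma through_power:
  assumes "left_module R E" "left_module R X" "f \<in> mod_hom R X (mod_power E n)" "g \<in> mod_hom R (mod_power E n) Y" "left_module R Y"
  shows "through R {E} X Y (\<lambda>x. g (f x))"
proof -
  note P = left_module_power[OF assms(1), of n]
  have fc: "f x i \<in> carrier E" if "x \<in> carrier X" "i < n" for x i
    using hom_in[OF assms(3) that(1)] that(2) by (auto simp: PiE_iff)
  \<comment> \<open>The first \<open>m\<close> coordinates of \<open>f x\<close>, with the others
    replaced by zero; the induction restores one coordinate at a time.\<close>
  define t where "t m x = (\<lambda>i\<in>{..<n}. if i < m then f x i else \<zero>\<^bsub>E\<^esub>)" for m x
  have tc: "t m x \<in> carrier (mod_power E n)" if "x \<in> carrier X" for m x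
    using fc[OF that] mod_simps(1)[OF assms(1)] by (auto simp: t_def)
  have "through R {E} X Y (\<lambda>x. g (t m x))" if "m \<le> n" for m
    using that
  proof (induction m)
    case 0
    have "t 0 x = \<zero>\<^bsub>mod_power E n\<^esub>" for x by (simp add: t_def)
    then show ?case using hom_simps(4)[OF P assms(5,4)] by (intro through.zero) (simp only:)
  next
    case (Suc m)
    define s where "s e = (\<lambda>i\<in>{..<n}. if i = m then e else \<zero>\<^bsub>E\<^esub>)" for e
    have s: "s \<in> mod_hom R E (mod_power E n)"
      by (rule mod_homI) (auto simp: s_def fun_eq_iff mod_simps(1,2,4,5,20)[OF assms(1)])
    have p: "(\<lambda>x. f x m) \<in> mod_hom R X E"
      by (rule mod_homI) (use fc Suc in \<open>auto simp: hom_simps(2,3)[OF assms(2) P assms(3)]\<close>)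
    have "t (Suc m) x = t m x \<oplus>\<^bsub>mod_power E n\<^esub> s (f x m)" if "x \<in> carrier X" for x
      using fc[OF that] Suc(2) by (auto simp: t_def s_def fun_eq_iff mod_simps(1,5,6)[OF assms(1)])
    then have "g (t (Suc m) x) = g (t m x) \<oplus>\<^bsub>Y\<^esub> g (s (f x m))" if "x \<in> carrier X" for x
      using that hom_simps(2)[OF P assms(5,4) tc[OF that] hom_in[OF s hom_in[OF p that]]] by (simp del: mod_power_sel)
    then show ?case
      using Suc by (intro through.step[OF Suc.IH _ p hom_comp[OF s assms(4)]]) auto
  qed
  from this[OF order_refl] show ?thesis
  proof (rule through_cong)
    fix x assume "x \<in> carrier X"
    then have "t n x = f x" using hom_in[OF assms(3)] by (auto simp: t_def fun_eq_iff PiE_iff extensional_def)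
    then show "g (t n x) = g (f x)" by simp
  qed
qed

lemma through_power_factor:
  assumes "through R {E} X Y h" "left_module R E" "left_module R X" "left_module R Y"
  shows "\<exists>n f g. f \<in> mod_hom R X (mod_power E n) \<and> g \<in> mod_hom R (mod_power E n) Y \<and> (\<forall>x\<in>carrier X. h x = g (f x))"
  using assms(1)
proof induction
  case (zero h)
  have f: "(\<lambda>x. \<lambda>i\<in>{..<0}. \<zero>\<^bsub>E\<^esub>) \<in> mod_hom R X (mod_power E 0)" by (rule mod_homI) auto
  show ?case using zero f hom_zero[OF assms(4), of "mod_power E 0"] by blast
next
  case (step h Z a b h')
  then obtain n f g where f: "f \<in> mod_hom R X (mod_power E n)" and g: "g \<in> mod_hom R (mod_power E n) Y"
    and h: "\<And>x. x \<in> carrier X \<Longrightarrow> h x = g (f x)" by auto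
  have a: "a \<in> mod_hom R X E" and b: "b \<in> mod_hom R E Y" using step by auto
  note P = left_module_power[OF assms(2)]
  have fc: "f x i \<in> carrier E" if "x \<in> carrier X" "i < n" for x i
    using hom_in[OF f that(1)] that(2) by (auto simp: PiE_iff)
  \<comment> \<open>The further composite is stored in a new last coordinate.\<close>
  define f' where "f' x = (\<lambda>i\<in>{..<Suc n}. if i = n then a x else f x i)" for x
  have f': "f' \<in> mod_hom R X (mod_power E (Suc n))"
    by (rule mod_homI)
      (auto simp: f'_def fun_eq_iff hom_in[OF a] fc hom_simps(2,3)[OF assms(3,2) a] hom_simps(2,3)[OF assms(3) P f] less_Suc_eq)
  have rs: "(\<lambda>v. \<lambda>i\<in>{..<n}. v i) \<in> mod_hom R (mod_power E (Suc n)) (mod_power E n)"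
    and pr: "(\<lambda>v. v n) \<in> mod_hom R (mod_power E (Suc n)) E"
    by (rule mod_homI; auto simp: fun_eq_iff PiE_iff)+
  have g': "(\<lambda>v. g (\<lambda>i\<in>{..<n}. v i) \<oplus>\<^bsub>Y\<^esub> b (v n)) \<in> mod_hom R (mod_power E (Suc n)) Y"
    by (rule hom_add[OF P assms(4) hom_comp[OF rs g] hom_comp[OF pr b]])
  have "h' x = g (\<lambda>i\<in>{..<n}. f' x i) \<oplus>\<^bsub>Y\<^esub> b (f' x n)" if x: "x \<in> carrier X" for x
  proof -
    have "(\<lambda>i\<in>{..<n}. f' x i) = f x" using hom_in[OF f x] by (auto simp: f'_def fun_eq_iff PiE_iff extensional_def)
    then show ?thesis using step(5)[OF x] h[OF x] by (simp add: f'_def)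
  qed
  then show ?case using f' g' by blast
qed

text \<open>From a summand, the projection along its complement gives the factorisation of the
  identity; from a factorisation through a power, the complement is the kernel of the second
  map.\<close>

lemma add_class_iff_through:
  fixes R :: "('r, 'x) ring_scheme" and E :: "('r, 'e) module" and X :: "'r umodule"
  assumes E: "left_module R E" and X: "left_module R X"
  shows "X \<in> add_class R E \<longleftrightarrow> through R {E} X X (\<lambda>x. x)"
proof
  assume "X \<in> add_class R E"
  then obtain n S C where ds: "internal_direct_sum R (mod_power E n) S C"
    and iso: "mod_iso R X ((mod_power E n)\<lparr>carrier := S\<rparr>)" unfolding add_class_def by blast
  let ?P = "mod_power E n"
  note P = left_module_power[OF E, of n]
  have S: "submod R ?P S" and C: "submod R ?P C" and SC: "S \<inter> C = {\<zero>\<^bsub>?P\<^esub>}"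
    and sum: "S <+>\<^bsub>?P\<^esub> C = carrier ?P"
    using ds unfolding internal_direct_sum_def submodule_iff_submod[OF P] by blast+
  let ?S = "?P\<lparr>carrier := S\<rparr>" and ?C = "?P\<lparr>carrier := C\<rparr>"
  note Sm = left_module_submod[OF P S] and Cm = left_module_submod[OF P C]
  have sub: "S \<subseteq> carrier ?P" "C \<subseteq> carrier ?P" using S C by (auto simp: submod_def)
  let ?D = "prod_module ?S ?C"
  have Dm: "left_module R ?D" by (rule left_module_prod[OF Sm Cm])
  have fs: "fst \<in> mod_hom R ?D ?S" "snd \<in> mod_hom R ?D ?C" by (auto intro!: mod_homI)
  have incl: "(\<lambda>x. x) \<in> mod_hom R ?S ?P" "(\<lambda>x. x) \<in> mod_hom R ?C ?P" by (rule hom_sub_dom[OF hom_id sub(1)], rule hom_sub_dom[OF hom_id sub(2)])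
  let ?s = "\<lambda>a. fst a \<oplus>\<^bsub>?P\<^esub> snd a"
  have s: "?s \<in> mod_hom R ?D ?P" by (rule hom_add[OF Dm P hom_comp[OF fs(1) incl(1)] hom_comp[OF fs(2) incl(2)]])
  have surj: "?s ` carrier ?D = carrier ?P"
    unfolding sum[symmetric] set_add_def' by (auto simp del: mod_power_sel simp: image_iff) blast+
  have inj: "fst a = \<zero>\<^bsub>?S\<^esub>" if a: "a \<in> carrier ?D" "?s a = \<zero>\<^bsub>?P\<^esub>" for a
  proof -
    have ac: "fst a \<in> S" "snd a \<in> C" "fst a \<in> carrier ?P" "snd a \<in> carrier ?P"
      using a(1) sub by (auto simp del: mod_power_sel)
    have "snd a = \<ominus>\<^bsub>?P\<^esub> fst a" by (rule neg_unique[OF P ac(3,4) a(2)])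
    then have "\<ominus>\<^bsub>?P\<^esub> (snd a) = fst a" using ac(3) by (simp only: mod_simps(14)[OF P])
    then have "fst a \<in> C" using submod_uminus[OF P C ac(2)] by simp
    then have "fst a \<in> {\<zero>\<^bsub>?P\<^esub>}" using ac(1) SC by blast
    then show ?thesis by simp
  qed
  \<comment> \<open>The projection onto \<open>S\<close> along \<open>C\<close>, obtained by
    factoring the first coordinate through the surjective sum map.\<close>
  obtain \<rho> where \<rho>: "\<rho> \<in> mod_hom R ?P ?S" "\<And>a. a \<in> carrier ?D \<Longrightarrow> \<rho> (?s a) = fst a"
    by (rule factor_epi[OF Dm P Sm s surj fs(1) inj]) (assumption, assumption, rule that)
  have \<rho>S: "\<rho> x = x" if "x \<in> S" for x
  proof -
    have z: "\<zero>\<^bsub>?P\<^esub> \<in> C" using C by (simp add: submod_def)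
    have "\<rho> (?s (x, \<zero>\<^bsub>?P\<^esub>)) = fst (x, \<zero>\<^bsub>?P\<^esub>)" by (rule \<rho>(2)) (use that z in simp)
    moreover have "?s (x, \<zero>\<^bsub>?P\<^esub>) = x" using mod_simps(6)[OF P, of x] that sub(1) by (auto simp del: mod_power_sel)
    ultimately show ?thesis by simp
  qed
  obtain f g where f: "f \<in> mod_hom R X ?S" and g: "g \<in> mod_hom R ?S X" and gf: "\<And>x. x \<in> carrier X \<Longrightarrow> g (f x) = x"
    by (rule mod_isoE[OF X Sm iso]) (rule that)
  have fP: "f \<in> mod_hom R X ?P" by (rule hom_sub_incl[OF f sub(1)])
  show "through R {E} X X (\<lambda>x. x)"
  proof (rule through_cong[OF through_power[OF E X fP hom_comp[OF \<rho>(1) g] X]])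
    fix x assume x: "x \<in> carrier X"
    have "f x \<in> S" using hom_in[OF f x] by simp
    then show "g (\<rho> (f x)) = x" using \<rho>S gf[OF x] by simp
  qed
next
  assume t: "through R {E} X X (\<lambda>x. x)"
  obtain n f g where f: "f \<in> mod_hom R X (mod_power E n)" and g: "g \<in> mod_hom R (mod_power E n) X"
    and gf: "\<And>x. x \<in> carrier X \<Longrightarrow> x = g (f x)"
    using through_power_factor[OF t E X X] by (elim exE conjE) (rule that, auto)
  let ?P = "mod_power E n"
  note P = left_module_power[OF E, of n]
  let ?S = "f ` carrier X" and ?C = "{v \<in> carrier ?P. g v = \<zero>\<^bsub>X\<^esub>}"
  have S: "submod R ?P ?S" by (rule submod_image[OF X P f])
  have C: "submod R ?P ?C" by (rule submod_kernel[OF P X g])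
  have "?S \<inter> ?C \<subseteq> {\<zero>\<^bsub>?P\<^esub>}"
  proof
    fix v assume "v \<in> ?S \<inter> ?C"
    then obtain x where x: "x \<in> carrier X" "v = f x" "g v = \<zero>\<^bsub>X\<^esub>" by auto
    then have "x = \<zero>\<^bsub>X\<^esub>" using gf[OF x(1)] by simp
    then show "v \<in> {\<zero>\<^bsub>?P\<^esub>}" using x(2) hom_simps(4)[OF X P f] by simp
  qed
  moreover have "\<zero>\<^bsub>?P\<^esub> \<in> ?S" "\<zero>\<^bsub>?P\<^esub> \<in> ?C" using S C by (simp_all add: submod_def)
  ultimately have SC: "?S \<inter> ?C = {\<zero>\<^bsub>?P\<^esub>}" by blast
  have "v \<in> ?S <+>\<^bsub>?P\<^esub> ?C" if v: "v \<in> carrier ?P" for v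
  proof -
    have gv: "g v \<in> carrier X" "f (g v) \<in> carrier ?P" using hom_in[OF g v] hom_in[OF f] by auto
    let ?c = "v \<oplus>\<^bsub>?P\<^esub> \<ominus>\<^bsub>?P\<^esub> f (g v)"
    have c: "?c \<in> carrier ?P" by (rule mod_simps(2)[OF P v mod_simps(3)[OF P gv(2)]])
    have "g ?c = g v \<oplus>\<^bsub>X\<^esub> \<ominus>\<^bsub>X\<^esub> g (f (g v))"
      by (simp only: hom_simps(2)[OF P X g v mod_simps(3)[OF P gv(2)]] hom_simps(5)[OF P X g gv(2)])
    then have "g ?c = \<zero>\<^bsub>X\<^esub>" using gf[OF gv(1)] gv(1) by (simp add: mod_simps(8)[OF X] del: mod_power_sel)
    then have "?c \<in> ?C" using c by blast
    moreover have "v = f (g v) \<oplus>\<^bsub>?P\<^esub> ?c" by (rule mod_simps(11)[OF P gv(2) v, symmetric])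
    ultimately show ?thesis unfolding set_add_def' using gv(1) by blast
  qed
  moreover have "?S <+>\<^bsub>?P\<^esub> ?C \<subseteq> carrier ?P"
    unfolding set_add_def' using mod_simps(2)[OF P] S by (auto simp: submod_def simp del: mod_power_sel)
  ultimately have "?S <+>\<^bsub>?P\<^esub> ?C = carrier ?P" by blast
  then have ds: "internal_direct_sum R ?P ?S ?C"
    unfolding internal_direct_sum_def submodule_iff_submod[OF P] using S C SC by blast
  have "inj_on f (carrier X)" by (rule inj_on_inverseI[where g = g]) (rule gf[symmetric])
  then have "mod_iso R X (?P\<lparr>carrier := ?S\<rparr>)"
    unfolding mod_iso_def using hom_sub_cod[OF f order_refl] by (intro bexI[of _ f]) (auto simp: bij_betw_def)
  then show "X \<in> add_class R E" unfolding add_class_def using X ds by blast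
qed

text \<open>Composing the decomposition of the identity of \<open>Z\<close> with the two maps of the
  retraction decomposes the identity of the retract.\<close>

lemma gp_retract_closed_if_add_class:
  fixes R :: "('r, 'x) ring_scheme" and E :: "('r, 'e) module"
  assumes E: "left_module R E" and "GP_class R = add_class R E"
  shows "gp_retract_closed R"
proof -
  have gp: "gp R X \<longleftrightarrow> X \<in> add_class R E" for X :: "'r umodule"
    using assms(2) gorenstein_projective_iff_gp[of R X] by (auto simp: GP_class_def)
  show ?thesis
    unfolding gp_retract_closed_def
  proof (intro allI impI, elim conjE)
    fix X Z :: "'r umodule" and f g
    assume Z: "gp R Z" and X: "left_module R X" and f: "f \<in> mod_hom R X Z" and g: "g \<in> mod_hom R Z X"
      and gf: "\<forall>x\<in>carrier X. g (f x) = x"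
    have "through R {E} Z Z (\<lambda>x. x)" using Z gp add_class_iff_through[OF E gp_module[OF Z]] by simp
    from through_comp[OF this gp_module[OF Z] X f g]
    have "through R {E} X X (\<lambda>x. x)" by (rule through_cong) (use gf in simp)
    then show "gp R X" using gp add_class_iff_through[OF E X] by simp
  qed
qed

section \<open>Projective dimension\<close>

lemma left_resolution_iso:
  assumes res: "left_resolution R X P d e" and X: "left_module R X" and Y: "left_module R Y" and iso: "mod_iso R X Y"
  shows "\<exists>e'. left_resolution R Y P d e'"
proof -
  obtain f g where f: "f \<in> mod_hom R X Y" and g: "g \<in> mod_hom R Y X"
    and gf: "\<And>x. x \<in> carrier X \<Longrightarrow> g (f x) = x" and fg: "\<And>y. y \<in> carrier Y \<Longrightarrow> f (g y) = y"
    by (rule mod_isoE[OF X Y iso]) (rule that)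
  have e: "e \<in> mod_hom R (P 0) X" "e ` carrier (P 0) = carrier X" using res by (auto simp: left_resolution_def)
  have im: "f ` carrier X = carrier Y"
    using hom_in[OF f] hom_in[OF g] fg by (metis (no_types, lifting) image_eqI image_subsetI subsetI subset_antisym)
  have "f x = \<zero>\<^bsub>Y\<^esub> \<longleftrightarrow> x = \<zero>\<^bsub>X\<^esub>" if "x \<in> carrier X" for x
    using gf[OF that] hom_simps(4)[OF X Y f] hom_simps(4)[OF Y X g] by auto
  then have "a_kernel (P 0) Y (\<lambda>x. f (e x)) = a_kernel (P 0) X e"
    using hom_in[OF e(1)] by (auto simp: a_kernel_def')
  moreover have "(\<lambda>x. f (e x)) ` carrier (P 0) = carrier Y"
    unfolding image_image[of f e, symmetric] e(2) im ..
  ultimately have "left_resolution R Y P d (\<lambda>x. f (e x))"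
    using res hom_comp[OF e(1) f] by (simp add: left_resolution_def)
  then show ?thesis by blast
qed

text \<open>Cuts off the first term: the kernel of the augmentation is resolved by the remaining
  terms. Inductions on resolutions descend this way.\<close>

lemma resolution_syzygy:
  fixes X :: "('r, 'm) module" and P :: "nat \<Rightarrow> ('r, 'p) module"
  assumes res: "left_resolution R X P d e" and X: "left_module R X"
  shows "ses R ((P 0)\<lparr>carrier := {y \<in> carrier (P 0). e y = \<zero>\<^bsub>X\<^esub>}\<rparr>) (P 0) X (\<lambda>x. x) e"
    and "left_resolution R ((P 0)\<lparr>carrier := {y \<in> carrier (P 0). e y = \<zero>\<^bsub>X\<^esub>}\<rparr>) (\<lambda>i. P (Suc i)) (\<lambda>i. d (Suc i)) (d 0)"
      (is "left_resolution R ?K _ _ _")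
proof -
  show "ses R ?K (P 0) X (\<lambda>x. x) e" by (rule ses_kernel) (use res X in \<open>auto simp: left_resolution_def\<close>)
  have "d 0 ` carrier (P (Suc 0)) = carrier ?K" using res by (simp add: left_resolution_def a_kernel_def')
  moreover from this have "d 0 \<in> mod_hom R (P (Suc 0)) ?K"
    using res by (intro hom_sub_cod) (auto simp: left_resolution_def)
  moreover have "a_kernel (P (Suc 0)) ?K (d 0) = a_kernel (P (Suc 0)) (P 0) (d 0)" by (simp add: a_kernel_def')
  ultimately show "left_resolution R ?K (\<lambda>i. P (Suc i)) (\<lambda>i. d (Suc i)) (d 0)"
    using res by (simp add: left_resolution_def)
qed

lemma pdl_if_resolution:
  fixes X :: "'r umodule"
  assumes "fg_projective_resolution R X P d e" "left_module R X" "\<And>i. i \<ge> k \<Longrightarrow> carrier (P i) = {\<zero>\<^bsub>P i\<^esub>}"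
  shows "pdl R k X"
  using assms
proof (induction k arbitrary: X P d e)
  case 0
  have P: "left_module R (P 0)" "e \<in> mod_hom R (P 0) X" "e ` carrier (P 0) = carrier X"
    using 0(1) by (auto simp: fg_projective_resolution_def left_resolution_def)
  have "carrier X = {\<zero>\<^bsub>X\<^esub>}"
    unfolding P(3)[symmetric] using 0(3)[of 0] hom_simps(4)[OF P(1) 0(2) P(2)] by simp
  then show ?case by (rule pdl.zero[OF 0(2)])
next
  case (Suc k)
  have res: "left_resolution R X P d e" and P: "projective R (P i)" "fin_gen R (P i)" for i
    using Suc(2) by (auto simp: fg_projective_resolution_def)
  note S = resolution_syzygy[OF res Suc(3)]
  show ?case
  proof (rule pdl.suc[OF S(1) P Suc.IH])
    show "fg_projective_resolution R ((P 0)\<lparr>carrier := {y \<in> carrier (P 0). e y = \<zero>\<^bsub>X\<^esub>}\<rparr>) (\<lambda>i. P (Suc i)) (\<lambda>i. d (Suc i)) (d 0)"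
      unfolding fg_projective_resolution_def using S(2) P by blast
  qed (use sesD(1)[OF S(1)] Suc(4) in auto)
qed

lemma resolution_if_pdl:
  fixes X :: "'r umodule"
  assumes "pdl R k X"
  shows "\<exists>P d e. fg_projective_resolution R X P d e \<and> (\<forall>i\<ge>k. carrier (P i) = {\<zero>\<^bsub>P i\<^esub>})"
  using assms
proof induction
  case (zero X)
  have "fg_projective_resolution R X (\<lambda>_. X) (\<lambda>_ x. x) (\<lambda>x. x)"
    unfolding fg_projective_resolution_def left_resolution_def
    using zero projective_zero[OF zero] fin_gen_zero[OF zero] hom_id[of R X] by (auto simp: a_kernel_def')
  then show ?case using zero by blast
next
  case (suc K Q X i p k)
  then obtain P d e where res: "fg_projective_resolution R K P d e" and P: "\<And>i. i \<ge> k \<Longrightarrow> carrier (P i) = {\<zero>\<^bsub>P i\<^esub>}"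
    by auto
  note D = sesD[OF suc(1)]
  \<comment> \<open>The new cover is placed in degree zero, and the old augmentation followed by the
    inclusion of the kernel becomes the first differential.\<close>
  let ?P = "\<lambda>j. case j of 0 \<Rightarrow> Q | Suc j \<Rightarrow> P j"
  let ?d = "\<lambda>j. case j of 0 \<Rightarrow> (\<lambda>x. i (e x)) | Suc j \<Rightarrow> d j"
  have r: "left_resolution R K P d e" "\<And>i. projective R (P i) \<and> fin_gen R (P i)"
    using res by (auto simp: fg_projective_resolution_def)
  have e: "e \<in> mod_hom R (P 0) K" "e ` carrier (P 0) = carrier K" "d 0 ` carrier (P 1) = a_kernel (P 0) K e"
    using r(1) by (auto simp: left_resolution_def)
  have im: "(\<lambda>x. i (e x)) ` carrier (P 0) = a_kernel Q X p"
    unfolding image_image[of i e, symmetric] e(2) D(7) a_kernel_def' ..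
  have "i (e x) = \<zero>\<^bsub>Q\<^esub> \<longleftrightarrow> e x = \<zero>\<^bsub>K\<^esub>" if "x \<in> carrier (P 0)" for x
    using ses_inj[OF suc(1) hom_in[OF e(1) that]] hom_simps(4)[OF D(1,2,4)] by auto
  then have ker: "a_kernel (P 0) Q (\<lambda>x. i (e x)) = a_kernel (P 0) K e" by (auto simp: a_kernel_def')
  have "left_resolution R X ?P ?d p"
    unfolding left_resolution_def
  proof (intro conjI allI)
    fix j
    show "left_module R (?P j)" using D(2) r(1) by (cases j) (auto simp: left_resolution_def)
    show "?d j \<in> mod_hom R (?P (Suc j)) (?P j)"
      using hom_comp[OF e(1) D(4)] r(1) by (cases j) (auto simp: left_resolution_def)
    show "?d (Suc j) ` carrier (?P (Suc (Suc j))) = a_kernel (?P (Suc j)) (?P j) (?d j)"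
      using ker e(3) r(1) by (cases j) (auto simp: left_resolution_def)
  qed (use D im in simp_all)
  moreover have "projective R (?P j) \<and> fin_gen R (?P j)" for j using suc(2,3) r(2) by (cases j) auto
  moreover have "carrier (?P j) = {\<zero>\<^bsub>?P j\<^esub>}" if "j \<ge> Suc k" for j using that P by (cases j) auto
  ultimately show ?case unfolding fg_projective_resolution_def
    by (intro exI[of _ ?P] exI[of _ ?d] exI[of _ p]) blast
qed

text \<open>A finite bound forces the defining set to be nonempty, and a nonempty set of extended
  naturals contains its infimum.\<close>

lemma proj_dim_le_iff:
  fixes X :: "('r, 'm) module"
  shows "proj_dim R X \<le> enat k \<longleftrightarrow> (\<exists>P d e. fg_projective_resolution R X P d e \<and> (\<forall>i>k. carrier (P i) = {\<zero>\<^bsub>P i\<^esub>}))"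
proof
  define A where "A = {enat n | n. \<exists>P d e. fg_projective_resolution R X P d e \<and> (\<forall>i>n. carrier (P i) = {\<zero>\<^bsub>P i\<^esub>})}"
  have pd: "proj_dim R X = Inf A" by (simp add: proj_dim_def A_def)
  assume le: "proj_dim R X \<le> enat k"
  have "A \<noteq> {}"
    using le unfolding pd by (auto simp: Inf_enat_def)
  then have "proj_dim R X \<in> A" unfolding pd by (metis ex_in_conv wellorder_InfI)
  then have "\<exists>n. proj_dim R X = enat n \<and>
      (\<exists>P d e. fg_projective_resolution R X P d e \<and> (\<forall>i>n. carrier (P i) = {\<zero>\<^bsub>P i\<^esub>}))"
    unfolding A_def mem_Collect_eq .
  then obtain n P d e where n: "proj_dim R X = enat n" "fg_projective_resolution R X P d e" "\<forall>i>n. carrier (P i) = {\<zero>\<^bsub>P i\<^esub>}"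
    by (elim exE conjE) (rule that)
  moreover have "n \<le> k" using n(1) le by simp
  ultimately have "\<forall>i>k. carrier (P i) = {\<zero>\<^bsub>P i\<^esub>}" by simp
  then show "\<exists>P d e. fg_projective_resolution R X P d e \<and> (\<forall>i>k. carrier (P i) = {\<zero>\<^bsub>P i\<^esub>})"
    using n(2) by (intro exI conjI)
next
  assume "\<exists>P d e. fg_projective_resolution R X P d e \<and> (\<forall>i>k. carrier (P i) = {\<zero>\<^bsub>P i\<^esub>})"
  then show "proj_dim R X \<le> enat k" unfolding proj_dim_def by (intro Inf_lower) blast
qed

text \<open>Degrees zero to \<open>k\<close> make \<open>k + 1\<close> terms, whence the
  successor.\<close>

lemma proj_dim_le_iff_pdl:
  fixes X :: "'r umodule"
  assumes "left_module R X"
  shows "proj_dim R X \<le> enat k \<longleftrightarrow> pdl R (Suc k) X"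
proof
  assume "proj_dim R X \<le> enat k"
  then obtain P d e where P: "fg_projective_resolution R X P d e" "\<forall>i>k. carrier (P i) = {\<zero>\<^bsub>P i\<^esub>}"
    unfolding proj_dim_le_iff by (elim exE conjE) (rule that)
  show "pdl R (Suc k) X" by (rule pdl_if_resolution[OF P(1) assms]) (use P(2) in simp)
next
  assume "pdl R (Suc k) X"
  from resolution_if_pdl[OF this] show "proj_dim R X \<le> enat k"
    unfolding proj_dim_le_iff Suc_le_eq .
qed

section \<open>Tensor products\<close>

lemma right_module_abelian: "right_module R T \<Longrightarrow> abelian_group T"
  by (simp add: right_module_def)

lemma keys_diff_sub:
  "Poly_Mapping.keys a \<subseteq> S \<Longrightarrow> Poly_Mapping.keys b \<subseteq> S \<Longrightarrow> Poly_Mapping.keys (a - b) \<subseteq> S"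
  using keys_diff[of a b] by blast

lemma keys_add_sub:
  "Poly_Mapping.keys a \<subseteq> S \<Longrightarrow> Poly_Mapping.keys b \<subseteq> S \<Longrightarrow> Poly_Mapping.keys (a + b) \<subseteq> S"
  using keys_add[of a b] by blast

lemma tensor_relations_sub:
  assumes T: "right_module R T" and X: "left_module R X"
  shows "tensor_relations R T X \<subseteq> carrier (free_Abelian_group (carrier T \<times> carrier X))"
proof -
  interpret T: right_module R T by fact
  interpret X: left_module R X by fact
  show ?thesis
    unfolding tensor_relations_def
    by (intro Un_least subsetI; elim CollectE exE conjE; simp only: carrier_free_Abelian_group_iff;
        intro keys_diff_sub; simp)
qed

lemma tensor_kernel_normal:
  assumes T: "right_module R T" and X: "left_module R X"
  shows "tensor_kernel R T X \<lhd> free_Abelian_group (carrier T \<times> carrier X)"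
  unfolding tensor_kernel_def
  using comm_group.normal_iff_subgroup[OF abelian_free_Abelian_group]
    group.generate_is_subgroup[OF group_free_Abelian_group tensor_relations_sub[OF assms]] by blast

lemma comm_group_tensor:
  assumes T: "right_module R T" and X: "left_module R X"
  shows "comm_group (tensor R T X)"
  unfolding tensor_def
  using comm_group.abelian_FactGroup[OF abelian_free_Abelian_group]
    normal_imp_subgroup[OF tensor_kernel_normal[OF assms]] by blast

definition tcls :: "('r, 'x) ring_scheme \<Rightarrow> ('r, 't) module \<Rightarrow> ('r, 'm) module \<Rightarrow> ('t \<times> 'm \<Rightarrow>\<^sub>0 int) \<Rightarrow> ('t \<times> 'm \<Rightarrow>\<^sub>0 int) set" where
  "tcls R T X c = tensor_kernel R T X #>\<^bsub>free_Abelian_group (carrier T \<times> carrier X)\<^esub> c"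

definition pure :: "('r, 'x) ring_scheme \<Rightarrow> ('r, 't) module \<Rightarrow> ('r, 'm) module \<Rightarrow> 't \<Rightarrow> 'm \<Rightarrow> ('t \<times> 'm \<Rightarrow>\<^sub>0 int) set" where
  "pure R T X t x = tcls R T X (frag_of (t, x))"

lemma tcls_hom:
  assumes "right_module R T" "left_module R X"
  shows "tcls R T X \<in> hom (free_Abelian_group (carrier T \<times> carrier X)) (tensor R T X)"
  unfolding tensor_def tcls_def by (rule normal.r_coset_hom_Mod[OF tensor_kernel_normal[OF assms]])

lemma carrier_tensor:
  "carrier (tensor R T X) = tcls R T X ` {c. Poly_Mapping.keys c \<subseteq> carrier T \<times> carrier X}"
  unfolding tensor_def carrier_FactGroup tcls_def by auto

lemma tcls_eq_iff:
  assumes "right_module R T" "left_module R X" "Poly_Mapping.keys c \<subseteq> carrier T \<times> carrier X" "Poly_Mapping.keys c' \<subseteq> carrier T \<times> carrier X"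
  shows "tcls R T X c = tcls R T X c' \<longleftrightarrow> c - c' \<in> tensor_kernel R T X"
proof -
  let ?F = "free_Abelian_group (carrier T \<times> carrier X)" and ?N = "tensor_kernel R T X"
  have N: "subgroup ?N ?F" by (rule normal_imp_subgroup[OF tensor_kernel_normal[OF assms(1,2)]])
  have F: "group ?F" by simp
  have c: "c \<in> carrier ?F" "c' \<in> carrier ?F" using assms by auto
  have "?N #>\<^bsub>?F\<^esub> c = ?N #>\<^bsub>?F\<^esub> c' \<longleftrightarrow> c \<in> ?N #>\<^bsub>?F\<^esub> c'"
    using group.repr_independence[OF F _ c(2) N] group.rcos_self[OF F c(1) N] by metis
  also have "\<dots> \<longleftrightarrow> c - c' \<in> ?N"
  proof
    assume "c \<in> ?N #>\<^bsub>?F\<^esub> c'"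
    then obtain h where "h \<in> ?N" "c = h + c'" by (auto simp: r_coset_def)
    then show "c - c' \<in> ?N" by simp
  next
    assume "c - c' \<in> ?N"
    then show "c \<in> ?N #>\<^bsub>?F\<^esub> c'" unfolding r_coset_def by (intro UN_I[of "c - c'"]) auto
  qed
  finally show ?thesis unfolding tcls_def .
qed

lemma pure_in:
  assumes "t \<in> carrier T" "x \<in> carrier X"
  shows "pure R T X t x \<in> carrier (tensor R T X)"
  unfolding pure_def carrier_tensor using assms by (intro imageI) simp

lemma pure_relation:
  assumes T: "right_module R T" and X: "left_module R X"
  shows "\<And>t t' x. t \<in> carrier T \<Longrightarrow> t' \<in> carrier T \<Longrightarrow> x \<in> carrier X \<Longrightarrow>
      pure R T X (t \<oplus>\<^bsub>T\<^esub> t') x = pure R T X t x \<otimes>\<^bsub>tensor R T X\<^esub> pure R T X t' x"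
    and "\<And>t x x'. t \<in> carrier T \<Longrightarrow> x \<in> carrier X \<Longrightarrow> x' \<in> carrier X \<Longrightarrow>
      pure R T X t (x \<oplus>\<^bsub>X\<^esub> x') = pure R T X t x \<otimes>\<^bsub>tensor R T X\<^esub> pure R T X t x'"
    and "\<And>r t x. r \<in> carrier R \<Longrightarrow> t \<in> carrier T \<Longrightarrow> x \<in> carrier X \<Longrightarrow>
      pure R T X (r \<odot>\<^bsub>T\<^esub> t) x = pure R T X t (r \<odot>\<^bsub>X\<^esub> x)"
proof -
  interpret T: right_module R T by fact
  interpret X: left_module R X by fact
  have s: "tcls R T X a \<otimes>\<^bsub>tensor R T X\<^esub> tcls R T X b = tcls R T X (a + b)"
    if "Poly_Mapping.keys a \<subseteq> carrier T \<times> carrier X" "Poly_Mapping.keys b \<subseteq> carrier T \<times> carrier X" for a b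
    using hom_mult[OF tcls_hom[OF T X], of a b] that by simp
  show "pure R T X (t \<oplus>\<^bsub>T\<^esub> t') x = pure R T X t x \<otimes>\<^bsub>tensor R T X\<^esub> pure R T X t' x"
    if "t \<in> carrier T" "t' \<in> carrier T" "x \<in> carrier X" for t t' x
  proof -
    have "frag_of (t \<oplus>\<^bsub>T\<^esub> t', x) - frag_of (t, x) - frag_of (t', x) \<in> tensor_kernel R T X"
      unfolding tensor_kernel_def tensor_relations_def using that by (intro generate.incl) blast
    then show ?thesis using that unfolding pure_def
      by (subst s) (simp_all add: tcls_eq_iff[OF T X] keys_add_sub diff_diff_eq)
  qed
  show "pure R T X t (x \<oplus>\<^bsub>X\<^esub> x') = pure R T X t x \<otimes>\<^bsub>tensor R T X\<^esub> pure R T X t x'"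
    if "t \<in> carrier T" "x \<in> carrier X" "x' \<in> carrier X" for t x x'
  proof -
    have "frag_of (t, x \<oplus>\<^bsub>X\<^esub> x') - frag_of (t, x) - frag_of (t, x') \<in> tensor_kernel R T X"
      unfolding tensor_kernel_def tensor_relations_def using that by (intro generate.incl) blast
    then show ?thesis using that unfolding pure_def
      by (subst s) (simp_all add: tcls_eq_iff[OF T X] keys_add_sub diff_diff_eq)
  qed
  show "pure R T X (r \<odot>\<^bsub>T\<^esub> t) x = pure R T X t (r \<odot>\<^bsub>X\<^esub> x)"
    if "r \<in> carrier R" "t \<in> carrier T" "x \<in> carrier X" for r t x
  proof -
    have "frag_of (r \<odot>\<^bsub>T\<^esub> t, x) - frag_of (t, r \<odot>\<^bsub>X\<^esub> x) \<in> tensor_kernel R T X"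
      unfolding tensor_kernel_def tensor_relations_def using that by (intro generate.incl) blast
    then show ?thesis using that unfolding pure_def by (auto simp: tcls_eq_iff[OF T X])
  qed
qed

lemma tensor_hom_eqI:
  assumes T: "right_module R T" and X: "left_module R X" and H: "group H"
    and f: "f \<in> hom (tensor R T X) H" and g: "g \<in> hom (tensor R T X) H"
    and eq: "\<And>t x. t \<in> carrier T \<Longrightarrow> x \<in> carrier X \<Longrightarrow> f (pure R T X t x) = g (pure R T X t x)"
    and c: "c \<in> carrier (tensor R T X)"
  shows "f c = g c"
proof -
  let ?F = "free_Abelian_group (carrier T \<times> carrier X)"
  have ft: "(\<lambda>c. f (tcls R T X c)) \<in> hom ?F H" and gt: "(\<lambda>c. g (tcls R T X c)) \<in> hom ?F H"
    using Group.hom_compose[OF tcls_hom[OF T X] f] Group.hom_compose[OF tcls_hom[OF T X] g] by (auto simp: comp_def)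
  interpret f: group_hom ?F H "\<lambda>c. f (tcls R T X c)"
    using ft H by (simp add: group_hom_def group_hom_axioms_def)
  interpret g: group_hom ?F H "\<lambda>c. g (tcls R T X c)"
    using gt H by (simp add: group_hom_def group_hom_axioms_def)
  obtain a where a: "Poly_Mapping.keys a \<subseteq> carrier T \<times> carrier X" "c = tcls R T X a"
    using c unfolding carrier_tensor by auto
  have "f (tcls R T X a) = g (tcls R T X a)"
  proof (rule free_Abelian_group_induct[OF a(1)])
    show "f (tcls R T X 0) = g (tcls R T X 0)" using f.hom_one g.hom_one by simp
  next
    fix x y assume 2: "Poly_Mapping.keys x \<subseteq> carrier T \<times> carrier X" "Poly_Mapping.keys y \<subseteq> carrier T \<times> carrier X"
      "f (tcls R T X x) = g (tcls R T X x)" "f (tcls R T X y) = g (tcls R T X y)"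
    have my: "Poly_Mapping.keys (- y) \<subseteq> carrier T \<times> carrier X" using 2(2) by simp
    have "f (tcls R T X (x - y)) = f (tcls R T X x) \<otimes>\<^bsub>H\<^esub> inv\<^bsub>H\<^esub> f (tcls R T X y)"
      using f.hom_mult[of x "- y"] f.hom_inv[of y] 2(1,2) my by simp
    moreover have "g (tcls R T X (x - y)) = g (tcls R T X x) \<otimes>\<^bsub>H\<^esub> inv\<^bsub>H\<^esub> g (tcls R T X y)"
      using g.hom_mult[of x "- y"] g.hom_inv[of y] 2(1,2) my by simp
    ultimately show "f (tcls R T X (x - y)) = g (tcls R T X (x - y))" using 2(3,4) by simp
  next
    show "f (tcls R T X (frag_of z)) = g (tcls R T X (frag_of z))" if "z \<in> carrier T \<times> carrier X" for z
      using that eq unfolding pure_def by auto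
  qed
  then show ?thesis using a(2) by simp
qed

text \<open>The third conclusion evaluates \<open>\<phi>\<close> on the class of any formal sum,
  through any homomorphism \<open>h\<close> on formal sums that has the prescribed values. It is
  what identifies the union of cosets in \<open>tensor_map\<close> with
  \<open>\<phi>\<close>.\<close>

lemma tensor_universal:
  assumes T: "right_module R T" and X: "left_module R X" and H: "comm_group H"
    and cl: "\<And>t x. t \<in> carrier T \<Longrightarrow> x \<in> carrier X \<Longrightarrow> \<beta> t x \<in> carrier H"
    and l: "\<And>t t' x. t \<in> carrier T \<Longrightarrow> t' \<in> carrier T \<Longrightarrow> x \<in> carrier X \<Longrightarrow> \<beta> (t \<oplus>\<^bsub>T\<^esub> t') x = \<beta> t x \<otimes>\<^bsub>H\<^esub> \<beta> t' x"
    and r: "\<And>t x x'. t \<in> carrier T \<Longrightarrow> x \<in> carrier X \<Longrightarrow> x' \<in> carrier X \<Longrightarrow> \<beta> t (x \<oplus>\<^bsub>X\<^esub> x') = \<beta> t x \<otimes>\<^bsub>H\<^esub> \<beta> t x'"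
    and b: "\<And>a t x. a \<in> carrier R \<Longrightarrow> t \<in> carrier T \<Longrightarrow> x \<in> carrier X \<Longrightarrow> \<beta> (a \<odot>\<^bsub>T\<^esub> t) x = \<beta> t (a \<odot>\<^bsub>X\<^esub> x)"
  obtains \<phi> where "\<phi> \<in> hom (tensor R T X) H" "\<And>t x. t \<in> carrier T \<Longrightarrow> x \<in> carrier X \<Longrightarrow> \<phi> (pure R T X t x) = \<beta> t x"
    "\<forall>h c. h \<in> hom (free_Abelian_group (carrier T \<times> carrier X)) H \<and>
        (\<forall>t\<in>carrier T. \<forall>x\<in>carrier X. h (frag_of (t, x)) = \<beta> t x) \<and>
        Poly_Mapping.keys c \<subseteq> carrier T \<times> carrier X \<longrightarrow> \<phi> (tcls R T X c) = h c"
proof -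
  interpret H: comm_group H by fact
  interpret T: right_module R T by fact
  interpret X: left_module R X by fact
  let ?F = "free_Abelian_group (carrier T \<times> carrier X)"
  have "(\<lambda>(t, x). \<beta> t x) ` (carrier T \<times> carrier X) \<subseteq> carrier H" using cl by auto
  then obtain h where h: "h \<in> hom ?F H" "\<And>z. z \<in> carrier T \<times> carrier X \<Longrightarrow> h (frag_of z) = (\<lambda>(t, x). \<beta> t x) z"
    by (rule H.free_Abelian_group_universal) (rule that)
  interpret h: group_hom ?F H h using h(1) by (simp add: group_hom_def group_hom_axioms_def)
  have hd: "h (x - y) = h x \<otimes>\<^bsub>H\<^esub> inv\<^bsub>H\<^esub> h y" if "Poly_Mapping.keys x \<subseteq> carrier T \<times> carrier X" "Poly_Mapping.keys y \<subseteq> carrier T \<times> carrier X" for x y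
    using h.hom_mult[of x "- y"] h.hom_inv[of y] that by simp
  have hf: "h (frag_of (t, x)) = \<beta> t x" if "t \<in> carrier T" "x \<in> carrier X" for t x using h(2)[of "(t, x)"] that by simp
  have rel: "h c = \<one>\<^bsub>H\<^esub>" if "c \<in> tensor_relations R T X" for c
    using that unfolding tensor_relations_def
  proof (elim UnE CollectE exE conjE)
    fix t t' x assume c: "c = frag_of (t \<oplus>\<^bsub>T\<^esub> t', x) - frag_of (t, x) - frag_of (t', x)" "t \<in> carrier T" "t' \<in> carrier T" "x \<in> carrier X"
    then have "h c = (\<beta> t x \<otimes>\<^bsub>H\<^esub> \<beta> t' x) \<otimes>\<^bsub>H\<^esub> inv\<^bsub>H\<^esub> \<beta> t x \<otimes>\<^bsub>H\<^esub> inv\<^bsub>H\<^esub> \<beta> t' x" by (simp add: hd keys_diff_sub hf l)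
    then show "h c = \<one>\<^bsub>H\<^esub>" using cl[of t x] cl[of t' x] c H.m_comm[of "\<beta> t x" "\<beta> t' x"] by (simp add: H.m_assoc)
  next
    fix t x x' assume c: "c = frag_of (t, x \<oplus>\<^bsub>X\<^esub> x') - frag_of (t, x) - frag_of (t, x')" "t \<in> carrier T" "x \<in> carrier X" "x' \<in> carrier X"
    then have "h c = (\<beta> t x \<otimes>\<^bsub>H\<^esub> \<beta> t x') \<otimes>\<^bsub>H\<^esub> inv\<^bsub>H\<^esub> \<beta> t x \<otimes>\<^bsub>H\<^esub> inv\<^bsub>H\<^esub> \<beta> t x'" by (simp add: hd keys_diff_sub hf r)
    then show "h c = \<one>\<^bsub>H\<^esub>" using cl[of t x] cl[of t x'] c H.m_comm[of "\<beta> t x" "\<beta> t x'"] by (simp add: H.m_assoc)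
  next
    fix a t x assume c: "c = frag_of (a \<odot>\<^bsub>T\<^esub> t, x) - frag_of (t, a \<odot>\<^bsub>X\<^esub> x)" "a \<in> carrier R" "t \<in> carrier T" "x \<in> carrier X"
    then show "h c = \<one>\<^bsub>H\<^esub>" using cl[of t "a \<odot>\<^bsub>X\<^esub> x"] by (simp add: hd hf b)
  qed
  have ker: "h c = \<one>\<^bsub>H\<^esub>" if "c \<in> tensor_kernel R T X" for c
  proof -
    have "c \<in> carrier ?F \<and> h c = \<one>\<^bsub>H\<^esub>"
      using that unfolding tensor_kernel_def
    proof induction
      case (inv z)
      then have "z \<in> carrier ?F" using tensor_relations_sub[OF T X] by blast
      then show ?case using rel[OF inv] h.hom_inv[of z] by simp
    next
      case (eng x y)
      then show ?case using h.hom_mult[of x y] h.G.m_closed[of x y] by (simp del: mult_free_Abelian_group)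
    next
      case (incl z)
      then show ?case using rel[OF incl] subsetD[OF tensor_relations_sub[OF T X] incl] by simp
    qed (use h.hom_one in simp)
    then show ?thesis by simp
  qed
  have "h x = h y" if "x \<in> carrier ?F" "y \<in> carrier ?F" "tensor_kernel R T X #>\<^bsub>?F\<^esub> x = tensor_kernel R T X #>\<^bsub>?F\<^esub> y" for x y
  proof -
    have "x - y \<in> tensor_kernel R T X" using tcls_eq_iff[OF T X, of x y] that unfolding tcls_def by simp
    then have "h x \<otimes>\<^bsub>H\<^esub> inv\<^bsub>H\<^esub> h y = \<one>\<^bsub>H\<^esub>" using ker hd[of x y] that by simp
    then show ?thesis using h.hom_closed that H.inv_equality[of "h x" "inv\<^bsub>H\<^esub> h y"] by simp
  qed
  then obtain \<phi> where \<phi>0: "\<phi> \<in> hom (?F Mod tensor_kernel R T X) H"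
      "\<And>c. c \<in> carrier ?F \<Longrightarrow> \<phi> (tensor_kernel R T X #>\<^bsub>?F\<^esub> c) = h c"
    by (rule FactGroup_universal[OF h(1) tensor_kernel_normal[OF T X]]) (assumption+, rule that)
  note \<phi> = \<phi>0[folded tensor_def tcls_def]
  show ?thesis
  proof (rule that[OF \<phi>(1)])
    show "\<phi> (pure R T X t x) = \<beta> t x" if "t \<in> carrier T" "x \<in> carrier X" for t x
      using \<phi>(2)[of "frag_of (t, x)"] that hf by (simp add: pure_def)
  next
    show "\<forall>h c. h \<in> hom ?F H \<and> (\<forall>t\<in>carrier T. \<forall>x\<in>carrier X. h (frag_of (t, x)) = \<beta> t x) \<and>
        Poly_Mapping.keys c \<subseteq> carrier T \<times> carrier X \<longrightarrow> \<phi> (tcls R T X c) = h c"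
    proof (intro allI impI, elim conjE)
    fix h' and c :: "_ \<Rightarrow>\<^sub>0 int" assume h': "h' \<in> hom ?F H" "\<forall>t\<in>carrier T. \<forall>x\<in>carrier X. h' (frag_of (t, x)) = \<beta> t x"
      and c: "Poly_Mapping.keys c \<subseteq> carrier T \<times> carrier X"
    interpret h': group_hom ?F H h' using h'(1) by (simp add: group_hom_def group_hom_axioms_def)
    have "h c = h' c"
    proof (rule free_Abelian_group_induct[OF c])
      show "h 0 = h' 0" using h.hom_one h'.hom_one by simp
    next
      fix x y assume 2: "Poly_Mapping.keys x \<subseteq> carrier T \<times> carrier X" "Poly_Mapping.keys y \<subseteq> carrier T \<times> carrier X"
        "h x = h' x" "h y = h' y"
      have "h' (x - y) = h' x \<otimes>\<^bsub>H\<^esub> inv\<^bsub>H\<^esub> h' y" using h'.hom_mult[of x "- y"] h'.hom_inv[of y] 2(1,2) by simp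
      then show "h (x - y) = h' (x - y)" using hd[OF 2(1,2)] 2(3,4) by simp
    next
      show "h (frag_of z) = h' (frag_of z)" if "z \<in> carrier T \<times> carrier X" for z using that hf h'(2) by auto
    qed
    then show "\<phi> (tcls R T X c) = h' c" using \<phi>(2)[of c] c by simp
    qed
  qed
qed

lemma tensor_map_hom:
  fixes R :: "('r, 'x) ring_scheme" and T' :: "('r, 't) module" and X' :: "('r, 'm) module"
  assumes T: "right_module R T'" and X: "left_module R X'" and U: "right_module R T" and Y: "left_module R X"
    and f: "f \<in> mod_hom R T' T" and g: "g \<in> mod_hom R X' X"
  shows "tensor_map R T X f g \<in> hom (tensor R T' X') (tensor R T X)"
    and "\<And>t x. t \<in> carrier T' \<Longrightarrow> x \<in> carrier X' \<Longrightarrow> tensor_map R T X f g (pure R T' X' t x) = pure R T X (f t) (g x)"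
proof -
  let ?F = "free_Abelian_group (carrier T' \<times> carrier X')" and ?F' = "free_Abelian_group (carrier T \<times> carrier X)"
  note C = comm_group_tensor[OF U Y]
  let ?e = "frag_extend (\<lambda>(t, x). frag_of (f t, g x))"
  have ek: "Poly_Mapping.keys (?e c) \<subseteq> carrier T \<times> carrier X" if "Poly_Mapping.keys c \<subseteq> carrier T' \<times> carrier X'" for c
  proof (rule order_trans[OF keys_frag_extend UN_least])
    fix z assume "z \<in> Poly_Mapping.keys c"
    then have "fst z \<in> carrier T'" "snd z \<in> carrier X'" using that by auto
    then show "Poly_Mapping.keys ((\<lambda>(t, x). frag_of (f t, g x)) z) \<subseteq> carrier T \<times> carrier X"
      using hom_in[OF f] hom_in[OF g] by (simp add: case_prod_beta)
  qed
  have e: "?e \<in> hom ?F ?F'" by (rule homI) (use ek in \<open>auto simp: frag_extend_add\<close>)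
  have fg: "f t \<in> carrier T" "g x \<in> carrier X" if "t \<in> carrier T'" "x \<in> carrier X'" for t x
    using hom_in[OF f] hom_in[OF g] that by auto
  have fs: "f (t \<oplus>\<^bsub>T'\<^esub> t') = f t \<oplus>\<^bsub>T\<^esub> f t'" "f (r \<odot>\<^bsub>T'\<^esub> t) = r \<odot>\<^bsub>T\<^esub> f t"
    if "t \<in> carrier T'" "t' \<in> carrier T'" "r \<in> carrier R" for t t' r
    using f that by (auto simp: mod_hom_def)
  have fa: "f (t \<oplus>\<^bsub>T'\<^esub> t') = f t \<oplus>\<^bsub>T\<^esub> f t'" if "t \<in> carrier T'" "t' \<in> carrier T'" for t t'
    using f that by (auto simp: mod_hom_def)
  have gs: "g (x \<oplus>\<^bsub>X'\<^esub> x') = g x \<oplus>\<^bsub>X\<^esub> g x'" "r \<in> carrier R \<Longrightarrow> g (r \<odot>\<^bsub>X'\<^esub> x) = r \<odot>\<^bsub>X\<^esub> g x"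
    if "x \<in> carrier X'" "x' \<in> carrier X'" for x x' r
    using g that by (auto simp: mod_hom_def)
  have b0: "pure R T X (f t) (g x) \<in> carrier (tensor R T X)" if "t \<in> carrier T'" "x \<in> carrier X'" for t x
    by (rule pure_in[OF fg(1)[OF that] fg(2)[OF that]])
  have b1: "pure R T X (f (t \<oplus>\<^bsub>T'\<^esub> t')) (g x) = pure R T X (f t) (g x) \<otimes>\<^bsub>tensor R T X\<^esub> pure R T X (f t') (g x)"
    if "t \<in> carrier T'" "t' \<in> carrier T'" "x \<in> carrier X'" for t t' x
    using that fg by (simp add: fa pure_relation(1)[OF U Y])
  have b2: "pure R T X (f t) (g (x \<oplus>\<^bsub>X'\<^esub> x')) = pure R T X (f t) (g x) \<otimes>\<^bsub>tensor R T X\<^esub> pure R T X (f t) (g x')"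
    if "t \<in> carrier T'" "x \<in> carrier X'" "x' \<in> carrier X'" for t x x'
    using that fg by (simp add: gs pure_relation(2)[OF U Y])
  have b3: "pure R T X (f (a \<odot>\<^bsub>T'\<^esub> t)) (g x) = pure R T X (f t) (g (a \<odot>\<^bsub>X'\<^esub> x))"
    if "a \<in> carrier R" "t \<in> carrier T'" "x \<in> carrier X'" for a t x
    using that fg by (simp add: fs gs pure_relation(3)[OF U Y])
  obtain \<phi> where \<phi>: "\<phi> \<in> hom (tensor R T' X') (tensor R T X)"
      "\<And>t x. t \<in> carrier T' \<Longrightarrow> x \<in> carrier X' \<Longrightarrow> \<phi> (pure R T' X' t x) = pure R T X (f t) (g x)"
      "\<forall>h c. h \<in> hom ?F (tensor R T X) \<and>
        (\<forall>t\<in>carrier T'. \<forall>x\<in>carrier X'. h (frag_of (t, x)) = pure R T X (f t) (g x)) \<and>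
        Poly_Mapping.keys c \<subseteq> carrier T' \<times> carrier X' \<longrightarrow> \<phi> (tcls R T' X' c) = h c"
    by (rule tensor_universal[OF T X C b0 b1 b2 b3]) (assumption+, rule that)
  have h: "(\<lambda>c. tcls R T X (?e c)) \<in> hom ?F (tensor R T X)"
    using Group.hom_compose[OF e tcls_hom[OF U Y]] by (simp add: comp_def)
  have \<phi>c: "\<phi> (tcls R T' X' c) = tcls R T X (?e c)" if "Poly_Mapping.keys c \<subseteq> carrier T' \<times> carrier X'" for c
    using \<phi>(3)[rule_format, of "\<lambda>c. tcls R T X (?e c)" c] h that by (simp add: pure_def)
  \<comment> \<open>All representatives of \<open>C\<close> are sent to the same class, by
    comparison with \<phi>, so the union in \<open>tensor_map\<close> collapses to one
    coset.\<close>
  have eq: "tensor_map R T X f g C = \<phi> C" if C: "C \<in> carrier (tensor R T' X')" for C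
  proof -
    obtain c where c: "Poly_Mapping.keys c \<subseteq> carrier T' \<times> carrier X'" "C = tcls R T' X' c"
      using C unfolding carrier_tensor by auto
    have N: "subgroup (tensor_kernel R T' X') ?F" by (rule normal_imp_subgroup[OF tensor_kernel_normal[OF T X]])
    have sub: "Poly_Mapping.keys c' \<subseteq> carrier T' \<times> carrier X' \<and> tcls R T' X' c' = tcls R T' X' c" if "c' \<in> C" for c'
    proof -
      have c': "c' \<in> tensor_kernel R T' X' #>\<^bsub>?F\<^esub> c" using that c(2) by (simp add: tcls_def)
      have "c' \<in> carrier ?F"
        by (rule subsetD[OF monoid.r_coset_subset_G[OF group.is_monoid[OF group_free_Abelian_group] subgroup.subset[OF N]] c'])
          (use c(1) in simp)
      then show ?thesis
        using group.repr_independence[OF group_free_Abelian_group c' _ N] c(1) by (simp add: tcls_def)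
    qed
    have cC: "c \<in> C" unfolding c(2) tcls_def by (rule group.rcos_self[OF group_free_Abelian_group _ N]) (use c in simp)
    have "tensor_map R T X f g C = (\<Union>c'\<in>C. tcls R T X (?e c'))" by (simp add: tensor_map_def tcls_def)
    also have "\<dots> = (\<Union>c'\<in>C. \<phi> C)"
    proof (rule SUP_cong[OF refl])
      fix c' assume "c' \<in> C"
      then show "tcls R T X (?e c') = \<phi> C" using sub[of c'] \<phi>c[of c'] c(2) by simp
    qed
    also have "\<dots> = \<phi> C" using cC by blast
    finally show ?thesis .
  qed
  show "tensor_map R T X f g \<in> hom (tensor R T' X') (tensor R T X)"
  proof (rule homI)
    fix x y assume "x \<in> carrier (tensor R T' X')" "y \<in> carrier (tensor R T' X')"
    then show "tensor_map R T X f g (x \<otimes>\<^bsub>tensor R T' X'\<^esub> y) = tensor_map R T X f g x \<otimes>\<^bsub>tensor R T X\<^esub> tensor_map R T X f g y"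
      using hom_mult[OF \<phi>(1)] eq comm_groupE(1)[OF comm_group_tensor[OF T X]] by metis
  qed (use eq hom_carrier[OF \<phi>(1)] in auto)
  show "tensor_map R T X f g (pure R T' X' t x) = pure R T X (f t) (g x)" if "t \<in> carrier T'" "x \<in> carrier X'" for t x
    using eq[OF pure_in[OF that]] \<phi>(2)[OF that] by simp
qed

lemma comm_group_add_monoid: "abelian_group T \<Longrightarrow> comm_group (add_monoid T)"
  by (rule abelian_group.a_comm_group)

lemma right_hom_zero:
  assumes "right_module R T" "right_module R T'" "f \<in> mod_hom R T T'"
  shows "f \<zero>\<^bsub>T\<^esub> = \<zero>\<^bsub>T'\<^esub>"
proof -
  interpret T: abelian_group T by (rule right_module_abelian[OF assms(1)])
  interpret T': abelian_group T' by (rule right_module_abelian[OF assms(2)])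
  have c: "f \<zero>\<^bsub>T\<^esub> \<in> carrier T'" by (rule hom_in[OF assms(3)]) simp
  have "f (\<zero>\<^bsub>T\<^esub> \<oplus>\<^bsub>T\<^esub> \<zero>\<^bsub>T\<^esub>) = f \<zero>\<^bsub>T\<^esub> \<oplus>\<^bsub>T'\<^esub> f \<zero>\<^bsub>T\<^esub>"
    using assms(3) T.zero_closed unfolding mod_hom_def by blast
  then show ?thesis using c by (simp add: T'.add.l_cancel_one')
qed

lemma group_idem_one: "group G \<Longrightarrow> x \<in> carrier G \<Longrightarrow> x \<otimes>\<^bsub>G\<^esub> x = x \<Longrightarrow> x = \<one>\<^bsub>G\<^esub>"
  by (metis group.l_cancel_one)

lemma pure_zero:
  assumes T: "right_module R T" and X: "left_module R X"
  shows "t \<in> carrier T \<Longrightarrow> pure R T X t \<zero>\<^bsub>X\<^esub> = \<one>\<^bsub>tensor R T X\<^esub>"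
    and "x \<in> carrier X \<Longrightarrow> pure R T X \<zero>\<^bsub>T\<^esub> x = \<one>\<^bsub>tensor R T X\<^esub>"
proof -
  interpret T: abelian_group T by (rule right_module_abelian[OF T])
  have G: "group (tensor R T X)" using comm_group_tensor[OF T X] by (simp add: comm_group_def)
  note z = mod_simps(1)[OF X]
  show "pure R T X t \<zero>\<^bsub>X\<^esub> = \<one>\<^bsub>tensor R T X\<^esub>" if "t \<in> carrier T"
    using pure_relation(2)[OF T X that z z] mod_simps(5)[OF X z] by (intro group_idem_one[OF G] pure_in that z) simp
  show "pure R T X \<zero>\<^bsub>T\<^esub> x = \<one>\<^bsub>tensor R T X\<^esub>" if "x \<in> carrier X"
    using pure_relation(1)[OF T X T.zero_closed T.zero_closed that] by (intro group_idem_one[OF G] pure_in that) simp_all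
qed

text \<open>This is the tensor product with \<open>f\<close>, followed by the identification of T
  tensor R with \<open>T\<close>: it sends t tensor x to t f(x).\<close>

definition tensor_eval ::
  "('r, 'x) ring_scheme \<Rightarrow> ('r, 't) module \<Rightarrow> ('r, 'm) module \<Rightarrow> ('m \<Rightarrow> 'r) \<Rightarrow> ('t \<times> 'm \<Rightarrow>\<^sub>0 int) set \<Rightarrow> 't" where
  "tensor_eval R T X f = (SOME e. e \<in> hom (tensor R T X) (add_monoid T) \<and>
     (\<forall>t\<in>carrier T. \<forall>x\<in>carrier X. e (pure R T X t x) = f x \<odot>\<^bsub>T\<^esub> t))"

lemma tensor_eval:
  assumes T: "right_module R T" and X: "left_module R X" and f: "f \<in> mod_hom R X (regular_module R)"
  shows "tensor_eval R T X f \<in> hom (tensor R T X) (add_monoid T)"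
    and "\<And>t x. t \<in> carrier T \<Longrightarrow> x \<in> carrier X \<Longrightarrow> tensor_eval R T X f (pure R T X t x) = f x \<odot>\<^bsub>T\<^esub> t"
proof -
  interpret T: right_module R T by fact
  have fc: "f x \<in> carrier R" if "x \<in> carrier X" for x using hom_in[OF f that] by simp
  have fa: "f (x \<oplus>\<^bsub>X\<^esub> x') = f x \<oplus>\<^bsub>R\<^esub> f x'" if "x \<in> carrier X" "x' \<in> carrier X" for x x'
    using f that by (simp add: mod_hom_def)
  have fm: "f (a \<odot>\<^bsub>X\<^esub> x) = a \<otimes>\<^bsub>R\<^esub> f x" if "a \<in> carrier R" "x \<in> carrier X" for a x
    using f that by (simp add: mod_hom_def)
  have 0: "f x \<odot>\<^bsub>T\<^esub> t \<in> carrier (add_monoid T)" if "t \<in> carrier T" "x \<in> carrier X" for t x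
    using that fc by simp
  have 1: "f x \<odot>\<^bsub>T\<^esub> (t \<oplus>\<^bsub>T\<^esub> t') = (f x \<odot>\<^bsub>T\<^esub> t) \<otimes>\<^bsub>add_monoid T\<^esub> (f x \<odot>\<^bsub>T\<^esub> t')"
    if "t \<in> carrier T" "t' \<in> carrier T" "x \<in> carrier X" for t t' x
    using that fc by (simp add: T.smult_r_distr)
  have 2: "f (x \<oplus>\<^bsub>X\<^esub> x') \<odot>\<^bsub>T\<^esub> t = (f x \<odot>\<^bsub>T\<^esub> t) \<otimes>\<^bsub>add_monoid T\<^esub> (f x' \<odot>\<^bsub>T\<^esub> t)"
    if "t \<in> carrier T" "x \<in> carrier X" "x' \<in> carrier X" for t x x'
    using that fc by (simp add: fa T.smult_l_distr)
  have 3: "f x \<odot>\<^bsub>T\<^esub> (a \<odot>\<^bsub>T\<^esub> t) = f (a \<odot>\<^bsub>X\<^esub> x) \<odot>\<^bsub>T\<^esub> t" if "a \<in> carrier R" "t \<in> carrier T" "x \<in> carrier X" for a t x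
    using that fc by (simp add: fm T.smult_assoc)
  obtain e where e: "e \<in> hom (tensor R T X) (add_monoid T)"
    "\<And>t x. t \<in> carrier T \<Longrightarrow> x \<in> carrier X \<Longrightarrow> e (pure R T X t x) = f x \<odot>\<^bsub>T\<^esub> t"
    by (rule tensor_universal[OF T X comm_group_add_monoid[OF right_module_abelian[OF T]] 0 1 2 3]) (assumption+, rule that)
  have "tensor_eval R T X f \<in> hom (tensor R T X) (add_monoid T) \<and>
     (\<forall>t\<in>carrier T. \<forall>x\<in>carrier X. tensor_eval R T X f (pure R T X t x) = f x \<odot>\<^bsub>T\<^esub> t)"
    unfolding tensor_eval_def by (rule someI[of _ e]) (use e in blast)
  then show "tensor_eval R T X f \<in> hom (tensor R T X) (add_monoid T)"
    and "\<And>t x. t \<in> carrier T \<Longrightarrow> x \<in> carrier X \<Longrightarrow> tensor_eval R T X f (pure R T X t x) = f x \<odot>\<^bsub>T\<^esub> t"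
    by auto
qed

lemma tensor_eval_simps:
  assumes T: "right_module R T" and X: "left_module R X" and f: "f \<in> mod_hom R X (regular_module R)"
  shows "\<And>c. c \<in> carrier (tensor R T X) \<Longrightarrow> tensor_eval R T X f c \<in> carrier T"
    and "\<And>c c'. c \<in> carrier (tensor R T X) \<Longrightarrow> c' \<in> carrier (tensor R T X) \<Longrightarrow>
      tensor_eval R T X f (c \<otimes>\<^bsub>tensor R T X\<^esub> c') = tensor_eval R T X f c \<oplus>\<^bsub>T\<^esub> tensor_eval R T X f c'"
    and "tensor_eval R T X f \<one>\<^bsub>tensor R T X\<^esub> = \<zero>\<^bsub>T\<^esub>"
proof -
  note e = tensor_eval(1)[OF assms]
  show "\<And>c. c \<in> carrier (tensor R T X) \<Longrightarrow> tensor_eval R T X f c \<in> carrier T" using hom_in_carrier[OF e] by simp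
  show "\<And>c c'. c \<in> carrier (tensor R T X) \<Longrightarrow> c' \<in> carrier (tensor R T X) \<Longrightarrow>
      tensor_eval R T X f (c \<otimes>\<^bsub>tensor R T X\<^esub> c') = tensor_eval R T X f c \<oplus>\<^bsub>T\<^esub> tensor_eval R T X f c'"
    using hom_mult[OF e] by simp
  show "tensor_eval R T X f \<one>\<^bsub>tensor R T X\<^esub> = \<zero>\<^bsub>T\<^esub>"
    using group_hom.hom_one[of "tensor R T X" "add_monoid T" "tensor_eval R T X f"] e comm_group_tensor[OF T X]
      comm_group_add_monoid[OF right_module_abelian[OF T]]
    by (simp add: group_hom_def group_hom_axioms_def comm_group_def)
qed

lemma hom_group_mult:
  assumes H: "comm_group H" and f: "f \<in> hom G H" and g: "g \<in> hom G H"
  shows "(\<lambda>x. f x \<otimes>\<^bsub>H\<^esub> g x) \<in> hom G H"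
proof -
  interpret comm_group H by fact
  show ?thesis
    by (rule homI) (use hom_in_carrier[OF f] hom_in_carrier[OF g] hom_mult[OF f] hom_mult[OF g] in \<open>simp_all add: m_ac\<close>)
qed

lemma hom_group_one: "group H \<Longrightarrow> (\<lambda>x. \<one>\<^bsub>H\<^esub>) \<in> hom G H"
  by (rule homI) (simp_all add: group.is_monoid)

lemma tensor_map_comp:
  assumes T: "right_module R T" and T': "right_module R T'" and T'': "right_module R T''"
    and X: "left_module R X" and X': "left_module R X'" and X'': "left_module R X''"
    and f: "f \<in> mod_hom R T T'" and f': "f' \<in> mod_hom R T' T''" and g: "g \<in> mod_hom R X X'" and g': "g' \<in> mod_hom R X' X''"
    and c: "c \<in> carrier (tensor R T X)"
  shows "tensor_map R T'' X'' f' g' (tensor_map R T' X' f g c) = tensor_map R T'' X'' (\<lambda>t. f' (f t)) (\<lambda>x. g' (g x)) c"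
proof -
  note a = tensor_map_hom[OF T X T' X' f g] and b = tensor_map_hom[OF T' X' T'' X'' f' g']
  note ab = tensor_map_hom[OF T X T'' X'' hom_comp[OF f f'] hom_comp[OF g g']]
  have h: "(\<lambda>c. tensor_map R T'' X'' f' g' (tensor_map R T' X' f g c)) \<in> hom (tensor R T X) (tensor R T'' X'')"
    using Group.hom_compose[OF a(1) b(1)] by (simp add: comp_def)
  have G: "group (tensor R T'' X'')" using comm_group_tensor[OF T'' X''] by (simp add: comm_group_def)
  show ?thesis
    by (rule tensor_hom_eqI[OF T X G h ab(1) _ c]) (simp add: a(2) b(2) ab(2) hom_in[OF f] hom_in[OF g])
qed

lemma tensor_map_identity:
  assumes T: "right_module R T" and X: "left_module R X" and f: "f \<in> mod_hom R T T" and g: "g \<in> mod_hom R X X"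
    and "\<And>t. t \<in> carrier T \<Longrightarrow> f t = t" "\<And>x. x \<in> carrier X \<Longrightarrow> g x = x" and c: "c \<in> carrier (tensor R T X)"
  shows "tensor_map R T X f g c = c"
proof -
  note a = tensor_map_hom[OF T X T X f g]
  have G: "group (tensor R T X)" using comm_group_tensor[OF T X] by (simp add: comm_group_def)
  have "(\<lambda>c. c) \<in> hom (tensor R T X) (tensor R T X)" by (rule homI) simp_all
  then show ?thesis by (intro tensor_hom_eqI[OF T X G a(1) _ _ c]) (simp_all add: a(2) assms)
qed

lemma tensor_map_zero:
  assumes T: "right_module R T" and X: "left_module R X" and Y: "left_module R Y" and f: "f \<in> mod_hom R T T" and g: "g \<in> mod_hom R X Y"
    and "\<And>x. x \<in> carrier X \<Longrightarrow> g x = \<zero>\<^bsub>Y\<^esub>" and c: "c \<in> carrier (tensor R T X)"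
  shows "tensor_map R T Y f g c = \<one>\<^bsub>tensor R T Y\<^esub>"
proof -
  note a = tensor_map_hom[OF T X T Y f g]
  have G: "group (tensor R T Y)" using comm_group_tensor[OF T Y] by (simp add: comm_group_def)
  show ?thesis
    by (rule tensor_hom_eqI[OF T X G a(1) hom_group_one[OF G] _ c])
      (simp add: a(2) assms(6) pure_zero(1)[OF T Y hom_in[OF f]])
qed

lemma id_hom: "id \<in> mod_hom R M M"
  by (simp add: mod_hom_def)

text \<open>A map through the regular module acts on $T \otimes X$ through \<open>T\<close>, because $t \otimes \varphi(x) y = t \varphi(x) \otimes y$.\<close>

lemma tensor_map_step:
  assumes T: "right_module R T" and X: "left_module R X" and h: "h \<in> mod_hom R X X"
    and f: "f \<in> mod_hom R X (regular_module R)" and g: "g \<in> mod_hom R (regular_module R) X"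
    and h': "\<And>x. x \<in> carrier X \<Longrightarrow> h' x = h x \<oplus>\<^bsub>X\<^esub> g (f x)"
    and c: "c \<in> carrier (tensor R T X)"
  shows "tensor_map R T X id h' c = tensor_map R T X id h c \<otimes>\<^bsub>tensor R T X\<^esub> pure R T X (tensor_eval R T X f c) (g \<one>\<^bsub>R\<^esub>)"
proof -
  have R: "ring R" using X by (simp add: left_module_def)
  note reg = left_module_regular[OF R]
  have 1: "\<one>\<^bsub>R\<^esub> \<in> carrier (regular_module R)" using R by (simp add: ring.ring_simprules(6))
  have g1: "g \<one>\<^bsub>R\<^esub> \<in> carrier X" by (rule hom_in[OF g 1])
  have h'm: "h' \<in> mod_hom R X X"
    by (rule hom_cong[OF hom_add[OF X X h hom_comp[OF f g]] X]) (rule h'[symmetric])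
  note C = comm_group_tensor[OF T X] and E = tensor_eval_simps[OF T X f]
  have G: "group (tensor R T X)" using C by (simp add: comm_group_def)
  note a = tensor_map_hom[OF T X T X id_hom h] and b = tensor_map_hom[OF T X T X id_hom h'm]
  have "(\<lambda>c. pure R T X (tensor_eval R T X f c) (g \<one>\<^bsub>R\<^esub>)) \<in> hom (tensor R T X) (tensor R T X)"
    by (rule homI) (simp_all add: E pure_in[OF E(1) g1] pure_relation(1)[OF T X _ _ g1])
  from hom_group_mult[OF C a(1) this] show ?thesis
  proof (rule tensor_hom_eqI[OF T X G b(1) _ _ c])
    fix t x assume t: "t \<in> carrier T" and x: "x \<in> carrier X"
    have fx: "f x \<in> carrier R" using hom_in[OF f x] by simp
    have "g (f x) = f x \<odot>\<^bsub>X\<^esub> g \<one>\<^bsub>R\<^esub>" by (rule hom_regular_eq[OF R X g fx])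
    then have "pure R T X t (h' x) = pure R T X t (h x) \<otimes>\<^bsub>tensor R T X\<^esub> pure R T X t (f x \<odot>\<^bsub>X\<^esub> g \<one>\<^bsub>R\<^esub>)"
      using h'[OF x] pure_relation(2)[OF T X t hom_in[OF h x]] mod_simps(4)[OF X fx g1] by simp
    then show "tensor_map R T X id h' (pure R T X t x) =
        tensor_map R T X id h (pure R T X t x) \<otimes>\<^bsub>tensor R T X\<^esub> pure R T X (tensor_eval R T X f (pure R T X t x)) (g \<one>\<^bsub>R\<^esub>)"
      using a(2)[OF t x] b(2)[OF t x] tensor_eval(2)[OF T X f t x] pure_relation(3)[OF T X fx t g1] by simp
  qed
qed

text \<open>Flatness of the regular module is passed to its summands: if the image of
  \<open>c\<close> vanishes, so do all evaluations of \<open>c\<close>, by naturality and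
  injectivity of \<open>f\<close>, and a decomposition of the identity of \<open>F\<close> recovers
  \<open>c\<close> from finitely many evaluations.\<close>

lemma projective_flat:
  fixes R :: "('r, 'x) ring_scheme" and F :: "'r umodule"
  assumes F: "projective R F" "fin_gen R F"
  shows "flat R F"
  unfolding flat_def
proof (intro conjI allI ballI impI)
  note X = projective_module[OF F(1)]
  show "left_module R F" by (rule X)
  fix K L :: "'r umodule" and f
  assume f: "f \<in> mod_hom R K L" and "right_module R K \<and> right_module R L \<and> inj_on f (carrier K)"
  then have K: "right_module R K" and L: "right_module R L" and inj: "inj_on f (carrier K)" by auto
  interpret KF: comm_group "tensor R K F" by (rule comm_group_tensor[OF K X])
  interpret LF: comm_group "tensor R L F" by (rule comm_group_tensor[OF L X])
  interpret Ka: abelian_group K by (rule right_module_abelian[OF K])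
  note m = tensor_map_hom[OF K X L X f id_hom]
  interpret m: group_hom "tensor R K F" "tensor R L F" "tensor_map R L F f id"
    using m(1) by unfold_locales
  have claim: "tensor_map R K F id e c = \<one>\<^bsub>tensor R K F\<^esub>"
    if "through R {regular_module R} F F e" and c: "c \<in> carrier (tensor R K F)" "tensor_map R L F f id c = \<one>\<^bsub>tensor R L F\<^esub>" for e c
    using that(1)
  proof induction
    case (zero h)
    have h: "h \<in> mod_hom R F F" by (rule through_hom[OF through.zero[OF zero] X X])
    show ?case by (rule tensor_map_zero[OF K X X id_hom h zero c(1)])
  next
    case (step h Z a g h')
    have a: "a \<in> mod_hom R F (regular_module R)" and g: "g \<in> mod_hom R (regular_module R) F" using step by auto
    have h: "h \<in> mod_hom R F F" by (rule through_hom[OF step(1) X X])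
    have R: "ring R" using X by (simp add: left_module_def)
    have g1: "g \<one>\<^bsub>R\<^esub> \<in> carrier F" by (rule hom_in[OF g]) (simp add: R ring.ring_simprules(6))
    have La: "group (add_monoid L)"
      using comm_group_add_monoid[OF right_module_abelian[OF L]] by (simp add: comm_group_def)
    note eK = tensor_eval[OF K X a] and eL = tensor_eval[OF L X a]
    \<comment> \<open>Naturality of evaluation in the right module, checked on pure tensors.\<close>
    have "f (tensor_eval R K F a c) = tensor_eval R L F a (tensor_map R L F f id c)"
    proof (rule tensor_hom_eqI[OF K X La _ _ _ c(1)])
      show "(\<lambda>c. f (tensor_eval R K F a c)) \<in> hom (tensor R K F) (add_monoid L)"
        by (rule homI) (use tensor_eval_simps(1,2)[OF K X a] f in \<open>auto simp: mod_hom_def\<close>)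
      show "(\<lambda>c. tensor_eval R L F a (tensor_map R L F f id c)) \<in> hom (tensor R K F) (add_monoid L)"
        using Group.hom_compose[OF m(1) eL(1)] by (simp add: comp_def)
      show "f (tensor_eval R K F a (pure R K F t x)) = tensor_eval R L F a (tensor_map R L F f id (pure R K F t x))"
        if "t \<in> carrier K" "x \<in> carrier F" for t x
      proof -
        have "a x \<in> carrier R" using hom_in[OF a that(2)] by simp
        then have "f (a x \<odot>\<^bsub>K\<^esub> t) = a x \<odot>\<^bsub>L\<^esub> f t" using f that(1) by (simp add: mod_hom_def)
        then show ?thesis using that eK(2) m(2) eL(2) hom_in[OF f] by simp
      qed
    qed
    also have "\<dots> = f \<zero>\<^bsub>K\<^esub>" using c(2) tensor_eval_simps(3)[OF L X a] right_hom_zero[OF K L f] by simp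
    finally have z: "tensor_eval R K F a c = \<zero>\<^bsub>K\<^esub>"
      by (rule inj_onD[OF inj _ tensor_eval_simps(1)[OF K X a c(1)] Ka.zero_closed])
    show ?case
      using tensor_map_step[OF K X h a g step(5) c(1)] step(6) pure_zero(2)[OF K X g1] KF.l_one[OF KF.one_closed]
      unfolding id_def z by simp
  qed
  show "inj_on (tensor_map R L F f id) (carrier (tensor R K F))"
  proof (rule inj_onI)
    fix c c' assume c: "c \<in> carrier (tensor R K F)" "c' \<in> carrier (tensor R K F)"
      and eq: "tensor_map R L F f id c = tensor_map R L F f id c'"
    let ?d = "c \<otimes>\<^bsub>tensor R K F\<^esub> inv\<^bsub>tensor R K F\<^esub> c'"
    have d: "?d \<in> carrier (tensor R K F)" using c by simp
    have "tensor_map R L F f id ?d = \<one>\<^bsub>tensor R L F\<^esub>" using c eq by (simp add: m.hom_inv)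
    from claim[OF projective_through_regular[OF F] d this] have "?d = \<one>\<^bsub>tensor R K F\<^esub>"
      using tensor_map_identity[OF K X id_hom hom_id _ _ d] by simp
    then show "c = c'" using c KF.inv_equality[of c "inv\<^bsub>tensor R K F\<^esub> c'"] by simp
  qed
qed

text \<open>If the quotient group is trivial, the coset of a cycle is the group of boundaries, which
  therefore contains the cycle. The degree is positive, so that the cycles in \<open>Tor\<close> are
  a kernel.\<close>

lemma tor_trivial_exact:
  assumes T: "right_module R T" and P: "\<And>i. left_module R (P i)" and d: "\<And>i. d i \<in> mod_hom R (P (Suc i)) (P i)"
    and triv: "trivial_group (Tor R T P d (Suc j))"
    and z: "z \<in> carrier (tensor R T (P (Suc j)))" "tensor_map R T (P j) id (d j) z = \<one>\<^bsub>tensor R T (P j)\<^esub>"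
  shows "\<exists>w\<in>carrier (tensor R T (P (Suc (Suc j)))). tensor_map R T (P (Suc j)) id (d (Suc j)) w = z"
proof -
  let ?C = "tensor R T (P (Suc j))" and ?C' = "tensor R T (P (Suc (Suc j)))"
  let ?I = "tensor_map R T (P (Suc j)) id (d (Suc j)) ` carrier ?C'"
  let ?Z = "kernel ?C (tensor R T (P j)) (tensor_map R T (P j) id (d j))"
  let ?G = "?C\<lparr>carrier := ?Z\<rparr>"
  have zZ: "z \<in> ?Z" using z by (simp add: kernel_def)
  have m: "tensor_map R T (P (Suc j)) id (d (Suc j)) \<in> hom ?C' ?C" by (rule tensor_map_hom(1)[OF T P T P id_hom d])
  interpret C: comm_group ?C by (rule comm_group_tensor[OF T P])
  interpret C': comm_group ?C' by (rule comm_group_tensor[OF T P])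
  interpret m: group_hom ?C' ?C "tensor_map R T (P (Suc j)) id (d (Suc j))" using m by unfold_locales
  have one: "\<one>\<^bsub>?C\<^esub> \<in> ?I" using m.hom_one by (intro image_eqI[of _ _ "\<one>\<^bsub>?C'\<^esub>"]) simp_all
  have "carrier (?G Mod ?I) = {?I}" using triv by (simp add: Tor_def trivial_group_def Let_def)
  moreover have "?I #>\<^bsub>?G\<^esub> z \<in> carrier (?G Mod ?I)" unfolding carrier_FactGroup using zZ by simp
  ultimately have "?I #>\<^bsub>?G\<^esub> z = ?I" by blast
  moreover have "\<one>\<^bsub>?C\<^esub> \<otimes>\<^bsub>?C\<^esub> z \<in> ?I #>\<^bsub>?G\<^esub> z" unfolding r_coset_def using one by auto
  ultimately have "z \<in> ?I" using C.l_one[OF z(1)] by simp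
  then show ?thesis by blast
qed

section \<open>Modules over the endomorphism ring\<close>

lemma End_right_module_sel [simp]:
  "carrier (End_right_module M) = carrier M" "\<zero>\<^bsub>End_right_module M\<^esub> = \<zero>\<^bsub>M\<^esub>"
  "x \<oplus>\<^bsub>End_right_module M\<^esub> y = x \<oplus>\<^bsub>M\<^esub> y" "b \<odot>\<^bsub>End_right_module M\<^esub> x = b x"
  by (simp_all add: End_right_module_def)

lemma End_ring_carrier: "b \<in> carrier (End_ring R M) \<longleftrightarrow> b \<in> mod_hom R M M \<and> b \<in> extensional (carrier M)"
  by (simp add: End_ring_def)

lemma End_ring_zero: "\<zero>\<^bsub>End_ring R M\<^esub> = (\<lambda>x\<in>carrier M. \<zero>\<^bsub>M\<^esub>)"
  by (simp add: End_ring_def)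

lemma hom_restrict:
  assumes "left_module R M" "f \<in> mod_hom R M N"
  shows "restrict f (carrier M) \<in> mod_hom R M N"
  by (rule hom_cong[OF assms(2,1)]) simp

text \<open>The tensor product of \<open>M\<close> and \<open>Q\<close> over the endomorphism ring,
  as a left module over \<open>A\<close>; the action on the left factor is well defined because
  scalars commute with endomorphisms, see \<open>scalar_hom\<close>.\<close>

definition tensor_module ::
  "('a, 'x) ring_scheme \<Rightarrow> ('a, 'm) module \<Rightarrow> ('m \<Rightarrow> 'm, 'q) module \<Rightarrow> ('a, ('m \<times> 'q \<Rightarrow>\<^sub>0 int) set) module" where
  "tensor_module A M Q = (let C = tensor (End_ring A M) (End_right_module M) Q in
     \<lparr>carrier = carrier C, monoid.mult = undefined, monoid.one = undefined,
      ring.zero = \<one>\<^bsub>C\<^esub>, ring.add = monoid.mult C,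
      smult = (\<lambda>a. tensor_map (End_ring A M) (End_right_module M) Q (\<lambda>m. a \<odot>\<^bsub>M\<^esub> m) id)\<rparr>)"

lemma tensor_module_sel [simp]:
  "carrier (tensor_module A M Q) = carrier (tensor (End_ring A M) (End_right_module M) Q)"
  "\<zero>\<^bsub>tensor_module A M Q\<^esub> = \<one>\<^bsub>tensor (End_ring A M) (End_right_module M) Q\<^esub>"
  "c \<oplus>\<^bsub>tensor_module A M Q\<^esub> c' = c \<otimes>\<^bsub>tensor (End_ring A M) (End_right_module M) Q\<^esub> c'"
  "a \<odot>\<^bsub>tensor_module A M Q\<^esub> c = tensor_map (End_ring A M) (End_right_module M) Q (\<lambda>m. a \<odot>\<^bsub>M\<^esub> m) id c"
  by (simp_all add: tensor_module_def Let_def)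

locale endomorphisms =
  fixes A :: "('a, 'y) ring_scheme" and M :: "('a, 'm) module"
  assumes M: "left_module A M"
begin

abbreviation "B \<equiv> End_ring A M"
abbreviation "T \<equiv> End_right_module M"

lemma B_ring: "ring B"
  by (rule End_ring_is_ring[OF M])

lemma T_module: "right_module B T"
  by (rule End_right_module_is_module[OF M])

lemma scalar_hom: "a \<in> carrier A \<Longrightarrow> (\<lambda>m. a \<odot>\<^bsub>M\<^esub> m) \<in> mod_hom B T T"
  by (rule mod_homI) (auto simp: mod_simps(4,19)[OF M] End_ring_carrier mod_hom_def)

lemma tensor_abelian: "left_module B Q \<Longrightarrow> comm_group (tensor B T Q)"
  by (rule comm_group_tensor[OF T_module])

lemma tensor_scalar:
  assumes Q: "left_module B Q" and a: "a \<in> carrier A"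
  shows "tensor_map B T Q (\<lambda>m. a \<odot>\<^bsub>M\<^esub> m) id \<in> hom (tensor B T Q) (tensor B T Q)"
    and "\<And>m q. m \<in> carrier M \<Longrightarrow> q \<in> carrier Q \<Longrightarrow>
      tensor_map B T Q (\<lambda>m. a \<odot>\<^bsub>M\<^esub> m) id (pure B T Q m q) = pure B T Q (a \<odot>\<^bsub>M\<^esub> m) q"
  using tensor_map_hom[OF T_module Q T_module Q scalar_hom[OF a] id_hom] by simp_all

lemma tensor_module_is_module:
  assumes Q: "left_module B Q"
  shows "left_module A (tensor_module A M Q)"
proof -
  interpret M: left_module A M by (rule M)
  interpret C: comm_group "tensor B T Q" by (rule tensor_abelian[OF Q])
  let ?N = "tensor_module A M Q"
  note s = tensor_scalar[OF Q] and eqI = tensor_hom_eqI[OF T_module Q C.group_axioms]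
  have ab: "abelian_group ?N"
  proof (rule abelian_groupI)
    fix x assume "x \<in> carrier ?N"
    then show "\<exists>y\<in>carrier ?N. y \<oplus>\<^bsub>?N\<^esub> x = \<zero>\<^bsub>?N\<^esub>" by (intro bexI[of _ "inv\<^bsub>tensor B T Q\<^esub> x"]) simp_all
  qed (simp_all add: C.m_ac)
  show ?thesis
  proof (rule left_module_axiomsI[OF M.R.ring_axioms ab])
    fix a x assume a: "a \<in> carrier A" and x: "x \<in> carrier ?N"
    show "a \<odot>\<^bsub>?N\<^esub> x \<in> carrier ?N" using hom_in_carrier[OF s(1)[OF a]] x by simp
  next
    fix a b x assume a: "a \<in> carrier A" and b: "b \<in> carrier A" and x: "x \<in> carrier ?N"
    have ab: "a \<oplus>\<^bsub>A\<^esub> b \<in> carrier A" "a \<otimes>\<^bsub>A\<^esub> b \<in> carrier A" using a b by auto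
    have x': "x \<in> carrier (tensor B T Q)" using x by simp
    have "tensor_map B T Q (\<lambda>m. (a \<oplus>\<^bsub>A\<^esub> b) \<odot>\<^bsub>M\<^esub> m) id x =
        tensor_map B T Q (\<lambda>m. a \<odot>\<^bsub>M\<^esub> m) id x \<otimes>\<^bsub>tensor B T Q\<^esub> tensor_map B T Q (\<lambda>m. b \<odot>\<^bsub>M\<^esub> m) id x"
      by (rule eqI[OF s(1)[OF ab(1)] hom_group_mult[OF C.comm_group_axioms s(1)[OF a] s(1)[OF b]] _ x'])
        (use a b ab pure_relation(1)[OF T_module Q] in \<open>simp add: s(2) M.smult_l_distr\<close>)
    then show "(a \<oplus>\<^bsub>A\<^esub> b) \<odot>\<^bsub>?N\<^esub> x = a \<odot>\<^bsub>?N\<^esub> x \<oplus>\<^bsub>?N\<^esub> b \<odot>\<^bsub>?N\<^esub> x" by simp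
    have c: "(\<lambda>x. tensor_map B T Q (\<lambda>m. a \<odot>\<^bsub>M\<^esub> m) id (tensor_map B T Q (\<lambda>m. b \<odot>\<^bsub>M\<^esub> m) id x)) \<in> hom (tensor B T Q) (tensor B T Q)"
      using Group.hom_compose[OF s(1)[OF b] s(1)[OF a]] by (simp add: comp_def)
    have "tensor_map B T Q (\<lambda>m. (a \<otimes>\<^bsub>A\<^esub> b) \<odot>\<^bsub>M\<^esub> m) id x =
        tensor_map B T Q (\<lambda>m. a \<odot>\<^bsub>M\<^esub> m) id (tensor_map B T Q (\<lambda>m. b \<odot>\<^bsub>M\<^esub> m) id x)"
      by (rule eqI[OF s(1)[OF ab(2)] c _ x']) (use a b ab in \<open>simp add: s(2) M.smult_assoc\<close>)
    then show "(a \<otimes>\<^bsub>A\<^esub> b) \<odot>\<^bsub>?N\<^esub> x = a \<odot>\<^bsub>?N\<^esub> (b \<odot>\<^bsub>?N\<^esub> x)" by simp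
  next
    fix a x y assume "a \<in> carrier A" "x \<in> carrier ?N" "y \<in> carrier ?N"
    then show "a \<odot>\<^bsub>?N\<^esub> (x \<oplus>\<^bsub>?N\<^esub> y) = a \<odot>\<^bsub>?N\<^esub> x \<oplus>\<^bsub>?N\<^esub> a \<odot>\<^bsub>?N\<^esub> y"
      using hom_mult[OF s(1)] by simp
  next
    fix x assume x: "x \<in> carrier ?N"
    show "\<one>\<^bsub>A\<^esub> \<odot>\<^bsub>?N\<^esub> x = x"
      using tensor_map_identity[OF T_module Q scalar_hom[OF M.R.one_closed] id_hom, of x] x by simp
  qed
qed

lemma pure_hom:
  assumes Q: "left_module B Q" and q: "q \<in> carrier Q"
  shows "(\<lambda>m. pure B T Q m q) \<in> mod_hom A M (tensor_module A M Q)"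
  by (rule mod_homI)
    (use q pure_in[of _ T q Q B] pure_relation(1)[OF T_module Q] in \<open>simp_all add: tensor_scalar(2)[OF Q]\<close>)

lemma tensor_map_module_hom:
  assumes Q: "left_module B Q" and Q': "left_module B Q'" and d: "d \<in> mod_hom B Q Q'"
  shows "tensor_map B T Q' id d \<in> mod_hom A (tensor_module A M Q) (tensor_module A M Q')"
proof (rule mod_homI)
  note t = tensor_map_hom[OF T_module Q T_module Q' id_hom d]
  show "tensor_map B T Q' id d c \<in> carrier (tensor_module A M Q')" if "c \<in> carrier (tensor_module A M Q)" for c
    using hom_in_carrier[OF t(1)] that by simp
  show "tensor_map B T Q' id d (c \<oplus>\<^bsub>tensor_module A M Q\<^esub> c') =
      tensor_map B T Q' id d c \<oplus>\<^bsub>tensor_module A M Q'\<^esub> tensor_map B T Q' id d c'"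
    if "c \<in> carrier (tensor_module A M Q)" "c' \<in> carrier (tensor_module A M Q)" for c c'
    using hom_mult[OF t(1)] that by simp
  show "tensor_map B T Q' id d (a \<odot>\<^bsub>tensor_module A M Q\<^esub> c) = a \<odot>\<^bsub>tensor_module A M Q'\<^esub> tensor_map B T Q' id d c"
    if a: "a \<in> carrier A" and c: "c \<in> carrier (tensor_module A M Q)" for a c
    using tensor_map_comp[OF T_module T_module T_module Q Q Q' scalar_hom[OF a] id_hom id_hom d, of c]
      tensor_map_comp[OF T_module T_module T_module Q Q' Q' id_hom scalar_hom[OF a] d id_hom, of c] c
    by simp
qed

text \<open>The values of \<open>f\<close> are endomorphisms of \<open>M\<close>, and these commute
  with scalars.\<close>

lemma tensor_eval_module_hom:
  assumes Q: "left_module B Q" and f: "f \<in> mod_hom B Q (regular_module B)"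
  shows "tensor_eval B T Q f \<in> mod_hom A (tensor_module A M Q) M"
proof (rule mod_homI)
  note E = tensor_eval_simps[OF T_module Q f] and e = tensor_eval[OF T_module Q f]
  interpret M: left_module A M by (rule M)
  show "tensor_eval B T Q f c \<in> carrier M" if "c \<in> carrier (tensor_module A M Q)" for c
    using E(1) that by simp
  show "tensor_eval B T Q f (c \<oplus>\<^bsub>tensor_module A M Q\<^esub> c') = tensor_eval B T Q f c \<oplus>\<^bsub>M\<^esub> tensor_eval B T Q f c'"
    if "c \<in> carrier (tensor_module A M Q)" "c' \<in> carrier (tensor_module A M Q)" for c c'
    using E(2) that by simp
  show "tensor_eval B T Q f (a \<odot>\<^bsub>tensor_module A M Q\<^esub> c) = a \<odot>\<^bsub>M\<^esub> tensor_eval B T Q f c"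
    if a: "a \<in> carrier A" and c: "c \<in> carrier (tensor_module A M Q)" for a c
  proof -
    note s = tensor_scalar[OF Q a]
    have 1: "(\<lambda>c. tensor_eval B T Q f (tensor_map B T Q (\<lambda>m. a \<odot>\<^bsub>M\<^esub> m) id c)) \<in> hom (tensor B T Q) (add_monoid T)"
      using Group.hom_compose[OF s(1) e(1)] by (simp add: comp_def)
    have 2: "(\<lambda>c. a \<odot>\<^bsub>M\<^esub> tensor_eval B T Q f c) \<in> hom (tensor B T Q) (add_monoid T)"
      by (rule homI) (use a E(1,2) in \<open>simp_all add: M.smult_r_distr\<close>)
    have G: "group (add_monoid T)"
      using comm_group_add_monoid[OF right_module_abelian[OF T_module]] by (simp add: comm_group_def)
    have "tensor_eval B T Q f (tensor_map B T Q (\<lambda>m. a \<odot>\<^bsub>M\<^esub> m) id c) = a \<odot>\<^bsub>M\<^esub> tensor_eval B T Q f c"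
    proof (rule tensor_hom_eqI[OF T_module Q G 1 2])
      fix m q assume m: "m \<in> carrier T" and q: "q \<in> carrier Q"
      have "f q \<in> mod_hom A M M" using hom_in[OF f q] by (simp add: End_ring_carrier)
      then have "f q (a \<odot>\<^bsub>M\<^esub> m) = a \<odot>\<^bsub>M\<^esub> f q m" using a m by (simp add: mod_hom_def)
      then show "tensor_eval B T Q f (tensor_map B T Q (\<lambda>m. a \<odot>\<^bsub>M\<^esub> m) id (pure B T Q m q)) = a \<odot>\<^bsub>M\<^esub> tensor_eval B T Q f (pure B T Q m q)"
        using m q a s(2) e(2) by simp
    qed (use c in simp)
    then show ?thesis by simp
  qed
qed

lemma regular_one: "g \<in> mod_hom B (regular_module B) Q \<Longrightarrow> g \<one>\<^bsub>B\<^esub> \<in> carrier Q"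
  by (erule hom_in) (simp add: B_ring ring.ring_simprules(6))

text \<open>A map through the regular module becomes evaluation into \<open>M\<close> followed by m
  to m tensor g(1), so add of the ring is carried into add of \<open>M\<close>.\<close>

lemma tensor_through:
  assumes "through B {regular_module B} Q Q e" and Q: "left_module B Q"
  shows "through A {M} (tensor_module A M Q) (tensor_module A M Q) (tensor_map B T Q id e)"
  using assms(1)
proof induction
  case (zero h)
  have h: "h \<in> mod_hom B Q Q" by (rule through_hom[OF through.zero[OF zero] Q Q])
  show ?case
    by (rule through.zero) (unfold tensor_module_sel, rule tensor_map_zero[OF T_module Q Q id_hom h zero])
next
  case (step h Z f g h')
  have f: "f \<in> mod_hom B Q (regular_module B)" and g: "g \<in> mod_hom B (regular_module B) Q" using step by auto
  have h: "h \<in> mod_hom B Q Q" by (rule through_hom[OF step(1) Q Q])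
  show ?case
    by (rule through.step[OF step(6) _ tensor_eval_module_hom[OF Q f] pure_hom[OF Q regular_one[OF g]]])
      (use tensor_map_step[OF T_module Q h f g step(5)] in \<open>simp_all del: id_apply\<close>)
qed

text \<open>Evaluating at a map \<open>f\<close> to the ring shows that the endomorphism
  \<open>f q\<close> kills \<open>M\<close>, hence is zero; a decomposition of the identity of
  \<open>Q\<close> into maps through the ring then kills \<open>q\<close>.\<close>

lemma pure_faithful:
  assumes e: "through B {regular_module B} Q Q (\<lambda>x. x)" and Q: "left_module B Q" and q: "q \<in> carrier Q"
    and z: "\<And>m. m \<in> carrier M \<Longrightarrow> pure B T Q m q = \<one>\<^bsub>tensor B T Q\<^esub>"
  shows "q = \<zero>\<^bsub>Q\<^esub>"
proof -
  have "e q = \<zero>\<^bsub>Q\<^esub>" if "through B {regular_module B} Q Q e" for e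
    using that
  proof induction
    case (step h Z f g h')
    have f: "f \<in> mod_hom B Q (regular_module B)" and g: "g \<in> mod_hom B (regular_module B) Q" using step by auto
    have fq: "f q \<in> extensional (carrier M)" using hom_in[OF f q] by (simp add: End_ring_carrier)
    have "f q m = \<zero>\<^bsub>M\<^esub>" if "m \<in> carrier M" for m
      using tensor_eval(2)[OF T_module Q f, of m q] tensor_eval_simps(3)[OF T_module Q f] z[OF that] q that by simp
    then have "f q = \<zero>\<^bsub>regular_module B\<^esub>" using fq by (auto simp: End_ring_zero fun_eq_iff extensional_def)
    then have "g (f q) = \<zero>\<^bsub>Q\<^esub>" using hom_simps(4)[OF left_module_regular[OF B_ring] Q g] by simp
    then show ?case using step(5)[OF q] step(6) mod_simps(1,5)[OF Q] by simp
  qed (use q in simp)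
  from this[OF e] show ?thesis .
qed

text \<open>Together with \<open>pure_faithful\<close> this identifies \<open>Q\<close> with
  Hom_A(M, M tensor Q) for \<open>Q\<close> in add of the ring; this is the full faithfulness that
  transfers kernels.\<close>

lemma pure_full:
  assumes e: "through B {regular_module B} Q Q (\<lambda>x. x)" and Q: "left_module B Q"
    and f: "\<phi> \<in> mod_hom A M (tensor_module A M Q)"
  shows "\<exists>q\<in>carrier Q. \<forall>m\<in>carrier M. \<phi> m = pure B T Q m q"
proof -
  have fc: "\<phi> m \<in> carrier (tensor B T Q)" if "m \<in> carrier M" for m using hom_in[OF f that] by simp
  have "\<exists>q\<in>carrier Q. \<forall>m\<in>carrier M. tensor_map B T Q id e (\<phi> m) = pure B T Q m q"
    if "through B {regular_module B} Q Q e" for e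
    using that
  proof induction
    case (zero h)
    have h: "h \<in> mod_hom B Q Q" by (rule through_hom[OF through.zero[OF zero] Q Q])
    show ?case
      using tensor_map_zero[OF T_module Q Q id_hom h zero fc] pure_zero(1)[OF T_module Q]
      by (intro bexI[OF _ mod_simps(1)[OF Q]] ballI) (simp del: id_apply)
  next
    case (step h Z a g h')
    have a: "a \<in> mod_hom B Q (regular_module B)" and g: "g \<in> mod_hom B (regular_module B) Q" using step by auto
    have h: "h \<in> mod_hom B Q Q" by (rule through_hom[OF step(1) Q Q])
    obtain q where q: "q \<in> carrier Q" "\<And>m. m \<in> carrier M \<Longrightarrow> tensor_map B T Q id h (\<phi> m) = pure B T Q m q"
      using step(6) by blast
    \<comment> \<open>Evaluation after \<phi> is an endomorphism \<open>b\<close> of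
      \<open>M\<close>, and m b tensor g(1) equals m tensor b g(1); so this summand contributes b
      g(1) to \<open>q\<close>. The restriction is there because elements of the endomorphism ring
      are extensional.\<close>
    define b where "b = restrict (\<lambda>m. tensor_eval B T Q a (\<phi> m)) (carrier M)"
    have b: "b \<in> carrier B"
      unfolding End_ring_carrier b_def
      using hom_restrict[OF M hom_comp[OF f tensor_eval_module_hom[OF Q a]]] by simp
    have g1: "g \<one>\<^bsub>B\<^esub> \<in> carrier Q" by (rule regular_one[OF g])
    have bg: "b \<odot>\<^bsub>Q\<^esub> g \<one>\<^bsub>B\<^esub> \<in> carrier Q" by (rule mod_simps(4)[OF Q b g1])
    have "tensor_map B T Q id h' (\<phi> m) = pure B T Q m (q \<oplus>\<^bsub>Q\<^esub> b \<odot>\<^bsub>Q\<^esub> g \<one>\<^bsub>B\<^esub>)" if m: "m \<in> carrier M" for m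
    proof -
      have "pure B T Q (tensor_eval B T Q a (\<phi> m)) (g \<one>\<^bsub>B\<^esub>) = pure B T Q m (b \<odot>\<^bsub>Q\<^esub> g \<one>\<^bsub>B\<^esub>)"
        using pure_relation(3)[OF T_module Q b, of m "g \<one>\<^bsub>B\<^esub>"] m g1 by (simp add: b_def)
      then show ?thesis
        using tensor_map_step[OF T_module Q h a g step(5) fc[OF m]] q(2)[OF m] pure_relation(2)[OF T_module Q _ q(1) bg, of m] m
        by simp
    qed
    then show ?case using mod_simps(2)[OF Q q(1) bg] by blast
  qed
  from this[OF e] show ?thesis
    using tensor_map_identity[OF T_module Q id_hom hom_id _ _ fc] by simp
qed

lemma Hom_module_carrier:
  "\<phi> \<in> carrier (Hom_module A M X) \<longleftrightarrow> \<phi> \<in> mod_hom A M X \<and> \<phi> \<in> extensional (carrier M)"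
  by (simp add: Hom_module_def)

text \<open>The hypotheses on \<open>\<beta>\<close> say that it induces an isomorphism of \<open>W\<close> with $\mathrm{Hom}_A(M, N)$.\<close>

lemma through_Hom_module:
  assumes N: "left_module A N" and E: "left_module A E" and W: "left_module B W"
    and hom: "\<And>q. q \<in> carrier W \<Longrightarrow> (\<lambda>m. \<beta> m q) \<in> mod_hom A M N"
    and add: "\<And>m q q'. m \<in> carrier M \<Longrightarrow> q \<in> carrier W \<Longrightarrow> q' \<in> carrier W \<Longrightarrow> \<beta> m (q \<oplus>\<^bsub>W\<^esub> q') = \<beta> m q \<oplus>\<^bsub>N\<^esub> \<beta> m q'"
    and sm: "\<And>b m q. b \<in> carrier B \<Longrightarrow> m \<in> carrier M \<Longrightarrow> q \<in> carrier W \<Longrightarrow> \<beta> m (b \<odot>\<^bsub>W\<^esub> q) = \<beta> (b m) q"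
    and inj: "\<And>q q'. q \<in> carrier W \<Longrightarrow> q' \<in> carrier W \<Longrightarrow> (\<And>m. m \<in> carrier M \<Longrightarrow> \<beta> m q = \<beta> m q') \<Longrightarrow> q = q'"
    and surj: "\<And>\<phi>. \<phi> \<in> mod_hom A M N \<Longrightarrow> \<exists>q\<in>carrier W. \<forall>m\<in>carrier M. \<beta> m q = \<phi> m"
    and t: "through A {E} N N (\<lambda>x. x)"
  shows "through B {Hom_module A M E} W W (\<lambda>x. x)"
proof -
  let ?H = "Hom_module A M E"
  have H: "left_module B ?H" by (rule Hom_module_is_module[OF M E])
  have Bm: "b m \<in> carrier M" if "b \<in> carrier B" "m \<in> carrier M" for b m
    using that hom_in[of b A M M m] by (simp add: End_ring_carrier)
  have \<beta>in: "\<beta> m q \<in> carrier N" if "m \<in> carrier M" "q \<in> carrier W" for m q by (rule hom_in[OF hom[OF that(2)] that(1)])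
  have "\<exists>w. through B {?H} W W w \<and> (\<forall>q\<in>carrier W. \<forall>m\<in>carrier M. \<beta> m (w q) = e (\<beta> m q))"
    if "through A {E} N N e" for e
    using that
  proof induction
    case (zero h)
    have "\<beta> m \<zero>\<^bsub>W\<^esub> = \<zero>\<^bsub>N\<^esub>" if "m \<in> carrier M" for m
    proof -
      note z = mod_simps(1)[OF W]
      have "\<beta> m \<zero>\<^bsub>W\<^esub> = \<beta> m \<zero>\<^bsub>W\<^esub> \<oplus>\<^bsub>N\<^esub> \<beta> m \<zero>\<^bsub>W\<^esub>" using add[OF that z z] mod_simps(5)[OF W z] by simp
      then show ?thesis using mod_simps(8,11)[OF N \<beta>in[OF that z]] \<beta>in[OF that z]
        by (metis mod_simps(10)[OF N] mod_simps(7)[OF N])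
    qed
    then show ?case using zero \<beta>in by (intro exI[of _ "\<lambda>_. \<zero>\<^bsub>W\<^esub>"]) (auto intro: through.zero)
  next
    case (step h Z f g h')
    have f: "f \<in> mod_hom A N E" and g: "g \<in> mod_hom A E N" using step by auto
    obtain w where w: "through B {?H} W W w" "\<And>q m. q \<in> carrier W \<Longrightarrow> m \<in> carrier M \<Longrightarrow> \<beta> m (w q) = h (\<beta> m q)"
      using step(6) by auto
    have win: "w q \<in> carrier W" if "q \<in> carrier W" for q by (rule through_in[OF w(1) W that])
    \<comment> \<open>Under the isomorphism induced by \<beta>, the composite of \<open>F\<close>
      and \<open>G\<close> is what Hom(M, -) makes of \<open>g\<close> after \<open>f\<close>. The
      preimage that \<open>G\<close> selects is unique by \<open>inj\<close>, whence its
      linearity.\<close>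
    define F where "F q = restrict (\<lambda>m. f (\<beta> m q)) (carrier M)" for q
    define G where "G \<phi> = (SOME q. q \<in> carrier W \<and> (\<forall>m\<in>carrier M. \<beta> m q = g (\<phi> m)))" for \<phi>
    have Fm: "F q m = f (\<beta> m q)" if "m \<in> carrier M" for q m using that by (simp add: F_def)
    have G: "G \<phi> \<in> carrier W \<and> (\<forall>m\<in>carrier M. \<beta> m (G \<phi>) = g (\<phi> m))" if "\<phi> \<in> mod_hom A M E" for \<phi>
      unfolding G_def by (rule someI_ex) (use surj[OF hom_comp[OF that g]] in blast)
    have Fin: "F q \<in> mod_hom A M E" if "q \<in> carrier W" for q
      unfolding F_def by (rule hom_restrict[OF M hom_comp[OF hom[OF that] f]])
    have Fh: "F \<in> mod_hom B W ?H"
    proof (rule mod_homI)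
      show "F q \<in> carrier ?H" if "q \<in> carrier W" for q
        using Fin[OF that] by (simp add: Hom_module_carrier F_def)
      show "F (q \<oplus>\<^bsub>W\<^esub> q') = F q \<oplus>\<^bsub>?H\<^esub> F q'" if "q \<in> carrier W" "q' \<in> carrier W" for q q'
        using that \<beta>in by (auto simp: F_def Hom_module_def fun_eq_iff add hom_simps(2)[OF N E f])
      show "F (b \<odot>\<^bsub>W\<^esub> q) = b \<odot>\<^bsub>?H\<^esub> F q" if "b \<in> carrier B" "q \<in> carrier W" for b q
        using that Bm by (auto simp: F_def Hom_module_def fun_eq_iff sm)
    qed
    have Gh: "G \<in> mod_hom B ?H W"
    proof (rule mod_homI)
      show Gin: "G \<phi> \<in> carrier W" if "\<phi> \<in> carrier ?H" for \<phi> using that G by (simp add: Hom_module_carrier)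
      have G\<beta>: "\<beta> m (G \<phi>) = g (\<phi> m)" if "\<phi> \<in> carrier ?H" "m \<in> carrier M" for \<phi> m
        using that G by (simp add: Hom_module_carrier)
      show "G (\<phi> \<oplus>\<^bsub>?H\<^esub> \<psi>) = G \<phi> \<oplus>\<^bsub>W\<^esub> G \<psi>" if p: "\<phi> \<in> carrier ?H" "\<psi> \<in> carrier ?H" for \<phi> \<psi>
      proof (rule inj)
        have s: "\<phi> \<oplus>\<^bsub>?H\<^esub> \<psi> \<in> carrier ?H" by (rule mod_simps(2)[OF H p])
        show "G (\<phi> \<oplus>\<^bsub>?H\<^esub> \<psi>) \<in> carrier W" "G \<phi> \<oplus>\<^bsub>W\<^esub> G \<psi> \<in> carrier W"
          using Gin[OF s] mod_simps(2)[OF W Gin[OF p(1)] Gin[OF p(2)]] by auto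
        fix m assume m: "m \<in> carrier M"
        have "\<phi> m \<in> carrier E" "\<psi> m \<in> carrier E" using p m hom_in[of _ A M E m] by (auto simp: Hom_module_carrier)
        moreover have "(\<phi> \<oplus>\<^bsub>?H\<^esub> \<psi>) m = \<phi> m \<oplus>\<^bsub>E\<^esub> \<psi> m" using m by (simp add: Hom_module_def)
        ultimately show "\<beta> m (G (\<phi> \<oplus>\<^bsub>?H\<^esub> \<psi>)) = \<beta> m (G \<phi> \<oplus>\<^bsub>W\<^esub> G \<psi>)"
          using G\<beta>[OF s m] G\<beta>[OF p(1) m] G\<beta>[OF p(2) m] add[OF m Gin[OF p(1)] Gin[OF p(2)]]
          by (simp add: hom_simps(2)[OF E N g])
      qed
      show "G (b \<odot>\<^bsub>?H\<^esub> \<phi>) = b \<odot>\<^bsub>W\<^esub> G \<phi>" if b: "b \<in> carrier B" and p: "\<phi> \<in> carrier ?H" for b \<phi>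
      proof (rule inj)
        have s: "b \<odot>\<^bsub>?H\<^esub> \<phi> \<in> carrier ?H" by (rule mod_simps(4)[OF H b p])
        show "G (b \<odot>\<^bsub>?H\<^esub> \<phi>) \<in> carrier W" "b \<odot>\<^bsub>W\<^esub> G \<phi> \<in> carrier W"
          using Gin[OF s] mod_simps(4)[OF W b Gin[OF p]] by auto
        fix m assume m: "m \<in> carrier M"
        have "(b \<odot>\<^bsub>?H\<^esub> \<phi>) m = \<phi> (b m)" using m by (simp add: Hom_module_def)
        then show "\<beta> m (G (b \<odot>\<^bsub>?H\<^esub> \<phi>)) = \<beta> m (b \<odot>\<^bsub>W\<^esub> G \<phi>)"
          using G\<beta>[OF s m] G\<beta>[OF p Bm[OF b m]] sm[OF b m Gin[OF p]] by simp
      qed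
    qed
    have "through B {?H} W W (\<lambda>q. w q \<oplus>\<^bsub>W\<^esub> G (F q))"
      by (rule through.step[OF w(1) _ Fh Gh]) simp_all
    moreover have "\<beta> m (w q \<oplus>\<^bsub>W\<^esub> G (F q)) = h' (\<beta> m q)" if q: "q \<in> carrier W" and m: "m \<in> carrier M" for q m
    proof -
      have "G (F q) \<in> carrier W" "\<beta> m (G (F q)) = g (f (\<beta> m q))" using G[OF Fin[OF q]] m Fm[OF m] by auto
      then show ?thesis using add[OF m win[OF q]] w(2)[OF q m] step(5)[OF \<beta>in[OF m q]] by simp
    qed
    ultimately show ?case by (intro exI conjI ballI)
  qed
  from this[OF t] obtain w where w: "through B {?H} W W w" "\<And>q m. q \<in> carrier W \<Longrightarrow> m \<in> carrier M \<Longrightarrow> \<beta> m (w q) = \<beta> m q"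
    by auto
  show ?thesis
    by (rule through_cong[OF w(1)], rule inj) (use w(2) through_in[OF w(1) W] in auto)
qed

end

text \<open>The kernel of \<open>d i\<close> is the syzygy of order \<open>i + 2\<close>: the terms
  in degrees 0 to \<open>i + 1\<close> come before its own resolution.\<close>

lemma pdl_of_syzygy:
  fixes X :: "'r umodule"
  assumes "fg_projective_resolution R X P d e" "left_module R X"
    "pdl R k ((P (Suc i))\<lparr>carrier := {x \<in> carrier (P (Suc i)). d i x = \<zero>\<^bsub>P i\<^esub>}\<rparr>)"
  shows "pdl R (Suc (Suc (i + k))) X"
  using assms
proof (induction i arbitrary: X P d e)
  case 0
  have res: "left_resolution R X P d e" and P: "projective R (P i)" "fin_gen R (P i)" for i
    using 0(1) by (auto simp: fg_projective_resolution_def)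
  note S = resolution_syzygy[OF res 0(2)]
  note S' = resolution_syzygy(1)[OF S(2) sesD(1)[OF S(1)]]
  show ?case using pdl.suc[OF S(1) P pdl.suc[OF S' P]] 0(3) by simp
next
  case (Suc i)
  have res: "left_resolution R X P d e" and P: "projective R (P i)" "fin_gen R (P i)" for i
    using Suc(2) by (auto simp: fg_projective_resolution_def)
  note S = resolution_syzygy[OF res Suc(3)]
  have "pdl R (Suc (Suc (i + k))) ((P 0)\<lparr>carrier := {y \<in> carrier (P 0). e y = \<zero>\<^bsub>X\<^esub>}\<rparr>)"
  proof (rule Suc.IH)
    show "fg_projective_resolution R ((P 0)\<lparr>carrier := {y \<in> carrier (P 0). e y = \<zero>\<^bsub>X\<^esub>}\<rparr>) (\<lambda>i. P (Suc i)) (\<lambda>i. d (Suc i)) (d 0)"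
      unfolding fg_projective_resolution_def using S(2) P by blast
  qed (use sesD(1)[OF S(1)] Suc(4) in simp_all)
  then show ?case using pdl.suc[OF S(1) P] by simp
qed

section \<open>Bounding the finitistic dimension of the endomorphism ring\<close>

text \<open>Finite projective dimension is bounded by the supremum, so a resolution of any finite
  length \<open>k\<close> can be exchanged for one in degrees 0 to \<open>n\<close>.\<close>

lemma fin_dim_pdl:
  fixes C :: "'r umodule"
  assumes "fin_dim R \<le> enat n" "pdl R k C"
  shows "pdl R (Suc n) C"
proof -
  have C: "left_module R C" "fin_gen R C" using assms(2) by (rule pdl_module, rule pdl_fin_gen)
  have k: "proj_dim R C \<le> enat k" using proj_dim_le_iff_pdl[OF C(1)] pdl_mono_Suc[OF assms(2)] by simp
  then have "proj_dim R C < \<infinity>" using enat_ord_simps(4) order.strict_trans1 by blast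
  then have "proj_dim R C \<le> fin_dim R" unfolding fin_dim_def using C by (intro Sup_upper) blast
  then show ?thesis using proj_dim_le_iff_pdl[OF C(1), of n] assms(1) by (meson order_trans)
qed

text \<open>The infimum is attained, and the vanishing beyond it includes every degree above
  \<open>r\<close>.\<close>

lemma rfd_Tor:
  fixes X :: "'r umodule"
  assumes "rfd R T \<le> enat r" "left_module R X" "flat_dim R X < \<infinity>" "fg_projective_resolution R X P d e" "i > r"
  shows "trivial_group (Tor R T P d i)"
proof -
  define S where "S = {enat m | m. \<forall>(X :: 'r umodule) P d e.
     left_module R X \<and> flat_dim R X < \<infinity> \<and> fg_projective_resolution R X P d e \<longrightarrow>
     (\<forall>i>m. trivial_group (Tor R T P d i))}"
  have rfd: "rfd R T = Inf S" by (simp add: rfd_def S_def)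
  have "S \<noteq> {}" using assms(1) unfolding rfd by (auto simp: Inf_enat_def)
  then have "rfd R T \<in> S" unfolding rfd by (metis ex_in_conv wellorder_InfI)
  then obtain m where m: "rfd R T = enat m" "\<forall>(X :: 'r umodule) P d e.
     left_module R X \<and> flat_dim R X < \<infinity> \<and> fg_projective_resolution R X P d e \<longrightarrow>
     (\<forall>i>m. trivial_group (Tor R T P d i))"
    unfolding S_def mem_Collect_eq by (elim exE conjE) (rule that)
  have "i > m" using m(1) assms(1,5) by simp
  then show ?thesis using m(2)[THEN spec, of X, THEN spec, of P, THEN spec, of d, THEN spec, of e] assms(2-4) by simp
qed

text \<open>The exact sequence is completed by the cokernel of \<open>d 0\<close>. Only from order
  two on are its syzygies kernels of differentials, hence the form of the bound; the one of order
  \<open>n + 2\<close> is the kernel of \<open>d n\<close>.\<close>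

lemma gp_kernel_in_exact_sequence:
  fixes R :: "('r, 'x) ring_scheme" and G :: "nat \<Rightarrow> 'r umodule"
  assumes ret: "gp_retract_closed R" and n: "fin_dim R \<le> enat (Suc (Suc n))"
    and G: "\<And>j. gp R (G j)" and d: "\<And>j. d j \<in> mod_hom R (G (Suc j)) (G j)"
    and ex: "\<And>j. d (Suc j) ` carrier (G (Suc (Suc j))) = {x \<in> carrier (G (Suc j)). d j x = \<zero>\<^bsub>G j\<^esub>}"
    and z: "carrier (G (Suc s)) = {\<zero>\<^bsub>G (Suc s)\<^esub>}"
  shows "gp R ((G (Suc n))\<lparr>carrier := {x \<in> carrier (G (Suc n)). d n x = \<zero>\<^bsub>G n\<^esub>}\<rparr>)"
proof -
  have Gm: "left_module R (G j)" for j by (rule gp_module[OF G])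
  define I where "I j = (G j)\<lparr>carrier := d j ` carrier (G (Suc j))\<rparr>" for j
  have I: "left_module R (I j)" for j
    unfolding I_def by (rule left_module_submod[OF Gm submod_image[OF Gm Gm d]])
  have sub: "d j ` carrier (G (Suc j)) \<subseteq> carrier (G j)" for j using hom_in[OF d] by blast
  have incl: "(\<lambda>x. x) \<in> mod_hom R (I 0) (G 0)"
    unfolding I_def by (rule hom_sub_dom[OF hom_id sub])
  obtain C :: "'r umodule" and p where C: "ses R (I 0) (G 0) C (\<lambda>x. x) p"
    by (rule ses_quotient[OF I Gm incl]) (simp, rule that)
  \<comment> \<open>Order zero is the cokernel and order \<open>Suc i\<close> the image of
    \<open>d i\<close>; by exactness the image of \<open>d (Suc i)\<close> is the kernel of
    \<open>d i\<close>.\<close>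
  define K where "K j = (case j of 0 \<Rightarrow> C | Suc i \<Rightarrow> I i)" for j
  have S: "ses R (K (Suc j)) (G j) (K j) (\<lambda>x. x) (case j of 0 \<Rightarrow> p | Suc i \<Rightarrow> d i)" for j
  proof (cases j)
    case 0
    then show ?thesis using C by (simp add: K_def)
  next
    case (Suc i)
    have "ses R ((G (Suc i))\<lparr>carrier := {y \<in> carrier (G (Suc i)). d i y = \<zero>\<^bsub>I i\<^esub>}\<rparr>) (G (Suc i)) (I i) (\<lambda>x. x) (d i)"
      by (rule ses_kernel[OF Gm I]) (unfold I_def, rule hom_sub_cod[OF d], simp_all)
    moreover have "(G (Suc i))\<lparr>carrier := {y \<in> carrier (G (Suc i)). d i y = \<zero>\<^bsub>I i\<^esub>}\<rparr> = I (Suc i)"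
      by (simp add: I_def ex)
    ultimately show ?thesis using Suc by (simp add: K_def)
  qed
  have "carrier (K (Suc (Suc s))) \<subseteq> {\<zero>\<^bsub>K (Suc (Suc s))\<^esub>}"
    using sub[of "Suc s"] z by (auto simp: K_def I_def)
  moreover have "\<zero>\<^bsub>K (Suc (Suc s))\<^esub> \<in> carrier (K (Suc (Suc s)))"
    using mod_simps(1)[OF I, of "Suc s"] by (simp add: K_def)
  ultimately have zero: "carrier (K (Suc (Suc s))) = {\<zero>\<^bsub>K (Suc (Suc s))\<^esub>}" by blast
  have "gp R (K (Suc (Suc n)))"
    using gp_syzygy[where K = K and G = G and s = "Suc (Suc s)", OF ret fin_dim_pdl[OF n] S G zero] .
  then show ?thesis by (simp add: K_def I_def ex)
qed

context endomorphisms
begin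

text \<open>The tensor product lies in add M, hence in add E, so its copy in the universe is
  Gorenstein projective. The isomorphisms are kept, since the differentials have to be moved to the
  copies.\<close>

lemma tensor_module_gp_copy:
  fixes Q :: "('m \<Rightarrow> 'm) umodule"
  assumes fg: "fin_gen A M" and E: "left_module A E" and GP: "GP_class A = add_class A E" and t: "through A {E} M M (\<lambda>x. x)"
    and Q: "projective B Q" "fin_gen B Q"
  obtains N :: "'a umodule" and f g where "gp A N" "f \<in> mod_hom A (tensor_module A M Q) N"
    "g \<in> mod_hom A N (tensor_module A M Q)" "\<And>x. x \<in> carrier (tensor_module A M Q) \<Longrightarrow> g (f x) = x"
    "\<And>y. y \<in> carrier N \<Longrightarrow> f (g y) = y"
proof -
  let ?T = "tensor_module A M Q"
  note Qm = projective_module[OF Q(1)]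
  have Tm: "left_module A ?T" by (rule tensor_module_is_module[OF Qm])
  have "through A {M} ?T ?T (\<lambda>x. x)"
    by (rule through_cong[OF tensor_through[OF projective_through_regular[OF Q] Qm]])
      (rule tensor_map_identity[OF T_module Qm id_hom hom_id], simp_all)
  note tT = this
  have fT: "fin_gen A ?T" by (rule through_fin_gen[OF tT Tm]) (use M fg in simp)
  obtain N :: "'a umodule" where N: "left_module A N" "mod_iso A ?T N"
    using fin_gen_iso_universe[OF Tm fT] by blast
  obtain f g where fg: "f \<in> mod_hom A ?T N" "g \<in> mod_hom A N ?T"
    "\<And>x. x \<in> carrier ?T \<Longrightarrow> g (f x) = x" "\<And>y. y \<in> carrier N \<Longrightarrow> f (g y) = y"
    by (rule mod_isoE[OF Tm N]) (rule that)
  have "through A {E} ?T ?T (\<lambda>x. x)" by (rule through_trans[OF tT Tm]) (use M t in simp)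
  from through_comp[OF this Tm N(1) fg(2,1)] have "through A {E} N N (\<lambda>x. x)"
    by (rule through_cong) (rule fg(4))
  then have "N \<in> GP_class A" unfolding GP add_class_iff_through[OF E N(1)] .
  then have "gp A N" by (simp add: GP_class_def gorenstein_projective_iff_gp)
  then show ?thesis using fg by (rule that)
qed

text \<open>Hom_A(M, -) is left exact and takes M tensor Q to \<open>Q\<close>, so it takes the
  kernel of the tensored differential to the kernel of \<open>d\<close>. The maps \<open>f\<close>,
  \<open>g\<close>, \<open>f'\<close>, \<open>g'\<close> only move between the tensor products and
  their copies.\<close>

lemma through_Hom_module_kernel:
  fixes Q :: "('m \<Rightarrow> 'm, 'q) module" and N :: "('a, 'n) module"
  assumes E: "left_module A E" and Q: "left_module B Q" "through B {regular_module B} Q Q (\<lambda>x. x)"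
    and Q': "left_module B Q'" "through B {regular_module B} Q' Q' (\<lambda>x. x)"
    and d: "d \<in> mod_hom B Q Q'"
    and N: "left_module A N" "f \<in> mod_hom A (tensor_module A M Q) N" "g \<in> mod_hom A N (tensor_module A M Q)"
      "\<And>x. x \<in> carrier (tensor_module A M Q) \<Longrightarrow> g (f x) = x" "\<And>y. y \<in> carrier N \<Longrightarrow> f (g y) = y"
    and N': "left_module A N'" "f' \<in> mod_hom A (tensor_module A M Q') N'" "g' \<in> mod_hom A N' (tensor_module A M Q')"
      "\<And>x. x \<in> carrier (tensor_module A M Q') \<Longrightarrow> g' (f' x) = x"
    and t: "through A {E} (N\<lparr>carrier := {x \<in> carrier N. f' (tensor_map B T Q' id d (g x)) = \<zero>\<^bsub>N'\<^esub>}\<rparr>)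
      (N\<lparr>carrier := {x \<in> carrier N. f' (tensor_map B T Q' id d (g x)) = \<zero>\<^bsub>N'\<^esub>}\<rparr>) (\<lambda>x. x)"
  shows "through B {Hom_module A M E} (Q\<lparr>carrier := {q \<in> carrier Q. d q = \<zero>\<^bsub>Q'\<^esub>}\<rparr>)
    (Q\<lparr>carrier := {q \<in> carrier Q. d q = \<zero>\<^bsub>Q'\<^esub>}\<rparr>) (\<lambda>x. x)"
proof -
  let ?D = "\<lambda>x. f' (tensor_map B T Q' id d (g x))"
  let ?W = "Q\<lparr>carrier := {q \<in> carrier Q. d q = \<zero>\<^bsub>Q'\<^esub>}\<rparr>"
  let ?N = "N\<lparr>carrier := {x \<in> carrier N. ?D x = \<zero>\<^bsub>N'\<^esub>}\<rparr>"
  note T = T_module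
  note Tm = tensor_module_is_module[OF Q(1)] and Tm' = tensor_module_is_module[OF Q'(1)]
  have map: "tensor_map B T Q' id d \<in> mod_hom A (tensor_module A M Q) (tensor_module A M Q')"
    by (rule tensor_map_module_hom[OF Q(1) Q'(1) d])
  have D: "?D \<in> mod_hom A N N'" by (rule hom_comp[OF hom_comp[OF N(3) map] N'(2)])
  have Nm: "left_module A ?N" by (rule left_module_submod[OF N(1) submod_kernel[OF N(1) N'(1) D]])
  have Wm: "left_module B ?W" by (rule left_module_submod[OF Q(1) submod_kernel[OF Q(1) Q'(1) d]])
  have pin: "pure B T Q m q \<in> carrier (tensor_module A M Q)" if "m \<in> carrier M" "q \<in> carrier Q" for m q
    using pure_in[of m T q Q B] that by simp
  have pin': "pure B T Q' m q \<in> carrier (tensor_module A M Q')" if "m \<in> carrier M" "q \<in> carrier Q'" for m q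
    using pure_in[of m T q Q' B] that by simp
  have mp: "tensor_map B T Q' id d (pure B T Q m q) = pure B T Q' m (d q)" if "m \<in> carrier M" "q \<in> carrier Q" for m q
    using tensor_map_hom(2)[OF T Q(1) T Q'(1) id_hom d, of m q] that by simp
  have p0: "pure B T Q' m \<zero>\<^bsub>Q'\<^esub> = \<zero>\<^bsub>tensor_module A M Q'\<^esub>" if "m \<in> carrier M" for m
    using pure_zero(1)[OF T Q'(1), of m] that by simp
  show ?thesis
  proof (rule through_Hom_module[OF Nm E Wm _ _ _ _ _ t, where \<beta> = "\<lambda>m q. f (pure B T Q m q)"])
    fix q assume q: "q \<in> carrier ?W"
    have "?D (f (pure B T Q m q)) = \<zero>\<^bsub>N'\<^esub>" if m: "m \<in> carrier M" for m
      using q m N(4)[OF pin] mp p0 hom_simps(4)[OF Tm' N'(1,2)] by simp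
    then show "(\<lambda>m. f (pure B T Q m q)) \<in> mod_hom A M ?N"
      using q hom_in[OF N(2) pin] by (intro hom_sub_cod[OF hom_comp[OF pure_hom[OF Q(1)] N(2)]]) auto
  next
    fix m q q' assume "m \<in> carrier M" "q \<in> carrier ?W" "q' \<in> carrier ?W"
    then show "f (pure B T Q m (q \<oplus>\<^bsub>?W\<^esub> q')) = f (pure B T Q m q) \<oplus>\<^bsub>?N\<^esub> f (pure B T Q m q')"
      using hom_simps(2)[OF Tm N(1,2) pin pin, of m q m q'] pure_relation(2)[OF T Q(1), of m q q'] by simp
  next
    fix b m q assume "b \<in> carrier B" "m \<in> carrier M" "q \<in> carrier ?W"
    then show "f (pure B T Q m (b \<odot>\<^bsub>?W\<^esub> q)) = f (pure B T Q (b m) q)"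
      using pure_relation(3)[OF T Q(1), of b m q] by simp
  next
    fix q q' assume W: "q \<in> carrier ?W" "q' \<in> carrier ?W"
      and eq: "\<And>m. m \<in> carrier M \<Longrightarrow> f (pure B T Q m q) = f (pure B T Q m q')"
    have q: "q \<in> carrier Q" "q' \<in> carrier Q" using W by simp_all
    note nq' = mod_simps(3)[OF Q(1) q(2)]
    have "q \<oplus>\<^bsub>Q\<^esub> \<ominus>\<^bsub>Q\<^esub> q' = \<zero>\<^bsub>Q\<^esub>"
    proof (rule pure_faithful[OF Q(2,1) mod_simps(2)[OF Q(1) q(1) nq']])
      fix m assume m: "m \<in> carrier M"
      have "pure B T Q m q = g (f (pure B T Q m q'))" using N(4)[OF pin[OF m q(1)]] unfolding eq[OF m] ..
      also have "\<dots> = pure B T Q m q'" by (rule N(4)[OF pin[OF m q(2)]])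
      finally have e: "pure B T Q m q = pure B T Q m q'" .
      have r: "pure B T Q m (x \<oplus>\<^bsub>Q\<^esub> \<ominus>\<^bsub>Q\<^esub> q') = pure B T Q m x \<otimes>\<^bsub>tensor B T Q\<^esub> pure B T Q m (\<ominus>\<^bsub>Q\<^esub> q')"
        if "x \<in> carrier Q" for x by (rule pure_relation(2)[OF T Q(1) _ that nq']) (simp add: m)
      have "pure B T Q m (q \<oplus>\<^bsub>Q\<^esub> \<ominus>\<^bsub>Q\<^esub> q') = pure B T Q m (q' \<oplus>\<^bsub>Q\<^esub> \<ominus>\<^bsub>Q\<^esub> q')"
        unfolding r[OF q(1)] r[OF q(2)] e ..
      also have "\<dots> = \<one>\<^bsub>tensor B T Q\<^esub>"
        unfolding mod_simps(8)[OF Q(1) q(2)] by (rule pure_zero(1)[OF T Q(1)]) (simp add: m)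
      finally show "pure B T Q m (q \<oplus>\<^bsub>Q\<^esub> \<ominus>\<^bsub>Q\<^esub> q') = \<one>\<^bsub>tensor B T Q\<^esub>" .
    qed
    then show "q = q'" by (rule diff_zero_eq[OF Q(1) q(1,2)])
  next
    fix \<phi> assume \<phi>: "\<phi> \<in> mod_hom A M ?N"
    have \<phi>N: "\<phi> \<in> mod_hom A M N" by (rule hom_sub_incl[OF \<phi>]) auto
    obtain q where q: "q \<in> carrier Q" "\<And>m. m \<in> carrier M \<Longrightarrow> g (\<phi> m) = pure B T Q m q"
      using pure_full[OF Q(2,1) hom_comp[OF \<phi>N N(3)]] by blast
    \<comment> \<open>Faithfulness over \<open>Q'\<close> turns the vanishing of m tensor d(q) for
      all \<open>m\<close> into d(q) = 0, which places \<open>q\<close> in the kernel.\<close>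
    have "d q = \<zero>\<^bsub>Q'\<^esub>"
    proof (rule pure_faithful[OF Q'(2,1) hom_in[OF d q(1)]])
      fix m assume m: "m \<in> carrier M"
      have "?D (\<phi> m) = \<zero>\<^bsub>N'\<^esub>" using hom_in[OF \<phi> m] by simp
      then have "f' (pure B T Q' m (d q)) = \<zero>\<^bsub>N'\<^esub>" using mp[OF m q(1)] q(2)[OF m] by simp
      then have "pure B T Q' m (d q) = g' \<zero>\<^bsub>N'\<^esub>" using N'(4)[OF pin'[OF m hom_in[OF d q(1)]]] by simp
      then show "pure B T Q' m (d q) = \<one>\<^bsub>tensor B T Q'\<^esub>" using hom_simps(4)[OF N'(1) Tm' N'(3)] by simp
    qed
    moreover have "f (pure B T Q m q) = \<phi> m" if "m \<in> carrier M" for m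
      using q(2)[OF that] N(5)[OF hom_in[OF \<phi>N that]] by simp
    ultimately show "\<exists>q\<in>carrier ?W. \<forall>m\<in>carrier M. f (pure B T Q m q) = \<phi> m" using q(1) by auto
  qed
qed

text \<open>Finiteness of the projective dimension of \<open>Y\<close> enters twice: it makes
  \<open>Y\<close> a test module for \<open>rfd\<close>, and it lets the tensored resolution end in
  zeros, where the Gorenstein projective approximations start. The bound counts terms: n + 2 + r
  from the resolution \<open>Q\<close> and p + 1 for the syzygy.\<close>

lemma pdl_End:
  fixes E :: "('a, 'e) module" and H Y :: "('m \<Rightarrow> 'm) umodule"
  assumes fg: "fin_gen A M" and E: "left_module A E" and GP: "GP_class A = add_class A E" and t: "through A {E} M M (\<lambda>x. x)"
    and n: "fin_dim A \<le> enat (Suc (Suc n))" and r: "rfd B T \<le> enat r"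
    and H: "pdl B (Suc p) H" "mod_iso B (Hom_module A M E) H" and Y: "pdl B k Y"
  shows "pdl B (Suc (Suc (Suc n) + r + p)) Y"
proof -
  have Ym: "left_module B Y" by (rule pdl_module[OF Y])
  obtain Q d e where Q: "fg_projective_resolution B Y Q d e" "\<And>i. i \<ge> k \<Longrightarrow> carrier (Q i) = {\<zero>\<^bsub>Q i\<^esub>}"
    using resolution_if_pdl[OF Y] by (elim exE conjE) (rule that, assumption, simp)
  have Qp: "projective B (Q i)" "fin_gen B (Q i)" and res: "left_resolution B Y Q d e" for i
    using Q(1) by (auto simp: fg_projective_resolution_def)
  note Qm = projective_module[OF Qp(1)] and Qt = projective_through_regular[OF Qp]
  have d: "d i \<in> mod_hom B (Q (Suc i)) (Q i)"
    and dd: "d (Suc i) ` carrier (Q (Suc (Suc i))) = {x \<in> carrier (Q (Suc i)). d i x = \<zero>\<^bsub>Q i\<^esub>}" for i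
    using res by (simp_all add: left_resolution_def a_kernel_def')
  \<comment> \<open>Finitely generated projectives are flat, so the given resolution bounds the flat
    dimension too.\<close>
  have "flat_dim B Y \<le> enat k"
    unfolding flat_dim_def
    by (intro Inf_lower CollectI exI[of _ k] exI[of _ Q] exI[of _ d] exI[of _ e] conjI)
      (use res projective_flat[OF Qp] Q(2) in auto)
  then have "flat_dim B Y < \<infinity>" using enat_ord_simps(4) order.strict_trans1 by blast
  note tor = rfd_Tor[OF r Ym this Q(1)]
  \<comment> \<open>Module and both isomorphisms are packed into one triple, so that a single choice
    produces the whole family of copies.\<close>
  define copy where "copy i x \<longleftrightarrow> gp A (fst x) \<and> fst (snd x) \<in> mod_hom A (tensor_module A M (Q i)) (fst x) \<and>
      snd (snd x) \<in> mod_hom A (fst x) (tensor_module A M (Q i)) \<and>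
      (\<forall>c\<in>carrier (tensor_module A M (Q i)). snd (snd x) (fst (snd x) c) = c) \<and>
      (\<forall>y\<in>carrier (fst x). fst (snd x) (snd (snd x) y) = y)" for i and x :: "'a umodule \<times> _"
  have "\<exists>x. copy i x" for i
  proof -
    obtain N :: "'a umodule" and f g where "gp A N" "f \<in> mod_hom A (tensor_module A M (Q i)) N"
      "g \<in> mod_hom A N (tensor_module A M (Q i))" "\<And>x. x \<in> carrier (tensor_module A M (Q i)) \<Longrightarrow> g (f x) = x"
      "\<And>y. y \<in> carrier N \<Longrightarrow> f (g y) = y"
      by (rule tensor_module_gp_copy[OF fg E GP t Qp]) (rule that)
    then have "copy i (N, f, g)" by (simp add: copy_def)
    then show ?thesis ..
  qed
  then obtain F where F: "\<And>i. copy i (F i)" by metis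
  define N f g where "N i = fst (F i)" and "f i = fst (snd (F i))" and "g i = snd (snd (F i))" for i
  have N: "gp A (N i)" "f i \<in> mod_hom A (tensor_module A M (Q i)) (N i)" "g i \<in> mod_hom A (N i) (tensor_module A M (Q i))"
    "\<And>x. x \<in> carrier (tensor_module A M (Q i)) \<Longrightarrow> g i (f i x) = x" "\<And>y. y \<in> carrier (N i) \<Longrightarrow> f i (g i y) = y" for i
    using F[of i] unfolding copy_def N_def f_def g_def by auto
  note Nm = gp_module[OF N(1)] and Tm = tensor_module_is_module[OF Qm]
  define \<delta> where "\<delta> i x = f i (tensor_map B T (Q i) id (d i) (g (Suc i) x))" for i x
  note map = tensor_map_module_hom[OF Qm Qm d]
  have \<delta>: "\<delta> i \<in> mod_hom A (N (Suc i)) (N i)" for i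
    unfolding \<delta>_def by (rule hom_comp[OF hom_comp[OF N(3) map] N(2)])
  have f0: "f i \<one>\<^bsub>tensor B T (Q i)\<^esub> = \<zero>\<^bsub>N i\<^esub>" and g0: "g i \<zero>\<^bsub>N i\<^esub> = \<one>\<^bsub>tensor B T (Q i)\<^esub>" for i
    using hom_simps(4)[OF Tm Nm N(2)] hom_simps(4)[OF Nm Tm N(3)] by simp_all
  have gin: "g i x \<in> carrier (tensor B T (Q i))" if "x \<in> carrier (N i)" for i x
    using hom_in[OF N(3) that] by simp
  have \<delta>\<delta>: "\<delta> j (\<delta> (Suc j) y) = \<zero>\<^bsub>N j\<^esub>" if y: "y \<in> carrier (N (Suc (Suc j)))" for j y
  proof -
    have dz: "d j (d (Suc j) x) = \<zero>\<^bsub>Q j\<^esub>" if "x \<in> carrier (Q (Suc (Suc j)))" for x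
      using dd[of j] that by blast
    have "\<delta> j (\<delta> (Suc j) y) = f j (tensor_map B T (Q j) id (d j) (tensor_map B T (Q (Suc j)) id (d (Suc j)) (g (Suc (Suc j)) y)))"
      unfolding \<delta>_def using N(4)[OF hom_in[OF map hom_in[OF N(3) y]]] by simp
    also have "tensor_map B T (Q j) id (d j) (tensor_map B T (Q (Suc j)) id (d (Suc j)) (g (Suc (Suc j)) y)) =
        tensor_map B T (Q j) (\<lambda>t. id (id t)) (\<lambda>x. d j (d (Suc j) x)) (g (Suc (Suc j)) y)"
      by (rule tensor_map_comp[OF T_module T_module T_module Qm Qm Qm id_hom id_hom d d gin[OF y]])
    also have "\<dots> = \<one>\<^bsub>tensor B T (Q j)\<^esub>"
      by (rule tensor_map_zero[OF T_module Qm Qm hom_comp[OF id_hom id_hom] hom_comp[OF d d] dz gin[OF y]])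
    finally show ?thesis by (simp add: f0)
  qed
  \<comment> \<open>The cycles sit in degree \<open>Suc j\<close>, which exceeds \<open>r\<close>
    exactly when \<open>j\<close> is at least \<open>r\<close>.\<close>
  have exact: "\<delta> (Suc j) ` carrier (N (Suc (Suc j))) = {x \<in> carrier (N (Suc j)). \<delta> j x = \<zero>\<^bsub>N j\<^esub>}" if j: "j \<ge> r" for j
  proof (intro subset_antisym subsetI)
    fix x assume "x \<in> \<delta> (Suc j) ` carrier (N (Suc (Suc j)))"
    then show "x \<in> {x \<in> carrier (N (Suc j)). \<delta> j x = \<zero>\<^bsub>N j\<^esub>}" using \<delta>\<delta> hom_in[OF \<delta>] by auto
  next
    fix x assume "x \<in> {x \<in> carrier (N (Suc j)). \<delta> j x = \<zero>\<^bsub>N j\<^esub>}"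
    then have x: "x \<in> carrier (N (Suc j))" "\<delta> j x = \<zero>\<^bsub>N j\<^esub>" by auto
    have "g j (\<delta> j x) = \<one>\<^bsub>tensor B T (Q j)\<^esub>" using x(2) g0 by simp
    then have "tensor_map B T (Q j) id (d j) (g (Suc j) x) = \<one>\<^bsub>tensor B T (Q j)\<^esub>"
      unfolding \<delta>_def using N(4)[OF hom_in[OF map hom_in[OF N(3) x(1)]]] by simp
    then obtain w where w: "w \<in> carrier (tensor B T (Q (Suc (Suc j))))"
      "tensor_map B T (Q (Suc j)) id (d (Suc j)) w = g (Suc j) x"
      using tor_trivial_exact[OF T_module Qm d tor gin[OF x(1)]] j by auto
    have w': "w \<in> carrier (tensor_module A M (Q (Suc (Suc j))))" using w(1) by simp
    have "\<delta> (Suc j) (f (Suc (Suc j)) w) = x"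
      unfolding \<delta>_def N(4)[OF w'] w(2) by (rule N(5)[OF x(1)])
    then show "x \<in> \<delta> (Suc j) ` carrier (N (Suc (Suc j)))" using hom_in[OF N(2) w'] by (metis imageI)
  qed
  \<comment> \<open>Where \<open>Q i\<close> vanishes its identity is the zero map, so the tensor
    product vanishes as well.\<close>
  have N0: "x = \<zero>\<^bsub>N i\<^esub>" if i: "i \<ge> k" and x: "x \<in> carrier (N i)" for i x
  proof -
    have "g i x = tensor_map B T (Q i) id (\<lambda>x. x) (g i x)"
      by (rule tensor_map_identity[OF T_module Qm id_hom hom_id _ _ gin[OF x], symmetric]) simp_all
    also have "\<dots> = \<one>\<^bsub>tensor B T (Q i)\<^esub>"
      by (rule tensor_map_zero[OF T_module Qm Qm id_hom hom_id _ gin[OF x]]) (use Q(2)[OF i] in simp)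
    finally show ?thesis using N(5)[OF x] f0 by simp
  qed
  have zero: "carrier (N (r + Suc k)) = {\<zero>\<^bsub>N (r + Suc k)\<^esub>}"
    using mod_simps(1)[OF Nm] N0[of "r + Suc k"] by auto
  \<comment> \<open>With degree \<open>r\<close> as the new origin, the kernel in degree
    \<open>r + n + 1\<close> is the syzygy of order \<open>n + 2\<close> of the cokernel in degree
    \<open>r\<close>.\<close>
  let ?i = "r + n"
  let ?K = "(N (Suc ?i))\<lparr>carrier := {x \<in> carrier (N (Suc ?i)). \<delta> ?i x = \<zero>\<^bsub>N ?i\<^esub>}\<rparr>"
  have "gp A ((N (r + Suc n))\<lparr>carrier := {x \<in> carrier (N (r + Suc n)). \<delta> (r + n) x = \<zero>\<^bsub>N (r + n)\<^esub>}\<rparr>)"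
  proof (rule gp_kernel_in_exact_sequence[where G = "\<lambda>j. N (r + j)" and d = "\<lambda>j. \<delta> (r + j)" and s = k])
    show "gp_retract_closed A" by (rule gp_retract_closed_if_add_class[OF E GP])
    show "fin_dim A \<le> enat (Suc (Suc n))" by (rule n)
  qed (use N(1) \<delta> exact zero in simp_all)
  then have K: "gp A ?K" by simp
  then have "?K \<in> add_class A E" unfolding GP[symmetric] by (simp add: GP_class_def gorenstein_projective_iff_gp)
  then have "through A {E} ?K ?K (\<lambda>x. x)" unfolding add_class_iff_through[OF E gp_module[OF K]] .
  note tK = this[unfolded \<delta>_def]
  let ?W = "(Q (Suc ?i))\<lparr>carrier := {q \<in> carrier (Q (Suc ?i)). d ?i q = \<zero>\<^bsub>Q ?i\<^esub>}\<rparr>"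
  have "through B {Hom_module A M E} ?W ?W (\<lambda>x. x)"
    by (rule through_Hom_module_kernel[OF E Qm Qt Qm Qt d Nm N(2) N(3) N(4) N(5) Nm N(2) N(3) N(4) tK])
  note tW = this
  have Wm: "left_module B ?W" by (rule left_module_submod[OF Qm submod_kernel[OF Qm Qm d]])
  have Hm: "left_module B (Hom_module A M E)" by (rule Hom_module_is_module[OF M E])
  \<comment> \<open>The Hom module is exchanged for its copy \<open>H\<close> in the universe, since
    \<open>pdl\<close> speaks of such modules only.\<close>
  obtain a b where "a \<in> mod_hom B (Hom_module A M E) H" "b \<in> mod_hom B H (Hom_module A M E)"
    "\<And>x. x \<in> carrier (Hom_module A M E) \<Longrightarrow> b (a x) = x"
    by (rule mod_isoE[OF Hm pdl_module[OF H(1)] H(2)]) (rule that)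
  then have "through B {H} (Hom_module A M E) (Hom_module A M E) (\<lambda>x. x)"
    by (intro through_cong[OF through_single[OF _ _ _ Hm, of H]]) auto
  then have "through B {H} ?W ?W (\<lambda>x. x)" using Hm by (intro through_trans[OF tW Wm]) simp
  then have "pdl B (Suc p) ?W" by (rule pdl_through[OF _ Wm]) (use H(1) in simp)
  from pdl_of_syzygy[OF Q(1) Ym this] show ?thesis by (simp add: add_ac)
qed

end

theorem theorem1p1:
  fixes K :: "('k, 'x) ring_scheme" and \<phi> :: "'k \<Rightarrow> 'a" and A :: "('a, 'y) ring_scheme"
    and M :: "('a, 'm) module" and E :: "('a, 'e) module"
  assumes "artin_algebra K \<phi> A"
    and "left_module A M" and "fin_gen A M" and "gorenstein_projective A M"
    and "CM_finite A"
    and "left_module A E" and "fin_gen A E" and "GP_class A = add_class A E"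
    and "fin_dim A \<ge> 2"
  shows "fin_dim (End_ring A M) \<le>
    fin_dim A + rfd (End_ring A M) (End_right_module M)
      + proj_dim (End_ring A M) (Hom_module A M E)"
proof (cases "fin_dim A = \<infinity> \<or> rfd (End_ring A M) (End_right_module M) = \<infinity> \<or>
    proj_dim (End_ring A M) (Hom_module A M E) = \<infinity>")
  case True
  then show ?thesis by auto
next
  case False
  let ?B = "End_ring A M" and ?H = "Hom_module A M E"
  interpret endomorphisms A M by (rule endomorphisms.intro[OF assms(2)])
  have Hm: "left_module ?B ?H" by (rule Hom_module_is_module[OF assms(2,6)])
  obtain n' r p where n': "fin_dim A = enat n'" and r: "rfd ?B (End_right_module M) = enat r"
    and p: "proj_dim ?B ?H = enat p"
    using False by auto
  \<comment> \<open>This is where finitistic dimension at least two enters: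
    \<open>n' = n + 2\<close> is the form in which the syzygy is a kernel of a differential.\<close>
  obtain n where n: "n' = Suc (Suc n)"
    using assms(9) n' by (metis add_2_eq_Suc le_Suc_ex numeral_eq_enat enat_ord_simps(1))
  obtain P d e where P: "fg_projective_resolution ?B ?H P d e" "\<forall>i>p. carrier (P i) = {\<zero>\<^bsub>P i\<^esub>}"
    using p proj_dim_le_iff[of ?B ?H p] by auto
  have res: "left_resolution ?B ?H P d e" and P0: "projective ?B (P 0)" "fin_gen ?B (P 0)"
    using P(1) by (auto simp: fg_projective_resolution_def)
  \<comment> \<open>Finiteness of its projective dimension supplies a finitely generated projective
    mapping onto the Hom module, which therefore has a copy in the universe.\<close>
  have "fin_gen ?B ?H"
    by (rule fin_gen_image[OF projective_module[OF P0(1)] Hm _ _ P0(2)])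
      (use res in \<open>auto simp: left_resolution_def\<close>)
  then obtain H :: "('m \<Rightarrow> 'm) umodule" where H: "left_module ?B H" "mod_iso ?B ?H H"
    using fin_gen_iso_universe[OF Hm] by blast
  obtain e' where "left_resolution ?B H P d e'" using left_resolution_iso[OF res Hm H] by blast
  then have "fg_projective_resolution ?B H P d e'" using P(1) by (simp add: fg_projective_resolution_def)
  then have pH: "pdl ?B (Suc p) H" by (rule pdl_if_resolution[OF _ H(1)]) (use P(2) in simp)
  \<comment> \<open>\<open>M\<close> has an arbitrary carrier type while \<open>GP_class\<close>
    concerns the universe, so the decomposition of the identity of \<open>M\<close> through
    \<open>E\<close> is obtained from a copy \<open>G\<close>.\<close>
  obtain G :: "'a umodule" where G: "gp A G" "mod_iso A M G"
    by (rule gorenstein_projective_iso_gp[OF assms(4)]) (rule that)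
  have "G \<in> add_class A E"
    using G(1) unfolding assms(8)[symmetric] by (simp add: GP_class_def gorenstein_projective_iff_gp)
  then have tG: "through A {E} G G (\<lambda>x. x)" unfolding add_class_iff_through[OF assms(6) gp_module[OF G(1)]] .
  obtain f g where fg: "f \<in> mod_hom A M G" "g \<in> mod_hom A G M" "\<And>x. x \<in> carrier M \<Longrightarrow> g (f x) = x"
    by (rule mod_isoE[OF assms(2) gp_module[OF G(1)] G(2)]) (rule that)
  have t: "through A {E} M M (\<lambda>x. x)"
    by (rule through_cong[OF through_comp[OF tG gp_module[OF G(1)] assms(2) fg(1,2)] fg(3)])
  have "x \<le> enat (n' + r + p)" if x: "x \<in> {proj_dim ?B Y | Y :: ('m \<Rightarrow> 'm) umodule.
      left_module ?B Y \<and> fin_gen ?B Y \<and> proj_dim ?B Y < \<infinity>}" for x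
  proof -
    obtain Y :: "('m \<Rightarrow> 'm) umodule" where Y: "x = proj_dim ?B Y" "left_module ?B Y" "proj_dim ?B Y < \<infinity>"
      using x by blast
    then obtain k where "proj_dim ?B Y = enat k" by auto
    then have "pdl ?B (Suc k) Y" using proj_dim_le_iff_pdl[OF Y(2), of k] by simp
    from pdl_End[OF assms(3,6,8) t _ _ pH H(2) this, of n r] n' r n
    have "pdl ?B (Suc (n' + r + p)) Y" by simp
    then show ?thesis using proj_dim_le_iff_pdl[OF Y(2)] Y(1) by blast
  qed
  then have "fin_dim ?B \<le> enat (n' + r + p)" unfolding fin_dim_def by (rule Sup_least)
  then show ?thesis by (simp add: n' r p)
qed

end
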